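(* Let $x\in\mathbb{R}^p_+$ with $F_X(x)>0$, let $\rho_x>0$, and let $k_n$ be a sequence of positive integers. Write, for $j=1,2$, $\hat q_j=\hat\varphi_{1-\frac{jk_n-1}{n\hat F_X(x)}}(x)$. (i) Suppose that $F(\cdot|x)$ has a positive density $F'(\cdot|x)$ on $]0,\varphi(x)[$ such that $t\mapsto F'(\varphi(x)-\frac1t\mid x)$ belongs to $RV_{1-\rho_x}$. Then $$\sqrt{2k_n}\;\frac{\hat q_1-\varphi_{1-\frac{p_n}{F_X(x)}}(x)}{\hat q_1-\hat q_2}\stackrel{d}{\longrightarrow}\mathcal{N}(0,V_1(\rho_x)),\qquad V_1(\rho_x)=\frac{\rho_x^{-2}2^{1-2/\rho_x}}{(2^{-1/\rho_x}-1)^2},$$ provided that $p_n\to0$, $np_n\to\infty$ and $k_n=[np_n]$ (integer part). For (ii) and (iii), let $U(t)=\varphi_{1-\frac1{tF_X(x)}}(x)$, $t>1/F_X(x)$, and suppose that at least one of the following two sets of conditions holds: (a) $U$ has a positive derivative $U'$, there is a positive function $A$ such that, for one choice of the sign $\pm$ and all $z>0$, $\lim_{t\to\infty}\{(tz)^{1+1/\rho_x}U'(tz)-t^{1+1/\rho_x}U'(t)\}/A(t)=\pm\log z$, and $k_n\to\infty$ with $k_n=o(n/g^{-1}(n))$, where $g(t)=t^{3+2/\rho_x}\{U'(t)/A(t)\}^2$; (b) for some $\kappa>0$ and $\delta>0$, the function $t\mapsto t^{\rho_x-1}F'(\varphi(x)-\frac1t\mid x)-\delta$ belongs to $RV_{-\kappa}$,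 and $k_n\to\infty$ with $k_n=o(n/g^{-1}(n))$, where $g(t)=t^{3+2/\rho_x}\bigl\{U'(t)/\bigl(t^{1+1/\rho_x}U'(t)-[\delta F_X(x)]^{-1/\rho_x}\rho_x^{1/\rho_x-1}\bigr)\bigr\}^2$. (ii) Define $\hat\varphi_1^*(x)=(2^{1/\hat\rho_x}-1)^{-1}\{\hat q_1-\hat q_2\}+\hat q_1$. Then $$\sqrt{2k_n}\;\frac{\hat\varphi_1^*(x)-\varphi(x)}{\hat q_1-\hat q_2}\stackrel{d}{\longrightarrow}\mathcal{N}(0,V_2(\rho_x)),\qquad V_2(\rho_x)=\frac{3\rho_x^{-2}2^{-1-2/\rho_x}}{(2^{-1/\rho_x}-1)^6}.$$ (iii) Define $\tilde\varphi_1^*(x)=(2^{1/\rho_x}-1)^{-1}\{\hat q_1-\hat q_2\}+\hat q_1$. Then $$\sqrt{2k_n}\;\frac{\tilde\varphi_1^*(x)-\varphi(x)}{\hat q_1-\hat q_2}\stackrel{d}{\longrightarrow}\mathcal{N}(0,V_3(\rho_x)),\qquad V_3(\rho_x)=\frac{\rho_x^{-2}2^{-2/\rho_x}}{(2^{-1/\rho_x}-1)^4},$$ and $$\frac{\hat q_1-\hat q_2}{\frac{n}{2k_n}U'\bigl(\frac{n}{2k_n}\bigr)}\stackrel{p}{\longrightarrow}\rho_x(1-2^{-1/\rho_x}).$$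
   Context: $(X,Y)$ is a random vector in $\mathbb{R}^p_+\times\mathbb{R}_+$ with joint distribution function $F(x,y)=\mathbb{P}(X\le x,Y\le y)$ (inequalities between vectors are componentwise), and $(X_i,Y_i)$, $i=1,\dots,n$, are i.i.d. copies of $(X,Y)$. Put $F_X(x)=F(x,\infty)$ and, for $F_X(x)>0$, $F(y|x)=F(x,y)/F_X(x)$; $F'(\cdot|x)$ denotes the derivative of $y\mapsto F(y|x)$. The frontier function is $\varphi(x)=\sup\{y\ge0: F(y|x)<1\}$, assumed finite. For $\alpha\in(0,1]$, $\varphi_\alpha(x)=\inf\{y\ge0:F(y|x)\ge\alpha\}$. Empirical versions: $\hat F_n(x,y)=\frac1n\sum_{i=1}^n\mathbf{1}(X_i\le x,Y_i\le y)$, $\hat F_X(x)=\hat F_n(x,\infty)$, $\hat F(y|x)=\hat F_n(x,y)/\hat F_X(x)$, $\hat\varphi_\alpha(x)=\inf\{y\ge0:\hat F(y|x)\ge\alpha\}$. The orders of the empirical quantiles used are positive, with probability one, for $n$ large enough. The Pickands-type estimator of $\rho_x$, with $k=k_n$, is $$\hat\rho_x=\log 2\left(\log\frac{\hat\varphi_{1-\frac{2k-1}{n\hat F_X(x)}}(x)-\hat\varphi_{1-\frac{4k-1}{n\hat F_X(x)}}(x)}{\hat\varphi_{1-\frac{k-1}{n\hat F_X(x)}}(x)-\hat\varphi_{1-\frac{2k-1}{n\hat F_X(x)}}(x)}\right)^{-1}.$$ $f\in RV_a$ means $f(tz)/f(t)\to z^a$ as $t\to\infty$ for all $z>0$. The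 generalized inverse of $g$ is $g^{-1}(s)=\inf\{t:g(t)\ge s\}$.
   Formalization: In (a),(b) the inverse g^{-1}(n) is the infimum over t ≥ t0 for all large t0, since over all t the growth condition can degenerate to k_n=o(n), where the claim fails if g is unbounded at a finite point; in (i) the density is taken to leave no mass at φ(x). *)

theory Defs
  imports "HOL-Probability.Probability" "HOL-Library.Landau_Symbols"
begin

text \<open>
  Vectors of \<^typ>\<open>real^'p\<close> are compared by the componentwise order of \<^theory>\<open>HOL-Analysis.Cartesian_Euclidean_Space\<close>.
\<close>

subsection \<open>Distribution functions, frontier and quantiles\<close>

definition joint_cdf ::
  "'w measure \<Rightarrow> ('w \<Rightarrow> real^'p) \<Rightarrow> ('w \<Rightarrow> real) \<Rightarrow> real^'p \<Rightarrow> real \<Rightarrow> real" where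
  "joint_cdf M X Y x y = measure M {\<omega> \<in> space M. X \<omega> \<le> x \<and> Y \<omega> \<le> y}"

text \<open>$F_X(x) = F(x,\infty)$.\<close>

definition marg_cdf :: "'w measure \<Rightarrow> ('w \<Rightarrow> real^'p) \<Rightarrow> real^'p \<Rightarrow> real" where
  "marg_cdf M X x = measure M {\<omega> \<in> space M. X \<omega> \<le> x}"

text \<open>$F(y|x)$: the conditioning event is $X \le x$, not $X = x$.\<close>

definition cond_cdf ::
  "'w measure \<Rightarrow> ('w \<Rightarrow> real^'p) \<Rightarrow> ('w \<Rightarrow> real) \<Rightarrow> real^'p \<Rightarrow> real \<Rightarrow> real" where
  "cond_cdf M X Y x y = joint_cdf M X Y x y / marg_cdf M X x"

text \<open>
  For \<open>G = F(\<cdot>|x)\<close> these are $\varphi(x)$ and $\varphi_\alpha(x)$.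
  The supremum is a real number; finiteness of the frontier is the separate
  hypothesis that the set below is bounded above.
\<close>

definition frontier_of_cdf :: "(real \<Rightarrow> real) \<Rightarrow> real" where
  "frontier_of_cdf G = Sup {y. 0 \<le> y \<and> G y < 1}"

definition quantile_of_cdf :: "(real \<Rightarrow> real) \<Rightarrow> real \<Rightarrow> real" where
  "quantile_of_cdf G \<alpha> = Inf {y. 0 \<le> y \<and> \<alpha> \<le> G y}"

text \<open>$U(t) = \varphi_{1 - 1/(t F_X(x))}(x)$; only meaningful for $t > 1/F_X(x)$.\<close>

definition tail_quantile ::
  "'w measure \<Rightarrow> ('w \<Rightarrow> real^'p) \<Rightarrow> ('w \<Rightarrow> real) \<Rightarrow> real^'p \<Rightarrow> real \<Rightarrow> real" where
  "tail_quantile M X Y x t = quantile_of_cdf (cond_cdf M X Y x) (1 - 1 / (t * marg_cdf M X x))"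

subsection \<open>Empirical versions\<close>

text \<open>The sample is indexed by \<open>i = 1, 2, \<dots>\<close>; index \<open>0\<close> is never used.\<close>

definition emp_joint_cdf ::
  "(nat \<Rightarrow> 'w \<Rightarrow> real^'p) \<Rightarrow> (nat \<Rightarrow> 'w \<Rightarrow> real) \<Rightarrow> nat \<Rightarrow> 'w \<Rightarrow> real^'p \<Rightarrow> real \<Rightarrow> real" where
  "emp_joint_cdf Xs Ys n \<omega> x y = 1 / real n * (\<Sum>i=1..n. of_bool (Xs i \<omega> \<le> x \<and> Ys i \<omega> \<le> y))"

definition emp_marg_cdf :: "(nat \<Rightarrow> 'w \<Rightarrow> real^'p) \<Rightarrow> nat \<Rightarrow> 'w \<Rightarrow> real^'p \<Rightarrow> real" where
  "emp_marg_cdf Xs n \<omega> x = 1 / real n * (\<Sum>i=1..n. of_bool (Xs i \<omega> \<le> x))"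

definition emp_cond_cdf ::
  "(nat \<Rightarrow> 'w \<Rightarrow> real^'p) \<Rightarrow> (nat \<Rightarrow> 'w \<Rightarrow> real) \<Rightarrow> nat \<Rightarrow> 'w \<Rightarrow> real^'p \<Rightarrow> real \<Rightarrow> real" where
  "emp_cond_cdf Xs Ys n \<omega> x y = emp_joint_cdf Xs Ys n \<omega> x y / emp_marg_cdf Xs n \<omega> x"

text \<open>
  $\hat\varphi_{1-(jk-1)/(n\hat F_X(x))}(x)$, which is $\hat q_j$ for $j = 1,2$; the value
  $j = 4$ enters the estimator of $\rho_x$.
\<close>

definition qhat ::
  "(nat \<Rightarrow> 'w \<Rightarrow> real^'p) \<Rightarrow> (nat \<Rightarrow> 'w \<Rightarrow> real) \<Rightarrow> real^'p \<Rightarrow> (nat \<Rightarrow> nat) \<Rightarrow> nat \<Rightarrow> nat \<Rightarrow> 'w \<Rightarrow> real" where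
  "qhat Xs Ys x k j n \<omega> =
     quantile_of_cdf (emp_cond_cdf Xs Ys n \<omega> x)
       (1 - (real j * real (k n) - 1) / (real n * emp_marg_cdf Xs n \<omega> x))"

definition rho_hat ::
  "(nat \<Rightarrow> 'w \<Rightarrow> real^'p) \<Rightarrow> (nat \<Rightarrow> 'w \<Rightarrow> real) \<Rightarrow> real^'p \<Rightarrow> (nat \<Rightarrow> nat) \<Rightarrow> nat \<Rightarrow> 'w \<Rightarrow> real" where
  "rho_hat Xs Ys x k n \<omega> =
     ln 2 * inverse (ln ((qhat Xs Ys x k 2 n \<omega> - qhat Xs Ys x k 4 n \<omega>)
                         / (qhat Xs Ys x k 1 n \<omega> - qhat Xs Ys x k 2 n \<omega>)))"

definition phi_star ::
  "(nat \<Rightarrow> 'w \<Rightarrow> real^'p) \<Rightarrow> (nat \<Rightarrow> 'w \<Rightarrow> real) \<Rightarrow> real^'p \<Rightarrow> (nat \<Rightarrow> nat) \<Rightarrow> real \<Rightarrow> nat \<Rightarrow> 'w \<Rightarrow> real" where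
  "phi_star Xs Ys x k r n \<omega> =
     inverse (2 powr (1 / r) - 1) * (qhat Xs Ys x k 1 n \<omega> - qhat Xs Ys x k 2 n \<omega>)
     + qhat Xs Ys x k 1 n \<omega>"

definition phi_hat_star ::
  "(nat \<Rightarrow> 'w \<Rightarrow> real^'p) \<Rightarrow> (nat \<Rightarrow> 'w \<Rightarrow> real) \<Rightarrow> real^'p \<Rightarrow> (nat \<Rightarrow> nat) \<Rightarrow> nat \<Rightarrow> 'w \<Rightarrow> real" where
  "phi_hat_star Xs Ys x k n \<omega> = phi_star Xs Ys x k (rho_hat Xs Ys x k n \<omega>) n \<omega>"

definition phi_tilde_star ::
  "(nat \<Rightarrow> 'w \<Rightarrow> real^'p) \<Rightarrow> (nat \<Rightarrow> 'w \<Rightarrow> real) \<Rightarrow> real^'p \<Rightarrow> (nat \<Rightarrow> nat) \<Rightarrow> real \<Rightarrow> nat \<Rightarrow> 'w \<Rightarrow> real" where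
  "phi_tilde_star Xs Ys x k \<rho> n \<omega> = phi_star Xs Ys x k \<rho> n \<omega>"

subsection \<open>Regular variation and the growth conditions\<close>

definition regularly_varying :: "real \<Rightarrow> (real \<Rightarrow> real) \<Rightarrow> bool" where
  "regularly_varying a f \<longleftrightarrow> (\<forall>z>0. ((\<lambda>t. f (t * z) / f t) \<longlongrightarrow> z powr a) at_top)"

text \<open>
  \<open>G\<close> has a density that is its derivative and is positive on \<open>]0, b[\<close>.
  The integral identity at \<open>y = b\<close> says that no mass sits at the endpoint, which differentiability
  in the interior alone would not exclude. An atom at \<open>0\<close> is allowed.
\<close>

definition has_positive_density_upto :: "(real \<Rightarrow> real) \<Rightarrow> real \<Rightarrow> bool" where
  "has_positive_density_upto G b \<longleftrightarrow>
     (\<forall>y\<in>{0<..<b}. G differentiable (at y) \<and> 0 < deriv G y) \<and>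
     (\<forall>y\<in>{0..b}. (deriv G has_integral (G y - G 0)) {0..y})"

text \<open>
  $g^{-1}(s) = \inf\{t : g(t) \ge s\}$ for the function \<open>g\<close> on $[t_0,\infty[$,
  with $\inf\emptyset = \infty$.
\<close>

definition gen_inverse_from :: "real \<Rightarrow> (real \<Rightarrow> real) \<Rightarrow> real \<Rightarrow> ereal" where
  "gen_inverse_from t0 g s = (INF t\<in>{t. t0 \<le> t \<and> s \<le> g t}. ereal t)"

text \<open>
  $k_n = o(n/g^{-1}(n))$. The functions \<open>g\<close> used below are only determined near infinity: their
  ingredients \<open>A\<close>, \<open>F'\<close>, \<open>U'\<close> are constrained (in the second case even defined) only
  there, and a denominator may vanish at some finite point. The
  inverse is therefore that of \<open>g\<close> near infinity, i.e. taken on $[t_0,\infty[$ for all large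
  $t_0$. If \<open>g\<close> tends to infinity and is locally bounded on $[t_1,\infty[$, then all
  $t_0 \ge t_1$ give the same $g^{-1}(n)$ for large \<open>n\<close>. If $g^{-1}(n) = \infty$,
  then $n/g^{-1}(n) = 0$.
\<close>

definition small_o_rate :: "(nat \<Rightarrow> nat) \<Rightarrow> (real \<Rightarrow> real) \<Rightarrow> bool" where
  "small_o_rate k g \<longleftrightarrow>
     (\<forall>\<^sub>F t0 in at_top.
        (\<lambda>n. real (k n)) \<in> o(\<lambda>n. real_of_ereal (ereal (real n) / gen_inverse_from t0 g (real n))))"

definition condition_a :: "real \<Rightarrow> real \<Rightarrow> (real \<Rightarrow> real) \<Rightarrow> (nat \<Rightarrow> nat) \<Rightarrow> bool" where
  "condition_a \<rho> FX U k \<longleftrightarrow>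
     (\<forall>t > 1 / FX. U differentiable (at t) \<and> 0 < deriv U t) \<and>
     (\<exists>A s. (\<forall>t > 1 / FX. 0 < A t) \<and> s \<in> {1, -1} \<and>
        (\<forall>z>0. ((\<lambda>t. ((t * z) powr (1 + 1 / \<rho>) * deriv U (t * z) - t powr (1 + 1 / \<rho>) * deriv U t) / A t)
                 \<longlongrightarrow> s * ln z) at_top) \<and>
        filterlim k at_top sequentially \<and>
        small_o_rate k (\<lambda>t. t powr (3 + 2 / \<rho>) * (deriv U t / A t)\<^sup>2))"

text \<open>
  Here \<open>G\<close> is $F(\cdot|x)$ and \<open>b\<close> is $\varphi(x)$. The differentiability clause states that
  $F'(\varphi(x)-1/t|x)$ exists for large \<open>t\<close>; \<^const>\<open>deriv\<close> is a total operator.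
\<close>

definition condition_b ::
  "real \<Rightarrow> real \<Rightarrow> (real \<Rightarrow> real) \<Rightarrow> real \<Rightarrow> (real \<Rightarrow> real) \<Rightarrow> (nat \<Rightarrow> nat) \<Rightarrow> bool" where
  "condition_b \<rho> FX G b U k \<longleftrightarrow>
     (\<forall>\<^sub>F t in at_top. G differentiable (at (b - 1 / t))) \<and>
     (\<exists>\<kappa>>0. \<exists>\<delta>>0.
        regularly_varying (- \<kappa>) (\<lambda>t. t powr (\<rho> - 1) * deriv G (b - 1 / t) - \<delta>) \<and>
        filterlim k at_top sequentially \<and>
        small_o_rate k (\<lambda>t. t powr (3 + 2 / \<rho>) *
          (deriv U t / (t powr (1 + 1 / \<rho>) * deriv U t
                        - (\<delta> * FX) powr (- 1 / \<rho>) * \<rho> powr (1 / \<rho> - 1)))\<^sup>2))"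

subsection \<open>Limits of random variables and limiting variances\<close>

text \<open>The second argument of \<^const>\<open>normal_density\<close> is the standard deviation.\<close>

definition conv_distr_normal :: "'w measure \<Rightarrow> (nat \<Rightarrow> 'w \<Rightarrow> real) \<Rightarrow> real \<Rightarrow> bool" where
  "conv_distr_normal M Z V \<longleftrightarrow>
     weak_conv_m (\<lambda>n. distr M borel (Z n)) (density lborel (normal_density 0 (sqrt V)))"

definition conv_in_prob :: "'w measure \<Rightarrow> (nat \<Rightarrow> 'w \<Rightarrow> real) \<Rightarrow> real \<Rightarrow> bool" where
  "conv_in_prob M Z c \<longleftrightarrow>
     (\<forall>n. Z n \<in> borel_measurable M) \<and>
     (\<forall>\<epsilon>>0. (\<lambda>n. measure M {\<omega> \<in> space M. \<bar>Z n \<omega> - c\<bar> > \<epsilon>}) \<longlonglongrightarrow> 0)"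

definition V1 :: "real \<Rightarrow> real" where
  "V1 \<rho> = \<rho> powr (-2) * 2 powr (1 - 2 / \<rho>) / (2 powr (- 1 / \<rho>) - 1) ^ 2"

definition V2 :: "real \<Rightarrow> real" where
  "V2 \<rho> = 3 * \<rho> powr (-2) * 2 powr (- 1 - 2 / \<rho>) / (2 powr (- 1 / \<rho>) - 1) ^ 6"

definition V3 :: "real \<Rightarrow> real" where
  "V3 \<rho> = \<rho> powr (-2) * 2 powr (- 2 / \<rho>) / (2 powr (- 1 / \<rho>) - 1) ^ 4"

end

theory Submission
  imports Defs
begin

text \<open>
  Only the points of the sample with \<open>X\<^sub>i \<le> x\<close> matter: with \<open>S y = P(X \<le> x, Y > y)\<close>, the empirical
  quantile of order \<open>1 - (j k - 1) / (n F\<^sub>X)\<close> is the \<open>j k\<close>-th largest of their \<open>Y\<^sub>i\<close>, so it exceeds \<open>y\<close> iff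
  at least \<open>j k\<close> sample points exceed \<open>y\<close>, an event about a binomial count of mean \<open>n S y\<close>. In a
  Bahadur representation, \<open>sqrt k (n S(q\<^sub>j) / k - j)\<close> equals the negative of the normalized count above
  \<open>U(n / (j k))\<close>, up to \<open>o\<^sub>P(1)\<close>; the characteristic functions of these counts for \<open>j = 1, 2, 4\<close>
  converge to those of a Brownian motion at the times \<open>1, 2, 4\<close>. As \<open>U\<close> inverts \<open>1 / S\<close> and \<open>U'\<close> is
  regularly varying of index \<open>-1 - 1 / \<rho>\<close>, every statistic in question is an asymptotically linear
  function of these errors. The endpoint statements need in addition that the bias
  \<open>(\<phi> - U(t)) / (t U'(t)) - \<rho>\<close> is \<open>o(1 / sqrt k)\<close> at \<open>t = n / k\<close>; the second-order conditions
  bound it by the rate function, and this is what \<open>k = o(n / g\<inverse>(n))\<close> controls.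
\<close>

section \<open>Regular variation\<close>

text \<open>Regular variation and the relation for \<open>A\<close> are limits for each fixed
  \<open>z\<close>, and \<open>A\<close> is not assumed measurable. Uniformity in \<open>z\<close>
  is therefore extracted from the measurability of \<open>U'\<close> or \<open>F'\<close>, which are
  limits of difference quotients. The joint law of the order statistics is avoided: counts are
  monotone in the level, so comparing them on a finite grid of deterministic levels gives the
  Bahadur representation from second moments alone. Both rate functions equal, up to bounded
  factors, \<open>g(t) = t / e(t)^2\<close>, where \<open>e\<close> measures the relative
  oscillation of \<open>V(t) = t^(1+1/\<rho>) U'(t)\<close>. Thus \<open>n <= g(\<tau>)\<close>
  reads \<open>n e(\<tau>)^2 <= \<tau>\<close>, and a Potter bound carries this estimate from \<tau>
  to \<open>n / k\<close>. The limiting variances are values of the form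
  \<open>(c1 + c2 + c4)^2 + (c2 + c4)^2 + 2 c4^2\<close>, the variance of
  \<open>c1 B(1) + c2 B(2) + c4 B(4)\<close> for a Brownian motion \<open>B\<close>; the
  coefficients come from \<open>U(t / j)\<close> having increments of slope
  \<open>- j^(1/\<rho> - 1)\<close> in \<open>j\<close>, in units of \<open>t U'(t)\<close>.\<close>

lemma null_mult_bounded:
  fixes g h :: "'a \<Rightarrow> real"
  assumes "(g \<longlongrightarrow> 0) F" "\<forall>\<^sub>F n in F. \<bar>h n\<bar> \<le> K"
  shows "((\<lambda>n. g n * h n) \<longlongrightarrow> 0) F"
proof (rule Lim_null_comparison)
  show "((\<lambda>n. \<bar>g n\<bar> * K) \<longlongrightarrow> 0) F"
    using tendsto_mult_left_zero[OF tendsto_rabs_zero[OF assms(1)]] .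
  show "\<forall>\<^sub>F n in F. norm (g n * h n) \<le> \<bar>g n\<bar> * K"
    using assms(2) by eventually_elim (simp add: abs_mult mult_left_mono)
qed

lemma filterlim_add_bounded_at_top:
  fixes x u :: "nat \<Rightarrow> real"
  assumes "filterlim x at_top sequentially" "\<And>n. \<bar>u n\<bar> \<le> B"
  shows "filterlim (\<lambda>n. x n + u n) at_top sequentially"
proof (rule filterlim_at_top_mono)
  show "filterlim (\<lambda>n. - B + x n) at_top sequentially"
    by (rule filterlim_tendsto_add_at_top[OF tendsto_const assms(1)])
  show "\<forall>\<^sub>F n in sequentially. - B + x n \<le> x n + u n"
    using assms(2) by (intro always_eventually) (auto simp: abs_le_iff, smt (verit))
qed

text \<open>The common point \<open>x n + u n + v\<close> is reached both from \<open>x n\<close>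
  and from \<open>x n + u n\<close>. Each of the two increments is controlled on average over
  \<open>v\<close> in \<open>[0, 1]\<close>, and their difference is the increment over the moving
  shift \<open>u n\<close>. Measurability is asked of \<open>f\<close> only: \<open>a\<close> enters
  through its values along the two sequences, and the auxiliary function of a de Haan class may be
  arbitrary.\<close>

lemma uniform_increments:
  fixes f a :: "real \<Rightarrow> real" and x u :: "nat \<Rightarrow> real"
  assumes f [measurable]: "f \<in> borel_measurable borel"
    and conv: "\<And>w. ((\<lambda>y. (f (y + w) - f y) / a y) \<longlongrightarrow> L * w) at_top"
    and x: "filterlim x at_top sequentially" and u: "\<And>n. \<bar>u n\<bar> \<le> B"
    and ratio: "(\<lambda>n. a (x n + u n) / a (x n)) \<longlonglongrightarrow> 1"
  shows "(\<lambda>n. (f (x n + u n) - f (x n)) / a (x n) - L * u n) \<longlonglongrightarrow> 0"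
proof -
  \<comment> \<open>Truncation at 1 supplies a dominating function; the increments themselves carry
    no bound.\<close>
  define F where "F n w = min 1 \<bar>(f (x n + w) - f (x n)) / a (x n) - L * w\<bar>" for n w
  define G where "G n v = min 1 \<bar>(f (x n + u n + v) - f (x n + u n)) / a (x n + u n) - L * v\<bar>" for n v
  define r where "r n = a (x n + u n) / a (x n)" for n
  define \<Delta> where "\<Delta> n = (f (x n + u n) - f (x n)) / a (x n) - L * u n" for n
  have B: "0 \<le> B" using u[of 0] by linarith
  have xu: "filterlim (\<lambda>n. x n + u n) at_top sequentially"
    by (rule filterlim_add_bounded_at_top[OF x u])
  have pointwise: "(\<lambda>n. min 1 \<bar>(f (y n + w) - f (y n)) / a (y n) - L * w\<bar>) \<longlonglongrightarrow> 0"
    if "filterlim y at_top sequentially" for y w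
  proof -
    have "(\<lambda>n. (f (y n + w) - f (y n)) / a (y n)) \<longlonglongrightarrow> L * w"
      by (rule filterlim_compose[OF conv that])
    then have "(\<lambda>n. min 1 \<bar>(f (y n + w) - f (y n)) / a (y n) - L * w\<bar>) \<longlonglongrightarrow> min 1 \<bar>L * w - L * w\<bar>"
      by (intro tendsto_intros)
    then show ?thesis by simp
  qed
  have intlim: "(\<lambda>n. LINT w|lborel. indicator {c..d} w * H n w) \<longlonglongrightarrow> 0"
    if H: "\<And>n. H n \<in> borel_measurable borel" "\<And>n w. 0 \<le> H n w \<and> H n w \<le> 1" "\<And>w. (\<lambda>n. H n w) \<longlonglongrightarrow> 0"
    for H :: "nat \<Rightarrow> real \<Rightarrow> real" and c d :: real
  proof -
    have "(\<lambda>n. LINT w|lborel. indicator {c..d} w * H n w) \<longlonglongrightarrow> (LINT w|(lborel::real measure). 0)"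
    proof (rule integral_dominated_convergence[where w = "indicator {c..d}"])
      show "AE w in lborel. (\<lambda>n. indicator {c..d} w * H n w) \<longlonglongrightarrow> 0"
        using H(3) by (intro AE_I2) (auto intro!: tendsto_eq_intros)
      show "AE w in lborel. norm (indicator {c..d} w * H n w) \<le> indicator {c..d} w" for n
        using H(2) by (intro AE_I2) (auto simp: indicator_def abs_le_iff intro: order_trans[of _ 0])
      show "integrable lborel (indicator {c..d} :: real \<Rightarrow> real)"
        by (intro integrable_real_indicator) (auto simp: emeasure_lborel_Icc_eq)
      show "(\<lambda>w. indicator {c..d} w * H n w) \<in> borel_measurable lborel" for n
        using H(1)[of n] by measurable
    qed auto
    then show ?thesis by simp
  qed
  have int: "integrable lborel (\<lambda>w. indicator {c..d} w * h w)"
    if "h \<in> borel_measurable borel" "\<And>w. 0 \<le> h w \<and> h w \<le> 1" for h :: "real \<Rightarrow> real" and c d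
  proof (rule Bochner_Integration.integrable_bound)
    show "integrable lborel (indicator {c..d} :: real \<Rightarrow> real)"
      by (intro integrable_real_indicator) (auto simp: emeasure_lborel_Icc_eq)
    show "(\<lambda>w. indicator {c..d} w * h w) \<in> borel_measurable lborel"
      using that(1) by measurable
    show "AE w in lborel. norm (indicator {c..d} w * h w) \<le> norm (indicator {c..d} w :: real)"
      using that(2) by (intro AE_I2) (auto simp: indicator_def abs_le_iff intro: order_trans[of _ 0])
  qed
  have Fm: "F n \<in> borel_measurable borel" for n unfolding F_def by measurable
  have Gm: "G n \<in> borel_measurable borel" for n unfolding G_def by measurable
  have F01: "0 \<le> F n w \<and> F n w \<le> 1" for n w by (auto simp: F_def)
  have G01: "0 \<le> G n w \<and> G n w \<le> 1" for n w by (auto simp: G_def)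
  let ?IF = "\<lambda>n. LINT w|lborel. indicator {-B..B+1} w * F n w"
  let ?IG = "\<lambda>n. LINT v|lborel. indicator {0..1} v * G n v"
  have IF: "?IF \<longlonglongrightarrow> 0" and IG: "?IG \<longlonglongrightarrow> 0"
    by (intro intlim Fm Gm F01 G01; simp add: F_def G_def pointwise x xu)+
  \<comment> \<open>The increment over \<open>u n\<close> is the one over \<open>u n + v\<close>
    minus the one over \<open>v\<close> started at \<open>x n + u n\<close>. The latter is
    normalized by \<open>a (x n + u n)\<close>, hence the factor \<open>r n\<close>, which is below
    2.\<close>
  have key: "min 1 \<bar>\<Delta> n\<bar> \<le> F n (u n + v) + 2 * G n v + \<bar>L\<bar> * \<bar>r n - 1\<bar>"
    if v: "0 \<le> v" "v \<le> 1" and rn: "\<bar>r n - 1\<bar> < 1" for n v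
  proof -
    have nz: "a (x n) \<noteq> 0" "a (x n + u n) \<noteq> 0" using rn by (auto simp: r_def)
    define p where "p = (f (x n + (u n + v)) - f (x n)) / a (x n) - L * (u n + v)"
    define q where "q = (f (x n + u n + v) - f (x n + u n)) / a (x n + u n) - L * v"
    have "\<Delta> n = p - r n * q - L * v * (r n - 1)"
      using nz by (simp add: \<Delta>_def p_def q_def r_def field_simps)
    moreover have "\<bar>r n * q\<bar> \<le> 2 * \<bar>q\<bar>"
      unfolding abs_mult using rn by (intro mult_right_mono) auto
    moreover have "\<bar>L * v * (r n - 1)\<bar> \<le> \<bar>L\<bar> * \<bar>r n - 1\<bar>"
      unfolding abs_mult using v by (intro mult_right_mono mult_left_le) auto
    ultimately have "\<bar>\<Delta> n\<bar> \<le> \<bar>p\<bar> + 2 * \<bar>q\<bar> + \<bar>L\<bar> * \<bar>r n - 1\<bar>" by linarith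
    moreover have "0 \<le> \<bar>L\<bar> * \<bar>r n - 1\<bar>" by simp
    ultimately show ?thesis unfolding F_def G_def p_def[symmetric] q_def[symmetric] by linarith
  qed
  have bound: "min 1 \<bar>\<Delta> n\<bar> \<le> ?IF n + 2 * ?IG n + \<bar>L\<bar> * \<bar>r n - 1\<bar>" if rn: "\<bar>r n - 1\<bar> < 1" for n
  proof -
    let ?e = "\<bar>L\<bar> * \<bar>r n - 1\<bar>"
    have sh: "integrable lborel (\<lambda>v. indicator {0..1} v * F n (u n + v))"
      using F01 by (intro int) (use Fm in measurable)
    have "min 1 \<bar>\<Delta> n\<bar> = (LINT v|lborel. indicator {0..1::real} v * min 1 \<bar>\<Delta> n\<bar>)"
      by (simp add: content_real)
    also have "\<dots> \<le> (LINT v|lborel. indicator {0..1} v * F n (u n + v) + 2 * (indicator {0..1} v * G n v)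
        + indicator {0..1} v * ?e)"
    proof (rule integral_mono)
      show "integrable lborel (\<lambda>v. indicator {0..1} v * F n (u n + v) + 2 * (indicator {0..1} v * G n v)
        + indicator {0..1} v * ?e)"
        using sh int[OF Gm G01] by auto
      fix v :: real
      show "indicator {0..1} v * min 1 \<bar>\<Delta> n\<bar> \<le> indicator {0..1} v * F n (u n + v) + 2 * (indicator {0..1} v * G n v)
        + indicator {0..1} v * ?e"
        using key[of v n] rn by (auto simp: indicator_def)
    qed simp
    also have "\<dots> = (LINT v|lborel. indicator {0..1} v * F n (u n + v)) + 2 * ?IG n + ?e"
      using sh int[OF Gm G01] by simp
    \<comment> \<open>Substituting \<open>w = u n + v\<close> moves the average to
      \<open>[u n, u n + 1]\<close>, which lies in \<open>[- B, B + 1]\<close> for all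
      \<open>n\<close>; on this fixed interval dominated convergence applies.\<close>
    also have "(LINT v|lborel. indicator {0..1} v * F n (u n + v)) = (LINT v|lborel. (\<lambda>w. indicator {u n..u n + 1} w * F n w) (u n + 1 * v))"
      by (intro Bochner_Integration.integral_cong) (auto simp: indicator_def)
    also have "\<dots> = (LINT w|lborel. indicator {u n..u n + 1} w * F n w)"
      using lborel_integral_real_affine[of 1 "\<lambda>w. indicator {u n..u n + 1} w * F n w" "u n"] by simp
    also have "\<dots> \<le> ?IF n"
    proof (intro integral_mono int Fm F01)
      fix w show "indicator {u n..u n + 1} w * F n w \<le> indicator {-B..B+1} w * F n w"
        using u[of n] F01[of n w] by (auto simp: indicator_def abs_le_iff)
    qed
    finally show ?thesis by linarith
  qed
  have r: "r \<longlonglongrightarrow> 1" using ratio by (simp add: r_def[abs_def])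
  have ev: "\<forall>\<^sub>F n in sequentially. \<bar>r n - 1\<bar> < 1"
    using tendstoD[OF r, of 1] by (simp add: dist_real_def)
  have "(\<lambda>n. ?IF n + 2 * ?IG n + \<bar>L\<bar> * \<bar>r n - 1\<bar>) \<longlonglongrightarrow> 0 + 2 * 0 + \<bar>L\<bar> * \<bar>1 - 1\<bar>"
    by (intro tendsto_intros IF IG r)
  then have lim: "(\<lambda>n. ?IF n + 2 * ?IG n + \<bar>L\<bar> * \<bar>r n - 1\<bar>) \<longlonglongrightarrow> 0" by simp
  have "(\<lambda>n. min 1 \<bar>\<Delta> n\<bar>) \<longlonglongrightarrow> 0"
    by (rule tendsto_sandwich[OF _ _ tendsto_const lim]) (auto intro: eventually_mono[OF ev] bound)
  then have "(\<lambda>n. \<Delta> n) \<longlonglongrightarrow> 0"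
    unfolding tendsto_iff dist_real_def
  proof (intro allI impI)
    fix e :: real assume *: "\<forall>e>0. \<forall>\<^sub>F n in sequentially. \<bar>min 1 \<bar>\<Delta> n\<bar> - 0\<bar> < e" and e: "0 < e"
    have "\<forall>\<^sub>F n in sequentially. \<bar>min 1 \<bar>\<Delta> n\<bar> - 0\<bar> < min e 1"
      by (rule *[rule_format]) (use e in simp)
    then show "\<forall>\<^sub>F n in sequentially. \<bar>\<Delta> n - 0\<bar> < e" by eventually_elim (auto split: if_splits simp: min_def)
  qed
  then show ?thesis by (simp add: \<Delta>_def)
qed

lemma regularly_varying_cong:
  assumes "\<forall>\<^sub>F t in at_top. f t = g t" and "regularly_varying \<alpha> f"
  shows "regularly_varying \<alpha> g"
  unfolding regularly_varying_def
proof (intro allI impI)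
  fix z :: real assume z: "0 < z"
  have "filterlim (\<lambda>t. t * z) at_top at_top"
    using z by (intro filterlim_at_top_mult_tendsto_pos[OF tendsto_const] filterlim_ident)
  then have "\<forall>\<^sub>F t in at_top. f (t * z) = g (t * z)"
    using assms(1) by (rule filterlim_cong[OF refl refl, THEN iffD1, rotated] eventually_compose_filterlim[rotated])
  then have "\<forall>\<^sub>F t in at_top. f (t * z) / f t = g (t * z) / g t"
    using assms(1) by eventually_elim simp
  then show "((\<lambda>t. g (t * z) / g t) \<longlongrightarrow> z powr \<alpha>) at_top"
    using assms(2) z by (auto simp: regularly_varying_def elim: Lim_transform_eventually)
qed

text \<open>At \<open>z = 1\<close> the quotient is 1, or 0 by the convention
  \<open>x / 0 = 0\<close>; convergence to 1 excludes 0 for large \<open>t\<close>.\<close>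

lemma regularly_varying_nonzero:
  assumes "regularly_varying \<alpha> f"
  shows "\<forall>\<^sub>F t in at_top. f t \<noteq> 0"
proof -
  have "((\<lambda>t. f (t * 1) / f t) \<longlongrightarrow> 1 powr \<alpha>) at_top"
    using assms unfolding regularly_varying_def by (metis zero_less_one)
  then have "\<forall>\<^sub>F t in at_top. dist (f (t * 1) / f t) (1 powr \<alpha>) < 1"
    by (rule tendstoD) simp
  then show ?thesis by eventually_elim (auto simp: dist_real_def)
qed

text \<open>If uniformity failed, offending points could be chosen at each \<open>n\<close>, beyond
  \<open>n\<close>, and would form a sequence contradicting the hypothesis.\<close>

lemma eventually_uniform_of_sequences:
  fixes \<Phi> :: "real \<Rightarrow> real \<Rightarrow> real"
  assumes "\<And>x u. filterlim x at_top sequentially \<Longrightarrow> (\<And>n. u n \<in> I) \<Longrightarrow> (\<lambda>n. \<Phi> (x n) (u n)) \<longlonglongrightarrow> 0"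
    and "0 < \<epsilon>"
  shows "\<forall>\<^sub>F x in at_top. \<forall>u\<in>I. \<bar>\<Phi> x u\<bar> < \<epsilon>"
proof (rule ccontr)
  assume "\<not> ?thesis"
  then have "\<forall>n::nat. \<exists>x u. x \<ge> real n \<and> u \<in> I \<and> \<not> \<bar>\<Phi> x u\<bar> < \<epsilon>"
    unfolding eventually_at_top_linorder by blast
  then obtain x u where xu: "\<And>n::nat. x n \<ge> real n" "\<And>n. u n \<in> I" "\<And>n. \<not> \<bar>\<Phi> (x n) (u n)\<bar> < \<epsilon>"
    by metis
  have "filterlim x at_top sequentially"
    by (rule filterlim_at_top_mono[OF filterlim_real_sequentially]) (simp add: xu(1))
  then have "(\<lambda>n. \<Phi> (x n) (u n)) \<longlonglongrightarrow> 0" using assms(1) xu(2) by blast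
  then have "\<forall>\<^sub>F n in sequentially. dist (\<Phi> (x n) (u n)) 0 < \<epsilon>"
    using assms(2) by (rule tendstoD)
  then show False using xu(3) by (auto simp: dist_real_def dest: eventually_happens)
qed

text \<open>A unit step multiplies \<open>a\<close> by at most \<open>exp \<beta>\<close> once the
  limit \<open>exp \<alpha>\<close> is nearly attained; unit steps are iterated, and the fractional
  part of \<open>u\<close> costs a constant factor. Sequences are the form in which the uniform
  limits are available.\<close>

lemma potter_additive:
  fixes a :: "real \<Rightarrow> real"
  assumes lim: "\<And>x u. filterlim x at_top sequentially \<Longrightarrow> (\<And>n. 0 \<le> u n \<and> u n \<le> 1) \<Longrightarrow>
      (\<lambda>n. a (x n + u n) / a (x n) - exp (\<alpha> * u n)) \<longlonglongrightarrow> 0"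
    and pos: "\<forall>\<^sub>F y in at_top. 0 < a y" and "\<alpha> < \<beta>"
  shows "\<exists>C>0. \<forall>\<^sub>F x in at_top. \<forall>u\<ge>0. a (x + u) \<le> C * exp (\<beta> * u) * a x"
proof -
  \<comment> \<open>This tolerance turns the limit \<open>exp \<alpha>\<close> for a unit step into
    the bound \<open>exp \<beta>\<close>.\<close>
  define \<epsilon> where "\<epsilon> = exp \<beta> - exp \<alpha>"
  have \<epsilon>: "0 < \<epsilon>" using \<open>\<alpha> < \<beta>\<close> by (simp add: \<epsilon>_def)
  define C where "C = exp \<bar>\<alpha>\<bar> + \<epsilon>"
  have "\<forall>\<^sub>F x in at_top. \<forall>u\<in>{0..1}. \<bar>a (x + u) / a x - exp (\<alpha> * u)\<bar> < \<epsilon>"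
    by (rule eventually_uniform_of_sequences[OF _ \<epsilon>]) (rule lim, auto)
  then have "\<forall>\<^sub>F x in at_top. (\<forall>u\<in>{0..1}. \<bar>a (x + u) / a x - exp (\<alpha> * u)\<bar> < \<epsilon>) \<and> 0 < a x"
    using pos by eventually_elim auto
  then obtain x0 where x0: "\<And>x u. x \<ge> x0 \<Longrightarrow> 0 \<le> u \<Longrightarrow> u \<le> 1 \<Longrightarrow> \<bar>a (x + u) / a x - exp (\<alpha> * u)\<bar> < \<epsilon>"
    "\<And>x. x \<ge> x0 \<Longrightarrow> 0 < a x"
    unfolding eventually_at_top_linorder by fastforce
  have loc: "a (x + u) \<le> C * a x" if "x \<ge> x0" "0 \<le> u" "u \<le> 1" for x u
  proof -
    have "\<alpha> * u \<le> \<bar>\<alpha>\<bar>"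
      by (metis abs_ge_self abs_ge_zero mult_left_le mult_right_mono order_trans that(2,3))
    then have "exp (\<alpha> * u) \<le> exp \<bar>\<alpha>\<bar>" by simp
    then have "a (x + u) / a x \<le> C" using x0(1)[OF that] unfolding C_def abs_less_iff by linarith
    then show ?thesis using x0(2)[OF that(1)] by (simp add: divide_le_eq)
  qed
  have one: "a (x + 1) \<le> exp \<beta> * a x" if "x \<ge> x0" for x
  proof -
    have "a (x + 1) / a x \<le> exp \<beta>" using x0(1)[OF that, of 1] by (simp add: \<epsilon>_def abs_less_iff)
    then show ?thesis using x0(2)[OF that(1)] by (simp add: divide_le_eq)
  qed
  have iter: "a (x + real m) \<le> exp (\<beta> * real m) * a x" if "x \<ge> x0" for x m
  proof (induction m)
    case (Suc m)
    have "a (x + real (Suc m)) = a (x + real m + 1)" by (simp add: algebra_simps)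
    also have "\<dots> \<le> exp \<beta> * a (x + real m)" using that by (intro one) simp
    also have "\<dots> \<le> exp \<beta> * (exp (\<beta> * real m) * a x)" by (intro mult_left_mono Suc.IH) simp
    also have "\<dots> = exp (\<beta> * real (Suc m)) * a x" by (simp add: algebra_simps exp_add)
    finally show ?case .
  qed simp
  have C: "0 < C" using \<epsilon> by (simp add: C_def add_pos_pos)
  have "a (x + u) \<le> C * exp \<bar>\<beta>\<bar> * exp (\<beta> * u) * a x" if x: "x \<ge> x0" and u: "u \<ge> 0" for x u
  proof -
    define m where "m = nat \<lfloor>u\<rfloor>"
    define w where "w = u - real m"
    have w: "0 \<le> w" "w \<le> 1" using u by (auto simp: w_def m_def of_nat_nat) linarith
    have "a (x + u) = a (x + real m + w)" by (simp add: w_def)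
    also have "\<dots> \<le> C * a (x + real m)" using x w by (intro loc) auto
    also have "\<dots> \<le> C * (exp (\<beta> * real m) * a x)" using C x by (intro mult_left_mono iter) auto
    also have "\<dots> \<le> C * ((exp \<bar>\<beta>\<bar> * exp (\<beta> * u)) * a x)"
    proof (intro mult_left_mono mult_right_mono)
      \<comment> \<open>The factor \<open>exp \<bar>\<beta>\<bar>\<close> pays for replacing the
        integer part of \<open>u\<close> by \<open>u\<close>, whichever sign \<beta> has.\<close>
      have "\<bar>\<beta> * w\<bar> \<le> \<bar>\<beta>\<bar>" unfolding abs_mult using w by (intro mult_left_le) auto
      then have "\<beta> * real m \<le> \<bar>\<beta>\<bar> + \<beta> * u" by (simp add: w_def algebra_simps abs_le_iff)
      then show "exp (\<beta> * real m) \<le> exp \<bar>\<beta>\<bar> * exp (\<beta> * u)" by (simp flip: exp_add)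
    qed (use C x0(2)[OF x] in auto)
    finally show ?thesis by (simp add: mult_ac)
  qed
  then show ?thesis using C unfolding eventually_at_top_linorder
    by (intro exI[of _ "C * exp \<bar>\<beta>\<bar>"] conjI exI[of _ x0]) auto
qed

text \<open>In logarithmic coordinates regular variation says that the increments of
  \<open>ln \<bar>f (exp y)\<bar>\<close> over \<open>w\<close> tend to \<open>\<alpha> w\<close>,
  so the uniform theorem applies with auxiliary function 1. Absolute values appear because the
  remainder in a second-order condition may be negative.\<close>

lemma regularly_varying_uniform:
  fixes f :: "real \<Rightarrow> real"
  assumes f [measurable]: "f \<in> borel_measurable borel" and rv: "regularly_varying \<alpha> f"
    and x: "filterlim x at_top sequentially" and u: "\<And>n. \<bar>u n\<bar> \<le> B"
  shows "(\<lambda>n. \<bar>f (exp (x n + u n))\<bar> / \<bar>f (exp (x n))\<bar> - exp (\<alpha> * u n)) \<longlonglongrightarrow> 0"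
proof -
  define F where "F y = ln \<bar>f (exp y)\<bar>" for y
  have Fm: "F \<in> borel_measurable borel" unfolding F_def by measurable
  have nz: "\<forall>\<^sub>F y in at_top. f (exp y) \<noteq> 0"
    using eventually_compose_filterlim[OF regularly_varying_nonzero[OF rv] exp_at_top] .
  have shift: "filterlim (\<lambda>y. y + w) at_top at_top" for w :: real
    by (subst add.commute) (rule filterlim_tendsto_add_at_top[OF tendsto_const filterlim_ident])
  have conv: "((\<lambda>y. (F (y + w) - F y) / 1) \<longlongrightarrow> \<alpha> * w) at_top" for w
  proof -
    have "((\<lambda>t. f (t * exp w) / f t) \<longlongrightarrow> exp w powr \<alpha>) at_top"
      using rv unfolding regularly_varying_def by simp
    from filterlim_compose[OF this exp_at_top]
    have "((\<lambda>y. f (exp (y + w)) / f (exp y)) \<longlongrightarrow> exp (\<alpha> * w)) at_top"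
      by (simp add: exp_add powr_def)
    then have "((\<lambda>y. ln \<bar>f (exp (y + w)) / f (exp y)\<bar>) \<longlongrightarrow> ln \<bar>exp (\<alpha> * w)\<bar>) at_top"
      by (intro tendsto_intros) auto
    then have lim: "((\<lambda>y. ln \<bar>f (exp (y + w)) / f (exp y)\<bar>) \<longlongrightarrow> \<alpha> * w) at_top" by simp
    show ?thesis
      by (rule Lim_transform_eventually[OF lim], use nz eventually_compose_filterlim[OF nz shift[of w]] in eventually_elim)
        (simp add: F_def abs_divide ln_div)
  qed
  have "(\<lambda>n. (F (x n + u n) - F (x n)) / 1 - \<alpha> * u n) \<longlonglongrightarrow> 0"
    by (rule uniform_increments[OF Fm conv x u]) auto
  then have "(\<lambda>n. exp (F (x n + u n) - F (x n) - \<alpha> * u n) - 1) \<longlonglongrightarrow> exp 0 - 1"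
    by (intro tendsto_intros) simp
  then have e: "(\<lambda>n. exp (F (x n + u n) - F (x n) - \<alpha> * u n) - 1) \<longlonglongrightarrow> 0" by simp
  have "(\<lambda>n. (exp (F (x n + u n) - F (x n) - \<alpha> * u n) - 1) * exp (\<alpha> * u n)) \<longlonglongrightarrow> 0"
  proof (rule null_mult_bounded[OF e])
    have "\<alpha> * u n \<le> \<bar>\<alpha>\<bar> * B" for n
      using mult_left_mono[OF u[of n], of "\<bar>\<alpha>\<bar>"] abs_ge_self[of "\<alpha> * u n"] unfolding abs_mult by linarith
    then show "\<forall>\<^sub>F n in sequentially. \<bar>exp (\<alpha> * u n)\<bar> \<le> exp (\<bar>\<alpha>\<bar> * B)" by simp
  qed
  then show ?thesis
  proof (rule Lim_transform_eventually)
    have nz1: "\<forall>\<^sub>F n in sequentially. f (exp (x n)) \<noteq> 0"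
      by (rule eventually_compose_filterlim[OF nz x])
    have nz2: "\<forall>\<^sub>F n in sequentially. f (exp (x n + u n)) \<noteq> 0"
      by (rule eventually_compose_filterlim[OF nz filterlim_add_bounded_at_top[OF x u]])
    show "\<forall>\<^sub>F n in sequentially. (exp (F (x n + u n) - F (x n) - \<alpha> * u n) - 1) * exp (\<alpha> * u n) =
        \<bar>f (exp (x n + u n))\<bar> / \<bar>f (exp (x n))\<bar> - exp (\<alpha> * u n)"
      using nz1 nz2 by eventually_elim (simp add: F_def exp_diff left_diff_distrib)
  qed
qed

lemma potter_upper_bound:
  fixes f :: "real \<Rightarrow> real"
  assumes f: "f \<in> borel_measurable borel" and rv: "regularly_varying \<alpha> f" and "\<alpha> < \<beta>"
  shows "\<exists>C>0. \<forall>\<^sub>F t in at_top. \<forall>z\<ge>1. \<bar>f (t * z)\<bar> \<le> C * z powr \<beta> * \<bar>f t\<bar>"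
proof -
  have "\<exists>C>0. \<forall>\<^sub>F x in at_top. \<forall>u\<ge>0. \<bar>f (exp (x + u))\<bar> \<le> C * exp (\<beta> * u) * \<bar>f (exp x)\<bar>"
  proof (rule potter_additive[OF _ _ \<open>\<alpha> < \<beta>\<close>])
    show "\<forall>\<^sub>F y in at_top. 0 < \<bar>f (exp y)\<bar>"
      using eventually_compose_filterlim[OF regularly_varying_nonzero[OF rv] exp_at_top] by simp
    fix x u :: "nat \<Rightarrow> real"
    assume "filterlim x at_top sequentially" "\<And>n. 0 \<le> u n \<and> u n \<le> 1"
    then show "(\<lambda>n. \<bar>f (exp (x n + u n))\<bar> / \<bar>f (exp (x n))\<bar> - exp (\<alpha> * u n)) \<longlonglongrightarrow> 0"
      by (intro regularly_varying_uniform[OF f rv, where B = 1]) auto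
  qed
  then obtain C where C: "C > 0"
    "\<forall>\<^sub>F x in at_top. \<forall>u\<ge>0. \<bar>f (exp (x + u))\<bar> \<le> C * exp (\<beta> * u) * \<bar>f (exp x)\<bar>" by blast
  have "\<forall>\<^sub>F t in at_top. \<forall>z\<ge>1. \<bar>f (t * z)\<bar> \<le> C * z powr \<beta> * \<bar>f t\<bar>"
    using eventually_compose_filterlim[OF C(2) ln_at_top] eventually_gt_at_top[of 0]
  proof eventually_elim
    case (elim t)
    show ?case
    proof (intro allI impI)
      fix z :: real assume "1 \<le> z"
      then show "\<bar>f (t * z)\<bar> \<le> C * z powr \<beta> * \<bar>f t\<bar>"
        using elim(1)[rule_format, of "ln z"] elim(2) by (simp add: exp_add powr_def)
    qed
  qed
  then show ?thesis using C(1) by blast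
qed

text \<open>The unit increment \<open>b\<close> of \<open>f\<close>, with its sign corrected, is
  measurable and asymptotically equal to \<open>a\<close>. The uniform theorem applied to
  \<open>ln b\<close> makes \<open>b\<close>, hence \<open>a\<close>, slowly varying along bounded
  shifts; this is the ratio hypothesis needed to apply the theorem to \<open>f\<close>
  itself.\<close>

lemma de_haan_class_uniform:
  fixes f a :: "real \<Rightarrow> real"
  assumes f [measurable]: "f \<in> borel_measurable borel" and s: "s \<in> {1, - 1}"
    and pos: "\<forall>\<^sub>F y in at_top. 0 < a y"
    and conv: "\<And>w. ((\<lambda>y. (f (y + w) - f y) / a y) \<longlongrightarrow> s * w) at_top"
    and x: "filterlim x at_top sequentially" and u: "\<And>n. \<bar>u n\<bar> \<le> B"
  shows "(\<lambda>n. a (x n + u n) / a (x n)) \<longlonglongrightarrow> 1"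
    and "(\<lambda>n. (f (x n + u n) - f (x n)) / a (x n) - s * u n) \<longlonglongrightarrow> 0"
proof -
  define b where "b y = s * (f (y + 1) - f y)" for y
  have ss: "s * s = 1" using s by auto
  have shift: "filterlim (\<lambda>y. y + w) at_top at_top" for w :: real
    by (subst add.commute) (rule filterlim_tendsto_add_at_top[OF tendsto_const filterlim_ident])
  \<comment> \<open>The shifted unit increment telescopes into two increments based at the same
    point \<open>y\<close>, with limits \<open>s (w + 1)\<close> and \<open>s w\<close>.\<close>
  have bw: "((\<lambda>y. b (y + w) / a y) \<longlongrightarrow> 1) at_top" for w
  proof -
    have "((\<lambda>y. s * ((f (y + (w + 1)) - f y) / a y - (f (y + w) - f y) / a y)) \<longlongrightarrow> s * (s * (w + 1) - s * w)) at_top"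
      by (intro tendsto_intros conv)
    moreover have "s * ((f (y + (w + 1)) - f y) / a y - (f (y + w) - f y) / a y) = b (y + w) / a y" for y
      by (simp add: b_def add.assoc diff_divide_distrib right_diff_distrib)
    moreover have "s * (s * (w + 1) - s * w) = 1" using ss by (simp add: algebra_simps)
    ultimately show ?thesis by simp
  qed
  have ba: "((\<lambda>y. b y / a y) \<longlongrightarrow> 1) at_top" using bw[of 0] by simp
  have bpos: "\<forall>\<^sub>F y in at_top. 0 < b y"
    using order_tendstoD(1)[OF ba, of 0, simplified] pos by eventually_elim (simp add: zero_less_divide_iff)
  have bm: "(\<lambda>y. ln (b y)) \<in> borel_measurable borel" unfolding b_def by measurable
  have lnb: "((\<lambda>y. (ln (b (y + w)) - ln (b y)) / 1) \<longlongrightarrow> 0 * w) at_top" for w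
  proof -
    have "((\<lambda>y. ln ((b (y + w) / a y) / (b y / a y))) \<longlongrightarrow> ln (1 / 1)) at_top"
      by (intro tendsto_intros bw ba) auto
    then have lim: "((\<lambda>y. ln ((b (y + w) / a y) / (b y / a y))) \<longlongrightarrow> 0) at_top" by simp
    have "((\<lambda>y. ln (b (y + w)) - ln (b y)) \<longlongrightarrow> 0) at_top"
      by (rule Lim_transform_eventually[OF lim],
          use bpos pos eventually_compose_filterlim[OF bpos shift[of w]] in eventually_elim) (simp add: ln_div)
    then show ?thesis by simp
  qed
  have xu: "filterlim (\<lambda>n. x n + u n) at_top sequentially"
    by (rule filterlim_add_bounded_at_top[OF x u])
  have "(\<lambda>n. (ln (b (x n + u n)) - ln (b (x n))) / 1 - 0 * u n) \<longlonglongrightarrow> 0"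
    by (rule uniform_increments[OF bm lnb x u]) auto
  then have "(\<lambda>n. exp (ln (b (x n + u n)) - ln (b (x n)))) \<longlonglongrightarrow> exp 0"
    by (intro tendsto_exp) simp
  from tendsto_divide[OF tendsto_mult[OF this filterlim_compose[OF ba x]] filterlim_compose[OF ba xu]]
  have "(\<lambda>n. exp (ln (b (x n + u n)) - ln (b (x n))) * (b (x n) / a (x n)) / (b (x n + u n) / a (x n + u n))) \<longlonglongrightarrow> exp 0 * 1 / 1"
    by simp
  then have lim: "(\<lambda>n. exp (ln (b (x n + u n)) - ln (b (x n))) * (b (x n) / a (x n)) / (b (x n + u n) / a (x n + u n))) \<longlonglongrightarrow> 1"
    by simp
  show ratio: "(\<lambda>n. a (x n + u n) / a (x n)) \<longlonglongrightarrow> 1"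
    by (rule Lim_transform_eventually[OF lim], use eventually_compose_filterlim[OF bpos x] eventually_compose_filterlim[OF bpos xu]
      eventually_compose_filterlim[OF pos x] eventually_compose_filterlim[OF pos xu] in eventually_elim) (simp add: exp_diff)
  show "(\<lambda>n. (f (x n + u n) - f (x n)) / a (x n) - s * u n) \<longlonglongrightarrow> 0"
    by (rule uniform_increments[OF f conv x u ratio])
qed

text \<open>The derivative is the limit of difference quotients with steps \<open>1 / Suc n\<close>,
  which are continuous on the ray. Cutting off at \<open>T\<close> makes the function globally
  measurable without any knowledge of \<open>g\<close> to the left.\<close>

lemma borel_measurable_deriv_tail:
  fixes g :: "real \<Rightarrow> real"
  assumes diff: "\<And>t. T < t \<Longrightarrow> g differentiable (at t)"
  shows "(\<lambda>t. if T < t then deriv g t else 0) \<in> borel_measurable borel"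
proof (rule borel_measurable_LIMSEQ_real)
  define h where "h n t = (if t \<in> {T<..} then real (Suc n) * (g (t + 1 / real (Suc n)) - g t) else 0)" for n t
  have "continuous_on {T<..} g"
    using diff by (intro continuous_at_imp_continuous_on) (auto intro: differentiable_imp_continuous_within)
  moreover have "continuous_on {T<..} (\<lambda>t. g (t + 1 / real (Suc n)))" for n
  proof (rule continuous_on_compose2[OF \<open>continuous_on {T<..} g\<close>])
    have "0 < 1 / real (Suc n)" by simp
    then show "(\<lambda>t. t + 1 / real (Suc n)) ` {T<..} \<subseteq> {T<..}" 
      by (intro image_subsetI) (metis greaterThan_iff less_add_same_cancel1 less_trans)
  qed (intro continuous_intros)
  ultimately show "h n \<in> borel_measurable borel" for n
    unfolding h_def by (intro borel_measurable_continuous_on_if continuous_intros) auto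
  fix t
  show "(\<lambda>n. h n t) \<longlonglongrightarrow> (if T < t then deriv g t else 0)"
  proof (cases "T < t")
    case True
    then have "(g has_real_derivative deriv g t) (at t)"
      using diff[OF True] by (simp add: DERIV_deriv_iff_real_differentiable)
    then have "((\<lambda>e. (g (t + e) - g t) / e) \<longlongrightarrow> deriv g t) (at 0)"
      by (simp add: DERIV_def)
    moreover have "filterlim (\<lambda>n. 1 / real (Suc n)) (at 0) sequentially"
      using LIMSEQ_inverse_real_of_nat by (auto simp: filterlim_at inverse_eq_divide)
    ultimately have "(\<lambda>n. (g (t + 1 / real (Suc n)) - g t) / (1 / real (Suc n))) \<longlonglongrightarrow> deriv g t"
      by (rule filterlim_compose)
    then show ?thesis using True by (simp add: h_def mult.commute)
  qed (simp add: h_def)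
qed

lemma filterlim_at_top_mult_const:
  fixes z :: real
  assumes "0 < z"
  shows "filterlim (\<lambda>t. t * z) at_top at_top"
  using assms by (intro filterlim_at_top_mult_tendsto_pos[OF tendsto_const] filterlim_ident)

text \<open>The de Haan class with auxiliary function \<open>A\<close>; \<open>s\<close> encodes the
  sign in the second-order condition. It is used for
  \<open>V(t) = t^(1+1/\<rho>) U'(t)\<close>.\<close>

locale de_haan_class =
  fixes V A :: "real \<Rightarrow> real" and s :: real
  assumes V [measurable]: "V \<in> borel_measurable borel" and s: "s \<in> {1, - 1}"
    and A_pos: "\<forall>\<^sub>F t in at_top. 0 < A t" and V_pos: "\<forall>\<^sub>F t in at_top. 0 < V t"
    and conv: "\<And>z. 0 < z \<Longrightarrow> ((\<lambda>t. (V (t * z) - V t) / A t) \<longlongrightarrow> s * ln z) at_top"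
begin

text \<open>Positivity of \<open>V\<close> is the reason: for a suitable \<open>z\<close> the
  increment \<open>V (t z) - V t\<close> is below \<open>- A t / \<epsilon>\<close>, while
  \<open>V (t z)\<close> stays positive, so \<open>V t\<close> exceeds
  \<open>A t / \<epsilon>\<close>.\<close>

lemma ratio_tendsto_0: "((\<lambda>t. A t / V t) \<longlongrightarrow> 0) at_top"
proof (rule tendstoI)
  fix \<epsilon> :: real assume \<epsilon>: "0 < \<epsilon>"
  \<comment> \<open>Whether \<open>z\<close> lies above or below 1 depends on \<open>s\<close>; in
    both cases \<open>s ln z\<close> is the same negative number.\<close>
  define z where "z = exp (- s * (1 / \<epsilon> + 1))"
  have ss: "s * s = 1" using s by auto
  have "s * ln z = - (s * s) * (1 / \<epsilon> + 1)" by (simp add: z_def algebra_simps)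
  then have z: "s * ln z = - (1 / \<epsilon> + 1)" by (simp add: ss)
  have "0 < z" by (simp add: z_def)
  have "\<forall>\<^sub>F t in at_top. (V (t * z) - V t) / A t < - (1 / \<epsilon>)"
    by (rule order_tendstoD(2)[OF conv[OF \<open>0 < z\<close>]]) (simp add: z)
  moreover have "\<forall>\<^sub>F t in at_top. 0 < V (t * z)"
    by (rule eventually_compose_filterlim[OF V_pos filterlim_at_top_mult_const[OF \<open>0 < z\<close>]])
  ultimately show "\<forall>\<^sub>F t in at_top. dist (A t / V t) 0 < \<epsilon>"
    using A_pos V_pos
  proof eventually_elim
    case (elim t)
    then have "V (t * z) - V t < - (1 / \<epsilon>) * A t" by (simp add: divide_less_eq)
    with elim have "1 / \<epsilon> * A t < V t" by linarith
    then show ?case using elim \<epsilon> by (simp add: dist_real_def field_simps)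
  qed
qed

abbreviation f where "f y \<equiv> V (exp y)"
abbreviation a where "a y \<equiv> A (exp y)"

lemma additive:
  assumes "filterlim x at_top sequentially" "\<And>n. \<bar>u n\<bar> \<le> B"
  shows "(\<lambda>n. a (x n + u n) / a (x n)) \<longlonglongrightarrow> 1"
    and "(\<lambda>n. (f (x n + u n) - f (x n)) / a (x n) - s * u n) \<longlonglongrightarrow> 0"
proof -
  have m: "f \<in> borel_measurable borel" by measurable
  have p: "\<forall>\<^sub>F y in at_top. 0 < a y" using eventually_compose_filterlim[OF A_pos exp_at_top] .
  have c: "((\<lambda>y. (f (y + w) - f y) / a y) \<longlongrightarrow> s * w) at_top" for w
    using filterlim_compose[OF conv[of "exp w"] exp_at_top] by (simp add: exp_add)
  show "(\<lambda>n. a (x n + u n) / a (x n)) \<longlonglongrightarrow> 1"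
    and "(\<lambda>n. (f (x n + u n) - f (x n)) / a (x n) - s * u n) \<longlonglongrightarrow> 0"
    by (rule de_haan_class_uniform[OF m s p c assms])+
qed

text \<open>The relative increment of \<open>V\<close> is \<open>A / V\<close>, which vanishes,
  times the increment in units of \<open>A\<close>, which stays bounded.\<close>

lemma slowly_varying_additive:
  assumes x: "filterlim x at_top sequentially" and u: "\<And>n. \<bar>u n\<bar> \<le> B"
  shows "(\<lambda>n. f (x n + u n) / f (x n)) \<longlonglongrightarrow> 1"
proof -
  have e: "filterlim (\<lambda>n. exp (x n)) at_top sequentially" using filterlim_compose[OF exp_at_top x] .
  have "(\<lambda>n. (f (x n + u n) - f (x n)) / a (x n) - s * u n) \<longlonglongrightarrow> 0" by (rule additive[OF x u])
  then have 1: "(\<lambda>n. (a (x n) / f (x n)) * ((f (x n + u n) - f (x n)) / a (x n) - s * u n)) \<longlonglongrightarrow> 0 * 0"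
    by (intro tendsto_intros filterlim_compose[OF ratio_tendsto_0 e])
  have "(\<lambda>n. (a (x n) / f (x n)) * (s * u n)) \<longlonglongrightarrow> 0"
    by (rule null_mult_bounded[OF filterlim_compose[OF ratio_tendsto_0 e], where K = B]) (use u s in auto)
  from tendsto_add[OF tendsto_add[OF 1 this] tendsto_const[of 1]]
  have lim: "(\<lambda>n. (a (x n) / f (x n)) * ((f (x n + u n) - f (x n)) / a (x n) - s * u n) + (a (x n) / f (x n)) * (s * u n) + 1) \<longlonglongrightarrow> 1"
    by simp
  show ?thesis
    by (rule Lim_transform_eventually[OF lim], use eventually_compose_filterlim[OF V_pos e] eventually_compose_filterlim[OF A_pos e]
      in eventually_elim) (simp add: field_simps)
qed

lemma slowly_varying:
  assumes t: "filterlim t at_top sequentially" and z: "z \<longlonglongrightarrow> z0" "0 < z0"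
  shows "(\<lambda>n. V (t n * z n) / V (t n)) \<longlonglongrightarrow> 1"
proof -
  have "(\<lambda>n. ln (z n)) \<longlonglongrightarrow> ln z0" using z by (intro tendsto_intros) auto
  then have "Bseq (\<lambda>n. ln (z n))" by (intro convergent_imp_Bseq convergentI)
  then obtain B where B: "\<And>n. \<bar>ln (z n)\<bar> \<le> B" unfolding Bseq_def by auto
  have lim: "(\<lambda>n. f (ln (t n) + ln (z n)) / f (ln (t n))) \<longlonglongrightarrow> 1"
    by (rule slowly_varying_additive[OF filterlim_compose[OF ln_at_top t] B])
  have "\<forall>\<^sub>F n in sequentially. 0 < t n" using eventually_compose_filterlim[OF eventually_gt_at_top t] .
  moreover have "\<forall>\<^sub>F n in sequentially. 0 < z n" using order_tendstoD(1)[OF z] .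
  ultimately show ?thesis
    by (intro Lim_transform_eventually[OF lim], eventually_elim) (simp add: exp_add)
qed

text \<open>Both \<open>A\<close> and \<open>V\<close> vary slowly, so \<open>A / V\<close> has
  index 0 and Potter's bound holds with any positive exponent.\<close>

lemma ratio_upper_bound:
  assumes "0 < \<eta>"
  shows "\<exists>C>0. \<forall>\<^sub>F t in at_top. \<forall>z\<ge>1. A (t * z) / V (t * z) \<le> C * z powr \<eta> * (A t / V t)"
proof -
  have "\<exists>C>0. \<forall>\<^sub>F x in at_top. \<forall>u\<ge>0. a (x + u) / f (x + u) \<le> C * exp (\<eta> * u) * (a x / f x)"
  proof (rule potter_additive[OF _ _ assms])
    show "\<forall>\<^sub>F y in at_top. 0 < a y / f y"
      using eventually_compose_filterlim[OF A_pos exp_at_top] eventually_compose_filterlim[OF V_pos exp_at_top]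
      by eventually_elim simp
    fix x u :: "nat \<Rightarrow> real"
    assume x: "filterlim x at_top sequentially" and u: "\<And>n. 0 \<le> u n \<and> u n \<le> 1"
    then have u': "\<bar>u n\<bar> \<le> 1" for n by auto
    have "(\<lambda>n. (a (x n + u n) / a (x n)) / (f (x n + u n) / f (x n)) - exp (0 * u n)) \<longlonglongrightarrow> 1 / 1 - exp 0"
      by (intro tendsto_intros additive(1)[OF x u'] slowly_varying_additive[OF x u'] ) auto
    then show "(\<lambda>n. a (x n + u n) / f (x n + u n) / (a (x n) / f (x n)) - exp (0 * u n)) \<longlonglongrightarrow> 0"
      by (simp add: field_simps)
  qed
  then obtain C where C: "C > 0"
    "\<forall>\<^sub>F x in at_top. \<forall>u\<ge>0. a (x + u) / f (x + u) \<le> C * exp (\<eta> * u) * (a x / f x)" by blast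
  have "\<forall>\<^sub>F t in at_top. \<forall>z\<ge>1. A (t * z) / V (t * z) \<le> C * z powr \<eta> * (A t / V t)"
    using eventually_compose_filterlim[OF C(2) ln_at_top] eventually_gt_at_top[of 0]
  proof eventually_elim
    case (elim t)
    show ?case
    proof (intro allI impI)
      fix z :: real assume "1 \<le> z"
      then show "A (t * z) / V (t * z) \<le> C * z powr \<eta> * (A t / V t)"
        using elim(1)[rule_format, of "ln z"] elim(2) by (simp add: exp_add powr_def)
    qed
  qed
  then show ?thesis using C(1) by blast
qed

text \<open>The increment over \<open>ln z\<close> is split into unit steps, each bounded by a
  multiple of the current \<open>A\<close>, and the bounds grow geometrically by Potter. The range
  reaches below 1, down to \<open>1 / 8\<close>, because the quantiles at \<open>t / 2\<close> and
  \<open>t / 4\<close> are later compared with \<open>t\<close>.\<close>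

lemma increment_bound:
  assumes \<eta>: "0 < \<eta>"
  shows "\<exists>C>0. \<forall>\<^sub>F t in at_top. \<forall>z\<ge>1/8. \<bar>V (t * z) - V t\<bar> \<le> C * z powr \<eta> * A t"
proof -
  have "\<exists>C>0. \<forall>\<^sub>F x in at_top. \<forall>u\<ge>0. a (x + u) \<le> C * exp (\<eta> * u) * a x"
  proof (rule potter_additive[OF _ _ \<eta>])
    show "\<forall>\<^sub>F y in at_top. 0 < a y" using eventually_compose_filterlim[OF A_pos exp_at_top] .
    fix x u :: "nat \<Rightarrow> real"
    assume x: "filterlim x at_top sequentially" and u: "\<And>n. 0 \<le> u n \<and> u n \<le> 1"
    then have u': "\<bar>u n\<bar> \<le> 1" for n by auto
    show "(\<lambda>n. a (x n + u n) / a (x n) - exp (0 * u n)) \<longlonglongrightarrow> 0"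
      using tendsto_diff[OF additive(1)[OF x u'] tendsto_const[of 1]] by simp
  qed
  then obtain C where C: "C > 0"
    "\<forall>\<^sub>F x in at_top. \<forall>u\<ge>0. a (x + u) \<le> C * exp (\<eta> * u) * a x" by blast
  have ab: "\<bar>u\<bar> \<le> \<bar>c\<bar> + \<bar>d\<bar>" if "u \<in> {c..d}" for u c d :: real using that by auto
  have unif: "\<forall>\<^sub>F x in at_top. \<forall>u\<in>{- ln 8..1}. \<bar>(f (x + u) - f x) / a x - s * u\<bar> < 1"
    by (rule eventually_uniform_of_sequences) (rule additive(2)[OF _ ab], auto)
  have "\<forall>\<^sub>F x in at_top. (\<forall>u\<ge>0. a (x + u) \<le> C * exp (\<eta> * u) * a x) \<and> 0 < a x
      \<and> (\<forall>u\<in>{- ln 8..1}. \<bar>(f (x + u) - f x) / a x - s * u\<bar> < 1)"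
    using C(2) unif eventually_compose_filterlim[OF A_pos exp_at_top] by eventually_elim auto
  then obtain x0 where x0: "\<And>x u. x \<ge> x0 \<Longrightarrow> u \<ge> 0 \<Longrightarrow> a (x + u) \<le> C * exp (\<eta> * u) * a x"
    "\<And>x. x \<ge> x0 \<Longrightarrow> 0 < a x"
    "\<And>x u. x \<ge> x0 \<Longrightarrow> - ln 8 \<le> u \<Longrightarrow> u \<le> 1 \<Longrightarrow> \<bar>(f (x + u) - f x) / a x - s * u\<bar> < 1"
    unfolding eventually_at_top_linorder by fastforce
  \<comment> \<open>Makes \<open>ln 8\<close> a bound for \<open>\<bar>u\<bar>\<close> on the whole
    range \<open>- ln 8 <= u <= 1\<close>.\<close>
  have ln8: "1 \<le> ln (8::real)"
  proof -
    have "exp 1 \<le> (8::real)" using exp_le by linarith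
    then show ?thesis by (subst ln_ge_iff) auto
  qed
  have loc: "\<bar>f (x + u) - f x\<bar> \<le> (ln 8 + 1) * a x" if "x \<ge> x0" "- ln 8 \<le> u" "u \<le> 1" for x u
  proof -
    have "\<bar>s * u\<bar> \<le> ln 8" using s that(2,3) ln8 by auto
    then have "\<bar>(f (x + u) - f x) / a x\<bar> \<le> ln 8 + 1" using x0(3)[OF that] by linarith
    then show ?thesis using x0(2)[OF that(1)] by (simp add: abs_divide divide_le_eq)
  qed
  \<comment> \<open>\<open>K\<close> solves \<open>K + 1 = K exp \<eta>\<close>, so the bound on the
    sum of \<open>m\<close> steps reproduces itself in the induction.\<close>
  define K where "K = 1 / (exp \<eta> - 1)"
  define D where "D = (ln 8 + 1) * C"
  have K: "K + 1 = K * exp \<eta>" "0 < K" using \<eta> by (auto simp: K_def field_simps)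
  have D: "0 < D" using C ln8 by (simp add: D_def)
  have locm: "\<bar>f (x + real m + w) - f (x + real m)\<bar> \<le> D * exp (\<eta> * real m) * a x" if "x \<ge> x0" "0 \<le> w" "w \<le> 1" for x m w
  proof -
    have "\<bar>f (x + real m + w) - f (x + real m)\<bar> \<le> (ln 8 + 1) * a (x + real m)"
      using that ln8 by (intro loc) auto
    also have "\<dots> \<le> (ln 8 + 1) * (C * exp (\<eta> * real m) * a x)"
      using that ln8 by (intro mult_left_mono x0(1)) auto
    finally show ?thesis by (simp add: D_def mult_ac)
  qed
  have iter: "\<bar>f (x + real m) - f x\<bar> \<le> D * K * exp (\<eta> * real m) * a x" if x: "x \<ge> x0" for x m
  proof (induction m)
    case 0
    then show ?case using x0(2)[OF x] K D by simp
  next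
    case (Suc m)
    have "\<bar>f (x + real (Suc m)) - f x\<bar> \<le> \<bar>f (x + real m + 1) - f (x + real m)\<bar> + \<bar>f (x + real m) - f x\<bar>"
      by (simp add: algebra_simps)
    also have "\<dots> \<le> D * exp (\<eta> * real m) * a x + D * K * exp (\<eta> * real m) * a x"
      using locm[OF x, of 1 m] Suc.IH by simp
    also have "\<dots> = D * (K + 1) * exp (\<eta> * real m) * a x" by (simp add: algebra_simps)
    also have "\<dots> = D * K * exp (\<eta> * real (Suc m)) * a x" unfolding K(1) by (simp add: exp_add algebra_simps)
    finally show ?case .
  qed
  \<comment> \<open>The first summand serves \<open>u >= 0\<close>. The second serves
    \<open>- ln 8 <= u < 0\<close>, where \<open>exp (\<eta> u)\<close> may be as small as
    \<open>exp (- \<eta> ln 8)\<close>.\<close>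
  define E where "E = D * (K + 1) + (ln 8 + 1) * exp (\<eta> * ln 8)"
  have "\<bar>f (x + u) - f x\<bar> \<le> E * exp (\<eta> * u) * a x" if x: "x \<ge> x0" and u: "u \<ge> - ln 8" for x u
  proof (cases "0 \<le> u")
    case True
    define m where "m = nat \<lfloor>u\<rfloor>"
    define w where "w = u - real m"
    have w: "0 \<le> w" "w \<le> 1" using True by (auto simp: w_def m_def of_nat_nat) linarith
    have "\<bar>f (x + u) - f x\<bar> \<le> \<bar>f (x + real m + w) - f (x + real m)\<bar> + \<bar>f (x + real m) - f x\<bar>"
      by (simp add: w_def)
    also have "\<dots> \<le> D * exp (\<eta> * real m) * a x + D * K * exp (\<eta> * real m) * a x"
      using locm[OF x w, of m] iter[OF x, of m] by simp
    also have "\<dots> = D * (K + 1) * (exp (\<eta> * real m) * a x)" by (simp add: algebra_simps)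
    also have "\<dots> \<le> E * (exp (\<eta> * u) * a x)"
    proof (intro mult_mono)
      show "exp (\<eta> * real m) \<le> exp (\<eta> * u)" using \<eta> w(1) by (simp add: w_def)
    qed (use ln8 D K x0(2)[OF x] in \<open>auto simp: E_def\<close>)
    finally show ?thesis by (simp add: mult_ac)
  next
    case False
    have "\<bar>f (x + u) - f x\<bar> \<le> (ln 8 + 1) * 1 * a x" using loc[OF x u] False by simp
    also have "\<dots> \<le> (ln 8 + 1) * (exp (\<eta> * ln 8) * exp (\<eta> * u)) * a x"
    proof (intro mult_left_mono mult_right_mono)
      have "0 \<le> \<eta> * (ln 8 + u)" using \<eta> u by simp
      then show "1 \<le> exp (\<eta> * ln 8) * exp (\<eta> * u)" by (simp flip: exp_add add: algebra_simps)
    qed (use ln8 x0(2)[OF x] in auto)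
    also have "\<dots> = ((ln 8 + 1) * exp (\<eta> * ln 8)) * (exp (\<eta> * u) * a x)" by (simp add: mult_ac)
    also have "\<dots> \<le> E * (exp (\<eta> * u) * a x)"
      using D K x0(2)[OF x] by (intro mult_right_mono) (auto simp: E_def)
    finally show ?thesis by (simp add: mult_ac)
  qed
  moreover have "0 < E" using D K ln8 by (auto simp: E_def intro!: add_pos_pos mult_pos_pos)
  moreover have "\<forall>\<^sub>F t in at_top. \<forall>z\<ge>1/8. \<bar>V (t * z) - V t\<bar> \<le> E * z powr \<eta> * A t"
    if *: "\<And>x u. x \<ge> x0 \<Longrightarrow> u \<ge> - ln 8 \<Longrightarrow> \<bar>f (x + u) - f x\<bar> \<le> E * exp (\<eta> * u) * a x" for E
    using eventually_ge_at_top[of "exp x0"]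
  proof eventually_elim
    case (elim t)
    have t: "0 < t" using elim exp_gt_zero[of x0] by linarith
    show ?case
    proof (intro allI impI)
      fix z :: real assume z: "1 / 8 \<le> z"
      then have "ln (1 / 8) \<le> ln z" by (subst ln_le_cancel_iff) auto
      then have "- ln 8 \<le> ln z" by (simp add: ln_div)
      moreover have "x0 \<le> ln t" using elim t by (simp add: ln_ge_iff)
      ultimately show "\<bar>V (t * z) - V t\<bar> \<le> E * z powr \<eta> * A t"
        using *[of "ln t" "ln z"] t z by (simp add: exp_add powr_def)
    qed
  qed
  ultimately show ?thesis by blast
qed

end

section \<open>Karamata's theorem and the von Mises condition\<close>

text \<open>By the chain rule \<open>deriv r (1 / t)\<close> is \<open>- t^2\<close> times the
  derivative of \<open>r (1 / t)\<close>, a derivative on a ray to infinity.\<close>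

lemma borel_measurable_deriv_at_right:
  fixes r :: "real \<Rightarrow> real"
  assumes diff: "\<And>v. 0 < v \<Longrightarrow> v < v0 \<Longrightarrow> r differentiable (at v)" and "0 < v0"
  shows "(\<lambda>t. if 1 / v0 < t then deriv r (1 / t) else 0) \<in> borel_measurable borel"
proof -
  have der: "((\<lambda>t. r (1 / t)) has_real_derivative - (deriv r (1 / t) / t\<^sup>2)) (at t)" if "1 / v0 < t" for t
  proof -
    have t: "0 < t" using that \<open>0 < v0\<close> by (meson less_trans zero_less_divide_1_iff)
    have "r differentiable (at (1 / t))"
      by (rule diff) (use t that \<open>0 < v0\<close> in \<open>auto simp: field_simps\<close>)
    then have "(r has_real_derivative deriv r (1 / t)) (at (1 / t))"
      by (simp add: DERIV_deriv_iff_real_differentiable)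
    moreover have "((\<lambda>t. 1 / t) has_real_derivative - (1 / t\<^sup>2)) (at t)"
      using t by (auto intro!: derivative_eq_intros simp: power2_eq_square)
    ultimately have "((\<lambda>t. r (1 / t)) has_real_derivative deriv r (1 / t) * - (1 / t\<^sup>2)) (at t)"
      by (rule DERIV_chain2)
    then show ?thesis by simp
  qed
  have "(\<lambda>t. - (t\<^sup>2) * (if 1 / v0 < t then deriv (\<lambda>t. r (1 / t)) t else 0)) \<in> borel_measurable borel"
    by (intro borel_measurable_times borel_measurable_deriv_tail) (use der in \<open>auto simp: real_differentiable_def\<close>)
  also have "(\<lambda>t. - (t\<^sup>2) * (if 1 / v0 < t then deriv (\<lambda>t. r (1 / t)) t else 0)) = (\<lambda>t. if 1 / v0 < t then deriv r (1 / t) else 0)"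
  proof
    fix t
    have "0 < t" if "1 / v0 < t" using that \<open>0 < v0\<close> by (meson less_trans zero_less_divide_1_iff)
    then show "- (t\<^sup>2) * (if 1 / v0 < t then deriv (\<lambda>t. r (1 / t)) t else 0) = (if 1 / v0 < t then deriv r (1 / t) else 0)"
      by (auto simp: DERIV_imp_deriv[OF der])
  qed
  finally show ?thesis .
qed

text \<open>The quotient is the integral of \<open>r'(v z) / r'(v)\<close> over
  \<open>0 <= z <= 1\<close>, and the integrand tends to \<open>z^(\<beta> - 1)\<close>. The gauge
  integral accepts any derivative as integrand, so no continuity of \<open>r'\<close> enters; its
  sign is free as well.\<close>

lemma karamata_at_right_0:
  fixes r :: "real \<Rightarrow> real"
  assumes diff: "\<And>v. 0 < v \<Longrightarrow> v < v0 \<Longrightarrow> r differentiable (at v)" and "0 < v0" "0 < \<beta>"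
    and lim: "(r \<longlongrightarrow> 0) (at_right 0)"
    and rv: "regularly_varying (1 - \<beta>) (\<lambda>t. deriv r (1 / t))"
  shows "((\<lambda>v. r v / (v * deriv r v)) \<longlongrightarrow> 1 / \<beta>) (at_right 0)"
proof -
  define g where "g t = (if 1 / v0 < t then deriv r (1 / t) else 0)" for t
  have gm: "g \<in> borel_measurable borel"
    unfolding g_def by (rule borel_measurable_deriv_at_right[OF diff \<open>0 < v0\<close>])
  have grv: "regularly_varying (1 - \<beta>) g"
    by (rule regularly_varying_cong[OF _ rv])
      (use eventually_gt_at_top[of "1 / v0"] in \<open>eventually_elim, simp add: g_def\<close>)
  obtain C where C: "0 < C" "\<forall>\<^sub>F t in at_top. \<forall>z\<ge>1. \<bar>g (t * z)\<bar> \<le> C * z powr (1 - \<beta> / 2) * \<bar>g t\<bar>"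
    using potter_upper_bound[OF gm grv, of "1 - \<beta> / 2"] \<open>0 < \<beta>\<close> by auto
  have "\<forall>\<^sub>F t in at_top. (\<forall>z\<ge>1. \<bar>g (t * z)\<bar> \<le> C * z powr (1 - \<beta> / 2) * \<bar>g t\<bar>) \<and> g t \<noteq> 0 \<and> 1 / v0 < t"
    using C(2) regularly_varying_nonzero[OF grv] eventually_gt_at_top[of "1 / v0"] by eventually_elim auto
  then obtain t0 where t0: "\<And>t z. t \<ge> t0 \<Longrightarrow> z \<ge> 1 \<Longrightarrow> \<bar>g (t * z)\<bar> \<le> C * z powr (1 - \<beta> / 2) * \<bar>g t\<bar>"
    "\<And>t. t \<ge> t0 \<Longrightarrow> g t \<noteq> 0" "\<And>t. t \<ge> t0 \<Longrightarrow> 1 / v0 < t"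
    unfolding eventually_at_top_linorder by fastforce
  have t0pos: "0 < t0" using t0(3)[of t0] \<open>0 < v0\<close> by (meson less_trans order_refl zero_less_divide_1_iff)
  \<comment> \<open>At \<open>z = 0\<close> the value is set by hand, since nothing is known of
    \<open>r\<close> at 0.\<close>
  define F where "F v z = (if z = 0 then 0 else deriv r (v * z) / deriv r v)" for v z
  have small: "v < v0" "t0 \<le> 1 / v" if "0 < v" "v \<le> 1 / t0" for v
  proof -
    show 1: "t0 \<le> 1 / v" using that t0pos by (simp add: field_simps)
    show "v < v0" using t0(3)[OF 1] that \<open>0 < v0\<close> by (simp add: field_simps)
  qed
  have dg: "deriv r v = g (1 / v)" if "0 < v" "v \<le> 1 / t0" for v
    using small(1)[OF that] that \<open>0 < v0\<close> by (simp add: g_def field_simps)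
  have vz: "v * z \<le> 1 / t0" "0 < v * z" if "0 < v" "v \<le> 1 / t0" "0 < z" "z \<le> 1" for v z
  proof -
    have "v * z \<le> v" using that by (intro mult_left_le) auto
    then show "v * z \<le> 1 / t0" using that by linarith
  qed (use that in simp)
  have hasint: "(F v has_integral (r v / (v * deriv r v))) {0..1}" if v: "0 < v" "v \<le> 1 / t0" for v
  proof -
    \<comment> \<open>The antiderivative with its limit 0 inserted at \<open>z = 0\<close>;
      continuity there is the hypothesis that \<open>r\<close> vanishes at
      \<open>0+\<close>.\<close>
    define R where "R z = (if z = 0 then 0 else r (v * z) / (v * deriv r v))" for z
    have d0: "deriv r v \<noteq> 0" using t0(2)[OF small(2)[OF v]] dg[OF v] by simp
    have dR: "(R has_real_derivative F v z) (at z)" if z: "0 < z" "z \<le> 1" for z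
    proof -
      have "r differentiable (at (v * z))"
        by (rule diff) (use vz[OF v z] small(1)[of "v * z"] in auto)
      then have "(r has_real_derivative deriv r (v * z)) (at (v * z))"
        by (simp add: DERIV_deriv_iff_real_differentiable)
      then have "((\<lambda>z. r (v * z)) has_real_derivative deriv r (v * z) * v) (at z)"
        by (rule DERIV_chain2) (auto intro!: derivative_eq_intros)
      then have "((\<lambda>z. r (v * z) / (v * deriv r v)) has_real_derivative deriv r (v * z) * v / (v * deriv r v)) (at z)"
        by (rule DERIV_cdivide)
      then have "((\<lambda>z. r (v * z) / (v * deriv r v)) has_real_derivative F v z) (at z)"
        using v z by (simp add: F_def)
      then show ?thesis
        by (rule has_field_derivative_transform_within_open[of _ _ _ "{0<..}"]) (use z in \<open>auto simp: R_def\<close>)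
    qed
    have "continuous_on {0..1} R"
      unfolding continuous_on_eq_continuous_within
    proof
      fix z :: real assume z: "z \<in> {0..1}"
      show "continuous (at z within {0..1}) R"
      proof (cases "z = 0")
        case True
        have "filterlim (\<lambda>z. v * z) (at_right 0) (at_right 0)"
          using v by (auto simp: filterlim_at eventually_at_filter intro!: tendsto_eq_intros)
        from tendsto_divide[OF filterlim_compose[OF lim this] tendsto_const[of "v * deriv r v"]]
        have "((\<lambda>z. r (v * z) / (v * deriv r v)) \<longlongrightarrow> 0) (at_right 0)" using v d0 by simp
        then have "(R \<longlongrightarrow> 0) (at_right 0)"
          by (rule Lim_transform_eventually) (auto simp: R_def eventually_at_filter)
        moreover have "at (0::real) within {0..1} = at_right 0"
          by (rule at_within_Icc_at_right) simp
        ultimately show ?thesis using True by (simp add: continuous_within R_def)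
      next
        case False
        then have "isCont R z" using z by (intro DERIV_isCont[OF dR]) auto
        then show ?thesis by (rule continuous_at_imp_continuous_at_within)
      qed
    qed
    then have "(F v has_integral (R 1 - R 0)) {0..1}"
      by (intro fundamental_theorem_of_calculus_interior)
        (auto simp flip: has_real_derivative_iff_has_vector_derivative intro!: dR)
    then show ?thesis by (simp add: R_def)
  qed
  \<comment> \<open>The Potter exponent \<open>1 - \<beta> / 2\<close> exceeds the index
    \<open>1 - \<beta>\<close> and still leaves \<open>z^(\<beta>/2 - 1)\<close> integrable at
    0.\<close>
  have dom: "norm (F v z) \<le> C * z powr (\<beta> / 2 - 1)" if v: "0 < v" "v \<le> 1 / t0" and z: "z \<in> {0..1}" for v z
  proof (cases "z = 0")
    case False
    then have z': "0 < z" "z \<le> 1" using z by auto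
    have "\<bar>g (1 / v * (1 / z))\<bar> \<le> C * (1 / z) powr (1 - \<beta> / 2) * \<bar>g (1 / v)\<bar>"
      using z' by (intro t0 small(2)[OF v]) (simp add: field_simps)
    moreover have "(1 / z) powr (1 - \<beta> / 2) = z powr (\<beta> / 2 - 1)"
      using z' by (simp add: powr_def ln_div algebra_simps)
    ultimately have "\<bar>g (1 / (v * z))\<bar> \<le> C * z powr (\<beta> / 2 - 1) * \<bar>g (1 / v)\<bar>" by simp
    moreover have "g (1 / v) \<noteq> 0" using t0(2)[OF small(2)[OF v]] .
    ultimately show ?thesis
      using False dg[OF v] dg[of "v * z"] vz[OF v z'] by (simp add: F_def abs_divide divide_le_eq)
  qed (use C(1) in \<open>simp add: F_def\<close>)
  show ?thesis
    unfolding tendsto_at_iff_sequentially comp_def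
  proof (intro allI impI)
    fix X :: "nat \<Rightarrow> real"
    assume X: "\<forall>i. X i \<in> {0<..} - {0}" "X \<longlonglongrightarrow> 0"
    have "\<forall>\<^sub>F n in sequentially. X n < 1 / t0" using order_tendstoD(2)[OF X(2), of "1 / t0"] t0pos by simp
    then obtain N where N: "\<And>n. n \<ge> N \<Longrightarrow> X n < 1 / t0" unfolding eventually_sequentially by blast
    \<comment> \<open>Dropping finitely many terms lets the domination hold for every index.\<close>
    define Y where "Y n = X (n + N)" for n
    have Y: "0 < Y n" "Y n \<le> 1 / t0" for n using X(1) N[of "n + N"] by (auto simp: Y_def less_imp_le)
    have Y0: "Y \<longlonglongrightarrow> 0" unfolding Y_def by (rule LIMSEQ_ignore_initial_segment[OF X(2)])
    have Yi: "filterlim (\<lambda>n. 1 / Y n) at_top sequentially"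
      using Y Y0 filterlim_inverse_at_top[of Y sequentially] by (auto simp: inverse_eq_divide)
    have "(\<lambda>n. integral {0..1} (F (Y n))) \<longlonglongrightarrow> integral {0..1} (\<lambda>z. if z = 0 then 0 else z powr (\<beta> - 1))"
    proof (rule dominated_convergence(2))
      show "F (Y n) integrable_on {0..1}" for n using hasint[OF Y] by blast
      have "(\<lambda>z. z powr (\<beta> / 2 - 1)) integrable_on {0..1::real}"
        using has_integral_powr_from_0[of "\<beta> / 2 - 1" 1] \<open>0 < \<beta>\<close> by auto
      then show "(\<lambda>z. C * z powr (\<beta> / 2 - 1)) integrable_on {0..1}" 
        using integrable_cmul[of _ _ C] by fastforce
      show "norm (F (Y n) z) \<le> C * z powr (\<beta> / 2 - 1)" if "z \<in> {0..1}" for n z by (rule dom[OF Y that])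
      show "(\<lambda>n. F (Y n) z) \<longlonglongrightarrow> (if z = 0 then 0 else z powr (\<beta> - 1))" if z: "z \<in> {0..1}" for z
      proof (cases "z = 0")
        case False
        then have z': "0 < z" "z \<le> 1" using z by auto
        have "((\<lambda>t. g (t * (1 / z)) / g t) \<longlongrightarrow> (1 / z) powr (1 - \<beta>)) at_top"
          using grv[unfolded regularly_varying_def, rule_format, of "1 / z"] z' by simp
        from filterlim_compose[OF this Yi]
        have "(\<lambda>n. g (1 / Y n * (1 / z)) / g (1 / Y n)) \<longlonglongrightarrow> (1 / z) powr (1 - \<beta>)" .
        moreover have "(1 / z) powr (1 - \<beta>) = z powr (\<beta> - 1)"
          using z' by (simp add: powr_def ln_div algebra_simps)
        moreover have "g (1 / Y n * (1 / z)) / g (1 / Y n) = F (Y n) z" for n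
          using dg[OF Y, of n] dg[of "Y n * z"] vz[OF Y z'] False by (simp add: F_def)
        ultimately show ?thesis using False by simp
      qed (simp add: F_def)
    qed
    moreover have "integral {0..1} (\<lambda>z::real. if z = 0 then 0 else z powr (\<beta> - 1)) = 1 / \<beta>"
    proof -
      have "(\<lambda>z::real. if z = 0 then 0 else z powr (\<beta> - 1)) = (\<lambda>z. z powr (\<beta> - 1))" by auto
      then show ?thesis
        using has_integral_powr_from_0[of "\<beta> - 1" 1] \<open>0 < \<beta>\<close> by (intro integral_unique) simp
    qed
    moreover have "integral {0..1} (F (Y n)) = r (Y n) / (Y n * deriv r (Y n))" for n
      by (rule integral_unique[OF hasint[OF Y]])
    ultimately have "(\<lambda>n. r (Y n) / (Y n * deriv r (Y n))) \<longlonglongrightarrow> 1 / \<beta>" by simp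
    then show "(\<lambda>n. r (X n) / (X n * deriv r (X n))) \<longlonglongrightarrow> 1 / \<beta>"
      unfolding Y_def by (rule LIMSEQ_offset)
  qed
qed

text \<open>Regular variation of \<open>U'\<close> with index \<open>- 1 / \<rho> - 1\<close>, in the sequential form of
  the local uniformity.\<close>

definition deriv_varies :: "real \<Rightarrow> (real \<Rightarrow> real) \<Rightarrow> bool" where
  "deriv_varies \<rho> U \<longleftrightarrow> (\<forall>t z z0. filterlim t at_top sequentially \<longrightarrow> z \<longlonglongrightarrow> z0 \<longrightarrow> 0 < z0 \<longrightarrow>
     (\<lambda>n. deriv U (t n * z n) / deriv U (t n)) \<longlonglongrightarrow> z0 powr (- 1 / \<rho> - 1))"

lemma filterlim_mult_tendsto_pos_at_top:
  fixes t z :: "nat \<Rightarrow> real"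
  assumes "filterlim t at_top sequentially" "z \<longlonglongrightarrow> z0" "0 < z0"
  shows "filterlim (\<lambda>n. t n * z n) at_top sequentially"
  using filterlim_tendsto_pos_mult_at_top[OF assms(2,3,1)] by (simp add: mult.commute)

text \<open>The function \<open>ln (\<phi> - U (exp y))\<close> has derivative tending to
  \<open>- 1 / \<rho>\<close>. The mean value theorem gives the limit of its increments along moving
  shifts, with no measurability or continuity of \<open>U'\<close>.\<close>

lemma von_mises_ratio:
  fixes U :: "real \<Rightarrow> real"
  assumes diff: "\<forall>\<^sub>F t in at_top. U differentiable (at t)"
    and pos: "\<forall>\<^sub>F t in at_top. U t < \<phi>"
    and lim: "((\<lambda>t. t * deriv U t / (\<phi> - U t)) \<longlongrightarrow> 1 / \<rho>) at_top"
    and t: "filterlim t at_top sequentially" and z: "z \<longlonglongrightarrow> z0" "0 < z0"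
  shows "(\<lambda>n. (\<phi> - U (t n * z n)) / (\<phi> - U (t n))) \<longlonglongrightarrow> z0 powr (- 1 / \<rho>)"
proof -
  define L where "L y = ln (\<phi> - U (exp y))" for y
  define D where "D y = - (exp y * deriv U (exp y) / (\<phi> - U (exp y)))" for y
  have "\<forall>\<^sub>F t in at_top. U differentiable (at t) \<and> U t < \<phi>" using diff pos by eventually_elim auto
  from eventually_compose_filterlim[OF this exp_at_top]
  obtain y0 where y0: "\<And>y. y \<ge> y0 \<Longrightarrow> U differentiable (at (exp y))" "\<And>y. y \<ge> y0 \<Longrightarrow> U (exp y) < \<phi>"
    unfolding eventually_at_top_linorder by blast
  have L: "(L has_real_derivative D y) (at y)" if "y \<ge> y0" for y
  proof -
    have "(U has_real_derivative deriv U (exp y)) (at (exp y))"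
      using y0(1)[OF that] by (simp add: DERIV_deriv_iff_real_differentiable)
    then have "((\<lambda>y. U (exp y)) has_real_derivative deriv U (exp y) * exp y) (at y)"
      by (rule DERIV_chain2) (auto intro!: derivative_eq_intros)
    then show ?thesis unfolding L_def D_def using y0(2)[OF that]
      by (auto intro!: derivative_eq_intros)
  qed
  have D: "(D \<longlongrightarrow> - (1 / \<rho>)) at_top"
    unfolding D_def by (intro tendsto_minus filterlim_compose[OF lim exp_at_top])
  define x where "x n = ln (t n)" for n
  define u where "u n = ln (z n)" for n
  have x: "filterlim x at_top sequentially" unfolding x_def by (rule filterlim_compose[OF ln_at_top t])
  have u: "u \<longlonglongrightarrow> ln z0" unfolding u_def using z by (intro tendsto_intros) auto
  then have "Bseq u" by (intro convergent_imp_Bseq convergentI)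
  then obtain B where B: "\<And>n. \<bar>u n\<bar> \<le> B" unfolding Bseq_def by auto
  have xu: "filterlim (\<lambda>n. x n + u n) at_top sequentially" by (rule filterlim_add_bounded_at_top[OF x B])
  \<comment> \<open>The guarded form provides a witness for every \<open>n\<close>, so that a whole
    sequence can be chosen; the guards hold eventually.\<close>
  have "\<exists>\<xi>. (x n \<ge> y0 \<and> x n + u n \<ge> y0 \<longrightarrow> L (x n + u n) - L (x n) = u n * D \<xi>) \<and> min (x n) (x n + u n) \<le> \<xi>" for n
  proof (cases "x n \<ge> y0 \<and> x n + u n \<ge> y0 \<and> u n \<noteq> 0")
    case True
    then consider "u n > 0" | "u n < 0" by linarith
    then show ?thesis
    proof cases
      case 1
      have "\<exists>\<xi>>x n. \<xi> < x n + u n \<and> L (x n + u n) - L (x n) = (x n + u n - x n) * D \<xi>"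
        using 1 True by (intro MVT2 L) auto
      then show ?thesis using 1 by auto
    next
      case 2
      have "\<exists>\<xi>>x n + u n. \<xi> < x n \<and> L (x n) - L (x n + u n) = (x n - (x n + u n)) * D \<xi>"
        using 2 True by (intro MVT2 L) auto
      then obtain \<xi> where "x n + u n < \<xi>" "L (x n) - L (x n + u n) = (x n - (x n + u n)) * D \<xi>" by blast
      then show ?thesis using 2 by (intro exI[of _ \<xi>]) (auto simp: algebra_simps)
    qed
  qed (auto intro!: exI[of _ "x n"])
  then obtain \<xi> where \<xi>: "\<And>n. x n \<ge> y0 \<Longrightarrow> x n + u n \<ge> y0 \<Longrightarrow> L (x n + u n) - L (x n) = u n * D (\<xi> n)"
    "\<And>n. min (x n) (x n + u n) \<le> \<xi> n" by metis
  have "filterlim (\<lambda>n. x n + - B) at_top sequentially"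
    by (rule filterlim_add_bounded_at_top[OF x]) auto
  then have "filterlim \<xi> at_top sequentially"
    by (rule filterlim_at_top_mono) (use \<xi>(2) B in \<open>auto simp: min_def abs_le_iff intro!: always_eventually, smt (verit)\<close>)
  then have "(\<lambda>n. u n * D (\<xi> n)) \<longlonglongrightarrow> ln z0 * - (1 / \<rho>)"
    by (intro tendsto_intros u filterlim_compose[OF D])
  moreover have "\<forall>\<^sub>F n in sequentially. u n * D (\<xi> n) = L (x n + u n) - L (x n)"
    using eventually_compose_filterlim[OF eventually_ge_at_top[of y0] x] eventually_compose_filterlim[OF eventually_ge_at_top[of y0] xu]
    by eventually_elim (simp add: \<xi>(1))
  ultimately have "(\<lambda>n. L (x n + u n) - L (x n)) \<longlonglongrightarrow> ln z0 * - (1 / \<rho>)"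
    by (rule Lim_transform_eventually)
  then have "(\<lambda>n. exp (L (x n + u n) - L (x n))) \<longlonglongrightarrow> exp (ln z0 * - (1 / \<rho>))"
    by (rule tendsto_exp)
  then have lim2: "(\<lambda>n. exp (L (x n + u n) - L (x n))) \<longlonglongrightarrow> z0 powr (- 1 / \<rho>)"
    using z by (simp add: powr_def mult.commute)
  have "\<forall>\<^sub>F n in sequentially. 0 < t n" using eventually_compose_filterlim[OF eventually_gt_at_top t] .
  moreover have "\<forall>\<^sub>F n in sequentially. 0 < z n" using order_tendstoD(1)[OF z] .
  moreover have "\<forall>\<^sub>F n in sequentially. U (t n) < \<phi>" using eventually_compose_filterlim[OF pos t] .
  moreover have "\<forall>\<^sub>F n in sequentially. U (t n * z n) < \<phi>"
    using eventually_compose_filterlim[OF pos filterlim_mult_tendsto_pos_at_top[OF t z]] .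
  ultimately show ?thesis
    by (intro Lim_transform_eventually[OF lim2], eventually_elim) (simp add: L_def x_def u_def exp_add exp_diff)
qed

text \<open>Writing \<open>U'(t)\<close> as the von Mises quotient times
  \<open>(\<phi> - U t) / t\<close>, the quotient converges and the rest is regularly varying, which
  accounts for the extra \<open>- 1\<close> in the index.\<close>

lemma von_mises_deriv_varies:
  fixes U :: "real \<Rightarrow> real"
  assumes diff: "\<forall>\<^sub>F t in at_top. U differentiable (at t)"
    and pos: "\<forall>\<^sub>F t in at_top. U t < \<phi>"
    and lim: "((\<lambda>t. t * deriv U t / (\<phi> - U t)) \<longlongrightarrow> 1 / \<rho>) at_top" and "0 < \<rho>"
  shows "deriv_varies \<rho> U"
  unfolding deriv_varies_def
proof (intro allI impI)
  fix t z :: "nat \<Rightarrow> real" and z0 :: real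
  assume t: "filterlim t at_top sequentially" and z: "z \<longlonglongrightarrow> z0" "0 < z0"
  note tz = filterlim_mult_tendsto_pos_at_top[OF t z]
  let ?Q = "\<lambda>t. t * deriv U t / (\<phi> - U t)"
  have "(\<lambda>n. ?Q (t n * z n) / ?Q (t n) * ((\<phi> - U (t n * z n)) / (\<phi> - U (t n))) / z n) \<longlonglongrightarrow>
      (1 / \<rho>) / (1 / \<rho>) * z0 powr (- 1 / \<rho>) / z0"
    using z \<open>0 < \<rho>\<close>
    by (intro tendsto_intros filterlim_compose[OF lim t] filterlim_compose[OF lim tz] von_mises_ratio[OF diff pos lim t z]) auto
  moreover have "(1 / \<rho>) / (1 / \<rho>) * z0 powr (- 1 / \<rho>) / z0 = z0 powr (- 1 / \<rho> - 1)"
    using z \<open>0 < \<rho>\<close> by (simp add: powr_diff)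
  ultimately have lim2: "(\<lambda>n. ?Q (t n * z n) / ?Q (t n) * ((\<phi> - U (t n * z n)) / (\<phi> - U (t n))) / z n) \<longlonglongrightarrow> z0 powr (- 1 / \<rho> - 1)"
    by simp
  have "\<forall>\<^sub>F n in sequentially. 0 < t n" using eventually_compose_filterlim[OF eventually_gt_at_top t] .
  moreover have "\<forall>\<^sub>F n in sequentially. 0 < z n" using order_tendstoD(1)[OF z] .
  moreover have "\<forall>\<^sub>F n in sequentially. U (t n) < \<phi>" using eventually_compose_filterlim[OF pos t] .
  moreover have "\<forall>\<^sub>F n in sequentially. U (t n * z n) < \<phi>" using eventually_compose_filterlim[OF pos tz] .
  ultimately show "(\<lambda>n. deriv U (t n * z n) / deriv U (t n)) \<longlonglongrightarrow> z0 powr (- 1 / \<rho> - 1)"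
  proof (intro Lim_transform_eventually[OF lim2], eventually_elim)
    case (elim n)
    have "(t n * z n * d' / b) / (t n * d / a) * (b / a) / z n = d' / d" if "0 < a" "0 < b" for a b d d' :: real
      using elim that by (cases "d = 0") (simp_all add: field_simps)
    then show ?case using elim by simp
  qed
qed

text \<open>The difference \<open>\<phi> - U \<tau>\<close> is the tail integral of
  \<open>s^(-1/\<rho> - 1) V s\<close>; replacing \<open>V s\<close> by \<open>V t\<close> gives the
  main term. The integration is carried out by monotonicity: \<open>H 1\<close> decreases and
  \<open>H (- 1)\<close> increases on \<open>[\<tau>, \<infinity>)\<close>, both with limit
  \<phi>.\<close>

lemma tail_expansion:
  fixes U :: "real \<Rightarrow> real"
  assumes "0 < t" "0 < \<rho>" "0 \<le> E" "\<eta> < 1 / \<rho>"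
    and diff: "\<And>s. t / 8 \<le> s \<Longrightarrow> U differentiable (at s)"
    and lim: "(U \<longlongrightarrow> \<phi>) at_top"
    and V: "\<And>s. t / 8 \<le> s \<Longrightarrow> V s = s powr (1 + 1 / \<rho>) * deriv U s"
    and bound: "\<And>s. t / 8 \<le> s \<Longrightarrow> \<bar>V s - V t\<bar> \<le> E * (s / t) powr \<eta>"
    and \<tau>: "t / 8 \<le> \<tau>"
  shows "\<bar>\<phi> - U \<tau> - \<rho> * \<tau> powr (- 1 / \<rho>) * V t\<bar> \<le> E / (1 / \<rho> - \<eta>) * \<tau> powr (\<eta> - 1 / \<rho>) * t powr (- \<eta>)"
proof -
  \<comment> \<open>With this constant the derivative of the correction term in \<open>H\<close> is
    exactly the allowed deviation of \<open>V s\<close> from \<open>V t\<close>. Positivity of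
    \<open>1 / \<rho> - \<eta>\<close> makes the correction vanish at infinity.\<close>
  define c where "c = E / (1 / \<rho> - \<eta>)"
  have c: "c * (1 / \<rho> - \<eta>) = E" using \<open>\<eta> < 1 / \<rho>\<close> by (simp add: c_def)
  have spos: "0 < s" if "t / 8 \<le> s" for s using that \<open>0 < t\<close> by linarith
  define H where "H \<sigma> s = U s + \<rho> * V t * s powr (- 1 / \<rho>) + \<sigma> * c * t powr (- \<eta>) * s powr (\<eta> - 1 / \<rho>)" for \<sigma> s
  have dU: "(U has_real_derivative s powr (- 1 / \<rho> - 1) * V s) (at s)" if "t / 8 \<le> s" for s
  proof -
    have "(U has_real_derivative deriv U s) (at s)"
      using diff[OF that] by (simp add: DERIV_deriv_iff_real_differentiable)
    moreover have "s powr (- 1 / \<rho> - 1) * V s = deriv U s"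
      using spos[OF that] by (simp add: V[OF that] powr_add[symmetric] mult.assoc[symmetric])
    ultimately show ?thesis by simp
  qed
  have dH: "(H \<sigma> has_real_derivative s powr (- 1 / \<rho> - 1) * (V s - V t - \<sigma> * (E * (s / t) powr \<eta>))) (at s)"
    if s: "t / 8 \<le> s" for s \<sigma>
  proof -
    have "(H \<sigma> has_real_derivative s powr (- 1 / \<rho> - 1) * V s + \<rho> * V t * ((- 1 / \<rho>) * s powr (- 1 / \<rho> - 1))
        + \<sigma> * c * t powr (- \<eta>) * ((\<eta> - 1 / \<rho>) * s powr (\<eta> - 1 / \<rho> - 1))) (at s)"
      unfolding H_def using spos[OF s]
      by (intro DERIV_add DERIV_cmult dU[OF s] has_real_derivative_powr) 
    moreover have h1: "\<rho> * V t * ((- 1 / \<rho>) * s powr (- 1 / \<rho> - 1)) = - (s powr (- 1 / \<rho> - 1) * V t)"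
      using \<open>0 < \<rho>\<close> by simp
    moreover have h2: "\<sigma> * c * t powr (- \<eta>) * ((\<eta> - 1 / \<rho>) * s powr (\<eta> - 1 / \<rho> - 1)) =
        - (s powr (- 1 / \<rho> - 1) * (\<sigma> * (E * (s / t) powr \<eta>)))"
    proof -
      have "s powr (\<eta> - 1 / \<rho> - 1) = s powr \<eta> * s powr (- 1 / \<rho> - 1)"
        by (subst powr_add[symmetric]) (simp add: algebra_simps)
      moreover have "(s / t) powr \<eta> = s powr \<eta> * t powr (- \<eta>)"
        using spos[OF s] \<open>0 < t\<close> by (simp add: powr_divide powr_minus_divide)
      ultimately show ?thesis unfolding c[symmetric] by (simp add: algebra_simps)
    qed
    ultimately show ?thesis unfolding h1 h2 by (simp only: right_diff_distrib add_uminus_conv_diff)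
  qed
  have powr0: "((\<lambda>s::real. s powr a) \<longlongrightarrow> 0) at_top" if "a < 0" for a
    using that by (rule tendsto_neg_powr) (rule filterlim_ident)
  have H_lim: "(H \<sigma> \<longlongrightarrow> \<phi>) at_top" for \<sigma>
  proof -
    have "(H \<sigma> \<longlongrightarrow> \<phi> + \<rho> * V t * 0 + \<sigma> * c * t powr (- \<eta>) * 0) at_top"
      unfolding H_def using \<open>0 < \<rho>\<close> \<open>\<eta> < 1 / \<rho>\<close> by (intro tendsto_intros lim powr0) auto
    then show ?thesis by simp
  qed
  have up: "H 1 s \<le> H 1 \<tau>" if "\<tau> \<le> s" for s
  proof (rule DERIV_nonpos_imp_nonincreasing[OF that])
    fix x assume "\<tau> \<le> x" "x \<le> s"
    then have x: "t / 8 \<le> x" using \<tau> by linarith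
    have "x powr (- 1 / \<rho> - 1) * (V x - V t - 1 * (E * (x / t) powr \<eta>)) \<le> 0"
      using bound[OF x] by (intro mult_nonneg_nonpos) auto
    then show "\<exists>y. (H 1 has_real_derivative y) (at x) \<and> y \<le> 0" using dH[OF x, of 1] by blast
  qed
  have lo: "H (- 1) \<tau> \<le> H (- 1) s" if "\<tau> \<le> s" for s
  proof (rule DERIV_nonneg_imp_nondecreasing[OF that])
    fix x assume "\<tau> \<le> x" "x \<le> s"
    then have x: "t / 8 \<le> x" using \<tau> by linarith
    have "0 \<le> x powr (- 1 / \<rho> - 1) * (V x - V t - (- 1) * (E * (x / t) powr \<eta>))"
      using bound[OF x] by (intro mult_nonneg_nonneg) auto
    then show "\<exists>y. (H (- 1) has_real_derivative y) (at x) \<and> 0 \<le> y" using dH[OF x, of "- 1"] by blast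
  qed
  have "\<phi> \<le> H 1 \<tau>"
    by (rule tendsto_upperbound[OF H_lim[of 1]]) (use eventually_ge_at_top[of \<tau>] in \<open>eventually_elim, simp add: up\<close>, simp)
  moreover have "H (- 1) \<tau> \<le> \<phi>"
    by (rule tendsto_lowerbound[OF H_lim[of "- 1"]]) (use eventually_ge_at_top[of \<tau>] in \<open>eventually_elim, simp add: lo\<close>, simp)
  ultimately show ?thesis unfolding H_def c_def[symmetric] abs_le_iff by (simp add: mult_ac)
qed

section \<open>Bias and the growth condition\<close>

text \<open>The premise on \<open>g\<close> is the inequality \<open>g(t) <= t / e(t)^2\<close>,
  stated so that \<open>e(t) = 0\<close> does no harm. The rate provides \<tau> with
  \<open>n <= g \<tau>\<close> and \<open>\<tau> <= \<epsilon> n / k\<close>, hence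
  \<open>n e(\<tau>)^2 <= \<tau>\<close>. Potter's bound carries this to
  \<open>n / k = \<tau> z\<close> at the cost of \<open>z^(1/2)\<close>, against a gain of
  \<open>z\<close>, and \<open>1 / z <= \<epsilon>\<close>.\<close>

lemma small_o_rate_bias:
  fixes g e :: "real \<Rightarrow> real"
  assumes so: "small_o_rate k g" and kpos: "\<And>n. 1 \<le> n \<Longrightarrow> 0 < k n"
    and g: "\<forall>\<^sub>F t in at_top. \<forall>s>0. s \<le> g t \<longrightarrow> s * (e t)\<^sup>2 \<le> t"
    and C: "0 < C" "\<forall>\<^sub>F t in at_top. \<forall>z\<ge>1. \<bar>e (t * z)\<bar> \<le> C * z powr (1 / 4) * \<bar>e t\<bar>"
  shows "filterlim (\<lambda>n. real n / real (k n)) at_top sequentially"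
    and "(\<lambda>n. sqrt (real (k n)) * e (real n / real (k n))) \<longlonglongrightarrow> 0"
proof -
  from g obtain a1 where a1: "\<And>t s. t \<ge> a1 \<Longrightarrow> 0 < s \<Longrightarrow> s \<le> g t \<Longrightarrow> s * (e t)\<^sup>2 \<le> t"
    unfolding eventually_at_top_linorder by blast
  from C(2) obtain a2 where a2: "\<And>t z. t \<ge> a2 \<Longrightarrow> 1 \<le> z \<Longrightarrow> \<bar>e (t * z)\<bar> \<le> C * z powr (1 / 4) * \<bar>e t\<bar>"
    unfolding eventually_at_top_linorder by blast
  from so obtain a3 where a3: "\<And>t. t \<ge> a3 \<Longrightarrow>
      (\<lambda>n. real (k n)) \<in> o(\<lambda>n. real_of_ereal (ereal (real n) / gen_inverse_from t g (real n)))"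
    unfolding small_o_rate_def eventually_at_top_linorder by blast
  define t0 where "t0 = Max {1, a1, a2, a3}"
  have t0: "1 \<le> t0" "a1 \<le> t0" "a2 \<le> t0" "a3 \<le> t0" by (auto simp: t0_def)
  have key: "\<forall>\<^sub>F n in sequentially. 1 \<le> n \<and> (\<exists>\<tau>\<ge>t0. real n \<le> g \<tau> \<and> \<tau> * real (k n) \<le> \<epsilon> * real n)"
    if \<epsilon>: "0 < \<epsilon>" for \<epsilon>
  proof -
    have "\<forall>\<^sub>F n in sequentially. norm (real (k n)) \<le>
        \<epsilon> / 2 * norm (real_of_ereal (ereal (real n) / gen_inverse_from t0 g (real n)))"
      using a3[OF t0(4)] \<epsilon> by (intro landau_o.smallD) auto
    then show ?thesis using eventually_ge_at_top[of 1]
    proof eventually_elim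
      case (elim n)
      define I where "I = gen_inverse_from t0 g (real n)"
      have n: "0 < real n" and kn: "0 < real (k n)" using elim kpos by auto
      have I_ge: "ereal t0 \<le> I" unfolding I_def gen_inverse_from_def by (intro INF_greatest) auto
      \<comment> \<open>If \<open>g\<inverse>(n)\<close> were infinite, the rate would be 0, which
        no positive \<open>k n\<close> can obey.\<close>
      have nz: "real_of_ereal (ereal (real n) / I) \<noteq> 0"
      proof
        assume 0: "real_of_ereal (ereal (real n) / I) = 0"
        show False using elim(1) kn unfolding I_def[symmetric] 0 by simp
      qed
      obtain r where r: "I = ereal r"
      proof (cases I)
        case PInf
        then show ?thesis using nz by simp
      next
        case MInf
        then show ?thesis using I_ge by simp
      qed
      have rt: "t0 \<le> r" "0 < r" using I_ge r t0(1) by auto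
      have kb: "real (k n) \<le> \<epsilon> / 2 * (real n / r)"
        using elim(1) rt n unfolding I_def[symmetric] r by simp
      \<comment> \<open>The infimum need not be attained. The factor 2 leaves room for an actual
        point \<tau>, and \<open>\<epsilon> / 2\<close> in the rate compensates for it.\<close>
      have "I < ereal (2 * r)" using r rt by simp
      then obtain \<tau> where \<tau>: "t0 \<le> \<tau>" "real n \<le> g \<tau>" "\<tau> < 2 * r"
        unfolding I_def gen_inverse_from_def INF_less_iff by auto
      have "\<tau> * real (k n) \<le> (2 * r) * (\<epsilon> / 2 * (real n / r))"
        using \<tau> kb rt t0 by (intro mult_mono) auto
      also have "\<dots> = \<epsilon> * real n" using rt by (simp add: field_simps)
      finally show ?case using \<tau> elim by auto
    qed
  qed
  show "filterlim (\<lambda>n. real n / real (k n)) at_top sequentially"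
    unfolding filterlim_at_top
  proof
    fix Z :: real
    have "0 < 1 / max Z 1" by simp
    from key[OF this] show "\<forall>\<^sub>F n in sequentially. Z \<le> real n / real (k n)"
    proof eventually_elim
      case (elim n)
      then obtain \<tau> where \<tau>: "t0 \<le> \<tau>" "\<tau> * real (k n) \<le> 1 / max Z 1 * real n" by auto
      have kn: "0 < real (k n)" using elim kpos by auto
      have "1 * real (k n) \<le> \<tau> * real (k n)" using \<tau> t0 by (intro mult_right_mono) auto
      then have "real (k n) \<le> real n / max Z 1" using \<tau>(2) by simp
      then have "max Z 1 * real (k n) \<le> real n" by (simp add: le_divide_eq mult.commute split: if_splits)
      then have "max Z 1 \<le> real n / real (k n)" using kn by (simp add: le_divide_eq)
      then show ?case by simp
    qed
  qed
  show "(\<lambda>n. sqrt (real (k n)) * e (real n / real (k n))) \<longlonglongrightarrow> 0"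
  proof (rule tendstoI)
    fix x :: real assume x: "0 < x"
    \<comment> \<open>Chosen so that \<open>C^2 sqrt \<epsilon> <= x^2 / 4\<close>; the minimum with
      1 ensures \<open>z >= 1\<close>, where Potter's bound is available.\<close>
    define \<epsilon> where "\<epsilon> = min 1 ((x\<^sup>2 / (4 * C\<^sup>2))\<^sup>2)"
    have \<epsilon>: "0 < \<epsilon>" "\<epsilon> \<le> 1" using x C by (auto simp: \<epsilon>_def)
    have s\<epsilon>: "sqrt \<epsilon> \<le> x\<^sup>2 / (4 * C\<^sup>2)"
      by (rule real_le_lsqrt) (use C in \<open>auto simp: \<epsilon>_def\<close>)
    show "\<forall>\<^sub>F n in sequentially. dist (sqrt (real (k n)) * e (real n / real (k n))) 0 < x"
      using key[OF \<epsilon>(1)]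
    proof eventually_elim
      case (elim n)
      then obtain \<tau> where \<tau>: "t0 \<le> \<tau>" "real n \<le> g \<tau>" "\<tau> * real (k n) \<le> \<epsilon> * real n" by auto
      have kn: "0 < real (k n)" and n: "0 < real n" using elim kpos by auto
      have \<tau>p: "0 < \<tau>" using \<tau> t0 by linarith
      define z where "z = real n / (real (k n) * \<tau>)"
      have zp: "0 < z" using kn n \<tau>p by (simp add: z_def)
      have iz: "1 / z \<le> \<epsilon>" using \<tau>(3) kn n \<tau>p by (simp add: z_def field_simps)
      have z1: "1 \<le> z" using iz \<epsilon> zp by (simp add: divide_le_eq split: if_splits) (smt (verit) mult_left_le_one_le)
      have u: "real n / real (k n) = \<tau> * z" using \<tau>p by (simp add: z_def)
      have "\<bar>e (\<tau> * z)\<bar> \<le> C * z powr (1 / 4) * \<bar>e \<tau>\<bar>" using \<tau> t0 z1 by (intro a2) auto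
      then have "\<bar>e (\<tau> * z)\<bar>\<^sup>2 \<le> (C * z powr (1 / 4) * \<bar>e \<tau>\<bar>)\<^sup>2" by (intro power_mono) auto
      also have "\<dots> = C\<^sup>2 * sqrt z * (e \<tau>)\<^sup>2"
      proof -
        have "(z powr (1 / 4))\<^sup>2 = z powr (1 / 4 * 2)" using zp by (simp add: powr_powr flip: powr_numeral)
        also have "\<dots> = sqrt z" using zp by (simp add: powr_half_sqrt)
        finally show ?thesis by (simp add: power_mult_distrib)
      qed
      finally have "real (k n) * (e (\<tau> * z))\<^sup>2 \<le> real (k n) * (C\<^sup>2 * sqrt z * (e \<tau>)\<^sup>2)"
        using kn by (intro mult_left_mono) auto
      also have "\<dots> = (C\<^sup>2 * sqrt z * real (k n) / real n) * (real n * (e \<tau>)\<^sup>2)" using n by simp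
      also have "\<dots> \<le> (C\<^sup>2 * sqrt z * real (k n) / real n) * \<tau>"
        using \<tau> t0 n zp by (intro mult_left_mono a1) auto
      also have "\<dots> = C\<^sup>2 * (sqrt z / z)" using n kn \<tau>p by (simp add: z_def field_simps)
      also have "sqrt z / z = sqrt (1 / z)" using zp by (simp add: real_sqrt_divide real_div_sqrt field_simps)
      also have "C\<^sup>2 * sqrt (1 / z) \<le> C\<^sup>2 * (x\<^sup>2 / (4 * C\<^sup>2))"
        using iz s\<epsilon> by (intro mult_left_mono) (auto intro: order_trans[OF real_sqrt_le_mono])
      also have "\<dots> < x\<^sup>2" using C x by simp
      finally have "(sqrt (real (k n)) * e (real n / real (k n)))\<^sup>2 < x\<^sup>2"
        unfolding u by (simp add: power_mult_distrib)
      then have "\<bar>sqrt (real (k n)) * e (real n / real (k n))\<bar> < x"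
        using x by (intro power2_less_imp_less[where y = x]) auto
      then show ?case by (simp add: dist_real_def)
    qed
  qed
qed

text \<open>Here \<open>p v\<close> is the conditional tail at distance \<open>v\<close> from the
  endpoint, and \<open>T = 1 / (F p)\<close> strictly decreases in \<open>v\<close>. As
  \<open>p\<close> vanishes at \<open>0+\<close>, every large \<open>t\<close> is a value of
  \<open>T\<close> by the intermediate value theorem, so \<open>U\<close> inverts
  \<open>T (\<phi> - y)\<close> and the inverse function rule yields \<open>U'\<close>.\<close>

lemma tail_inverse:
  fixes p U :: "real \<Rightarrow> real"
  assumes diff: "\<And>v. 0 < v \<Longrightarrow> v < v0 \<Longrightarrow> p differentiable (at v)"
    and pos: "\<And>v. 0 < v \<Longrightarrow> v < v0 \<Longrightarrow> 0 < deriv p v" and "0 < v0" "0 < F"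
    and lim: "(p \<longlongrightarrow> 0) (at_right 0)"
    and inv: "\<And>v. 0 < v \<Longrightarrow> v < v0 \<Longrightarrow> U (1 / (F * p v)) = \<phi> - v"
  shows "\<exists>t1>0. \<forall>t>t1. 0 < \<phi> - U t \<and> \<phi> - U t < v0 \<and> F * p (\<phi> - U t) = 1 / t \<and>
      (U has_real_derivative 1 / (t\<^sup>2 * F * deriv p (\<phi> - U t))) (at t)"
    and "(U \<longlongrightarrow> \<phi>) at_top"
proof -
  have dp: "(p has_real_derivative deriv p v) (at v)" if "0 < v" "v < v0" for v
    using diff[OF that] by (simp add: DERIV_deriv_iff_real_differentiable)
  have mono: "p v < p w" if "0 < v" "v < w" "w < v0" for v w
  proof (rule DERIV_pos_imp_increasing[OF that(2)])
    fix x assume "v \<le> x" "x \<le> w"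
    then have "0 < x" "x < v0" using that by auto
    then show "\<exists>y. (p has_real_derivative y) (at x) \<and> 0 < y" using dp pos by blast
  qed
  have ppos: "0 < p v" if "0 < v" "v < v0" for v
  proof -
    have "0 \<le> p (v / 2)"
    proof (rule tendsto_upperbound[OF lim])
      have "\<forall>\<^sub>F u in at_right 0. u \<in> {0<..<v / 2}"
        using that by (intro eventually_at_right_real) simp
      then show "\<forall>\<^sub>F u in at_right 0. p u \<le> p (v / 2)"
        by eventually_elim (use that in \<open>auto intro!: less_imp_le mono\<close>)
    qed simp
    also have "\<dots> < p v" using that by (intro mono) auto
    finally show ?thesis .
  qed
  define T where "T v = 1 / (F * p v)" for v
  have Tmono: "T w < T v" if "0 < v" "v < w" "w < v0" for v w
    unfolding T_def using that mono[OF that] ppos[of v] ppos[of w] \<open>0 < F\<close>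
    by (intro divide_strict_left_mono mult_strict_left_mono mult_pos_pos) auto
  have Tinv: "U (T v) = \<phi> - v" if "0 < v" "v < v0" for v using inv[OF that] by (simp add: T_def)
  have dT: "(T has_real_derivative - (deriv p v * F / (F * p v)\<^sup>2)) (at v)" if "0 < v" "v < v0" for v
    unfolding T_def using ppos[OF that] \<open>0 < F\<close>
    by (auto intro!: derivative_eq_intros dp[OF that] simp: power2_eq_square)
  have Tcont: "isCont T v" if "0 < v" "v < v0" for v by (rule DERIV_isCont[OF dT[OF that]])
  have ex: "\<exists>v. 0 < v \<and> v < w \<and> T v = t" if t: "T w < t" and w: "0 < w" "w < v0" for t w
  proof -
    have "0 < T w" using ppos[OF w] \<open>0 < F\<close> by (simp add: T_def)
    then have t0: "0 < t" using t by linarith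
    have "\<forall>\<^sub>F u in at_right 0. p u < 1 / (F * t)"
      using order_tendstoD(2)[OF lim] t0 \<open>0 < F\<close> by simp
    moreover have "\<forall>\<^sub>F u in at_right 0. u \<in> {0<..<w}" using w by (intro eventually_at_right_real) simp
    ultimately have "\<forall>\<^sub>F u in at_right 0. p u < 1 / (F * t) \<and> u \<in> {0<..<w}" by eventually_elim auto
    then obtain u where u: "p u < 1 / (F * t)" "0 < u" "u < w" by (auto dest: eventually_happens)
    have Fp: "0 < F * p u" using u ppos[of u] w \<open>0 < F\<close> by (intro mult_pos_pos) auto
    have "p u * (F * t) < 1" using u(1) t0 \<open>0 < F\<close> by (subst (asm) less_divide_eq) auto
    then have "t * (F * p u) \<le> 1" by (simp add: mult_ac)
    then have "t \<le> T u" unfolding T_def using Fp by (subst le_divide_eq) auto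
    have "\<exists>v\<ge>u. v \<le> w \<and> T v = t"
    proof (rule IVT2)
      show "T w \<le> t" "t \<le> T u" "u \<le> w" using t \<open>t \<le> T u\<close> u by auto
      show "\<forall>x. u \<le> x \<and> x \<le> w \<longrightarrow> isCont T x" using u w Tcont by auto
    qed
    then obtain v where v: "u \<le> v" "v \<le> w" "T v = t" by blast
    moreover have "v \<noteq> w" using v t by auto
    ultimately show ?thesis using u by (intro exI[of _ v]) auto
  qed
  \<comment> \<open>Stopping at \<open>v0 / 2\<close> keeps a neighbourhood of each point inside the
    region where \<open>T\<close> is known.\<close>
  define t1 where "t1 = T (v0 / 2)"
  have t1: "0 < t1" using ppos[of "v0 / 2"] \<open>0 < v0\<close> \<open>0 < F\<close> by (simp add: t1_def T_def)
  have U: "0 < \<phi> - U t \<and> \<phi> - U t < v0 / 2 \<and> T (\<phi> - U t) = t" if t: "t1 < t" for t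
  proof -
    obtain v where "0 < v" "v < v0 / 2" "T v = t" using ex[OF t[unfolded t1_def]] \<open>0 < v0\<close> by auto
    then show ?thesis using Tinv[of v] \<open>0 < v0\<close> by auto
  qed
  have D: "(U has_real_derivative 1 / (t\<^sup>2 * F * deriv p (\<phi> - U t))) (at t)" if t: "t1 < t" for t
  proof -
    define v where "v = \<phi> - U t"
    have v: "0 < v" "v < v0 / 2" "T v = t" using U[OF t] by (auto simp: v_def)
    define d where "d = v / 2"
    have isc: "isCont U ((\<lambda>y. T (\<phi> - y)) (\<phi> - v))"
    proof (rule isCont_inverse_function[where f = "\<lambda>y. T (\<phi> - y)" and d = d])
      show "0 < d" using v by (simp add: d_def)
      show "U (T (\<phi> - z)) = z" if "\<bar>z - (\<phi> - v)\<bar> \<le> d" for z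
      proof -
        have "U (T (\<phi> - z)) = \<phi> - (\<phi> - z)" by (rule Tinv; use that v in \<open>unfold d_def, linarith\<close>)
        then show ?thesis by simp
      qed
      show "isCont (\<lambda>y. T (\<phi> - y)) z" if "\<bar>z - (\<phi> - v)\<bar> \<le> d" for z
        by (rule continuous_at_compose[of z "\<lambda>y. \<phi> - y" T, unfolded comp_def], intro continuous_intros, rule Tcont)
          (use that v in \<open>unfold d_def, linarith+\<close>)
    qed
    have "0 < t" using t t1 by linarith
    have pv: "F * p v = 1 / t" unfolding v(3)[symmetric] by (simp add: T_def)
    have "((\<lambda>y. T (\<phi> - y)) has_real_derivative - (deriv p v * F / (F * p v)\<^sup>2) * (- 1)) (at (U t))"
      using v(1,2) \<open>0 < v0\<close> by (intro DERIV_chain2[of T _ "\<lambda>y. \<phi> - y"]) (auto intro!: dT derivative_eq_intros simp: v_def)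
    then have "((\<lambda>y. T (\<phi> - y)) has_real_derivative deriv p v * F * t\<^sup>2) (at (U t))"
      unfolding pv by (simp add: power_divide)
    then have "(U has_real_derivative inverse (deriv p v * F * t\<^sup>2)) (at t)"
    proof (rule DERIV_inverse_function)
      show "deriv p v * F * t\<^sup>2 \<noteq> 0" using pos[of v] v \<open>0 < F\<close> \<open>0 < t\<close> by auto
      show "t1 < t" "t < t + 1" using t by auto
      show "T (\<phi> - U y) = y" if "t1 < y" for y using U[OF that] by auto
      show "isCont U t" using isc v by simp
    qed
    then show ?thesis by (simp add: inverse_eq_divide v_def mult_ac)
  qed
  show "\<exists>t1>0. \<forall>t>t1. 0 < \<phi> - U t \<and> \<phi> - U t < v0 \<and> F * p (\<phi> - U t) = 1 / t \<and>
      (U has_real_derivative 1 / (t\<^sup>2 * F * deriv p (\<phi> - U t))) (at t)"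
  proof (intro exI[of _ t1] conjI allI impI t1 D)
    fix t assume t: "t1 < t"
    then have "0 < t" using t1 by linarith
    show "0 < \<phi> - U t" "\<phi> - U t < v0" using U[OF t] by auto
    have "T (\<phi> - U t) = t" using U[OF t] by simp
    then have "1 / t = 1 / T (\<phi> - U t)" by simp
    then show "F * p (\<phi> - U t) = 1 / t" by (simp add: T_def)
  qed
  show "(U \<longlongrightarrow> \<phi>) at_top"
  proof (rule tendstoI)
    fix \<epsilon> :: real assume \<epsilon>: "0 < \<epsilon>"
    define w where "w = min \<epsilon> (v0 / 2)"
    have w: "0 < w" "w < v0" "w \<le> \<epsilon>" using \<epsilon> \<open>0 < v0\<close> by (auto simp: w_def)
    show "\<forall>\<^sub>F t in at_top. dist (U t) \<phi> < \<epsilon>"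
      using eventually_gt_at_top[of "T w"]
    proof eventually_elim
      case (elim t)
      then obtain v where v: "0 < v" "v < w" "T v = t" using ex[OF elim w(1,2)] by blast
      then have "U t = \<phi> - v" using Tinv[of v] w by auto
      then show ?case using v w by (simp add: dist_real_def)
    qed
  qed
qed

lemma regularly_varying_inverse:
  assumes "regularly_varying \<alpha> f"
  shows "regularly_varying (- \<alpha>) (\<lambda>t. 1 / f t)"
  unfolding regularly_varying_def
proof (intro allI impI)
  fix z :: real assume z: "0 < z"
  have "((\<lambda>t. inverse (f (t * z) / f t)) \<longlongrightarrow> inverse (z powr \<alpha>)) at_top"
    using assms z unfolding regularly_varying_def by (intro tendsto_inverse) auto
  then show "((\<lambda>t. (1 / f (t * z)) / (1 / f t)) \<longlongrightarrow> z powr (- \<alpha>)) at_top"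
    by (simp add: powr_minus)
qed

lemma regularly_varying_powr_mult:
  assumes "regularly_varying \<alpha> f"
  shows "regularly_varying (\<alpha> + b) (\<lambda>t. t powr b * f t)"
  unfolding regularly_varying_def
proof (intro allI impI)
  fix z :: real assume z: "0 < z"
  have "((\<lambda>t. z powr b * (f (t * z) / f t)) \<longlongrightarrow> z powr b * z powr \<alpha>) at_top"
    using assms z unfolding regularly_varying_def by (intro tendsto_mult tendsto_const) auto
  then have lim: "((\<lambda>t. z powr b * (f (t * z) / f t)) \<longlongrightarrow> z powr (\<alpha> + b)) at_top"
    by (simp add: powr_add mult.commute)
  show "((\<lambda>t. (t * z) powr b * f (t * z) / (t powr b * f t)) \<longlongrightarrow> z powr (\<alpha> + b)) at_top"
    by (rule Lim_transform_eventually[OF lim], use eventually_gt_at_top[of 0] in eventually_elim)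
      (use z in \<open>simp add: powr_mult\<close>)
qed

text \<open>Potter's bound from one fixed base point, with an exponent between
  \<open>- \<kappa>\<close> and 0.\<close>

lemma regularly_varying_neg_tendsto_0:
  assumes "f \<in> borel_measurable borel" "regularly_varying (- \<kappa>) f" "0 < \<kappa>"
  shows "(f \<longlongrightarrow> 0) at_top"
proof -
  obtain C where C: "0 < C" "\<forall>\<^sub>F t in at_top. \<forall>z\<ge>1. \<bar>f (t * z)\<bar> \<le> C * z powr (- \<kappa> / 2) * \<bar>f t\<bar>"
    using potter_upper_bound[OF assms(1,2), of "- \<kappa> / 2"] \<open>0 < \<kappa>\<close> by auto
  have "\<forall>\<^sub>F t in at_top. 1 \<le> t \<and> (\<forall>z\<ge>1. \<bar>f (t * z)\<bar> \<le> C * z powr (- \<kappa> / 2) * \<bar>f t\<bar>)"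
    using C(2) eventually_ge_at_top[of 1] by eventually_elim auto
  then obtain t where t: "1 \<le> t" "\<And>z. 1 \<le> z \<Longrightarrow> \<bar>f (t * z)\<bar> \<le> C * z powr (- \<kappa> / 2) * \<bar>f t\<bar>"
    by (auto dest: eventually_happens)
  have "((\<lambda>s. C * (s / t) powr (- \<kappa> / 2) * \<bar>f t\<bar>) \<longlongrightarrow> C * 0 * \<bar>f t\<bar>) at_top"
    using t \<open>0 < \<kappa>\<close> filterlim_at_top_mult_const[of "1 / t"]
    by (intro tendsto_intros tendsto_neg_powr) auto
  then have lim: "((\<lambda>s. C * (s / t) powr (- \<kappa> / 2) * \<bar>f t\<bar>) \<longlongrightarrow> 0) at_top" by simp
  show ?thesis
  proof (rule Lim_null_comparison[OF _ lim], use eventually_ge_at_top[of t] in eventually_elim)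
    case (elim s)
    have "\<bar>f (t * (s / t))\<bar> \<le> C * (s / t) powr (- \<kappa> / 2) * \<bar>f t\<bar>"
      using elim t(1) by (intro t(2)) (simp add: le_divide_eq)
    then show ?case using t(1) by simp
  qed
qed

text \<open>With \<open>v = \<phi> - U t\<close> the quantity \<open>V t\<close> becomes a function
  \<Psi> of \<open>v\<close> whose deviation from \<open>c\<close> is asymptotically
  \<open>L \<eta>(v)\<close> with \<open>L\<close> nonzero. So \<open>V - c\<close> is comparable to
  the regularly varying \<open>h\<close> at \<open>1 / v\<close>, and Potter bounds for
  \<open>h\<close> and \<open>1 / h\<close> transfer its behaviour back to
  \<open>V - c\<close>.\<close>

lemma second_order_endpoint:
  fixes p U :: "real \<Rightarrow> real"
  assumes diff: "\<And>v. 0 < v \<Longrightarrow> v < v0 \<Longrightarrow> p differentiable (at v)"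
    and "0 < v0" "0 < F" "0 < \<rho>" "0 < \<delta>" "0 < \<kappa>"
    and lim: "(p \<longlongrightarrow> 0) (at_right 0)"
    and rv: "regularly_varying (- \<kappa>) (\<lambda>t. t powr (\<rho> - 1) * deriv p (1 / t) - \<delta>)"
    and U: "\<forall>\<^sub>F t in at_top. U t < \<phi> \<and> F * p (\<phi> - U t) = 1 / t \<and> deriv U t = 1 / (t\<^sup>2 * F * deriv p (\<phi> - U t))"
    and Ulim: "(U \<longlongrightarrow> \<phi>) at_top"
    and Umono: "\<forall>\<^sub>F t in at_top. \<forall>s\<ge>t. U t \<le> U s"
  defines "c \<equiv> (\<delta> * F) powr (- 1 / \<rho>) * \<rho> powr (1 / \<rho> - 1)"
    and "V \<equiv> \<lambda>t. t powr (1 + 1 / \<rho>) * deriv U t"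
  shows "((\<lambda>t. t * deriv U t / (\<phi> - U t)) \<longlongrightarrow> 1 / \<rho>) at_top"
    and "(V \<longlongrightarrow> c) at_top"
    and "\<exists>C>0. \<forall>\<^sub>F t in at_top. \<forall>z\<ge>1/8. \<bar>V (t * z) - c\<bar> \<le> C * \<bar>V t - c\<bar>"
proof -
  define d where "d t = (if 1 / v0 < t then deriv p (1 / t) else 0)" for t
  define h where "h t = t powr (\<rho> - 1) * d t - \<delta>" for t
  have dm [measurable]: "d \<in> borel_measurable borel"
    unfolding d_def by (rule borel_measurable_deriv_at_right[OF diff \<open>0 < v0\<close>])
  have hm: "h \<in> borel_measurable borel" unfolding h_def by measurable
  have hrv: "regularly_varying (- \<kappa>) h"
    by (rule regularly_varying_cong[OF _ rv])
      (use eventually_gt_at_top[of "1 / v0"] in \<open>eventually_elim, simp add: h_def d_def\<close>)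
  have h0: "(h \<longlongrightarrow> 0) at_top" by (rule regularly_varying_neg_tendsto_0[OF hm hrv \<open>0 < \<kappa>\<close>])
  define \<eta> where "\<eta> v = h (1 / v)" for v
  have inv0: "filterlim (\<lambda>v. 1 / v) at_top (at_right (0::real))"
    using filterlim_inverse_at_top_right by (simp add: inverse_eq_divide)
  have \<eta>0: "(\<eta> \<longlongrightarrow> 0) (at_right 0)" unfolding \<eta>_def by (rule filterlim_compose[OF h0 inv0])
  have \<eta>nz: "\<forall>\<^sub>F v in at_right 0. \<eta> v \<noteq> 0"
    unfolding \<eta>_def by (rule eventually_compose_filterlim[OF regularly_varying_nonzero[OF hrv] inv0])
  have small: "\<forall>\<^sub>F v in at_right 0. 0 < v \<and> v < v0"
    using eventually_at_right_real[OF \<open>0 < v0\<close>] by simp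
  have dp: "deriv p v = v powr (\<rho> - 1) * (\<delta> + \<eta> v)" if "0 < v" "v < v0" for v
  proof -
    have "1 / v0 < 1 / v" using that by (intro divide_strict_left_mono) auto
    moreover have "(1 / v) powr (\<rho> - 1) * v powr (\<rho> - 1) = 1"
      using that by (simp flip: powr_mult)
    ultimately show ?thesis by (simp add: \<eta>_def h_def d_def mult_ac)
  qed
  \<comment> \<open>The part of the tail beyond its leading power. Its derivative
    \<open>v^(\<rho> - 1) \<eta>(v)\<close> has a regularly varying reciprocal form, of index
    \<open>1 - (\<rho> + \<kappa>)\<close>, so Karamata's theorem applies a second time to this
    remainder.\<close>
  define r where "r v = p v - \<delta> / \<rho> * v powr \<rho>" for v
  have dr: "(r has_real_derivative v powr (\<rho> - 1) * \<eta> v) (at v)" if "0 < v" "v < v0" for v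
  proof -
    have "(r has_real_derivative deriv p v - \<delta> / \<rho> * (\<rho> * v powr (\<rho> - 1))) (at v)"
      unfolding r_def using diff[OF that] that(1)
      by (intro DERIV_diff DERIV_cmult has_real_derivative_powr) (simp_all add: DERIV_deriv_iff_real_differentiable)
    moreover have "deriv p v - \<delta> / \<rho> * (\<rho> * v powr (\<rho> - 1)) = v powr (\<rho> - 1) * \<eta> v"
      using \<open>0 < \<rho>\<close> by (simp add: dp[OF that] distrib_left)
    ultimately show ?thesis by simp
  qed
  have powr0: "((\<lambda>v::real. v powr \<rho>) \<longlongrightarrow> 0) (at_right 0)"
    using \<open>0 < \<rho>\<close> by (intro tendsto_eq_intros) (auto simp: eventually_at_filter)
  have r0: "(r \<longlongrightarrow> 0) (at_right 0)"
    unfolding r_def using tendsto_diff[OF lim tendsto_mult_right_zero[OF powr0, of "\<delta> / \<rho>"]] by simp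
  have "regularly_varying (- \<kappa> + (1 - \<rho>)) (\<lambda>t. t powr (1 - \<rho>) * h t)"
    by (rule regularly_varying_powr_mult[OF hrv])
  then have "regularly_varying (1 - (\<rho> + \<kappa>)) (\<lambda>t. t powr (1 - \<rho>) * h t)"
    by (simp add: algebra_simps)
  then have rrv: "regularly_varying (1 - (\<rho> + \<kappa>)) (\<lambda>t. deriv r (1 / t))"
  proof (rule regularly_varying_cong[rotated])
    show "\<forall>\<^sub>F t in at_top. t powr (1 - \<rho>) * h t = deriv r (1 / t)"
      using eventually_gt_at_top[of "1 / v0"] eventually_gt_at_top[of 0]
    proof eventually_elim
      case (elim t)
      have "deriv r (1 / t) = (1 / t) powr (\<rho> - 1) * \<eta> (1 / t)"
        by (rule DERIV_imp_deriv[OF dr]) (use elim \<open>0 < v0\<close> in \<open>auto simp: field_simps\<close>)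
      moreover have "(1 / t) powr (\<rho> - 1) = t powr (1 - \<rho>)"
        using elim by (simp add: powr_def ln_div algebra_simps)
      ultimately show ?case by (simp add: \<eta>_def)
    qed
  qed
  have kar: "((\<lambda>v. r v / (v * deriv r v)) \<longlongrightarrow> 1 / (\<rho> + \<kappa>)) (at_right 0)"
    by (rule karamata_at_right_0[OF _ \<open>0 < v0\<close> _ r0 rrv])
      (use dr \<open>0 < \<rho>\<close> \<open>0 < \<kappa>\<close> in \<open>auto simp: real_differentiable_def\<close>)
  define m where "m v = r v / (v powr \<rho> * \<eta> v)" for v
  have m: "(m \<longlongrightarrow> 1 / (\<rho> + \<kappa>)) (at_right 0)"
  proof (rule Lim_transform_eventually[OF kar], use small in eventually_elim)
    case (elim v)
    have "v * v powr (\<rho> - 1) = v powr \<rho>" using elim by (simp add: powr_mult_base)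
    then show ?case using elim by (simp add: m_def DERIV_imp_deriv[OF dr] flip: mult.assoc)
  qed
  define P where "P v = p v * v powr (- \<rho>)" for v
  define P0 where "P0 = \<delta> / \<rho>"
  have P0: "0 < P0" using \<open>0 < \<delta>\<close> \<open>0 < \<rho>\<close> by (simp add: P0_def)
  have Pdiff: "\<forall>\<^sub>F v in at_right 0. P v - P0 = \<eta> v * m v"
    using small \<eta>nz
  proof eventually_elim
    case (elim v)
    have "v powr \<rho> * v powr (- \<rho>) = 1" using elim by (simp flip: powr_add)
    moreover have "P v - P0 = (p v - P0 * v powr \<rho>) * v powr (- \<rho>)"
      using calculation by (simp add: P_def left_diff_distrib mult.assoc)
    ultimately show ?case using elim by (simp add: m_def r_def P0_def powr_minus_divide)
  qed
  have "((\<lambda>v. P0 + \<eta> v * m v) \<longlongrightarrow> P0 + 0 * (1 / (\<rho> + \<kappa>))) (at_right 0)"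
    by (intro tendsto_intros \<eta>0 m)
  then have P': "((\<lambda>v. P0 + \<eta> v * m v) \<longlongrightarrow> P0) (at_right 0)" by simp
  have P: "(P \<longlongrightarrow> P0) (at_right 0)"
    by (rule Lim_transform_eventually[OF P']) (use Pdiff in \<open>eventually_elim, simp\<close>)
  have mpos: "\<forall>\<^sub>F v in at_right 0. 0 < m v"
    using order_tendstoD(1)[OF m, of 0] \<open>0 < \<rho>\<close> \<open>0 < \<kappa>\<close> by simp
  \<comment> \<open>The difference quotient of the power function at \<open>P0\<close> is composed
    with \<open>P\<close>, which must avoid \<open>P0\<close>; this follows from
    \<open>\<eta>\<close> and \<open>m\<close> being nonzero near 0.\<close>
  have P_at: "filterlim P (at P0) (at_right 0)"
  proof -
    have "\<forall>\<^sub>F v in at_right 0. P v \<noteq> P0" using Pdiff mpos \<eta>nz by eventually_elim auto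
    then show ?thesis unfolding filterlim_at using P by simp
  qed
  define a where "a = 1 - 1 / \<rho>"
  define \<Psi> where "\<Psi> v = F powr (- 1 / \<rho>) * (P v powr a / (\<delta> + \<eta> v))" for v
  have c: "c = F powr (- 1 / \<rho>) * (P0 powr a / \<delta>)"
  proof -
    have "P0 powr a / \<delta> = \<delta> powr (- 1 / \<rho>) * \<rho> powr (1 / \<rho> - 1)"
    proof -
      have "P0 powr a = \<delta> powr a * \<rho> powr (- a)"
        unfolding P0_def using \<open>0 < \<delta>\<close> \<open>0 < \<rho>\<close> by (simp add: powr_divide powr_minus_divide)
      moreover have "\<delta> powr a / \<delta> = \<delta> powr (- 1 / \<rho>)"
        using \<open>0 < \<delta>\<close> by (simp add: a_def powr_diff powr_minus_divide)
      ultimately have "P0 powr a / \<delta> = \<delta> powr (- 1 / \<rho>) * \<rho> powr (- a)"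
        by (metis mult.commute times_divide_eq_right)
      then show ?thesis by (simp add: a_def)
    qed
    then show ?thesis unfolding c_def using \<open>0 < \<delta>\<close> \<open>0 < F\<close> by (simp add: powr_mult)
  qed
  \<comment> \<open>The first-order effect of \<eta> on \<Psi>: through
    \<open>P - P0 = \<eta> m\<close> in the numerator and directly in the denominator.\<close>
  define L where "L = F powr (- 1 / \<rho>) * (a * P0 powr (a - 1) * (1 / (\<rho> + \<kappa>)) / (\<delta> + 0) - P0 powr a / (\<delta> * (\<delta> + 0)))"
  have L0: "L \<noteq> 0"
  proof -
    have "P0 powr a = P0 powr (a - 1) * P0" using P0 by (simp add: powr_diff)
    then have "L = F powr (- 1 / \<rho>) * (P0 powr (a - 1) / \<delta>) * (a / (\<rho> + \<kappa>) - 1 / \<rho>)"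
      unfolding L_def using \<open>0 < \<delta>\<close> by (simp add: P0_def field_simps)
    \<comment> \<open>The two first-order effects cannot cancel: their sum is proportional to
      \<open>- (1 + \<kappa>)\<close>.\<close>
    moreover have "a / (\<rho> + \<kappa>) - 1 / \<rho> = - (1 + \<kappa>) / (\<rho> * (\<rho> + \<kappa>))"
    proof -
      have "a / s - 1 / \<rho> = (\<rho> - 1 - s) / (\<rho> * s)" if "0 < s" for s
        using \<open>0 < \<rho>\<close> that by (simp add: a_def field_simps)
      from this[of "\<rho> + \<kappa>"] show ?thesis using \<open>0 < \<rho>\<close> \<open>0 < \<kappa>\<close> by simp
    qed
    moreover have "- (1 + \<kappa>) / (\<rho> * (\<rho> + \<kappa>)) \<noteq> 0" using \<open>0 < \<rho>\<close> \<open>0 < \<kappa>\<close> by simp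
    ultimately show ?thesis using \<open>0 < F\<close> P0 \<open>0 < \<delta>\<close> by simp
  qed
  have \<delta>\<eta>: "\<forall>\<^sub>F v in at_right 0. 0 < \<delta> + \<eta> v"
    using order_tendstoD(1)[OF \<eta>0, of "- \<delta>"] \<open>0 < \<delta>\<close> by simp (auto elim: eventually_mono)
  have \<Psi>c: "(\<Psi> \<longlongrightarrow> c) (at_right 0)"
  proof -
    have "(\<Psi> \<longlongrightarrow> F powr (- 1 / \<rho>) * (P0 powr a / (\<delta> + 0))) (at_right 0)"
      unfolding \<Psi>_def using P0 \<open>0 < \<delta>\<close> by (intro tendsto_intros P \<eta>0) auto
    then show ?thesis by (simp add: c)
  qed
  have dq: "((\<lambda>y. (y powr a - P0 powr a) / (y - P0)) \<longlongrightarrow> a * P0 powr (a - 1)) (at P0)"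
    using has_real_derivative_powr[OF P0, of a] by (simp add: has_field_derivative_iff)
  have "((\<lambda>v. F powr (- 1 / \<rho>) * ((P v powr a - P0 powr a) / (P v - P0) * m v / (\<delta> + \<eta> v) - P0 powr a / (\<delta> * (\<delta> + \<eta> v)))) \<longlongrightarrow> L) (at_right 0)"
    unfolding L_def using \<open>0 < \<delta>\<close> by (intro tendsto_intros filterlim_compose[OF dq P_at] m \<eta>0) auto
  then have \<Psi>L: "((\<lambda>v. (\<Psi> v - c) / \<eta> v) \<longlongrightarrow> L) (at_right 0)"
  proof (rule Lim_transform_eventually, use Pdiff \<eta>nz mpos \<delta>\<eta> in eventually_elim)
    case (elim v)
    have *: "(A - A0) / (\<eta> v * m v) * m v / (\<delta> + \<eta> v) - A0 / (\<delta> * (\<delta> + \<eta> v)) = (A / (\<delta> + \<eta> v) - A0 / \<delta>) / \<eta> v" for A A0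
      using elim \<open>0 < \<delta>\<close> by (simp add: divide_simps) (simp add: algebra_simps)
    show ?case unfolding \<Psi>_def c elim(1) by (simp only: * right_diff_distrib times_divide_eq_right)
  qed
  define v where "v t = \<phi> - U t" for t
  have v_at: "filterlim v (at_right 0) at_top"
    unfolding filterlim_at v_def using U tendsto_diff[OF tendsto_const[of \<phi>] Ulim]
    by (auto elim: eventually_mono)
  note atv = eventually_compose_filterlim[OF _ v_at]
  have ev: "\<forall>\<^sub>F t in at_top. 0 < t \<and> 0 < v t \<and> v t < v0 \<and> 0 < \<delta> + \<eta> (v t) \<and>
      F * (v t powr \<rho> * P (v t)) = 1 / t \<and> deriv U t = 1 / (t\<^sup>2 * F * (v t powr (\<rho> - 1) * (\<delta> + \<eta> (v t))))"
    using U eventually_gt_at_top[of 0] atv[OF small] atv[OF \<delta>\<eta>]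
  proof eventually_elim
    case (elim t)
    have "v t powr \<rho> * P (v t) = p (v t)" using elim by (simp add: P_def powr_minus_divide)
    then show ?case using elim by (auto simp: v_def dp)
  qed
  \<comment> \<open>The variable \<open>t\<close> is eliminated through
    \<open>1 / t = F v^\<rho> P(v)\<close>; the powers of \<open>v\<close> then cancel.\<close>
  have V\<Psi>: "\<forall>\<^sub>F t in at_top. V t = \<Psi> (v t)"
    using ev atv[OF order_tendstoD(1)[OF P P0]]
  proof eventually_elim
    case (elim t)
    then have t: "1 / t = F * v t powr \<rho> * P (v t)" and pos: "0 < t" "0 < v t" "0 < P (v t)" by auto
    have "V t = t powr (1 / \<rho> - 1) / (F * (v t powr (\<rho> - 1) * (\<delta> + \<eta> (v t))))"
    proof -
      have "t powr (1 + 1 / \<rho>) = t\<^sup>2 * t powr (1 / \<rho> - 1)"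
        using pos by (simp flip: powr_add powr_numeral)
      then show ?thesis using elim by (simp add: V_def)
    qed
    also have "t powr (1 / \<rho> - 1) = (1 / t) powr a"
      using pos by (simp add: a_def powr_def ln_div algebra_simps)
    also have "\<dots> = F powr a * v t powr (\<rho> - 1) * P (v t) powr a"
    proof -
      have "\<rho> * a = \<rho> - 1" using \<open>0 < \<rho>\<close> by (simp add: a_def algebra_simps)
      then show ?thesis unfolding t using pos \<open>0 < F\<close> by (simp add: powr_mult powr_powr)
    qed
    also have "F powr a = F * F powr (- 1 / \<rho>)"
      using \<open>0 < F\<close> by (simp add: a_def powr_diff powr_minus_divide)
    finally show ?case using pos \<open>0 < F\<close> by (simp add: \<Psi>_def)
  qed
  show "(V \<longlongrightarrow> c) at_top"
    by (rule Lim_transform_eventually[OF filterlim_compose[OF \<Psi>c v_at]]) (use V\<Psi> in \<open>eventually_elim, simp\<close>)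
  have "((\<lambda>v. P v / (\<delta> + \<eta> v)) \<longlongrightarrow> P0 / (\<delta> + 0)) (at_right 0)"
    using \<open>0 < \<delta>\<close> by (intro tendsto_intros P \<eta>0) auto
  then have "((\<lambda>v. P v / (\<delta> + \<eta> v)) \<longlongrightarrow> 1 / \<rho>) (at_right 0)" using \<open>0 < \<delta>\<close> by (simp add: P0_def)
  from filterlim_compose[OF this v_at]
  show "((\<lambda>t. t * deriv U t / (\<phi> - U t)) \<longlongrightarrow> 1 / \<rho>) at_top"
  proof (rule Lim_transform_eventually, use ev in eventually_elim)
    case (elim t)
    have "v t powr (\<rho> - 1) * v t = v t powr \<rho>" using elim by (simp add: powr_mult_base mult.commute)
    moreover have "t * (1 / (t\<^sup>2 * F * (X * D))) / y = (1 / t) / (F * (X * y) * D)" for X D y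
      using elim by (simp add: power2_eq_square)
    ultimately have "t * deriv U t / v t = (1 / t) / (F * v t powr \<rho> * (\<delta> + \<eta> (v t)))"
      using elim by simp
    also have "1 / t = F * (v t powr \<rho> * P (v t))" using elim by simp
    finally show ?case using elim \<open>0 < F\<close> by (simp add: v_def)
  qed
  define w where "w t = 1 / v t" for t
  have w: "filterlim w at_top at_top" unfolding w_def by (rule filterlim_compose[OF inv0 v_at])
  have eL: "((\<lambda>t. (V t - c) / h (w t)) \<longlongrightarrow> L) at_top"
    by (rule Lim_transform_eventually[OF filterlim_compose[OF \<Psi>L v_at]])
      (use V\<Psi> in \<open>eventually_elim, simp add: \<eta>_def w_def\<close>)
  have hnz: "\<forall>\<^sub>F t in at_top. h (w t) \<noteq> 0"
    by (rule eventually_compose_filterlim[OF regularly_varying_nonzero[OF hrv] w])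
  have "\<forall>\<^sub>F t in at_top. \<bar>L\<bar> / 2 < \<bar>(V t - c) / h (w t)\<bar> \<and> \<bar>(V t - c) / h (w t)\<bar> < 2 * \<bar>L\<bar>"
    using L0 by (intro eventually_conj order_tendstoD[OF tendsto_rabs[OF eL]]) auto
  then have comp: "\<forall>\<^sub>F t in at_top. \<bar>L\<bar> / 2 * \<bar>h (w t)\<bar> \<le> \<bar>V t - c\<bar> \<and> \<bar>V t - c\<bar> \<le> 2 * \<bar>L\<bar> * \<bar>h (w t)\<bar>"
    using hnz by eventually_elim (auto simp: abs_divide divide_less_eq less_divide_eq)
  obtain C1 where C1: "0 < C1" "\<forall>\<^sub>F t in at_top. \<forall>z\<ge>1. \<bar>h (t * z)\<bar> \<le> C1 * z powr 0 * \<bar>h t\<bar>"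
    using potter_upper_bound[OF hm hrv, of 0] \<open>0 < \<kappa>\<close> by auto
  \<comment> \<open>An upper bound for \<open>1 / h\<close> is a lower bound for \<open>h\<close>.
    It serves arguments below \<open>t\<close>, where \<open>v\<close> is larger and Potter's bound
    for \<open>h\<close> points the wrong way.\<close>
  obtain C2 where C2: "0 < C2" "\<forall>\<^sub>F t in at_top. \<forall>z\<ge>1. \<bar>1 / h (t * z)\<bar> \<le> C2 * z powr (2 * \<kappa>) * \<bar>1 / h t\<bar>"
  proof -
    have "(\<lambda>t. 1 / h t) \<in> borel_measurable borel" using hm by measurable
    then show ?thesis
      using potter_upper_bound[OF _ regularly_varying_inverse[OF hrv], of "2 * \<kappa>"] \<open>0 < \<kappa>\<close> that by auto
  qed
  \<comment> \<open>By \<open>1 / t = F v^\<rho> P(v)\<close> the \<rho>-th power of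
    \<open>v (t / 8) / v t\<close> tends to 8; 16 leaves a margin.\<close>
  define B where "B = 16 powr (1 / \<rho>)"
  have B: "1 \<le> B" using \<open>0 < \<rho>\<close> by (simp add: B_def ge_one_powr_ge_zero)
  have vB: "\<forall>\<^sub>F t in at_top. v (t / 8) / v t \<le> B"
  proof -
    have t8: "filterlim (\<lambda>t. t / 8) at_top (at_top :: real filter)"
      using filterlim_at_top_mult_const[of "1 / 8"] by simp
    have "((\<lambda>t. 8 * P (v t) / P (v (t / 8))) \<longlongrightarrow> 8 * P0 / P0) at_top"
      using P0 by (intro tendsto_intros filterlim_compose[OF P v_at]
        filterlim_compose[OF filterlim_compose[OF P v_at] t8]) auto
    then have "\<forall>\<^sub>F t in at_top. 8 * P (v t) / P (v (t / 8)) < 16"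
      using P0 by (intro order_tendstoD) auto
    then show ?thesis using ev eventually_compose_filterlim[OF ev t8] atv[OF order_tendstoD(1)[OF P P0]]
        eventually_compose_filterlim[OF atv[OF order_tendstoD(1)[OF P P0]] t8]
    proof eventually_elim
      case (elim t)
      have "F * (v (t / 8) powr \<rho> * P (v (t / 8))) = 8 * (F * (v t powr \<rho> * P (v t)))"
        using elim by simp
      then have "v (t / 8) powr \<rho> = 8 * P (v t) / P (v (t / 8)) * v t powr \<rho>"
        using elim \<open>0 < F\<close> by (simp add: field_simps)
      then have "(v (t / 8) / v t) powr \<rho> = 8 * P (v t) / P (v (t / 8))"
        using elim by (simp add: powr_divide)
      then have "(v (t / 8) / v t) powr \<rho> \<le> 16" using elim by simp
      then have "((v (t / 8) / v t) powr \<rho>) powr (1 / \<rho>) \<le> 16 powr (1 / \<rho>)"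
        using \<open>0 < \<rho>\<close> by (intro powr_mono2) auto
      then show ?case using elim \<open>0 < \<rho>\<close> by (simp add: powr_powr B_def)
    qed
  qed
  define K where "K = C1 + C2 * B powr (2 * \<kappa>)"
  have K: "0 < K" using C1 C2 by (simp add: K_def add_pos_nonneg)
  obtain x0 where x0: "\<And>x z. x \<ge> x0 \<Longrightarrow> 1 \<le> z \<Longrightarrow> \<bar>h (x * z)\<bar> \<le> C1 * \<bar>h x\<bar>"
    "\<And>x z. x \<ge> x0 \<Longrightarrow> 1 \<le> z \<Longrightarrow> \<bar>1 / h (x * z)\<bar> \<le> C2 * z powr (2 * \<kappa>) * \<bar>1 / h x\<bar>"
    "\<And>x. x \<ge> x0 \<Longrightarrow> h x \<noteq> 0"
  proof -
    have "\<forall>\<^sub>F x in at_top. 0 < x \<and> (\<forall>z\<ge>1. \<bar>h (x * z)\<bar> \<le> C1 * z powr 0 * \<bar>h x\<bar>) \<and>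
       (\<forall>z\<ge>1. \<bar>1 / h (x * z)\<bar> \<le> C2 * z powr (2 * \<kappa>) * \<bar>1 / h x\<bar>) \<and> h x \<noteq> 0"
      using C1(2) C2(2) regularly_varying_nonzero[OF hrv] eventually_gt_at_top[of 0] by eventually_elim auto
    then obtain x0 where "\<And>x. x \<ge> x0 \<Longrightarrow> 0 < x \<and> (\<forall>z\<ge>1. \<bar>h (x * z)\<bar> \<le> C1 * z powr 0 * \<bar>h x\<bar>) \<and>
       (\<forall>z\<ge>1. \<bar>1 / h (x * z)\<bar> \<le> C2 * z powr (2 * \<kappa>) * \<bar>1 / h x\<bar>) \<and> h x \<noteq> 0"
      unfolding eventually_at_top_linorder by blast
    then show ?thesis by (intro that[of x0]) (auto simp: powr_zero_eq_one)
  qed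
  have main: "\<bar>h (w s)\<bar> \<le> K * \<bar>h (w t)\<bar>"
    if "w s \<ge> x0" "w t \<ge> x0" "0 < v s" "0 < v t" "v s / v t \<le> B" for s t
  proof (cases "v s \<le> v t")
    case True
    have "w s = w t * (v t / v s)" using that by (simp add: w_def)
    then have "\<bar>h (w s)\<bar> \<le> C1 * \<bar>h (w t)\<bar>" using x0(1)[of "w t" "v t / v s"] that True by simp
    also have "\<dots> \<le> K * \<bar>h (w t)\<bar>" using C2 by (intro mult_right_mono) (auto simp: K_def)
    finally show ?thesis .
  next
    case False
    have "w t = w s * (v s / v t)" using that by (simp add: w_def)
    then have "\<bar>1 / h (w t)\<bar> \<le> C2 * (v s / v t) powr (2 * \<kappa>) * \<bar>1 / h (w s)\<bar>"
      using x0(2)[of "w s" "v s / v t"] that False by simp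
    also have "\<dots> \<le> C2 * B powr (2 * \<kappa>) * \<bar>1 / h (w s)\<bar>"
      using C2 that \<open>0 < \<kappa>\<close> by (intro mult_right_mono mult_left_mono powr_mono2) auto
    finally have "\<bar>h (w s)\<bar> \<le> C2 * B powr (2 * \<kappa>) * \<bar>h (w t)\<bar>"
      using x0(3)[of "w s"] x0(3)[of "w t"] that by (simp add: field_simps)
    also have "\<dots> \<le> K * \<bar>h (w t)\<bar>" using C1 by (intro mult_right_mono) (auto simp: K_def)
    finally show ?thesis .
  qed
  have t8: "filterlim (\<lambda>t. t / 8) at_top (at_top :: real filter)"
    using filterlim_at_top_mult_const[of "1 / 8"] by simp
  have "\<forall>\<^sub>F t in at_top. 0 < v t \<and> x0 \<le> w t \<and> \<bar>L\<bar> / 2 * \<bar>h (w t)\<bar> \<le> \<bar>V t - c\<bar> \<and> \<bar>V t - c\<bar> \<le> 2 * \<bar>L\<bar> * \<bar>h (w t)\<bar>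
     \<and> (\<forall>s\<ge>t. U t \<le> U s)"
    using ev comp eventually_compose_filterlim[OF eventually_ge_at_top[of x0] w] Umono by eventually_elim auto
  then obtain t0 where t0: "\<And>t. t \<ge> t0 \<Longrightarrow> 0 < v t" "\<And>t. t \<ge> t0 \<Longrightarrow> x0 \<le> w t"
    "\<And>t. t \<ge> t0 \<Longrightarrow> \<bar>L\<bar> / 2 * \<bar>h (w t)\<bar> \<le> \<bar>V t - c\<bar>" "\<And>t. t \<ge> t0 \<Longrightarrow> \<bar>V t - c\<bar> \<le> 2 * \<bar>L\<bar> * \<bar>h (w t)\<bar>"
    "\<And>t s. t \<ge> t0 \<Longrightarrow> t \<le> s \<Longrightarrow> U t \<le> U s"
    unfolding eventually_at_top_linorder by blast
  show "\<exists>C>0. \<forall>\<^sub>F t in at_top. \<forall>z\<ge>1/8. \<bar>V (t * z) - c\<bar> \<le> C * \<bar>V t - c\<bar>"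
  \<comment> \<open>The 4 is the quotient of the comparison constants \<open>2 \<bar>L\<bar>\<close>
    and \<open>\<bar>L\<bar> / 2\<close>.\<close>
  proof (intro exI[of _ "4 * K"] conjI)
    show "0 < 4 * K" using K by simp
    show "\<forall>\<^sub>F t in at_top. \<forall>z\<ge>1/8. \<bar>V (t * z) - c\<bar> \<le> 4 * K * \<bar>V t - c\<bar>"
      using vB eventually_ge_at_top[of "8 * max 1 t0"]
    proof eventually_elim
      case (elim t)
      show ?case
      proof (intro allI impI)
        fix z :: real assume z: "1 / 8 \<le> z"
        have tz: "t / 8 \<le> t * z" using z elim mult_left_mono[OF z, of t] by simp
        have ge: "t0 \<le> t * z" "t0 \<le> t" "t0 \<le> t / 8" using tz elim by auto
        have "v (t * z) \<le> v (t / 8)" using t0(5)[OF ge(3) tz] by (simp add: v_def)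
        then have "v (t * z) / v t \<le> B"
          using elim(1) t0(1)[OF ge(2)] by (meson divide_right_mono less_imp_le order_trans)
        then have "\<bar>h (w (t * z))\<bar> \<le> K * \<bar>h (w t)\<bar>" using ge t0 by (intro main) auto
        have "\<bar>V (t * z) - c\<bar> \<le> 2 * \<bar>L\<bar> * \<bar>h (w (t * z))\<bar>" using t0(4)[OF ge(1)] .
        also have "\<dots> \<le> 2 * \<bar>L\<bar> * (K * \<bar>h (w t)\<bar>)" by (intro mult_left_mono) (fact, simp)
        also have "\<dots> = 4 * K * (\<bar>L\<bar> / 2 * \<bar>h (w t)\<bar>)" by simp
        also have "\<dots> \<le> 4 * K * \<bar>V t - c\<bar>" using t0(3)[OF ge(2)] K by (intro mult_left_mono) auto
        finally show "\<bar>V (t * z) - c\<bar> \<le> 4 * K * \<bar>V t - c\<bar>" .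
      qed
    qed
  qed
qed

section \<open>Weak limits of sums over triangular arrays\<close>

lemma cmod_iexp_diff_le: "cmod (iexp a - iexp b) \<le> \<bar>a - b\<bar>"
proof -
  have "iexp a - iexp b = iexp b * (iexp (a - b) - 1)"
    by (simp add: algebra_simps flip: exp_add)
  then have "cmod (iexp a - iexp b) = cmod (iexp (a - b) - 1)" by (simp add: norm_mult)
  also have "\<dots> \<le> \<bar>a - b\<bar>" using iexp_approx1[of "a - b" 0] by simp
  finally show ?thesis .
qed

lemma char_normal_distribution:
  assumes "0 < \<sigma>"
  shows "char (density lborel (normal_density 0 \<sigma>)) t = complex_of_real (exp (- (\<sigma>\<^sup>2 * t\<^sup>2 / 2)))"
proof -
  interpret S: prob_space std_normal_distribution by (rule prob_space_normal_density) simp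
  have "distributed std_normal_distribution lborel (\<lambda>x. x) std_normal_density"
    unfolding distributed_def by (auto simp: distr_id2)
  from S.normal_density_affine[OF this, of \<sigma> 0] assms
  have "distr std_normal_distribution lborel (\<lambda>x. \<sigma> * x) = density lborel (normal_density 0 \<sigma>)"
    unfolding distributed_def by simp
  then have "char (density lborel (normal_density 0 \<sigma>)) t = char (distr std_normal_distribution lborel (\<lambda>x. \<sigma> * x)) t"
    by simp
  also have "\<dots> = char std_normal_distribution (\<sigma> * t)"
    unfolding char_def by (subst integral_distr) (auto simp: mult_ac)
  also have "\<dots> = complex_of_real (exp (- (\<sigma>\<^sup>2 * t\<^sup>2 / 2)))"
    by (simp add: char_std_normal_distribution power_mult_distrib)
  finally show ?thesis .
qed

context prob_space
begin

text \<open>Slutsky's lemma within Levy's continuity theorem: the characteristic functions of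
  \<open>T n\<close> and \<open>L n\<close> differ at \<open>t\<close> by at most
  \<open>\<bar>t\<bar> \<epsilon>\<close> plus twice the probability that the variables are more
  than \<epsilon> apart.\<close>

lemma conv_distr_normal_of_char:
  fixes T L :: "nat \<Rightarrow> 'a \<Rightarrow> real"
  assumes T [measurable]: "\<And>n. T n \<in> borel_measurable M" and L [measurable]: "\<And>n. L n \<in> borel_measurable M"
    and diff: "conv_in_prob M (\<lambda>n \<omega>. T n \<omega> - L n \<omega>) 0" and V: "0 < V"
    and char: "\<And>t. (\<lambda>n. char (distr M borel (L n)) t) \<longlonglongrightarrow> complex_of_real (exp (- (V * t\<^sup>2 / 2)))"
  shows "conv_distr_normal M T V"
  unfolding conv_distr_normal_def
proof (rule levy_continuity)
  show "real_distribution (distr M borel (T n))" for n by (rule real_distribution_distr) measurable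
  show "real_distribution (density lborel (normal_density 0 (sqrt V)))"
    using V by (auto simp: real_distribution_def real_distribution_axioms_def intro!: prob_space_normal_density)
  fix t
  let ?p = "\<lambda>n \<epsilon>. measure M {\<omega> \<in> space M. \<bar>T n \<omega> - L n \<omega> - 0\<bar> > \<epsilon>}"
  have bound: "cmod (char (distr M borel (T n)) t - char (distr M borel (L n)) t) \<le> \<bar>t\<bar> * \<epsilon> + 2 * ?p n \<epsilon>"
    if "0 < \<epsilon>" for n \<epsilon>
  proof -
    define B where "B = {\<omega> \<in> space M. \<bar>T n \<omega> - L n \<omega> - 0\<bar> > \<epsilon>}"
    have B [measurable]: "B \<in> sets M" unfolding B_def by measurable
    have int: "integrable M (\<lambda>\<omega>. iexp (t * f \<omega>))" if [measurable]: "f \<in> borel_measurable M" for f :: "'a \<Rightarrow> real"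
      by (rule integrable_const_bound[where B = 1]) auto
    have ch: "char (distr M borel f) t = (LINT \<omega>|M. iexp (t * f \<omega>))"
      if "f \<in> borel_measurable M" for f :: "'a \<Rightarrow> real"
      unfolding char_def using that by (subst integral_distr) auto
    have "char (distr M borel (T n)) t - char (distr M borel (L n)) t = (LINT \<omega>|M. iexp (t * T n \<omega>) - iexp (t * L n \<omega>))"
      unfolding ch[OF T] ch[OF L] by (rule Bochner_Integration.integral_diff[OF int[OF T] int[OF L], symmetric])
    also have "cmod \<dots> \<le> (LINT \<omega>|M. cmod (iexp (t * T n \<omega>) - iexp (t * L n \<omega>)))"
      by (rule integral_norm_bound)
    also have "\<dots> \<le> (LINT \<omega>|M. \<bar>t\<bar> * \<epsilon> + 2 * indicator B \<omega>)"
    proof (rule integral_mono)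
      show "integrable M (\<lambda>\<omega>. cmod (iexp (t * T n \<omega>) - iexp (t * L n \<omega>)))"
        by (intro integrable_norm Bochner_Integration.integrable_diff int) auto
      show "integrable M (\<lambda>\<omega>. \<bar>t\<bar> * \<epsilon> + 2 * indicator B \<omega>)"
        by (intro Bochner_Integration.integrable_add integrable_mult_right integrable_real_indicator) (auto simp: less_top[symmetric])
      fix \<omega> assume \<omega>: "\<omega> \<in> space M"
      show "cmod (iexp (t * T n \<omega>) - iexp (t * L n \<omega>)) \<le> \<bar>t\<bar> * \<epsilon> + 2 * indicator B \<omega>"
      proof (cases "\<omega> \<in> B")
        case True
        have "cmod (iexp (t * T n \<omega>) - iexp (t * L n \<omega>)) \<le> 1 + 1"
          by (rule order_trans[OF norm_triangle_ineq4]) simp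
        moreover have "0 \<le> \<bar>t\<bar> * \<epsilon>" using \<open>0 < \<epsilon>\<close> by simp
        ultimately show ?thesis using True by simp
      next
        case False
        then have "\<bar>T n \<omega> - L n \<omega>\<bar> \<le> \<epsilon>" using \<omega> by (simp add: B_def)
        then have "\<bar>t\<bar> * \<bar>T n \<omega> - L n \<omega>\<bar> \<le> \<bar>t\<bar> * \<epsilon>" by (intro mult_left_mono) auto
        then show ?thesis using False cmod_iexp_diff_le[of "t * T n \<omega>" "t * L n \<omega>"]
          by (simp add: abs_mult flip: right_diff_distrib)
      qed
    qed
    also have "\<dots> = \<bar>t\<bar> * \<epsilon> + 2 * prob B"
      by (subst Bochner_Integration.integral_add) (auto simp: prob_space less_top[symmetric] intro!: integrable_real_indicator)
    finally show ?thesis by (simp add: B_def)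
  qed
  have "(\<lambda>n. char (distr M borel (T n)) t - char (distr M borel (L n)) t) \<longlonglongrightarrow> 0"
  proof (rule tendstoI)
    fix e :: real assume e: "0 < e"
    define \<epsilon> where "\<epsilon> = e / (2 * (\<bar>t\<bar> + 1))"
    have \<epsilon>: "0 < \<epsilon>" using e by (simp add: \<epsilon>_def)
    have "\<bar>t\<bar> * \<epsilon> < (\<bar>t\<bar> + 1) * \<epsilon>" using \<epsilon> by simp
    also have "\<dots> = e / 2" by (simp add: \<epsilon>_def field_simps)
    finally have t\<epsilon>: "\<bar>t\<bar> * \<epsilon> < e / 2" .
    have "(\<lambda>n. ?p n \<epsilon>) \<longlonglongrightarrow> 0" using diff \<epsilon> by (simp add: conv_in_prob_def)
    then have "\<forall>\<^sub>F n in sequentially. ?p n \<epsilon> < e / 4" using e by (intro order_tendstoD) auto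
    then show "\<forall>\<^sub>F n in sequentially. dist (char (distr M borel (T n)) t - char (distr M borel (L n)) t) 0 < e"
    proof eventually_elim
      case (elim n)
      then show ?case using bound[OF \<epsilon>, of n] t\<epsilon> by simp
    qed
  qed
  from tendsto_add[OF this char[of t]]
  show "(\<lambda>n. char (distr M borel (T n)) t) \<longlonglongrightarrow> char (density lborel (normal_density 0 (sqrt V))) t"
    using V by (simp add: char_normal_distribution)
qed

definition tight_seq :: "(nat \<Rightarrow> 'a \<Rightarrow> real) \<Rightarrow> bool" where
  "tight_seq Z \<longleftrightarrow> (\<forall>n. Z n \<in> borel_measurable M) \<and>
     (\<forall>\<delta>>0. \<exists>K>0. \<forall>\<^sub>F n in sequentially. prob {\<omega> \<in> space M. \<bar>Z n \<omega>\<bar> > K} \<le> \<delta>)"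

lemma conv_in_prob_of_eventually_prob_le:
  assumes "\<And>n. Z n \<in> borel_measurable M"
    and "\<And>\<epsilon> \<delta>. 0 < \<epsilon> \<Longrightarrow> 0 < \<delta> \<Longrightarrow> \<forall>\<^sub>F n in sequentially. prob {\<omega> \<in> space M. \<bar>Z n \<omega> - c\<bar> > \<epsilon>} \<le> \<delta>"
  shows "conv_in_prob M Z c"
  unfolding conv_in_prob_def
proof (intro conjI allI impI assms(1) tendstoI)
  fix \<epsilon> e :: real assume "0 < \<epsilon>" "0 < e"
  from assms(2)[OF this(1), of "e / 2"] \<open>0 < e\<close>
  have "\<forall>\<^sub>F n in sequentially. prob {\<omega> \<in> space M. \<bar>Z n \<omega> - c\<bar> > \<epsilon>} \<le> e / 2" by simp
  then show "\<forall>\<^sub>F n in sequentially. dist (prob {\<omega> \<in> space M. \<bar>Z n \<omega> - c\<bar> > \<epsilon>}) 0 < e"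
    by eventually_elim (use \<open>0 < e\<close> in \<open>simp add: dist_real_def\<close>)
qed

lemma tight_seq_perturb:
  assumes W: "tight_seq W" and D: "\<And>n. D n \<in> borel_measurable M"
    and conv: "conv_in_prob M (\<lambda>n \<omega>. D n \<omega> + W n \<omega>) 0"
  shows "tight_seq D"
  unfolding tight_seq_def
proof (intro conjI allI impI D)
  fix \<delta> :: real assume "0 < \<delta>"
  then obtain K where K: "0 < K" "\<forall>\<^sub>F n in sequentially. prob {\<omega> \<in> space M. \<bar>W n \<omega>\<bar> > K} \<le> \<delta> / 2"
    using W unfolding tight_seq_def by (meson half_gt_zero)
  have Wm [measurable]: "W n \<in> borel_measurable M" for n using W by (simp add: tight_seq_def)
  note D [measurable]
  have "(\<lambda>n. prob {\<omega> \<in> space M. \<bar>D n \<omega> + W n \<omega> - 0\<bar> > 1}) \<longlonglongrightarrow> 0"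
    by (rule conv[unfolded conv_in_prob_def, THEN conjunct2, rule_format]) simp
  from order_tendstoD(2)[OF this, of "\<delta> / 2"] \<open>0 < \<delta>\<close>
  have "\<forall>\<^sub>F n in sequentially. prob {\<omega> \<in> space M. \<bar>D n \<omega> + W n \<omega> - 0\<bar> > 1} < \<delta> / 2" by simp
  with K(2) have "\<forall>\<^sub>F n in sequentially. prob {\<omega> \<in> space M. \<bar>D n \<omega>\<bar> > K + 1} \<le> \<delta>"
  proof eventually_elim
    case (elim n)
    have "prob {\<omega> \<in> space M. \<bar>D n \<omega>\<bar> > K + 1} \<le> prob ({\<omega> \<in> space M. \<bar>W n \<omega>\<bar> > K} \<union> {\<omega> \<in> space M. \<bar>D n \<omega> + W n \<omega> - 0\<bar> > 1})"
      by (rule finite_measure_mono) (auto, measurable)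
    also have "\<dots> \<le> prob {\<omega> \<in> space M. \<bar>W n \<omega>\<bar> > K} + prob {\<omega> \<in> space M. \<bar>D n \<omega> + W n \<omega> - 0\<bar> > 1}"
      by (rule measure_Un_le) measurable
    finally show ?case using elim by linarith
  qed
  then show "\<exists>K>0. \<forall>\<^sub>F n in sequentially. prob {\<omega> \<in> space M. \<bar>D n \<omega>\<bar> > K} \<le> \<delta>"
    using K(1) by (intro exI[of _ "K + 1"]) auto
qed

text \<open>The delta method: uniform convergence on compacts is expressed through bounded
  deterministic sequences.\<close>

lemma conv_in_prob_of_bounded_sequences:
  fixes D1 D2 D4 :: "nat \<Rightarrow> 'a \<Rightarrow> real" and \<Phi> :: "nat \<Rightarrow> real \<Rightarrow> real \<Rightarrow> real \<Rightarrow> real"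
  assumes T: "\<And>n. T n \<in> borel_measurable M"
    and D: "tight_seq D1" "tight_seq D2" "tight_seq D4"
    and T_eq: "\<And>K. 0 < K \<Longrightarrow> \<forall>\<^sub>F n in sequentially. \<forall>\<omega>\<in>space M. \<bar>D1 n \<omega>\<bar> \<le> K \<longrightarrow> \<bar>D2 n \<omega>\<bar> \<le> K \<longrightarrow> \<bar>D4 n \<omega>\<bar> \<le> K \<longrightarrow>
        T n \<omega> = \<Phi> n (D1 n \<omega>) (D2 n \<omega>) (D4 n \<omega>)"
    and lim: "\<And>K d1 d2 d4. (\<And>n. \<bar>d1 n\<bar> \<le> K) \<Longrightarrow> (\<And>n. \<bar>d2 n\<bar> \<le> K) \<Longrightarrow> (\<And>n. \<bar>d4 n\<bar> \<le> K) \<Longrightarrow>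
        (\<lambda>n. \<Phi> n (d1 n) (d2 n) (d4 n)) \<longlonglongrightarrow> c"
  shows "conv_in_prob M T c"
proof (rule conv_in_prob_of_eventually_prob_le[OF T])
  fix \<epsilon> \<delta> :: real assume \<epsilon>: "0 < \<epsilon>" and \<delta>: "0 < \<delta>"
  have "\<exists>K>0. \<forall>\<^sub>F n in sequentially. prob {\<omega> \<in> space M. \<bar>Z n \<omega>\<bar> > K} \<le> \<delta> / 3" if "tight_seq Z" for Z
    using that[unfolded tight_seq_def, THEN conjunct2, rule_format, of "\<delta> / 3"] \<delta> by simp
  note ex = this
  obtain K1 where K1: "0 < K1" "\<forall>\<^sub>F n in sequentially. prob {\<omega> \<in> space M. \<bar>D1 n \<omega>\<bar> > K1} \<le> \<delta> / 3"
    using ex[OF D(1)] by blast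
  obtain K2 where K2: "0 < K2" "\<forall>\<^sub>F n in sequentially. prob {\<omega> \<in> space M. \<bar>D2 n \<omega>\<bar> > K2} \<le> \<delta> / 3"
    using ex[OF D(2)] by blast
  obtain K4 where K4: "0 < K4" "\<forall>\<^sub>F n in sequentially. prob {\<omega> \<in> space M. \<bar>D4 n \<omega>\<bar> > K4} \<le> \<delta> / 3"
    using ex[OF D(3)] by blast
  have m [measurable]: "D1 n \<in> borel_measurable M" "D2 n \<in> borel_measurable M" "D4 n \<in> borel_measurable M" for n
    using D by (auto simp: tight_seq_def)
  define K where "K = K1 + K2 + K4"
  have K: "0 < K" "K1 \<le> K" "K2 \<le> K" "K4 \<le> K" using K1(1) K2(1) K4(1) by (auto simp: K_def)
  have "\<forall>\<^sub>F n in sequentially. \<forall>d1 d2 d4. \<bar>d1\<bar> \<le> K \<longrightarrow> \<bar>d2\<bar> \<le> K \<longrightarrow> \<bar>d4\<bar> \<le> K \<longrightarrow> \<bar>\<Phi> n d1 d2 d4 - c\<bar> \<le> \<epsilon>"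
  proof (rule ccontr)
    let ?bad = "\<lambda>n d1 d2 d4. \<bar>d1\<bar> \<le> K \<and> \<bar>d2\<bar> \<le> K \<and> \<bar>d4\<bar> \<le> K \<and> \<not> \<bar>\<Phi> n d1 d2 d4 - c\<bar> \<le> \<epsilon>"
    assume "\<not> ?thesis"
    then have freq: "\<exists>\<^sub>F n in sequentially. \<exists>d1 d2 d4. ?bad n d1 d2 d4"
      unfolding frequently_def by (auto elim: eventually_mono)
    have "\<forall>n. \<exists>d1 d2 d4. \<bar>d1\<bar> \<le> K \<and> \<bar>d2\<bar> \<le> K \<and> \<bar>d4\<bar> \<le> K \<and> ((\<exists>d1 d2 d4. ?bad n d1 d2 d4) \<longrightarrow> ?bad n d1 d2 d4)"
    proof
      fix n
      show "\<exists>d1 d2 d4. \<bar>d1\<bar> \<le> K \<and> \<bar>d2\<bar> \<le> K \<and> \<bar>d4\<bar> \<le> K \<and> ((\<exists>d1 d2 d4. ?bad n d1 d2 d4) \<longrightarrow> ?bad n d1 d2 d4)"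
      proof (cases "\<exists>d1 d2 d4. ?bad n d1 d2 d4")
        case False
        \<comment> \<open>At indices without a bad triple, 0 is the default, so the chosen sequences
          stay in \<open>[- K, K]\<close> for every \<open>n\<close>.\<close>
        then show ?thesis using K(1) by (intro exI[of _ 0]) simp
      qed blast
    qed
    then obtain d1 d2 d4 where d: "\<And>n. \<bar>d1 n\<bar> \<le> K" "\<And>n. \<bar>d2 n\<bar> \<le> K" "\<And>n. \<bar>d4 n\<bar> \<le> K"
      "\<And>n. (\<exists>d1 d2 d4. ?bad n d1 d2 d4) \<Longrightarrow> ?bad n (d1 n) (d2 n) (d4 n)" by metis
    have "\<forall>\<^sub>F n in sequentially. dist (\<Phi> n (d1 n) (d2 n) (d4 n)) c < \<epsilon>"
      using tendstoD[OF lim[OF d(1,2,3)] \<epsilon>] .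
    from frequently_ex[OF frequently_eventually_frequently[OF freq this]]
    obtain n where n: "\<exists>d1 d2 d4. ?bad n d1 d2 d4" "dist (\<Phi> n (d1 n) (d2 n) (d4 n)) c < \<epsilon>" by blast
    from d(4)[OF n(1)] n(2) show False by (simp add: dist_real_def)
  qed
  then show "\<forall>\<^sub>F n in sequentially. prob {\<omega> \<in> space M. \<bar>T n \<omega> - c\<bar> > \<epsilon>} \<le> \<delta>"
    using T_eq[OF K(1)] K1(2) K2(2) K4(2)
  proof eventually_elim
    case (elim n)
    have "prob {\<omega> \<in> space M. \<bar>T n \<omega> - c\<bar> > \<epsilon>} \<le>
       prob ({\<omega> \<in> space M. \<bar>D1 n \<omega>\<bar> > K1} \<union> {\<omega> \<in> space M. \<bar>D2 n \<omega>\<bar> > K2} \<union> {\<omega> \<in> space M. \<bar>D4 n \<omega>\<bar> > K4})"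
    proof (rule finite_measure_mono)
      show "{\<omega> \<in> space M. \<bar>T n \<omega> - c\<bar> > \<epsilon>} \<subseteq>
        {\<omega> \<in> space M. \<bar>D1 n \<omega>\<bar> > K1} \<union> {\<omega> \<in> space M. \<bar>D2 n \<omega>\<bar> > K2} \<union> {\<omega> \<in> space M. \<bar>D4 n \<omega>\<bar> > K4}"
      proof
        fix \<omega> assume \<omega>: "\<omega> \<in> {\<omega> \<in> space M. \<bar>T n \<omega> - c\<bar> > \<epsilon>}"
        show "\<omega> \<in> {\<omega> \<in> space M. \<bar>D1 n \<omega>\<bar> > K1} \<union> {\<omega> \<in> space M. \<bar>D2 n \<omega>\<bar> > K2} \<union> {\<omega> \<in> space M. \<bar>D4 n \<omega>\<bar> > K4}"
        proof (rule ccontr)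
          assume "\<not> ?thesis"
          then have b: "\<bar>D1 n \<omega>\<bar> \<le> K" "\<bar>D2 n \<omega>\<bar> \<le> K" "\<bar>D4 n \<omega>\<bar> \<le> K" using \<omega> K by auto
          then have "T n \<omega> = \<Phi> n (D1 n \<omega>) (D2 n \<omega>) (D4 n \<omega>)" using elim(2) \<omega> by blast
          then have "\<bar>T n \<omega> - c\<bar> \<le> \<epsilon>" using elim(1) b by simp
          then show False using \<omega> by simp
        qed
      qed
    qed measurable
    also have "\<dots> \<le> prob ({\<omega> \<in> space M. \<bar>D1 n \<omega>\<bar> > K1} \<union> {\<omega> \<in> space M. \<bar>D2 n \<omega>\<bar> > K2}) + prob {\<omega> \<in> space M. \<bar>D4 n \<omega>\<bar> > K4}"
      by (rule measure_Un_le) measurable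
    also have "prob ({\<omega> \<in> space M. \<bar>D1 n \<omega>\<bar> > K1} \<union> {\<omega> \<in> space M. \<bar>D2 n \<omega>\<bar> > K2}) \<le>
        prob {\<omega> \<in> space M. \<bar>D1 n \<omega>\<bar> > K1} + prob {\<omega> \<in> space M. \<bar>D2 n \<omega>\<bar> > K2}"
      by (rule measure_Un_le) measurable
    finally show ?case using elim by linarith
  qed
qed

end

section \<open>Moments and characteristic functions of centred sums over an i.i.d. sample\<close>

locale iid_sample = prob_space M for M :: "'w measure" +
  fixes N :: "'a measure" and Z0 :: "'w \<Rightarrow> 'a" and Z :: "nat \<Rightarrow> 'w \<Rightarrow> 'a"
  assumes Z0 [measurable]: "Z0 \<in> measurable M N"
    and indep: "indep_vars (\<lambda>_. N) Z {1..}"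
    and identical: "\<And>i. 1 \<le> i \<Longrightarrow> distr M N (Z i) = distr M N Z0"
begin

lemma Z_measurable: "1 \<le> i \<Longrightarrow> Z i \<in> measurable M N"
  using indep by (auto simp: indep_vars_def)

lemma integral_Z:
  fixes f :: "'a \<Rightarrow> real"
  assumes [measurable]: "f \<in> borel_measurable N" and i: "1 \<le> i"
  shows "(LINT \<omega>|M. f (Z i \<omega>)) = (LINT \<omega>|M. f (Z0 \<omega>))"
proof -
  have [measurable]: "Z i \<in> measurable M N" by (rule Z_measurable[OF i])
  have "(LINT \<omega>|M. f (Z i \<omega>)) = (LINT z|distr M N (Z i). f z)" by (simp add: integral_distr)
  also have "\<dots> = (LINT \<omega>|M. f (Z0 \<omega>))" by (simp add: identical[OF i] integral_distr)
  finally show ?thesis .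
qed

definition csum :: "('a \<Rightarrow> real) \<Rightarrow> nat \<Rightarrow> 'w \<Rightarrow> real" where
  "csum f n \<omega> = (\<Sum>i=1..n. f (Z i \<omega>) - (LINT \<omega>|M. f (Z0 \<omega>)))"

lemma csum_measurable [measurable]:
  assumes [measurable]: "f \<in> borel_measurable N"
  shows "csum f n \<in> borel_measurable M"
  unfolding csum_def by (intro borel_measurable_sum borel_measurable_diff measurable_compose[OF Z_measurable assms]) auto

text \<open>By induction on \<open>n\<close>: the new centred summand is independent of the earlier
  sum, so the cross term has mean 0. Bounding the variance by the raw second moment suffices, since
  for an indicator the resulting bound is the expected count.\<close>

lemma csum_moments:
  assumes f [measurable]: "f \<in> borel_measurable N" and B: "\<And>z. \<bar>f z\<bar> \<le> B"
  shows "(LINT \<omega>|M. csum f n \<omega>) = 0"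
    and "(LINT \<omega>|M. (csum f n \<omega>)\<^sup>2) \<le> real n * (LINT \<omega>|M. (f (Z0 \<omega>))\<^sup>2)"
    and "integrable M (\<lambda>\<omega>. (csum f n \<omega>)\<^sup>2)"
proof -
  define \<mu> where "\<mu> = (LINT \<omega>|M. f (Z0 \<omega>))"
  define g where "g z = f z - \<mu>" for z
  have g [measurable]: "g \<in> borel_measurable N" unfolding g_def by measurable
  have gB: "\<bar>g z\<bar> \<le> B + \<bar>\<mu>\<bar>" for z using B[of z] by (simp add: g_def)
  have B0: "0 \<le> B + \<bar>\<mu>\<bar>" using gB abs_ge_zero order_trans by blast
  have csum: "csum f n \<omega> = (\<Sum>i=1..n. g (Z i \<omega>))" for n \<omega> by (simp add: csum_def g_def \<mu>_def)
  have bdd: "\<bar>csum f n \<omega>\<bar> \<le> real n * (B + \<bar>\<mu>\<bar>)" for n \<omega>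
  proof -
    have "\<bar>csum f n \<omega>\<bar> \<le> (\<Sum>i=1..n. \<bar>g (Z i \<omega>)\<bar>)" unfolding csum by (rule sum_abs)
    also have "\<dots> \<le> real (card {1..n}) * (B + \<bar>\<mu>\<bar>)" by (rule sum_bounded_above) (rule gB)
    finally show ?thesis by simp
  qed
  have "0 \<le> B" using B abs_ge_zero order_trans by blast
  have int_f: "integrable M (\<lambda>\<omega>. f (Z0 \<omega>))"
    by (rule integrable_const_bound[where B = B]) (auto intro: B)
  have int_f2: "integrable M (\<lambda>\<omega>. (f (Z0 \<omega>))\<^sup>2)"
    by (rule integrable_const_bound[where B = "B\<^sup>2"]) (auto intro!: AE_I2 power2_le_iff_abs_le[THEN iffD2] B \<open>0 \<le> B\<close>)
  note int_g0 = int_f int_f2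
  have int_g: "integrable M (\<lambda>\<omega>. g (Z i \<omega>))" "integrable M (\<lambda>\<omega>. (g (Z i \<omega>))\<^sup>2)" if "1 \<le> i" for i
  proof -
    have [measurable]: "Z i \<in> measurable M N" by (rule Z_measurable[OF that])
    show "integrable M (\<lambda>\<omega>. g (Z i \<omega>))"
      by (rule integrable_const_bound[where B = "B + \<bar>\<mu>\<bar>"]) (auto intro: gB)
    show "integrable M (\<lambda>\<omega>. (g (Z i \<omega>))\<^sup>2)"
      by (rule integrable_const_bound[where B = "(B + \<bar>\<mu>\<bar>)\<^sup>2"]) (auto intro!: AE_I2 power2_le_iff_abs_le[THEN iffD2] gB B0)
  qed
  have int_c: "integrable M (csum f n)" for n
    by (rule integrable_const_bound[where B = "real n * (B + \<bar>\<mu>\<bar>)"]) (auto intro: bdd)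
  have int_c2: "integrable M (\<lambda>\<omega>. (csum f n \<omega>)\<^sup>2)" for n
    by (rule integrable_const_bound[where B = "(real n * (B + \<bar>\<mu>\<bar>))\<^sup>2"])
      (auto intro!: AE_I2 power2_le_iff_abs_le[THEN iffD2] bdd mult_nonneg_nonneg B0)
  show "integrable M (\<lambda>\<omega>. (csum f n \<omega>)\<^sup>2)" by (rule int_c2)
  have mean_g: "(LINT \<omega>|M. g (Z i \<omega>)) = 0" if "1 \<le> i" for i
  proof -
    have "(LINT \<omega>|M. g (Z i \<omega>)) = (LINT \<omega>|M. f (Z0 \<omega>) - \<mu>)" using integral_Z[OF g that] by (simp add: g_def)
    also have "\<dots> = 0" using int_g0 by (simp add: prob_space \<mu>_def)
    finally show ?thesis .
  qed
  have mean: "(LINT \<omega>|M. csum f n \<omega>) = 0" for n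
    unfolding csum by (subst Bochner_Integration.integral_sum) (auto intro: int_g simp: mean_g)
  show "(LINT \<omega>|M. csum f n \<omega>) = 0" by (rule mean)
  have var_g: "(LINT \<omega>|M. (g (Z i \<omega>))\<^sup>2) \<le> (LINT \<omega>|M. (f (Z0 \<omega>))\<^sup>2)" if "1 \<le> i" for i
  proof -
    have "(LINT \<omega>|M. (g (Z i \<omega>))\<^sup>2) = (LINT \<omega>|M. (g (Z0 \<omega>))\<^sup>2)"
      using integral_Z[of "\<lambda>z. (g z)\<^sup>2", OF _ that] by simp
    also have "\<dots> = (LINT \<omega>|M. (f (Z0 \<omega>))\<^sup>2) - \<mu>\<^sup>2"
      using variance_eq[OF int_g0] by (simp add: g_def \<mu>_def)
    finally show ?thesis by simp
  qed
  show "(LINT \<omega>|M. (csum f n \<omega>)\<^sup>2) \<le> real n * (LINT \<omega>|M. (f (Z0 \<omega>))\<^sup>2)"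
  proof (induction n)
    case 0
    then show ?case by (simp add: csum)
  next
    case (Suc n)
    have "indep_vars (\<lambda>_. borel) (\<lambda>i \<omega>. g (Z i \<omega>)) (insert (Suc n) {1..n})"
      by (rule indep_vars_compose2[OF indep_vars_subset[OF indep]]) auto
    then have iv: "indep_var borel (\<lambda>\<omega>. g (Z (Suc n) \<omega>)) borel (csum f n)"
      unfolding csum[abs_def] by (intro indep_vars_sum) auto
    have int_p: "integrable M (\<lambda>\<omega>. g (Z (Suc n) \<omega>) * csum f n \<omega>)"
      by (rule indep_var_integrable[OF iv int_g(1) int_c]) simp
    have "(csum f (Suc n) \<omega>)\<^sup>2 = (g (Z (Suc n) \<omega>))\<^sup>2 + 2 * (g (Z (Suc n) \<omega>) * csum f n \<omega>) + (csum f n \<omega>)\<^sup>2" for \<omega>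
      unfolding csum by (simp add: power2_eq_square algebra_simps)
    then have "(LINT \<omega>|M. (csum f (Suc n) \<omega>)\<^sup>2) = (LINT \<omega>|M. (g (Z (Suc n) \<omega>))\<^sup>2) +
        2 * (LINT \<omega>|M. g (Z (Suc n) \<omega>) * csum f n \<omega>) + (LINT \<omega>|M. (csum f n \<omega>)\<^sup>2)"
      using int_p int_g(2)[of "Suc n"] int_c2[of n] by simp
    also have "(LINT \<omega>|M. g (Z (Suc n) \<omega>) * csum f n \<omega>) = 0"
      using indep_var_lebesgue_integral[OF iv int_g(1) int_c] mean by simp
    finally show ?case using Suc.IH var_g[of "Suc n"] by (simp add: algebra_simps)
  qed
qed

lemma csum_chebyshev:
  assumes f [measurable]: "f \<in> borel_measurable N" and B: "\<And>z. \<bar>f z\<bar> \<le> B" and a: "0 < a"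
  shows "prob {\<omega> \<in> space M. a \<le> \<bar>csum f n \<omega>\<bar>} \<le> real n * (LINT \<omega>|M. (f (Z0 \<omega>))\<^sup>2) / a\<^sup>2"
proof -
  have "prob {\<omega> \<in> space M. a \<le> \<bar>csum f n \<omega>\<bar>} \<le> (LINT \<omega>|M. (csum f n \<omega>)\<^sup>2) / a\<^sup>2"
    using Chebyshev_inequality[OF csum_measurable[OF f] csum_moments(3)[OF f B] a, of n] csum_moments(1)[OF f B, of n]
    by simp
  also have "\<dots> \<le> real n * (LINT \<omega>|M. (f (Z0 \<omega>))\<^sup>2) / a\<^sup>2"
    by (intro divide_right_mono csum_moments(2)[OF f B]) simp
  finally show ?thesis .
qed

text \<open>A central limit theorem for a bounded triangular array. The normalization is by
  \<open>sqrt (\<kappa> n)\<close>, with \<kappa> of the order of the expected count, because the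
  events become rare. The normalized summands are at most \<open>2 B / sqrt (\<kappa> n)\<close>,
  which makes the cubic Taylor error negligible even after multiplication by
  \<open>n\<close>.\<close>

lemma csum_char_tendsto:
  fixes f :: "nat \<Rightarrow> 'a \<Rightarrow> real" and \<kappa> :: "nat \<Rightarrow> real"
  assumes f: "\<And>n. f n \<in> borel_measurable N" and B: "\<And>n z. \<bar>f n z\<bar> \<le> B"
    and \<kappa>: "filterlim \<kappa> at_top sequentially"
    and var: "(\<lambda>n. real n / \<kappa> n * variance (\<lambda>\<omega>. f n (Z0 \<omega>))) \<longlonglongrightarrow> V"
  shows "(\<lambda>n. char (distr M borel (\<lambda>\<omega>. csum (f n) n \<omega> / sqrt (\<kappa> n))) t) \<longlonglongrightarrow> complex_of_real (exp (- (V * t\<^sup>2 / 2)))"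
proof -
  define \<mu> where "\<mu> n = (LINT \<omega>|M. f n (Z0 \<omega>))" for n
  define g where "g n z = (f n z - \<mu> n) / sqrt (\<kappa> n)" for n z
  define v where "v n = variance (\<lambda>\<omega>. f n (Z0 \<omega>)) / \<kappa> n" for n
  define \<psi> where "\<psi> n = char (distr M borel (\<lambda>\<omega>. g n (Z0 \<omega>))) t" for n
  define a where "a n = t\<^sup>2 * v n / 2" for n
  have gm [measurable]: "g n \<in> borel_measurable N" for n unfolding g_def using f[of n] by measurable
  have B0: "0 \<le> B" using B abs_ge_zero order_trans by blast
  have int_f: "integrable M (\<lambda>\<omega>. f n (Z0 \<omega>))" for n
    using f[of n] B[of n] by (intro integrable_const_bound[where B = B]) (auto intro: measurable_compose[OF Z0])
  have \<mu>B: "\<bar>\<mu> n\<bar> \<le> B" for n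
  proof -
    have "\<bar>\<mu> n\<bar> \<le> (LINT \<omega>|M. \<bar>f n (Z0 \<omega>)\<bar>)" unfolding \<mu>_def by (rule integral_abs_bound)
    also have "\<dots> \<le> (LINT \<omega>|M. B)" using int_f[of n] B by (intro integral_mono) auto
    finally show ?thesis by (simp add: prob_space)
  qed
  have char_eq: "char (distr M borel (\<lambda>\<omega>. csum (f n) n \<omega> / sqrt (\<kappa> n))) t = \<psi> n ^ n" for n
  proof -
    have "(\<lambda>\<omega>. csum (f n) n \<omega> / sqrt (\<kappa> n)) = (\<lambda>\<omega>. \<Sum>i=1..n. g n (Z i \<omega>))"
      by (simp add: csum_def g_def \<mu>_def sum_divide_distrib)
    moreover have "char (distr M borel (\<lambda>\<omega>. \<Sum>i=1..n. g n (Z i \<omega>))) t = (\<Prod>i=1..n. char (distr M borel (\<lambda>\<omega>. g n (Z i \<omega>))) t)"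
      by (rule char_distr_sum, rule indep_vars_compose2[OF indep_vars_subset[OF indep]]) auto
    moreover have "char (distr M borel (\<lambda>\<omega>. g n (Z i \<omega>))) t = \<psi> n" if "i \<in> {1..n}" for i
    proof -
      have i: "1 \<le> i" using that by simp
      have [measurable]: "Z i \<in> measurable M N" by (rule Z_measurable[OF i])
      have "distr M borel (\<lambda>\<omega>. g n (Z i \<omega>)) = distr (distr M N (Z i)) borel (g n)"
        by (simp add: distr_distr comp_def)
      also have "\<dots> = distr M borel (\<lambda>\<omega>. g n (Z0 \<omega>))"
        by (simp add: identical[OF i] distr_distr comp_def)
      finally show ?thesis by (simp add: \<psi>_def)
    qed
    ultimately show ?thesis by simp
  qed
  have \<kappa>pos: "\<forall>\<^sub>F n in sequentially. 0 < \<kappa> n" by (rule eventually_compose_filterlim[OF eventually_gt_at_top \<kappa>])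
  have nv: "(\<lambda>n. real n * v n) \<longlonglongrightarrow> V"
    unfolding v_def using var by (simp only: times_divide_eq_left times_divide_eq_right)
  have na: "(\<lambda>n. real n * a n) \<longlonglongrightarrow> t\<^sup>2 * V / 2"
    using tendsto_mult[OF tendsto_const[of "t\<^sup>2 / 2"] nv] by (simp add: a_def mult_ac)
  have a0: "a \<longlonglongrightarrow> 0"
  proof -
    have "(\<lambda>n. (real n * a n) * (1 / real n)) \<longlonglongrightarrow> t\<^sup>2 * V / 2 * 0"
      by (intro tendsto_mult na lim_1_over_n)
    then have "(\<lambda>n. (real n * a n) * (1 / real n)) \<longlonglongrightarrow> 0" by simp
    then show ?thesis
      by (rule Lim_transform_eventually) (use eventually_gt_at_top[of 0] in \<open>eventually_elim, simp\<close>)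
  qed
  have inv_sqrt: "(\<lambda>n. 1 / sqrt (\<kappa> n)) \<longlonglongrightarrow> 0"
    using tendsto_inverse_0_at_top[OF filterlim_compose[OF sqrt_at_top \<kappa>]] by (simp add: inverse_eq_divide)
  \<comment> \<open>Of the two terms in the minimum of the Taylor bound the cubic one is kept; one
    factor is replaced by the uniform bound on \<open>g n\<close>, which leaves the
    variance.\<close>
  have approx: "cmod (\<psi> n - complex_of_real (1 - a n)) \<le> \<bar>t\<bar> ^ 3 / 6 * (2 * B / sqrt (\<kappa> n)) * v n" if k: "0 < \<kappa> n" for n
  proof -
    have mean0: "(LINT \<omega>|M. g n (Z0 \<omega>)) = 0"
      using int_f[of n] by (simp add: g_def \<mu>_def prob_space)
    have gB: "\<bar>g n z\<bar> \<le> 2 * B / sqrt (\<kappa> n)" for z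
    proof -
      have "\<bar>f n z - \<mu> n\<bar> \<le> 2 * B" using B[of n z] \<mu>B[of n] by linarith
      then show ?thesis using k by (simp add: g_def abs_divide divide_right_mono)
    qed
    have int_g: "integrable M (\<lambda>\<omega>. g n (Z0 \<omega>))"
      by (rule integrable_const_bound[where B = "2 * B / sqrt (\<kappa> n)"]) (auto intro: gB)
    have int_g2: "integrable M (\<lambda>\<omega>. (g n (Z0 \<omega>))\<^sup>2)"
      using k B0 by (intro integrable_const_bound[where B = "(2 * B / sqrt (\<kappa> n))\<^sup>2"])
        (auto intro!: AE_I2 power2_le_iff_abs_le[THEN iffD2] gB)
    have v: "(LINT \<omega>|M. (g n (Z0 \<omega>))\<^sup>2) = v n"
      using k by (simp add: g_def power_divide v_def \<mu>_def)
    have "cmod (\<psi> n - complex_of_real (1 - t\<^sup>2 * v n / 2)) \<le> t\<^sup>2 / 6 * (LINT \<omega>|M. min (6 * (g n (Z0 \<omega>))\<^sup>2) (\<bar>t\<bar> * \<bar>g n (Z0 \<omega>)\<bar> ^ 3))"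
      unfolding \<psi>_def by (rule char_approx3'[OF _ int_g int_g2 mean0]) (use mean0 v in auto)
    also have "\<dots> \<le> t\<^sup>2 / 6 * (LINT \<omega>|M. \<bar>t\<bar> * (2 * B / sqrt (\<kappa> n)) * (g n (Z0 \<omega>))\<^sup>2)"
    proof (intro mult_left_mono integral_mono)
      show "integrable M (\<lambda>\<omega>. \<bar>t\<bar> * (2 * B / sqrt (\<kappa> n)) * (g n (Z0 \<omega>))\<^sup>2)"
        using int_g2 by simp
      show "integrable M (\<lambda>\<omega>. min (6 * (g n (Z0 \<omega>))\<^sup>2) (\<bar>t\<bar> * \<bar>g n (Z0 \<omega>)\<bar> ^ 3))"
        by (rule Bochner_Integration.integrable_bound[of _ "\<lambda>\<omega>. 6 * (g n (Z0 \<omega>))\<^sup>2"]) (use int_g2 in auto)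
      fix \<omega>
      have "\<bar>g n (Z0 \<omega>)\<bar> ^ 3 = \<bar>g n (Z0 \<omega>)\<bar> * (g n (Z0 \<omega>))\<^sup>2" by (simp add: power3_eq_cube power2_eq_square)
      also have "\<dots> \<le> (2 * B / sqrt (\<kappa> n)) * (g n (Z0 \<omega>))\<^sup>2" by (intro mult_right_mono gB) simp
      finally have "\<bar>t\<bar> * \<bar>g n (Z0 \<omega>)\<bar> ^ 3 \<le> \<bar>t\<bar> * ((2 * B / sqrt (\<kappa> n)) * (g n (Z0 \<omega>))\<^sup>2)"
        by (intro mult_left_mono) auto
      then show "min (6 * (g n (Z0 \<omega>))\<^sup>2) (\<bar>t\<bar> * \<bar>g n (Z0 \<omega>)\<bar> ^ 3) \<le> \<bar>t\<bar> * (2 * B / sqrt (\<kappa> n)) * (g n (Z0 \<omega>))\<^sup>2"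
        by (simp add: min.coboundedI2 mult.assoc)
    qed simp
    also have "\<dots> = \<bar>t\<bar> ^ 3 / 6 * (2 * B / sqrt (\<kappa> n)) * v n"
      using v by (simp add: power3_eq_cube power2_eq_square)
    finally show ?thesis by (simp add: a_def)
  qed
  have exp_approx: "\<bar>(1 - b) - exp (- b)\<bar> \<le> b\<^sup>2" if "0 \<le> b" for b :: real
  proof -
    have "1 - b \<le> exp (- b)" using exp_ge_add_one_self[of "- b"] by simp
    moreover have "exp (- b) \<le> 1 - b + b\<^sup>2"
    proof -
      have "exp (- b) \<le> 1 / (1 + b)"
        using exp_ge_add_one_self[of b] that by (simp add: exp_minus inverse_eq_divide frac_le)
      also have "\<dots> \<le> 1 - b + b\<^sup>2"
      proof -
        have "(1 - b + b\<^sup>2) * (1 + b) = 1 + b ^ 3"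
          by (simp add: power2_eq_square power3_eq_cube algebra_simps)
        then have "1 \<le> (1 - b + b\<^sup>2) * (1 + b)" using that by simp
        then show ?thesis using that by (subst divide_le_eq) auto
      qed
      finally show ?thesis .
    qed
    ultimately show ?thesis by (simp add: abs_le_iff)
  qed
  have v_nonneg: "0 \<le> v n" if "0 < \<kappa> n" for n using that by (simp add: v_def)
  have "(\<lambda>n. \<psi> n ^ n - complex_of_real (exp (- a n)) ^ n) \<longlonglongrightarrow> 0"
  proof (rule Lim_null_comparison)
    have "(\<lambda>n. \<bar>t\<bar> ^ 3 / 6 * (2 * B * (1 / sqrt (\<kappa> n))) * (real n * v n) + (real n * a n) * a n) \<longlonglongrightarrow>
        \<bar>t\<bar> ^ 3 / 6 * (2 * B * 0) * V + t\<^sup>2 * V / 2 * 0"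
      by (intro tendsto_intros inv_sqrt nv na a0)
    then show "(\<lambda>n. \<bar>t\<bar> ^ 3 / 6 * (2 * B * (1 / sqrt (\<kappa> n))) * (real n * v n) + (real n * a n) * a n) \<longlonglongrightarrow> 0"
      by simp
    show "\<forall>\<^sub>F n in sequentially. norm (\<psi> n ^ n - complex_of_real (exp (- a n)) ^ n) \<le>
        \<bar>t\<bar> ^ 3 / 6 * (2 * B * (1 / sqrt (\<kappa> n))) * (real n * v n) + (real n * a n) * a n"
      using \<kappa>pos
    proof eventually_elim
      case (elim n)
      have an: "0 \<le> a n" using v_nonneg[OF elim] by (simp add: a_def)
      interpret R: real_distribution "distr M borel (\<lambda>\<omega>. g n (Z0 \<omega>))"
        by (rule real_distribution_distr) measurable
      \<comment> \<open>The difference of \<open>n\<close>-th powers is at most \<open>n\<close>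
        times the difference when both bases lie in the unit disc. That holds for
        \<open>exp (- a n)\<close>, whereas \<open>1 - a n\<close> may fall below
        \<open>- 1\<close>.\<close>
      have "norm (\<psi> n ^ n - complex_of_real (exp (- a n)) ^ n) \<le> n * norm (\<psi> n - complex_of_real (exp (- a n)))"
        using an by (intro norm_power_diff) (auto simp: \<psi>_def R.cmod_char_le_1)
      also have "\<dots> \<le> n * (\<bar>t\<bar> ^ 3 / 6 * (2 * B / sqrt (\<kappa> n)) * v n + (a n)\<^sup>2)"
      proof (rule mult_left_mono)
        have "norm (\<psi> n - complex_of_real (exp (- a n))) \<le>
            norm (\<psi> n - complex_of_real (1 - a n)) + norm (complex_of_real (1 - a n) - complex_of_real (exp (- a n)))"
          using dist_triangle[of "\<psi> n" "complex_of_real (exp (- a n))" "complex_of_real (1 - a n)"] unfolding dist_norm .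
        also have "\<dots> \<le> \<bar>t\<bar> ^ 3 / 6 * (2 * B / sqrt (\<kappa> n)) * v n + (a n)\<^sup>2"
        proof -
          have "norm (complex_of_real (1 - a n) - complex_of_real (exp (- a n))) = \<bar>(1 - a n) - exp (- a n)\<bar>"
            by (simp only: of_real_diff[symmetric] norm_of_real)
          then show ?thesis using approx[OF elim] exp_approx[OF an] by linarith
        qed
        finally show "norm (\<psi> n - complex_of_real (exp (- a n))) \<le> \<bar>t\<bar> ^ 3 / 6 * (2 * B / sqrt (\<kappa> n)) * v n + (a n)\<^sup>2" .
      qed simp
      finally show ?case by (simp add: algebra_simps power2_eq_square)
    qed
  qed
  moreover have "(\<lambda>n. complex_of_real (exp (- a n)) ^ n) \<longlonglongrightarrow> complex_of_real (exp (- (V * t\<^sup>2 / 2)))"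
  proof -
    have "(\<lambda>n. complex_of_real (exp (- (real n * a n)))) \<longlonglongrightarrow> complex_of_real (exp (- (t\<^sup>2 * V / 2)))"
      by (intro tendsto_intros na)
    moreover have "complex_of_real (exp (- (real n * a n))) = complex_of_real (exp (- a n)) ^ n" for n
      by (simp flip: of_real_power exp_of_nat_mult)
    ultimately show ?thesis by (simp add: mult.commute)
  qed
  ultimately show ?thesis unfolding char_eq using tendsto_add by fastforce
qed

end

section \<open>Upper order statistics\<close>

context prob_space
begin

lemma conv_in_prob_add:
  assumes "conv_in_prob M A 0" "conv_in_prob M B 0"
  shows "conv_in_prob M (\<lambda>n \<omega>. A n \<omega> + B n \<omega>) 0"
proof (rule conv_in_prob_of_eventually_prob_le)
  have [measurable]: "A n \<in> borel_measurable M" "B n \<in> borel_measurable M" for n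
    using assms by (auto simp: conv_in_prob_def)
  show "(\<lambda>\<omega>. A n \<omega> + B n \<omega>) \<in> borel_measurable M" for n by measurable
  fix \<epsilon> \<delta> :: real assume "0 < \<epsilon>" "0 < \<delta>"
  have *: "\<forall>\<^sub>F n in sequentially. prob {\<omega> \<in> space M. \<bar>C n \<omega> - 0\<bar> > \<epsilon> / 2} < \<delta> / 2" if "conv_in_prob M C 0" for C
  proof (rule order_tendstoD(2))
    show "(\<lambda>n. prob {\<omega> \<in> space M. \<bar>C n \<omega> - 0\<bar> > \<epsilon> / 2}) \<longlonglongrightarrow> 0"
      using that[unfolded conv_in_prob_def, THEN conjunct2, rule_format, of "\<epsilon> / 2"] \<open>0 < \<epsilon>\<close> by simp
  qed (use \<open>0 < \<delta>\<close> in simp)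
  show "\<forall>\<^sub>F n in sequentially. prob {\<omega> \<in> space M. \<bar>A n \<omega> + B n \<omega> - 0\<bar> > \<epsilon>} \<le> \<delta>"
    using *[OF assms(1)] *[OF assms(2)]
  proof eventually_elim
    case (elim n)
    have "prob {\<omega> \<in> space M. \<bar>A n \<omega> + B n \<omega> - 0\<bar> > \<epsilon>} \<le>
        prob ({\<omega> \<in> space M. \<bar>A n \<omega> - 0\<bar> > \<epsilon> / 2} \<union> {\<omega> \<in> space M. \<bar>B n \<omega> - 0\<bar> > \<epsilon> / 2})"
      by (rule finite_measure_mono) (auto, measurable)
    also have "\<dots> \<le> prob {\<omega> \<in> space M. \<bar>A n \<omega> - 0\<bar> > \<epsilon> / 2} + prob {\<omega> \<in> space M. \<bar>B n \<omega> - 0\<bar> > \<epsilon> / 2}"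
      by (rule measure_Un_le) measurable
    finally show ?case using elim by linarith
  qed
qed

lemma conv_in_prob_cmult:
  assumes "conv_in_prob M A 0"
  shows "conv_in_prob M (\<lambda>n \<omega>. c * A n \<omega>) 0"
proof (rule conv_in_prob_of_eventually_prob_le)
  have [measurable]: "A n \<in> borel_measurable M" for n
    using assms by (auto simp: conv_in_prob_def)
  show "(\<lambda>\<omega>. c * A n \<omega>) \<in> borel_measurable M" for n by measurable
  fix \<epsilon> \<delta> :: real assume \<epsilon>: "0 < \<epsilon>" and "0 < \<delta>"
  define e where "e = \<epsilon> / (\<bar>c\<bar> + 1)"
  have e: "0 < e" using \<epsilon> by (simp add: e_def)
  have "(\<lambda>n. prob {\<omega> \<in> space M. \<bar>A n \<omega> - 0\<bar> > e}) \<longlonglongrightarrow> 0"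
    using assms e by (simp add: conv_in_prob_def)
  from order_tendstoD(2)[OF this \<open>0 < \<delta>\<close>]
  show "\<forall>\<^sub>F n in sequentially. prob {\<omega> \<in> space M. \<bar>c * A n \<omega> - 0\<bar> > \<epsilon>} \<le> \<delta>"
  proof eventually_elim
    case (elim n)
    have "prob {\<omega> \<in> space M. \<bar>c * A n \<omega> - 0\<bar> > \<epsilon>} \<le> prob {\<omega> \<in> space M. \<bar>A n \<omega> - 0\<bar> > e}"
    proof (rule finite_measure_mono)
      show "{\<omega> \<in> space M. \<bar>c * A n \<omega> - 0\<bar> > \<epsilon>} \<subseteq> {\<omega> \<in> space M. \<bar>A n \<omega> - 0\<bar> > e}"
      proof safe
        fix \<omega> assume "\<epsilon> < \<bar>c * A n \<omega> - 0\<bar>"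
        also have "\<bar>c * A n \<omega> - 0\<bar> \<le> (\<bar>c\<bar> + 1) * \<bar>A n \<omega>\<bar>" by (simp add: abs_mult mult_right_mono)
        finally show "e < \<bar>A n \<omega> - 0\<bar>" by (simp add: e_def pos_divide_less_eq mult.commute)
      qed
    qed measurable
    then show ?case using elim by linarith
  qed
qed

end

section \<open>Counts above deterministic levels and the Bahadur representation\<close>

locale tail_sample = iid_sample M N Z0 Z
  for M :: "'w measure" and N :: "'a measure" and Z0 :: "'w \<Rightarrow> 'a" and Z :: "nat \<Rightarrow> 'w \<Rightarrow> 'a" +
  fixes E :: "real \<Rightarrow> 'a set" and U :: "real \<Rightarrow> real" and t1 :: real and k :: "nat \<Rightarrow> nat" and S :: "real \<Rightarrow> real"
  assumes E [measurable]: "\<And>y. E y \<in> sets N" and E_antimono: "\<And>y z. y \<le> z \<Longrightarrow> E z \<subseteq> E y"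
    and S: "\<And>y. S y = prob {\<omega> \<in> space M. Z0 \<omega> \<in> E y}"
    and t1: "0 < t1" and SU: "\<And>t. t1 < t \<Longrightarrow> S (U t) = 1 / t" and U_nonneg: "\<And>t. t1 < t \<Longrightarrow> 0 \<le> U t"
    and k: "filterlim (\<lambda>n. real (k n)) at_top sequentially"
    and nk: "filterlim (\<lambda>n. real n / real (k n)) at_top sequentially"
begin

definition cnt :: "real \<Rightarrow> nat \<Rightarrow> 'w \<Rightarrow> real" where
  "cnt y n \<omega> = (\<Sum>i=1..n. indicator (E y) (Z i \<omega>))"

text \<open>The level whose expected number of exceedances among \<open>n\<close> observations is
  \<open>j k + u sqrt k\<close>; this holds once the argument of \<open>U\<close> exceeds
  \<open>t1\<close>.\<close>

definition lev :: "real \<Rightarrow> real \<Rightarrow> nat \<Rightarrow> real" where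
  "lev j u n = U (real n / (j * real (k n) + u * sqrt (real (k n))))"

definition W :: "real \<Rightarrow> nat \<Rightarrow> 'w \<Rightarrow> real" where
  "W j n \<omega> = (cnt (lev j 0 n) n \<omega> - j * real (k n)) / sqrt (real (k n))"

text \<open>The error of \<open>q\<close> measured on the scale of expected counts,
  \<open>(n S q - j k) / sqrt k\<close>. On this scale the distribution of the sample no longer
  appears, and \<open>q\<close> too large means \<open>D\<close> negative.\<close>

definition D :: "real \<Rightarrow> (nat \<Rightarrow> 'w \<Rightarrow> real) \<Rightarrow> nat \<Rightarrow> 'w \<Rightarrow> real" where
  "D j q n \<omega> = sqrt (real (k n)) * (real n * S (q n \<omega>) / real (k n) - j)"

text \<open>What is used of the \<open>m\<close>-th largest observation \<open>q\<close>, with \<open>m = j k\<^sub>n\<close>.\<close>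

definition is_upper_order_stat :: "real \<Rightarrow> (nat \<Rightarrow> 'w \<Rightarrow> real) \<Rightarrow> bool" where
  "is_upper_order_stat j q \<longleftrightarrow> (\<forall>n. q n \<in> borel_measurable M) \<and>
     (\<forall>n\<ge>1. \<forall>\<omega>\<in>space M. \<forall>y\<ge>0. (\<exists>y'. 0 < cnt y' n \<omega>) \<longrightarrow> (q n \<omega> \<le> y \<longleftrightarrow> cnt y n \<omega> < j * real (k n)))"

lemma S_antimono: "y \<le> z \<Longrightarrow> S z \<le> S y"
  unfolding S using E_antimono by (intro finite_measure_mono) auto

lemma S_measurable [measurable]: "S \<in> borel_measurable borel"
proof -
  have "(\<lambda>y. - S y) \<in> borel_measurable borel"
    by (rule borel_measurable_mono) (auto intro!: monoI S_antimono)
  then show ?thesis using borel_measurable_uminus by fastforce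
qed

lemma integral_indicator_E: "(LINT \<omega>|M. indicator (E y) (Z0 \<omega>)) = S y"
proof -
  have "(LINT \<omega>|M. indicator (E y) (Z0 \<omega>) :: real) = (LINT \<omega>|M. indicator {\<omega> \<in> space M. Z0 \<omega> \<in> E y} \<omega>)"
    by (rule Bochner_Integration.integral_cong) (auto simp: indicator_def)
  then show ?thesis by (simp add: S)
qed

lemma integrable_indicator_E: "integrable M (\<lambda>\<omega>. indicator (E y) (Z0 \<omega>) :: real)"
  by (rule integrable_const_bound[where B = 1]) (auto simp: indicator_def)

lemma integral_indicators_E:
  "(LINT \<omega>|M. a * indicator (E x) (Z0 \<omega>) + b * indicator (E y) (Z0 \<omega>) + c * indicator (E z) (Z0 \<omega>)) =
     a * S x + b * S y + c * S z"
proof -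
  have int: "integrable M (\<lambda>\<omega>. c * indicator (E y) (Z0 \<omega>) :: real)" for c y
    by (rule integrable_mult_right) (rule integrable_indicator_E)
  show ?thesis
    unfolding Bochner_Integration.integral_add[OF Bochner_Integration.integrable_add[OF int int] int]
      Bochner_Integration.integral_add[OF int int]
    by (simp add: integral_indicator_E)
qed

lemma csum_indicator: "csum (indicator (E y)) n \<omega> = cnt y n \<omega> - real n * S y"
  by (simp add: csum_def cnt_def integral_indicator_E sum_subtractf)

lemma cnt_measurable [measurable]: "cnt y n \<in> borel_measurable M"
proof -
  have "cnt y n = (\<lambda>\<omega>. csum (indicator (E y)) n \<omega> + real n * S y)" by (auto simp: csum_indicator)
  then show ?thesis by simp
qed

lemma W_measurable [measurable]: "W j n \<in> borel_measurable M"
  unfolding W_def by measurable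

lemma D_measurable:
  assumes "is_upper_order_stat j q"
  shows "D j q n \<in> borel_measurable M"
proof -
  have [measurable]: "q n \<in> borel_measurable M" using assms by (simp add: is_upper_order_stat_def)
  show ?thesis unfolding D_def by measurable
qed

lemma lev_denominator:
  assumes u: "\<And>n. \<bar>u n\<bar> \<le> B"
  shows "(\<lambda>n. j + u n / sqrt (real (k n))) \<longlonglongrightarrow> j"
proof -
  have "(\<lambda>n. 1 / sqrt (real (k n))) \<longlonglongrightarrow> 0"
    using tendsto_inverse_0_at_top[OF filterlim_compose[OF sqrt_at_top k]] by (simp add: inverse_eq_divide)
  from tendsto_add[OF tendsto_const[of j] null_mult_bounded[OF this, of u B]]
  show ?thesis using u by simp
qed

lemma k_pos: "\<forall>\<^sub>F n in sequentially. 0 < k n"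
  using eventually_compose_filterlim[OF eventually_gt_at_top[of 0] k] by simp

lemma lev_valid:
  assumes j: "0 < j"
  shows "\<forall>\<^sub>F n in sequentially. 0 \<le> lev j u n \<and> real n * S (lev j u n) = j * real (k n) + u * sqrt (real (k n))"
proof -
  have lim: "(\<lambda>n. j + u / sqrt (real (k n))) \<longlonglongrightarrow> j" by (rule lev_denominator[where B = "\<bar>u\<bar>"]) simp
  have "filterlim (\<lambda>n. inverse (j + u / sqrt (real (k n))) * (real n / real (k n))) at_top sequentially"
    using j by (intro filterlim_tendsto_pos_mult_at_top[OF tendsto_inverse[OF lim] _ nk]) auto
  from eventually_compose_filterlim[OF eventually_gt_at_top[of t1] this]
  show ?thesis using k_pos order_tendstoD(1)[OF lim j] eventually_gt_at_top[of 0]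
  proof eventually_elim
    case (elim n)
    have s: "sqrt (real (k n)) * sqrt (real (k n)) = real (k n)" "0 < sqrt (real (k n))" using elim by auto
    have eq: "j * real (k n) + u * sqrt (real (k n)) = real (k n) * (j + u / sqrt (real (k n)))"
      using s elim by (simp add: distrib_left real_div_sqrt field_simps)
    have pos: "0 < j * real (k n) + u * sqrt (real (k n))" unfolding eq using elim by simp
    have "inverse (j + u / sqrt (real (k n))) * (real n / real (k n)) = real n / (j * real (k n) + u * sqrt (real (k n)))"
      unfolding eq by (simp add: divide_simps)
    then have t: "t1 < real n / (j * real (k n) + u * sqrt (real (k n)))" using elim by simp
    show ?case unfolding lev_def using SU[OF t] U_nonneg[OF t] pos elim by simp
  qed
qed

lemma indicator_diff_square:
  "(LINT \<omega>|M. (indicator (E y) (Z0 \<omega>) - indicator (E z) (Z0 \<omega>))\<^sup>2) = \<bar>S y - S z\<bar>"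
proof -
  have *: "(LINT \<omega>|M. (indicator (E y) (Z0 \<omega>) - indicator (E z) (Z0 \<omega>))\<^sup>2) = S y - S z" if "y \<le> z" for y z
  proof -
    have "(LINT \<omega>|M. (indicator (E y) (Z0 \<omega>) - indicator (E z) (Z0 \<omega>))\<^sup>2) = (LINT \<omega>|M. indicator (E y) (Z0 \<omega>) - indicator (E z) (Z0 \<omega>) :: real)"
      using E_antimono[OF that] by (intro Bochner_Integration.integral_cong) (auto simp: indicator_def)
    then show ?thesis by (simp add: integrable_indicator_E integral_indicator_E)
  qed
  show ?thesis
  proof (cases "y \<le> z")
    case True
    then show ?thesis using *[OF True] S_antimono[OF True] by simp
  next
    case False
    then have "z \<le> y" by simp
    then show ?thesis using *[OF \<open>z \<le> y\<close>] S_antimono[OF \<open>z \<le> y\<close>] by (simp add: power2_commute)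
  qed
qed

lemma W_tight:
  assumes j: "0 < j"
  shows "tight_seq (W j)"
  unfolding tight_seq_def
proof (intro conjI allI impI W_measurable)
  fix \<delta> :: real assume \<delta>: "0 < \<delta>"
  \<comment> \<open>Chebyshev's bound at \<open>K sqrt k\<close> for a count of mean
    \<open>j k\<close> is \<open>j / K^2\<close>, which equals \<delta> for this
    \<open>K\<close>.\<close>
  define K where "K = sqrt (j / \<delta>)"
  have K: "0 < K" "K\<^sup>2 = j / \<delta>" using j \<delta> by (auto simp: K_def)
  have "\<forall>\<^sub>F n in sequentially. prob {\<omega> \<in> space M. \<bar>W j n \<omega>\<bar> > K} \<le> \<delta>"
    using lev_valid[OF j, of 0] k_pos
  proof eventually_elim
    case (elim n)
    let ?f = "indicator (E (lev j 0 n)) :: 'a \<Rightarrow> real"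
    have Weq: "W j n \<omega> = csum ?f n \<omega> / sqrt (real (k n))" for \<omega>
      using elim by (simp add: W_def csum_indicator)
    have "prob {\<omega> \<in> space M. \<bar>W j n \<omega>\<bar> > K} \<le> prob {\<omega> \<in> space M. K * sqrt (real (k n)) \<le> \<bar>csum ?f n \<omega>\<bar>}"
      using elim by (intro finite_measure_mono) (auto simp: Weq abs_divide less_divide_eq)
    also have "\<dots> \<le> real n * (LINT \<omega>|M. (?f (Z0 \<omega>))\<^sup>2) / (K * sqrt (real (k n)))\<^sup>2"
      using K elim by (intro csum_chebyshev[where B = 1]) (auto simp: indicator_def)
    also have "(LINT \<omega>|M. (?f (Z0 \<omega>))\<^sup>2) = S (lev j 0 n)"
      unfolding integral_indicator_E[symmetric] by (intro Bochner_Integration.integral_cong) (auto simp: indicator_def)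
    also have "real n * S (lev j 0 n) = j * real (k n)" using elim by simp
    also have "j * real (k n) / (K * sqrt (real (k n)))\<^sup>2 = \<delta>"
      using K elim j \<delta> by (simp add: power_mult_distrib)
    finally show ?case .
  qed
  then show "\<exists>K>0. \<forall>\<^sub>F n in sequentially. prob {\<omega> \<in> space M. \<bar>W j n \<omega>\<bar> > K} \<le> \<delta>" using K by blast
qed

text \<open>Between the two levels about \<open>\<bar>u\<bar> sqrt k\<close> observations are
  expected, so the centred difference of the counts has variance at most
  \<open>\<bar>u\<bar> sqrt k\<close>, negligible against \<open>k\<close>.\<close>

lemma increment_small:
  assumes j: "0 < j" and \<epsilon>: "0 < \<epsilon>"
  shows "(\<lambda>n. prob {\<omega> \<in> space M. \<epsilon> \<le>
      \<bar>(cnt (lev j u n) n \<omega> - (j * real (k n) + u * sqrt (real (k n)))) / sqrt (real (k n)) - W j n \<omega>\<bar>}) \<longlonglongrightarrow> 0"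
    (is "(\<lambda>n. ?p n) \<longlonglongrightarrow> 0")
proof (rule tendsto_sandwich[OF _ _ tendsto_const])
  have "(\<lambda>n. 1 / sqrt (real (k n))) \<longlonglongrightarrow> 0"
    using tendsto_inverse_0_at_top[OF filterlim_compose[OF sqrt_at_top k]] by (simp add: inverse_eq_divide)
  from tendsto_mult[OF tendsto_const[of "\<bar>u\<bar> / \<epsilon>\<^sup>2"] this]
  show "(\<lambda>n. \<bar>u\<bar> / \<epsilon>\<^sup>2 * (1 / sqrt (real (k n)))) \<longlonglongrightarrow> 0" by simp
  show "\<forall>\<^sub>F n in sequentially. ?p n \<le> \<bar>u\<bar> / \<epsilon>\<^sup>2 * (1 / sqrt (real (k n)))"
    using lev_valid[OF j, of 0] lev_valid[OF j, of u] k_pos eventually_gt_at_top[of 0]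
  proof eventually_elim
    case (elim n)
    let ?f = "\<lambda>z. indicator (E (lev j u n)) z - indicator (E (lev j 0 n)) z :: real"
    have s: "0 < sqrt (real (k n))" using elim by simp
    have c: "csum ?f n \<omega> = csum (indicator (E (lev j u n))) n \<omega> - csum (indicator (E (lev j 0 n))) n \<omega>" for \<omega>
      unfolding csum_def sum_subtractf[symmetric] by (intro sum.cong refl) (simp add: integrable_indicator_E)
    have "(cnt (lev j u n) n \<omega> - (j * real (k n) + u * sqrt (real (k n)))) / sqrt (real (k n)) - W j n \<omega> = csum ?f n \<omega> / sqrt (real (k n))" for \<omega>
      using elim unfolding c by (simp add: W_def csum_indicator flip: diff_divide_distrib)
    then have "?p n = prob {\<omega> \<in> space M. \<epsilon> * sqrt (real (k n)) \<le> \<bar>csum ?f n \<omega>\<bar>}"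
      using s by (simp add: abs_divide le_divide_eq)
    also have "\<dots> \<le> real n * (LINT \<omega>|M. (?f (Z0 \<omega>))\<^sup>2) / (\<epsilon> * sqrt (real (k n)))\<^sup>2"
      using s \<epsilon> by (intro csum_chebyshev[where B = 1]) (auto simp: indicator_def)
    also have "real n * (LINT \<omega>|M. (?f (Z0 \<omega>))\<^sup>2) = \<bar>real n * S (lev j u n) - real n * S (lev j 0 n)\<bar>"
      unfolding indicator_diff_square by (simp add: abs_mult flip: right_diff_distrib)
    also have "\<dots> = \<bar>u\<bar> * sqrt (real (k n))" using elim by (simp add: abs_mult)
    also have "\<bar>u\<bar> * sqrt (real (k n)) / (\<epsilon> * sqrt (real (k n)))\<^sup>2 = \<bar>u\<bar> / \<epsilon>\<^sup>2 * (1 / sqrt (real (k n)))"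
      using s by (simp add: power2_eq_square)
    finally show ?case .
  qed
qed (simp add: always_eventually)

text \<open>Whether \<open>D\<close> lies above or below \<open>u\<close> is decided by whether the
  count above \<open>lev j u n\<close> reaches \<open>j k\<close>, and by
  \<open>increment_small\<close> that count equals \<open>j k + (u + W) sqrt k\<close> up to a small
  error; hence \<open>D\<close> switches sides at \<open>u = - W\<close>. Tightness of
  \<open>W\<close> confines \<open>u\<close> to a bounded range, so that a finite grid of values is
  enough.\<close>

lemma bahadur:
  assumes j: "0 < j" and q: "is_upper_order_stat j q"
  shows "conv_in_prob M (\<lambda>n \<omega>. D j q n \<omega> + W j n \<omega>) 0"
proof (rule conv_in_prob_of_eventually_prob_le)
  have [measurable]: "D j q n \<in> borel_measurable M" for n by (rule D_measurable[OF q])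
  show "(\<lambda>\<omega>. D j q n \<omega> + W j n \<omega>) \<in> borel_measurable M" for n by measurable
  fix \<epsilon> \<delta> :: real assume \<epsilon>: "0 < \<epsilon>" and \<delta>: "0 < \<delta>"
  obtain K where K: "0 < K" "\<forall>\<^sub>F n in sequentially. prob {\<omega> \<in> space M. \<bar>W j n \<omega>\<bar> > K} \<le> \<delta> / 2"
    using W_tight[OF j] \<delta> unfolding tight_seq_def by (meson half_gt_zero)
  define e where "e = \<epsilon> / 4"
  have e: "0 < e" using \<epsilon> by (simp add: e_def)
  \<comment> \<open>Indices of a grid of mesh \<open>e\<close> covering
    \<open>[- K - 4 e, K + 4 e]\<close>, which contains every grid point selected below when
    \<open>\<bar>W\<bar> <= K\<close>.\<close>
  define G where "G = {m::int. \<bar>real_of_int m\<bar> \<le> (K + 4 * e) / e}"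
  have finG: "finite G"
  proof (rule finite_subset)
    show "G \<subseteq> {\<lfloor>- ((K + 4 * e) / e)\<rfloor>..\<lceil>(K + 4 * e) / e\<rceil>}"
      unfolding G_def by (auto simp: abs_le_iff) linarith+
  qed simp
  define R where "R m n \<omega> = (cnt (lev j (real_of_int m * e) n) n \<omega> - (j * real (k n) + (real_of_int m * e) * sqrt (real (k n)))) / sqrt (real (k n)) - W j n \<omega>" for m n \<omega>
  have Rm [measurable]: "R m n \<in> borel_measurable M" for m n unfolding R_def by measurable
  have "(\<lambda>n. \<Sum>m\<in>G. prob {\<omega> \<in> space M. e \<le> \<bar>R m n \<omega>\<bar>}) \<longlonglongrightarrow> (\<Sum>m\<in>G. 0)"
    unfolding R_def by (intro tendsto_sum increment_small j e)
  then have "\<forall>\<^sub>F n in sequentially. (\<Sum>m\<in>G. prob {\<omega> \<in> space M. e \<le> \<bar>R m n \<omega>\<bar>}) < \<delta> / 2"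
    using \<delta> by (intro order_tendstoD(2)) auto
  moreover have "\<forall>\<^sub>F n in sequentially. \<forall>m\<in>G. 0 \<le> lev j (real_of_int m * e) n \<and> real n * S (lev j (real_of_int m * e) n) = j * real (k n) + (real_of_int m * e) * sqrt (real (k n))"
    using finG by (intro eventually_ball_finite ballI lev_valid j)
  moreover have "\<forall>\<^sub>F n in sequentially. K / j < sqrt (real (k n))"
    by (rule eventually_compose_filterlim[OF eventually_gt_at_top filterlim_compose[OF sqrt_at_top k]])
  ultimately show "\<forall>\<^sub>F n in sequentially. prob {\<omega> \<in> space M. \<bar>D j q n \<omega> + W j n \<omega> - 0\<bar> > \<epsilon>} \<le> \<delta>"
    using K(2) k_pos eventually_ge_at_top[of 1]
  proof eventually_elim
    case (elim n)
    define s where "s = sqrt (real (k n))"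
    have s: "0 < s" "s * s = real (k n)" using elim by (auto simp: s_def)
    have np: "0 < real n" using elim by simp
    have sub: "{\<omega> \<in> space M. \<bar>D j q n \<omega> + W j n \<omega> - 0\<bar> > \<epsilon>} \<subseteq>
        {\<omega> \<in> space M. \<bar>W j n \<omega>\<bar> > K} \<union> (\<Union>m\<in>G. {\<omega> \<in> space M. e \<le> \<bar>R m n \<omega>\<bar>})"
    proof (rule subsetI, rule ccontr)
      fix \<omega> assume \<omega>: "\<omega> \<in> {\<omega> \<in> space M. \<bar>D j q n \<omega> + W j n \<omega> - 0\<bar> > \<epsilon>}"
        and "\<omega> \<notin> {\<omega> \<in> space M. \<bar>W j n \<omega>\<bar> > K} \<union> (\<Union>m\<in>G. {\<omega> \<in> space M. e \<le> \<bar>R m n \<omega>\<bar>})"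
      then have sp: "\<omega> \<in> space M" and W: "\<bar>W j n \<omega>\<bar> \<le> K" and R: "\<And>m. m \<in> G \<Longrightarrow> \<bar>R m n \<omega>\<bar> < e" by auto
      \<comment> \<open>The characterization of an upper order statistic presupposes some
        exceedance; \<open>\<bar>W\<bar> <= K < j sqrt k\<close> provides one.\<close>
      have "0 < cnt (lev j 0 n) n \<omega>"
      proof -
        have "K < j * s" using elim(3) j by (simp add: s_def divide_less_eq mult.commute)
        then have "- (j * s) < W j n \<omega>" using W by linarith
        then have "- (j * s) * s < cnt (lev j 0 n) n \<omega> - j * real (k n)"
          using s by (simp add: W_def s_def[symmetric] less_divide_eq)
        then show ?thesis using s by (simp add: mult.assoc)
      qed
      then have qc: "q n \<omega> \<le> y \<longleftrightarrow> cnt y n \<omega> < j * real (k n)" if "0 \<le> y" for y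
        using q elim(6) sp that unfolding is_upper_order_stat_def by blast
      have Dlt: "D j q n \<omega> < u \<longleftrightarrow> real n * S (q n \<omega>) < j * real (k n) + u * s" for u
      proof -
        have "D j q n \<omega> = (real n * S (q n \<omega>) - j * real (k n)) / s"
          using s unfolding D_def s_def[symmetric] s(2)[symmetric] by (simp add: field_simps)
        then show ?thesis using s by (simp add: divide_less_eq) (auto simp: algebra_simps)
      qed
      have Dgt: "u < D j q n \<omega> \<longleftrightarrow> j * real (k n) + u * s < real n * S (q n \<omega>)" for u
      proof -
        have "D j q n \<omega> = (real n * S (q n \<omega>) - j * real (k n)) / s"
          using s unfolding D_def s_def[symmetric] s(2)[symmetric] by (simp add: field_simps)
        then show ?thesis using s by (simp add: less_divide_eq) (auto simp: algebra_simps)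
      qed
      \<comment> \<open>Since \<open>S\<close> need not be strictly decreasing, only a strict
        inequality between values of \<open>S\<close> may be turned into one between levels. This is
        why both bounds are proved by contradiction.\<close>
      have lower: "real_of_int m * e \<le> D j q n \<omega>" if m: "m \<in> G" and less: "real_of_int m * e < - W j n \<omega> - e" for m
      proof (rule ccontr)
        let ?y = "lev j (real_of_int m * e) n"
        assume "\<not> ?thesis"
        then have "real n * S (q n \<omega>) < real n * S ?y" using Dlt[of "real_of_int m * e"] elim(2) m by (simp add: s_def)
        then have "S (q n \<omega>) < S ?y" using mult_less_cancel_left_pos[OF np] by blast
        then have "\<not> q n \<omega> \<le> ?y" using S_antimono[of "q n \<omega>" ?y] by linarith
        then have "j * real (k n) \<le> cnt ?y n \<omega>" using qc[of ?y] elim(2) m by auto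
        then have "- (real_of_int m * e) \<le> R m n \<omega> + W j n \<omega>"
          unfolding R_def s_def[symmetric] using s by (simp add: le_divide_eq)
        then show False using R[OF m] less by linarith
      qed
      have upper: "D j q n \<omega> \<le> real_of_int m * e" if m: "m \<in> G" and ge: "- W j n \<omega> + e \<le> real_of_int m * e" for m
      proof (rule ccontr)
        let ?y = "lev j (real_of_int m * e) n"
        assume "\<not> ?thesis"
        then have "real n * S ?y < real n * S (q n \<omega>)" using Dgt[of "real_of_int m * e"] elim(2) m by (simp add: s_def)
        then have "S ?y < S (q n \<omega>)" using mult_less_cancel_left_pos[OF np] by blast
        then have "q n \<omega> \<le> ?y" using S_antimono[of ?y "q n \<omega>"] by linarith
        then have "cnt ?y n \<omega> < j * real (k n)" using qc[of ?y] elim(2) m by auto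
        then have "R m n \<omega> + W j n \<omega> < - (real_of_int m * e)"
          unfolding R_def s_def[symmetric] using s by (simp add: divide_less_eq)
        then show False using R[OF m] ge by linarith
      qed
      \<comment> \<open>\<open>m1 e\<close> falls in \<open>[- W - 3 e, - W - 2 e)\<close> and
        \<open>m2 e\<close> in \<open>[- W + e, - W + 2 e)\<close>: beyond the safety margin
        \<open>e\<close> of the two bounds, yet within \<open>4 e = \<epsilon>\<close> of
        \<open>- W\<close>.\<close>
      define m1 where "m1 = \<lceil>(- W j n \<omega> - 3 * e) / e\<rceil>"
      define m2 where "m2 = \<lceil>(- W j n \<omega> + e) / e\<rceil>"
      have m1: "(- W j n \<omega> - 3 * e) / e \<le> real_of_int m1" "real_of_int m1 < (- W j n \<omega> - 3 * e) / e + 1"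
        unfolding m1_def by linarith+
      have m2: "(- W j n \<omega> + e) / e \<le> real_of_int m2" "real_of_int m2 < (- W j n \<omega> + e) / e + 1"
        unfolding m2_def by linarith+
      have m1': "- W j n \<omega> - 3 * e \<le> real_of_int m1 * e" "real_of_int m1 * e < - W j n \<omega> - 2 * e"
        using m1 e by (simp_all add: divide_le_eq field_simps)
      have m2': "- W j n \<omega> + e \<le> real_of_int m2 * e" "real_of_int m2 * e < - W j n \<omega> + 2 * e"
        using m2 e by (simp_all add: divide_le_eq field_simps)
      have inG: "m \<in> G" if "\<bar>real_of_int m * e\<bar> \<le> K + 4 * e" for m
        using that e by (simp add: G_def le_divide_eq abs_mult)
      have "m1 \<in> G" "m2 \<in> G" using m1' m2' W e by (auto intro!: inG simp: abs_le_iff)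
      then have "real_of_int m1 * e \<le> D j q n \<omega>" "D j q n \<omega> \<le> real_of_int m2 * e"
        using lower[of m1] upper[of m2] m1' m2' e by auto
      then have "\<bar>D j q n \<omega> + W j n \<omega>\<bar> \<le> \<epsilon>" using m1' m2' e by (simp add: e_def abs_le_iff)
      then show False using \<omega> by simp
    qed
    have "prob {\<omega> \<in> space M. \<bar>D j q n \<omega> + W j n \<omega> - 0\<bar> > \<epsilon>} \<le>
        prob ({\<omega> \<in> space M. \<bar>W j n \<omega>\<bar> > K} \<union> (\<Union>m\<in>G. {\<omega> \<in> space M. e \<le> \<bar>R m n \<omega>\<bar>}))"
      by (rule finite_measure_mono[OF sub]) (use finG in measurable)
    also have "\<dots> \<le> prob {\<omega> \<in> space M. \<bar>W j n \<omega>\<bar> > K} + prob (\<Union>m\<in>G. {\<omega> \<in> space M. e \<le> \<bar>R m n \<omega>\<bar>})"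
      by (rule measure_Un_le) (use finG in measurable)
    also have "prob (\<Union>m\<in>G. {\<omega> \<in> space M. e \<le> \<bar>R m n \<omega>\<bar>}) \<le> (\<Sum>m\<in>G. prob {\<omega> \<in> space M. e \<le> \<bar>R m n \<omega>\<bar>})"
      by (rule measure_UNION_le[OF finG]) measurable
    finally show ?case using elim by linarith
  qed
qed

lemma D_tight: "0 < j \<Longrightarrow> is_upper_order_stat j q \<Longrightarrow> tight_seq (D j q)"
  by (rule tight_seq_perturb[OF W_tight D_measurable bahadur])

text \<open>The quadratic form is the variance of \<open>c1 B(1) + c2 B(2) + c4 B(4)\<close> for a
  Brownian motion \<open>B\<close>: the coefficients \<open>c1 + c2 + c4\<close>,
  \<open>c2 + c4\<close> and \<open>c4\<close> belong to the increments over \<open>[0, 1]\<close>,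
  \<open>[1, 2]\<close> and \<open>[2, 4]\<close>. The squared mean contributes a multiple of
  \<open>k / n\<close>, which vanishes.\<close>

lemma W_char_tendsto:
  "(\<lambda>n. char (distr M borel (\<lambda>\<omega>. c1 * W 1 n \<omega> + c2 * W 2 n \<omega> + c4 * W 4 n \<omega>)) t) \<longlonglongrightarrow>
     complex_of_real (exp (- (((c1 + c2 + c4)\<^sup>2 + (c2 + c4)\<^sup>2 + 2 * c4\<^sup>2) * t\<^sup>2 / 2)))"
proof -
  let ?I = "\<lambda>j n. indicator (E (lev j 0 n)) :: 'a \<Rightarrow> real"
  define f where "f n z = c1 * ?I 1 n z + c2 * ?I 2 n z + c4 * ?I 4 n z" for n z
  have fm: "f n \<in> borel_measurable N" for n unfolding f_def by measurable
  have fB: "\<bar>f n z\<bar> \<le> \<bar>c1\<bar> + \<bar>c2\<bar> + \<bar>c4\<bar>" for n z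
    by (auto simp: f_def indicator_def)
  define Q where "Q = (c1 + c2 + c4)\<^sup>2 + (c2 + c4)\<^sup>2 + 2 * c4\<^sup>2"
  have valid: "\<forall>\<^sub>F n in sequentially. 0 < k n \<and> 0 < n \<and> real n * S (lev 1 0 n) = real (k n) \<and>
      real n * S (lev 2 0 n) = 2 * real (k n) \<and> real n * S (lev 4 0 n) = 4 * real (k n)"
    using lev_valid[of 1 0, OF zero_less_one] lev_valid[of 2 0, OF zero_less_numeral]
      lev_valid[of 4 0, OF zero_less_numeral] k_pos eventually_gt_at_top[of 0]
    by eventually_elim simp
  have var: "(\<lambda>n. real n / real (k n) * variance (\<lambda>\<omega>. f n (Z0 \<omega>))) \<longlonglongrightarrow> Q"
  proof -
    have kn: "(\<lambda>n. real (k n) / real n) \<longlonglongrightarrow> 0"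
      using tendsto_inverse_0_at_top[OF nk] by (simp add: inverse_eq_divide)
    have "(\<lambda>n. Q - (c1 + 2 * c2 + 4 * c4)\<^sup>2 * (real (k n) / real n)) \<longlonglongrightarrow> Q - (c1 + 2 * c2 + 4 * c4)\<^sup>2 * 0"
      by (intro tendsto_intros kn)
    then have lim: "(\<lambda>n. Q - (c1 + 2 * c2 + 4 * c4)\<^sup>2 * (real (k n) / real n)) \<longlonglongrightarrow> Q" by simp
    show ?thesis
    proof (rule Lim_transform_eventually[OF lim], use valid in eventually_elim)
      case (elim n)
      then have kp: "0 < real (k n)" and np: "0 < real n" by auto
      define r where "r = real (k n) / real n"
      have r: "0 < r" "real n / real (k n) * r = 1" using kp np by (auto simp: r_def)
      have Sv: "S (lev 1 0 n) = r" "S (lev 2 0 n) = 2 * r" "S (lev 4 0 n) = 4 * r"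
        using elim np by (auto simp: r_def field_simps)
      have lt: "S (lev 1 0 n) < S (lev 2 0 n)" "S (lev 2 0 n) < S (lev 4 0 n)" using r by (auto simp: Sv)
      have "lev 2 0 n \<le> lev 1 0 n" "lev 4 0 n \<le> lev 2 0 n" using lt S_antimono by (meson le_cases not_le)+
      \<comment> \<open>The exceedance events are nested, so products of indicators collapse to the
        smaller one and the square becomes linear in the indicators.\<close>
      then have sub: "E (lev 1 0 n) \<subseteq> E (lev 2 0 n)" "E (lev 2 0 n) \<subseteq> E (lev 4 0 n)" using E_antimono by auto
      have "(LINT \<omega>|M. (f n (Z0 \<omega>))\<^sup>2) = (LINT \<omega>|M. (c1\<^sup>2 + 2 * c1 * c2 + 2 * c1 * c4) * ?I 1 n (Z0 \<omega>) +
          (c2\<^sup>2 + 2 * c2 * c4) * ?I 2 n (Z0 \<omega>) + c4\<^sup>2 * ?I 4 n (Z0 \<omega>))"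
        using sub by (intro Bochner_Integration.integral_cong) (auto simp: f_def indicator_def power2_eq_square algebra_simps)
      also have "\<dots> = (c1\<^sup>2 + 2 * c1 * c2 + 2 * c1 * c4) * S (lev 1 0 n) + (c2\<^sup>2 + 2 * c2 * c4) * S (lev 2 0 n) + c4\<^sup>2 * S (lev 4 0 n)"
        by (rule integral_indicators_E)
      finally have sq: "(LINT \<omega>|M. (f n (Z0 \<omega>))\<^sup>2) = Q * r"
        by (simp add: Sv Q_def power2_eq_square algebra_simps)
      have i1: "integrable M (\<lambda>\<omega>. f n (Z0 \<omega>))"
        using fm[of n] by (intro integrable_const_bound[where B = "\<bar>c1\<bar> + \<bar>c2\<bar> + \<bar>c4\<bar>"]) (auto intro: fB)
      have i2: "integrable M (\<lambda>\<omega>. (f n (Z0 \<omega>))\<^sup>2)"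
        using fm[of n] by (intro integrable_const_bound[where B = "(\<bar>c1\<bar> + \<bar>c2\<bar> + \<bar>c4\<bar>)\<^sup>2"])
          (auto intro!: AE_I2 power2_le_iff_abs_le[THEN iffD2] fB)
      have m: "(LINT \<omega>|M. f n (Z0 \<omega>)) = (c1 + 2 * c2 + 4 * c4) * r"
        unfolding f_def integral_indicators_E Sv by (simp add: algebra_simps)
      have "variance (\<lambda>\<omega>. f n (Z0 \<omega>)) = Q * r - ((c1 + 2 * c2 + 4 * c4) * r)\<^sup>2"
        by (subst variance_eq[OF i1 i2]) (simp only: sq m)
      also have "\<dots> = r * (Q - (c1 + 2 * c2 + 4 * c4)\<^sup>2 * r)"
        by (simp add: power2_eq_square algebra_simps)
      finally have "real n / real (k n) * variance (\<lambda>\<omega>. f n (Z0 \<omega>)) =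
          (real n / real (k n) * r) * (Q - (c1 + 2 * c2 + 4 * c4)\<^sup>2 * r)" by simp
      then show ?case unfolding r(2) by (simp add: r_def)
    qed
  qed
  have "(\<lambda>n. char (distr M borel (\<lambda>\<omega>. csum (f n) n \<omega> / sqrt (real (k n)))) t) \<longlonglongrightarrow> complex_of_real (exp (- (Q * t\<^sup>2 / 2)))"
    by (rule csum_char_tendsto[OF fm fB k var])
  then show ?thesis unfolding Q_def[symmetric]
  proof (rule Lim_transform_eventually, use valid in eventually_elim)
    case (elim n)
    have "csum (f n) n \<omega> = c1 * csum (?I 1 n) n \<omega> + c2 * csum (?I 2 n) n \<omega> + c4 * csum (?I 4 n) n \<omega>" for \<omega>
    proof -
      have "(LINT \<omega>|M. f n (Z0 \<omega>)) = c1 * S (lev 1 0 n) + c2 * S (lev 2 0 n) + c4 * S (lev 4 0 n)"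
        unfolding f_def using integrable_indicator_E by (simp add: integral_indicator_E)
      then show ?thesis
        by (simp add: csum_def integral_indicator_E f_def sum_subtractf sum.distrib sum_distrib_left algebra_simps)
    qed
    then have "csum (f n) n \<omega> / sqrt (real (k n)) = c1 * W 1 n \<omega> + c2 * W 2 n \<omega> + c4 * W 4 n \<omega>" for \<omega>
      using elim by (simp add: W_def csum_indicator add_divide_distrib)
    then show ?case by simp
  qed
qed

text \<open>The delta method removes the nonlinear part and the Bahadur representation replaces each
  \<open>D\<close> by \<open>- W\<close>; the sign change leaves the variance as it is. The identity
  between \<open>T\<close> and \<Phi> is required for bounded \<open>D\<close> only, because order
  statistics are values of \<open>U\<close> only near the tail.\<close>

theorem asymptotic_normality:
  assumes T: "\<And>n. T n \<in> borel_measurable M"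
    and q: "is_upper_order_stat 1 q1" "is_upper_order_stat 2 q2" "is_upper_order_stat 4 q4"
    and T_eq: "\<And>K. 0 < K \<Longrightarrow> \<forall>\<^sub>F n in sequentially. \<forall>\<omega>\<in>space M. \<bar>D 1 q1 n \<omega>\<bar> \<le> K \<longrightarrow> \<bar>D 2 q2 n \<omega>\<bar> \<le> K \<longrightarrow> \<bar>D 4 q4 n \<omega>\<bar> \<le> K \<longrightarrow>
        T n \<omega> = \<Phi> n (D 1 q1 n \<omega>) (D 2 q2 n \<omega>) (D 4 q4 n \<omega>)"
    and lim: "\<And>K d1 d2 d4. (\<And>n. \<bar>d1 n\<bar> \<le> K) \<Longrightarrow> (\<And>n. \<bar>d2 n\<bar> \<le> K) \<Longrightarrow> (\<And>n. \<bar>d4 n\<bar> \<le> K) \<Longrightarrow>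
        (\<lambda>n. \<Phi> n (d1 n) (d2 n) (d4 n) - (c1 * d1 n + c2 * d2 n + c4 * d4 n)) \<longlonglongrightarrow> 0"
    and V: "V = (c1 + c2 + c4)\<^sup>2 + (c2 + c4)\<^sup>2 + 2 * c4\<^sup>2" "0 < V"
  shows "conv_distr_normal M T V"
proof (rule conv_distr_normal_of_char[OF T])
  let ?L = "\<lambda>n \<omega>. (- c1) * W 1 n \<omega> + (- c2) * W 2 n \<omega> + (- c4) * W 4 n \<omega>"
  have [measurable]: "D 1 q1 n \<in> borel_measurable M" "D 2 q2 n \<in> borel_measurable M" "D 4 q4 n \<in> borel_measurable M" for n
    using D_measurable q by auto
  show "?L n \<in> borel_measurable M" for n by measurable
  note T [measurable]
  let ?R = "\<lambda>n \<omega>. T n \<omega> - (c1 * D 1 q1 n \<omega> + c2 * D 2 q2 n \<omega> + c4 * D 4 q4 n \<omega>)"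
  have R: "conv_in_prob M ?R 0"
  proof (rule conv_in_prob_of_bounded_sequences[where \<Phi> = "\<lambda>n d1 d2 d4. \<Phi> n d1 d2 d4 - (c1 * d1 + c2 * d2 + c4 * d4)"])
    show "?R n \<in> borel_measurable M" for n by measurable
    show "tight_seq (D 1 q1)" "tight_seq (D 2 q2)" "tight_seq (D 4 q4)" using D_tight q by auto
    show "(\<lambda>n. \<Phi> n (d1 n) (d2 n) (d4 n) - (c1 * d1 n + c2 * d2 n + c4 * d4 n)) \<longlonglongrightarrow> 0"
      if "\<And>n. \<bar>d1 n\<bar> \<le> K" "\<And>n. \<bar>d2 n\<bar> \<le> K" "\<And>n. \<bar>d4 n\<bar> \<le> K" for d1 d2 d4 K
      using lim[OF that] .
    show "\<forall>\<^sub>F n in sequentially. \<forall>\<omega>\<in>space M. \<bar>D 1 q1 n \<omega>\<bar> \<le> K \<longrightarrow> \<bar>D 2 q2 n \<omega>\<bar> \<le> K \<longrightarrow> \<bar>D 4 q4 n \<omega>\<bar> \<le> K \<longrightarrow>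
        ?R n \<omega> = \<Phi> n (D 1 q1 n \<omega>) (D 2 q2 n \<omega>) (D 4 q4 n \<omega>) - (c1 * D 1 q1 n \<omega> + c2 * D 2 q2 n \<omega> + c4 * D 4 q4 n \<omega>)"
      if "0 < K" for K using T_eq[OF that] by eventually_elim auto
  qed
  have "conv_in_prob M (\<lambda>n \<omega>. ?R n \<omega> + c1 * (D 1 q1 n \<omega> + W 1 n \<omega>) + c2 * (D 2 q2 n \<omega> + W 2 n \<omega>) + c4 * (D 4 q4 n \<omega> + W 4 n \<omega>)) 0"
    using q by (intro conv_in_prob_add conv_in_prob_cmult R bahadur) auto
  moreover have "?R n \<omega> + c1 * (D 1 q1 n \<omega> + W 1 n \<omega>) + c2 * (D 2 q2 n \<omega> + W 2 n \<omega>) + c4 * (D 4 q4 n \<omega> + W 4 n \<omega>) = T n \<omega> - ?L n \<omega>" for n \<omega>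
    by (simp add: algebra_simps)
  ultimately show "conv_in_prob M (\<lambda>n \<omega>. T n \<omega> - ?L n \<omega>) 0" by simp
  have "(- c1 + - c2 + - c4)\<^sup>2 + (- c2 + - c4)\<^sup>2 + 2 * (- c4)\<^sup>2 = V"
    unfolding V(1) by (simp add: power2_eq_square algebra_simps)
  then show "(\<lambda>n. char (distr M borel (?L n)) t) \<longlonglongrightarrow> complex_of_real (exp (- (V * t\<^sup>2 / 2)))" for t
    using W_char_tendsto[of "- c1" "- c2" "- c4" t] by (simp only:)
qed (rule V(2))

text \<open>Solving the definition of \<open>D\<close> gives
  \<open>S q = (k / n) (j + D / sqrt k)\<close>. For bounded \<open>D\<close> this is eventually
  positive and below \<open>1 / t1\<close>, where \<open>U\<close> inverts
  \<open>1 / S\<close>.\<close>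

lemma q_eq_U:
  assumes j: "0 < j" and U_inv: "\<And>y. 0 < S y \<Longrightarrow> S y < 1 / t1 \<Longrightarrow> y = U (1 / S y)" and K: "0 < K"
  shows "\<forall>\<^sub>F n in sequentially. \<forall>\<omega>\<in>space M. \<bar>D j q n \<omega>\<bar> \<le> K \<longrightarrow>
    q n \<omega> = U (real n / real (k n) / (j + D j q n \<omega> / sqrt (real (k n))))"
proof -
  have lim: "(\<lambda>n. j + x / sqrt (real (k n))) \<longlonglongrightarrow> j" for x by (rule lev_denominator[where B = "\<bar>x\<bar>"]) simp
  have "filterlim (\<lambda>n. inverse (j + K / sqrt (real (k n))) * (real n / real (k n))) at_top sequentially"
    using j by (intro filterlim_tendsto_pos_mult_at_top[OF tendsto_inverse[OF lim] _ nk]) auto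
  from eventually_compose_filterlim[OF eventually_gt_at_top[of t1] this]
  show ?thesis using k_pos order_tendstoD(1)[OF lim[of "- K"] j] order_tendstoD(1)[OF lim[of K] j] eventually_gt_at_top[of 0]
  proof eventually_elim
    case (elim n)
    show ?case
    proof (intro ballI impI)
      fix \<omega> assume d: "\<bar>D j q n \<omega>\<bar> \<le> K"
      define s where "s = sqrt (real (k n))"
      define x where "x = j + D j q n \<omega> / s"
      have s: "0 < s" using elim by (simp add: s_def)
      have kp: "0 < real (k n)" and np: "0 < real n" using elim by auto
      have "- K / s \<le> D j q n \<omega> / s" "D j q n \<omega> / s \<le> K / s"
        using d s by (intro divide_right_mono; linarith)+
      then have x: "0 < x" "x \<le> j + K / s" using elim by (auto simp: x_def s_def)
      have Sq: "S (q n \<omega>) = real (k n) / real n * x"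
        using s kp np unfolding x_def D_def s_def[symmetric] by simp
      have "t1 < real n / real (k n) / (j + K / s)" using elim(1) by (simp add: s_def divide_inverse mult.commute mult.left_commute)
      also have "\<dots> \<le> real n / real (k n) / x" using x kp np by (intro divide_left_mono mult_pos_pos) auto
      finally have t: "t1 < 1 / S (q n \<omega>)" using kp np x by (simp add: Sq)
      have Sp: "0 < S (q n \<omega>)" using x kp np by (simp add: Sq)
      have "S (q n \<omega>) < 1 / t1" using t Sp t1 by (simp add: field_simps)
      then have "q n \<omega> = U (1 / S (q n \<omega>))" using Sp by (intro U_inv)
      also have "1 / S (q n \<omega>) = real n / real (k n) / x" using kp np x by (simp add: Sq)
      finally show "q n \<omega> = U (real n / real (k n) / (j + D j q n \<omega> / sqrt (real (k n))))"
        by (simp add: x_def s_def)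
    qed
  qed
qed

end

section \<open>Statistics of intermediate quantiles\<close>

locale intermediate_quantiles =
  fixes U :: "real \<Rightarrow> real" and \<rho> t1 \<phi> :: real and k :: "nat \<Rightarrow> nat"
  assumes \<rho>: "0 < \<rho>" and t1: "0 < t1"
    and U_diff: "\<And>t. t1 < t \<Longrightarrow> U differentiable (at t)" and U_pos: "\<And>t. t1 < t \<Longrightarrow> 0 < deriv U t"
    and U_varies: "deriv_varies \<rho> U"
    and k: "filterlim (\<lambda>n. real (k n)) at_top sequentially"
    and nk: "filterlim (\<lambda>n. real n / real (k n)) at_top sequentially"
    and tail_ratio: "\<And>j. j \<in> {1, 2, 4} \<Longrightarrow> (\<lambda>n. (\<phi> - U (real n / real (k n) / j)) /
        (real n / real (k n) * deriv U (real n / real (k n)))) \<longlonglongrightarrow> \<rho> * j powr (1 / \<rho>)"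
begin

definition t :: "nat \<Rightarrow> real" where "t n = real n / real (k n)"

definition s :: "nat \<Rightarrow> real" where "s n = sqrt (real (k n))"

definition A :: "nat \<Rightarrow> real" where "A n = t n * deriv U (t n)"

text \<open>The order statistic as a function of its error:
  \<open>n S q = k (j + d / sqrt k)\<close> inverted by \<open>U\<close>.\<close>

definition Q :: "real \<Rightarrow> nat \<Rightarrow> real \<Rightarrow> real" where "Q j n d = U (t n / (j + d / s n))"

abbreviation r where "r \<equiv> 2 powr (1 / \<rho>)"

lemma t_lim: "filterlim t at_top sequentially" using nk by (simp add: t_def[abs_def])

lemma s_lim: "filterlim s at_top sequentially"
  unfolding s_def by (rule filterlim_compose[OF sqrt_at_top k])

lemma s_pos: "\<forall>\<^sub>F n in sequentially. 0 < s n"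
  by (rule eventually_compose_filterlim[OF eventually_gt_at_top s_lim])

lemma inv_s: "(\<lambda>n. 1 / s n) \<longlonglongrightarrow> 0"
  using tendsto_inverse_0_at_top[OF s_lim] by (simp add: inverse_eq_divide)

lemma A_pos: "\<forall>\<^sub>F n in sequentially. 0 < A n"
  using eventually_compose_filterlim[OF eventually_gt_at_top[of t1] t_lim]
    eventually_compose_filterlim[OF eventually_gt_at_top[of 0] t_lim]
  by eventually_elim (simp add: A_def U_pos)

text \<open>The mean value theorem provides an intermediate point between \<open>x n\<close> and
  \<open>y n\<close>, which also tends to \<open>x0\<close>; \<open>c\<close> is the ratio of
  derivatives there. Keeping it as a factor of an exact identity allows later multiplication by
  \<open>sqrt k\<close>.\<close>

lemma increment:
  assumes x: "x \<longlonglongrightarrow> x0" and y: "y \<longlonglongrightarrow> x0" and x0: "0 < x0"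
  shows "\<exists>c. c \<longlonglongrightarrow> x0 powr (- 1 / \<rho> - 1) \<and>
    (\<forall>\<^sub>F n in sequentially. (U (t n * x n) - U (t n * y n)) / A n = c n * (x n - y n))"
proof -
  have ex: "\<exists>\<xi>. min (x n) (y n) \<le> \<xi> \<and> \<xi> \<le> max (x n) (y n) \<and>
      (0 < t n \<longrightarrow> t1 < t n * x n \<longrightarrow> t1 < t n * y n \<longrightarrow> U (t n * x n) - U (t n * y n) = (x n - y n) * (t n * deriv U (t n * \<xi>)))" for n
  proof (cases "0 < t n \<and> t1 < t n * x n \<and> t1 < t n * y n \<and> x n \<noteq> y n")
    case True
    have *: "\<exists>\<xi>. a \<le> \<xi> \<and> \<xi> \<le> b \<and> U (t n * b) - U (t n * a) = (b - a) * (t n * deriv U (t n * \<xi>))"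
      if "a < b" "t1 < t n * a" for a b
    proof -
      have "\<exists>z>a. z < b \<and> U (t n * b) - U (t n * a) = (b - a) * (deriv U (t n * z) * t n)"
      proof (rule MVT2[OF \<open>a < b\<close>])
        fix z assume "a \<le> z" "z \<le> b"
        then have "t n * a \<le> t n * z" using True by (intro mult_left_mono) auto
        then have "t1 < t n * z" using that by linarith
        from U_diff[OF this] have "(U has_real_derivative deriv U (t n * z)) (at (t n * z))"
          by (simp add: DERIV_deriv_iff_real_differentiable)
        then show "((\<lambda>z. U (t n * z)) has_real_derivative deriv U (t n * z) * t n) (at z)"
          by (rule DERIV_chain2) (auto intro!: derivative_eq_intros)
      qed
      then obtain z where "a < z" "z < b" "U (t n * b) - U (t n * a) = (b - a) * (deriv U (t n * z) * t n)" by blast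
      then show ?thesis by (intro exI[of _ z]) (simp add: mult_ac)
    qed
    consider "x n < y n" | "y n < x n" using True by linarith
    then show ?thesis
    proof cases
      case 1
      from *[OF 1] True obtain \<xi> where "x n \<le> \<xi>" "\<xi> \<le> y n" "U (t n * y n) - U (t n * x n) = (y n - x n) * (t n * deriv U (t n * \<xi>))" by auto
      then show ?thesis using 1 by (intro exI[of _ \<xi>]) (auto simp: algebra_simps)
    next
      case 2
      from *[OF 2] True show ?thesis using 2 by auto
    qed
  qed (auto intro!: exI[of _ "x n"])
  then obtain \<xi> where \<xi>: "\<And>n. min (x n) (y n) \<le> \<xi> n" "\<And>n. \<xi> n \<le> max (x n) (y n)"
    "\<And>n. 0 < t n \<Longrightarrow> t1 < t n * x n \<Longrightarrow> t1 < t n * y n \<Longrightarrow> U (t n * x n) - U (t n * y n) = (x n - y n) * (t n * deriv U (t n * \<xi> n))"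
    by metis
  have "(\<lambda>n. min (x n) (y n)) \<longlonglongrightarrow> min x0 x0" "(\<lambda>n. max (x n) (y n)) \<longlonglongrightarrow> max x0 x0"
    by (intro tendsto_intros x y)+
  then have "\<xi> \<longlonglongrightarrow> x0"
    by (intro tendsto_sandwich[of "\<lambda>n. min (x n) (y n)" \<xi> _ "\<lambda>n. max (x n) (y n)"]) (auto simp: \<xi>)
  then have "(\<lambda>n. deriv U (t n * \<xi> n) / deriv U (t n)) \<longlonglongrightarrow> x0 powr (- 1 / \<rho> - 1)"
    using U_varies t_lim x0 unfolding deriv_varies_def by blast
  moreover have "\<forall>\<^sub>F n in sequentially. (U (t n * x n) - U (t n * y n)) / A n = deriv U (t n * \<xi> n) / deriv U (t n) * (x n - y n)"
    using eventually_compose_filterlim[OF eventually_gt_at_top[of 0] t_lim]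
      eventually_compose_filterlim[OF eventually_gt_at_top[of t1] filterlim_mult_tendsto_pos_at_top[OF t_lim x x0]]
      eventually_compose_filterlim[OF eventually_gt_at_top[of t1] filterlim_mult_tendsto_pos_at_top[OF t_lim y x0]]
    by eventually_elim (simp add: \<xi>(3) A_def)
  ultimately show ?thesis by blast
qed

lemma bounded_div_s:
  assumes "\<And>n. \<bar>d n\<bar> \<le> K"
  shows "(\<lambda>n. d n / s n) \<longlonglongrightarrow> 0"
  using null_mult_bounded[OF inv_s, of d K] assms by simp

text \<open>The arguments \<open>1 / (j + d / s)\<close> and \<open>1 / j\<close> differ by
  \<open>- (d / s) / (j (j + d / s))\<close>, and \<open>U'\<close> at \<open>t / j\<close> is
  \<open>j^(1/\<rho> + 1)\<close> times \<open>U'(t)\<close> asymptotically; the product gives the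
  slope \<open>- j^(1/\<rho> - 1)\<close>.\<close>

lemma Q_expansion:
  assumes j: "0 < j" and d: "\<And>n. \<bar>d n\<bar> \<le> K"
  shows "(\<lambda>n. s n * ((Q j n (d n) - U (t n / j)) / A n) + j powr (1 / \<rho> - 1) * d n) \<longlonglongrightarrow> 0"
proof -
  define x where "x n = 1 / (j + d n / s n)" for n
  have jd: "(\<lambda>n. j + d n / s n) \<longlonglongrightarrow> j"
    using tendsto_add[OF tendsto_const[of j] bounded_div_s[OF d]] by simp
  have x: "x \<longlonglongrightarrow> 1 / j" unfolding x_def using j by (intro tendsto_intros jd) auto
  obtain c where c: "c \<longlonglongrightarrow> (1 / j) powr (- 1 / \<rho> - 1)"
    "\<forall>\<^sub>F n in sequentially. (U (t n * x n) - U (t n * (1 / j))) / A n = c n * (x n - 1 / j)"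
    using increment[OF x tendsto_const] j by auto
  have "(\<lambda>n. j powr (1 / \<rho> - 1) - c n / (j * (j + d n / s n))) \<longlonglongrightarrow> j powr (1 / \<rho> - 1) - (1 / j) powr (- 1 / \<rho> - 1) / (j * j)"
    using j by (intro tendsto_intros c jd) auto
  moreover have "(1 / j) powr (- 1 / \<rho> - 1) / (j * j) = j powr (1 / \<rho> - 1)"
  proof -
    have "(1 / j) powr (- 1 / \<rho> - 1) = j powr (1 / \<rho> + 1)"
      using j by (simp add: powr_def ln_div algebra_simps)
    also have "\<dots> = j powr (1 / \<rho> - 1) * j powr 2"
      by (subst powr_add[symmetric]) (simp add: add.commute)
    also have "j powr 2 = j * j" using j by (simp add: power2_eq_square)
    finally show ?thesis using j by simp
  qed
  ultimately have "(\<lambda>n. j powr (1 / \<rho> - 1) - c n / (j * (j + d n / s n))) \<longlonglongrightarrow> 0" by simp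
  then have lim: "(\<lambda>n. (j powr (1 / \<rho> - 1) - c n / (j * (j + d n / s n))) * d n) \<longlonglongrightarrow> 0"
    by (rule null_mult_bounded[where K = K]) (use d in simp)
  show ?thesis
  proof (rule Lim_transform_eventually[OF lim], use c(2) s_pos order_tendstoD(1)[OF jd j] in eventually_elim)
    case (elim n)
    have "x n - 1 / j = - (d n / s n) / (j * (j + d n / s n))"
      using elim j by (simp add: x_def field_simps)
    then have "s n * (c n * (x n - 1 / j)) = - (c n / (j * (j + d n / s n))) * d n"
      using elim by simp
    moreover have "(Q j n (d n) - U (t n / j)) / A n = c n * (x n - 1 / j)"
      using elim(1) by (simp add: Q_def x_def)
    ultimately have "s n * ((Q j n (d n) - U (t n / j)) / A n) = - (c n / (j * (j + d n / s n))) * d n" by simp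
    then show ?case by (simp only: left_diff_distrib mult_minus_left uminus_add_conv_diff)
  qed
qed

lemma Q_bounded_expansion:
  assumes j: "0 < j" and d: "\<And>n. \<bar>d n\<bar> \<le> K"
  shows "(\<lambda>n. (Q j n (d n) - U (t n / j)) / A n) \<longlonglongrightarrow> 0"
proof -
  have "(\<lambda>n. (s n * ((Q j n (d n) - U (t n / j)) / A n) + j powr (1 / \<rho> - 1) * d n) * (1 / s n)
      - j powr (1 / \<rho> - 1) * (d n / s n)) \<longlonglongrightarrow> 0 * 0 - j powr (1 / \<rho> - 1) * 0"
    by (intro tendsto_intros Q_expansion[OF j d] inv_s bounded_div_s[OF d])
  then have "(\<lambda>n. (s n * ((Q j n (d n) - U (t n / j)) / A n) + j powr (1 / \<rho> - 1) * d n) * (1 / s n)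
      - j powr (1 / \<rho> - 1) * (d n / s n)) \<longlonglongrightarrow> 0" by simp
  then show ?thesis
  proof (rule Lim_transform_eventually, use s_pos in eventually_elim)
    case (elim n)
    have "(\<sigma> * X + c * y) * (1 / \<sigma>) - c * (y / \<sigma>) = X" if "0 < \<sigma>" for \<sigma> X c y :: real
      using that by (simp add: field_simps)
    from this[OF elim] show ?case .
  qed
qed

lemma tail_ratio':
  assumes "j \<in> {1, 2, 4}"
  shows "(\<lambda>n. (\<phi> - U (t n / j)) / A n) \<longlonglongrightarrow> \<rho> * j powr (1 / \<rho>)"
  using tail_ratio[OF assms] unfolding t_def A_def .

lemma Q_ratio:
  assumes j: "j \<in> {1, 2, 4}" and d: "\<And>n. \<bar>d n\<bar> \<le> K"
  shows "(\<lambda>n. (Q j n (d n) - \<phi>) / A n) \<longlonglongrightarrow> - (\<rho> * j powr (1 / \<rho>))"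
proof -
  have "0 < j" using j by auto
  from tendsto_diff[OF Q_bounded_expansion[where d = d and K = K, OF this d] tail_ratio'[OF j]]
  show ?thesis by (simp flip: diff_divide_distrib)
qed

lemma r: "1 < r" using \<rho> by simp

lemma powr4: "4 powr x = (2 powr x)\<^sup>2" for x :: real
proof -
  have "4 powr x = (2 * 2) powr x" by simp
  then show ?thesis unfolding powr_mult by (simp add: power2_eq_square)
qed

lemma spacing:
  assumes "\<And>n. \<bar>d1 n\<bar> \<le> K" "\<And>n. \<bar>d2 n\<bar> \<le> K"
  shows "(\<lambda>n. (Q 1 n (d1 n) - Q 2 n (d2 n)) / A n) \<longlonglongrightarrow> \<rho> * (r - 1)"
proof -
  have "(\<lambda>n. (Q 1 n (d1 n) - \<phi>) / A n - (Q 2 n (d2 n) - \<phi>) / A n) \<longlonglongrightarrow> - (\<rho> * 1 powr (1 / \<rho>)) - (- (\<rho> * r))"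
    by (intro tendsto_diff Q_ratio[OF _ assms(1)] Q_ratio[OF _ assms(2)]) auto
  then show ?thesis by (simp add: algebra_simps flip: diff_divide_distrib)
qed

text \<open>Combines an asymptotically linear numerator with a convergent factor, the reciprocal of
  a spacing; boundedness of \<open>d\<close> keeps the error of the factor harmless.\<close>

lemma mult_perturb:
  fixes N g d :: "nat \<Rightarrow> real"
  assumes "(\<lambda>n. N n - d n) \<longlonglongrightarrow> 0" "g \<longlonglongrightarrow> g0" "\<And>n. \<bar>d n\<bar> \<le> K"
  shows "(\<lambda>n. N n * g n - g0 * d n) \<longlonglongrightarrow> 0"
proof -
  have "(\<lambda>n. (N n - d n) * g n) \<longlonglongrightarrow> 0" using tendsto_mult[OF assms(1,2)] by simp
  moreover have "(\<lambda>n. (g n - g0) * d n) \<longlonglongrightarrow> 0"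
    by (rule null_mult_bounded[where K = K]) (use LIM_zero[OF assms(2)] assms(3) in auto)
  ultimately have "(\<lambda>n. (N n - d n) * g n + (g n - g0) * d n) \<longlonglongrightarrow> 0 + 0" by (rule tendsto_add)
  then show ?thesis by (simp add: algebra_simps)
qed

text \<open>The target is \<open>U (1 / p)\<close> and \<open>Q\<close> is centred at
  \<open>U (n / k)\<close>. As \<open>k\<close> is the integer part of \<open>n p\<close>, the ratio
  of the arguments differs from 1 by at most \<open>1 / k\<close>, which vanishes even after
  multiplication by \<open>sqrt k\<close>.\<close>

lemma quantile_limit:
  assumes d1: "\<And>n. \<bar>d1 n\<bar> \<le> K" and d2: "\<And>n. \<bar>d2 n\<bar> \<le> K"
    and p: "filterlim (\<lambda>n. real n * p n) at_top sequentially"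
    and kp: "\<And>n. 1 \<le> n \<Longrightarrow> int (k n) = \<lfloor>real n * p n\<rfloor>"
  shows "(\<lambda>n. sqrt (2 * real (k n)) * ((Q 1 n (d1 n) - U (1 / p n)) / (Q 1 n (d1 n) - Q 2 n (d2 n)))
      - (- (sqrt 2 / (\<rho> * (r - 1)))) * d1 n) \<longlonglongrightarrow> 0"
proof -
  define y where "y n = real (k n) / (real n * p n)" for n
  have np: "\<forall>\<^sub>F n in sequentially. 0 < n \<and> 1 < real n * p n \<and> 0 < real (k n) \<and> real (k n) \<le> real n * p n \<and> real n * p n < real (k n) + 1"
    using eventually_compose_filterlim[OF eventually_gt_at_top[of 1] p] eventually_ge_at_top[of 1]
      eventually_compose_filterlim[OF eventually_gt_at_top[of 0] k]
  proof eventually_elim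
    case (elim n)
    have kr: "real (k n) = real_of_int \<lfloor>real n * p n\<rfloor>" using kp[OF elim(2)] by (metis of_int_of_nat_eq)
    have "real (k n) \<le> real n * p n" "real n * p n < real (k n) + 1" unfolding kr by linarith+
    then show ?case using elim by auto
  qed
  have sy: "(\<lambda>n. s n * (1 - y n)) \<longlonglongrightarrow> 0"
  proof (rule Lim_null_comparison[OF _ inv_s], use np s_pos in eventually_elim)
    case (elim n)
    have ss: "s n * s n = real (k n)" by (simp add: s_def)
    have "0 \<le> 1 - y n" using elim by (simp add: y_def divide_le_eq)
    have "p n \<noteq> 0" using elim by auto
    then have "1 - y n = (real n * p n - real (k n)) / (real n * p n)" using elim by (simp add: y_def diff_divide_distrib)
    also have "\<dots> \<le> 1 / real (k n)" using elim by (intro frac_le) auto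
    finally have "s n * (1 - y n) \<le> s n * (1 / (s n * s n))" using elim unfolding ss by (intro mult_left_mono) auto
    then show ?case using elim \<open>0 \<le> 1 - y n\<close> by (simp add: abs_mult)
  qed
  have "(\<lambda>n. 1 - (s n * (1 - y n)) * (1 / s n)) \<longlonglongrightarrow> 1 - 0 * 0" by (intro tendsto_intros sy inv_s)
  then have "(\<lambda>n. 1 - (s n * (1 - y n)) * (1 / s n)) \<longlonglongrightarrow> 1" by simp
  then have y1: "y \<longlonglongrightarrow> 1"
    by (rule Lim_transform_eventually) (use s_pos in \<open>eventually_elim, simp\<close>)
  obtain c where c: "c \<longlonglongrightarrow> 1 powr (- 1 / \<rho> - 1)"
    "\<forall>\<^sub>F n in sequentially. (U (t n * 1) - U (t n * y n)) / A n = c n * (1 - y n)"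
    using increment[OF tendsto_const y1] by auto
  have "(\<lambda>n. c n * (s n * (1 - y n))) \<longlonglongrightarrow> 1 powr (- 1 / \<rho> - 1) * 0" by (intro tendsto_intros c sy)
  then have cs: "(\<lambda>n. c n * (s n * (1 - y n))) \<longlonglongrightarrow> 0" by simp
  have N: "(\<lambda>n. s n * ((Q 1 n (d1 n) - U (1 / p n)) / A n) - (- d1 n)) \<longlonglongrightarrow> 0"
  proof (rule Lim_transform_eventually)
    show "(\<lambda>n. (s n * ((Q 1 n (d1 n) - U (t n / 1)) / A n) + 1 powr (1 / \<rho> - 1) * d1 n) + c n * (s n * (1 - y n))) \<longlonglongrightarrow> 0"
      using tendsto_add[OF Q_expansion[OF zero_less_one d1] cs] by simp
    show "\<forall>\<^sub>F n in sequentially. (s n * ((Q 1 n (d1 n) - U (t n / 1)) / A n) + 1 powr (1 / \<rho> - 1) * d1 n) + c n * (s n * (1 - y n)) =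
        s n * ((Q 1 n (d1 n) - U (1 / p n)) / A n) - (- d1 n)"
      using c(2) np
    proof eventually_elim
      case (elim n)
      have "t n * y n = 1 / p n" using elim by (simp add: t_def y_def)
      then have "c n * (s n * (1 - y n)) = s n * ((U (t n) - U (1 / p n)) / A n)" using elim(1) by simp
      then show ?case by (simp add: diff_divide_distrib right_diff_distrib)
    qed
  qed
  have "(\<lambda>n. sqrt 2 / ((Q 1 n (d1 n) - Q 2 n (d2 n)) / A n)) \<longlonglongrightarrow> sqrt 2 / (\<rho> * (r - 1))"
    using \<rho> r by (intro tendsto_intros spacing[OF d1 d2]) auto
  from mult_perturb[OF N this, of K] d1
  have lim: "(\<lambda>n. s n * ((Q 1 n (d1 n) - U (1 / p n)) / A n) * (sqrt 2 / ((Q 1 n (d1 n) - Q 2 n (d2 n)) / A n)) - sqrt 2 / (\<rho> * (r - 1)) * (- d1 n)) \<longlonglongrightarrow> 0"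
    by simp
  show ?thesis
    by (rule Lim_transform_eventually[OF lim], use A_pos in eventually_elim) (simp add: s_def real_sqrt_mult)
qed

text \<open>Passing from scale \<open>n / k\<close> to \<open>n / (2 k)\<close> multiplies
  \<open>t U'(t)\<close> by \<open>r\<close> in the limit, so \<open>\<rho> (r - 1)\<close> becomes
  \<open>\<rho> (1 - 1 / r)\<close>.\<close>

lemma spacing_limit:
  assumes d: "\<And>n. \<bar>d1 n\<bar> \<le> K" "\<And>n. \<bar>d2 n\<bar> \<le> K"
  shows "(\<lambda>n. (Q 1 n (d1 n) - Q 2 n (d2 n)) / (real n / (2 * real (k n)) * deriv U (real n / (2 * real (k n)))))
    \<longlonglongrightarrow> \<rho> * (1 - 2 powr (- 1 / \<rho>))"
proof -
  have "(\<lambda>n. deriv U (t n * (1 / 2)) / deriv U (t n)) \<longlonglongrightarrow> (1 / 2) powr (- 1 / \<rho> - 1)"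
    using U_varies[unfolded deriv_varies_def, rule_format, OF t_lim tendsto_const, of "1 / 2"] by simp
  from tendsto_divide[OF spacing[OF d] tendsto_mult[OF tendsto_const[of "1 / 2"] this]]
  have "(\<lambda>n. (Q 1 n (d1 n) - Q 2 n (d2 n)) / A n / (1 / 2 * (deriv U (t n * (1 / 2)) / deriv U (t n)))) \<longlonglongrightarrow>
      \<rho> * (r - 1) / (1 / 2 * (1 / 2) powr (- 1 / \<rho> - 1))"
    by simp
  moreover have "1 / 2 * (1 / 2) powr (- 1 / \<rho> - 1) = r"
    by (simp add: powr_def ln_div exp_diff exp_add algebra_simps)
  moreover have "\<rho> * (r - 1) / r = \<rho> * (1 - 2 powr (- 1 / \<rho>))"
    by (simp add: powr_minus_divide right_diff_distrib diff_divide_distrib)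
  ultimately have lim: "(\<lambda>n. (Q 1 n (d1 n) - Q 2 n (d2 n)) / A n / (1 / 2 * (deriv U (t n * (1 / 2)) / deriv U (t n)))) \<longlonglongrightarrow> \<rho> * (1 - 2 powr (- 1 / \<rho>))"
    by simp
  show ?thesis
  proof (rule Lim_transform_eventually[OF lim], use A_pos in eventually_elim)
    case (elim n)
    have "t n * (1 / 2) = real n / (2 * real (k n))" by (simp add: t_def)
    moreover have "deriv U (t n) \<noteq> 0" "t n \<noteq> 0" using elim by (auto simp: A_def)
    ultimately show ?case by (simp add: A_def t_def mult.commute[of 2])
  qed
qed

end

section \<open>Asymptotic linearity of the endpoint estimators\<close>

locale unbiased_quantiles = intermediate_quantiles +
  assumes bias: "\<And>j. j \<in> {1, 2, 4} \<Longrightarrow> (\<lambda>n. sqrt (real (k n)) * ((\<phi> - U (real n / real (k n) / j)) /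
        (real n / real (k n) * deriv U (real n / real (k n))) - \<rho> * j powr (1 / \<rho>))) \<longlonglongrightarrow> 0"
begin

definition e :: "real \<Rightarrow> nat \<Rightarrow> real \<Rightarrow> real" where
  "e j n d = s n * ((Q j n d - \<phi>) / A n + \<rho> * j powr (1 / \<rho>))"

lemma e_lim:
  assumes j: "j \<in> {1, 2, 4}" and d: "\<And>n. \<bar>d n\<bar> \<le> K"
  shows "(\<lambda>n. e j n (d n) - (- (j powr (1 / \<rho> - 1) * d n))) \<longlonglongrightarrow> 0"
proof -
  have "0 < j" using j by auto
  have b: "(\<lambda>n. s n * ((\<phi> - U (t n / j)) / A n - \<rho> * j powr (1 / \<rho>))) \<longlonglongrightarrow> 0"
    using bias[OF j] by (simp add: s_def t_def A_def)
  have eq: "e j n (d n) - (- (j powr (1 / \<rho> - 1) * d n)) =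
      (s n * ((Q j n (d n) - U (t n / j)) / A n) + j powr (1 / \<rho> - 1) * d n) - s n * ((\<phi> - U (t n / j)) / A n - \<rho> * j powr (1 / \<rho>))" for n
    by (simp add: e_def diff_divide_distrib algebra_simps)
  show ?thesis unfolding eq using tendsto_diff[OF Q_expansion[where d = d and K = K, OF \<open>0 < j\<close> d] b] by simp
qed

lemma Q_e: "\<forall>\<^sub>F n in sequentially. \<forall>d. (Q j n d - \<phi>) / A n = - (\<rho> * j powr (1 / \<rho>)) + e j n d / s n"
  using s_pos by eventually_elim (simp add: e_def)

text \<open>In units of \<open>A\<close>, with \<open>x\<^sub>j = (q\<^sub>j - \<phi>) / A\<close>,
  the numerator is \<open>(r x\<^sub>1 - x\<^sub>2) / (r - 1)\<close>. The limits
  \<open>- \<rho>\<close> and \<open>- \<rho> r\<close> cancel in it, so \<open>sqrt k\<close> times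
  it is the same combination of the errors \<open>e\<close>.\<close>

lemma known_index_limit:
  assumes d1: "\<And>n. \<bar>d1 n\<bar> \<le> K" and d2: "\<And>n. \<bar>d2 n\<bar> \<le> K"
  shows "(\<lambda>n. sqrt (2 * real (k n)) * ((inverse (r - 1) * (Q 1 n (d1 n) - Q 2 n (d2 n)) + Q 1 n (d1 n) - \<phi>) / (Q 1 n (d1 n) - Q 2 n (d2 n)))
    - (- (sqrt 2 * r / (\<rho> * (r - 1)\<^sup>2)) * d1 n + sqrt 2 * r / (2 * \<rho> * (r - 1)\<^sup>2) * d2 n)) \<longlonglongrightarrow> 0"
proof -
  have K: "0 \<le> K" using d1[of 0] by linarith
  define N where "N n = (r * e 1 n (d1 n) - e 2 n (d2 n)) / (r - 1)" for n
  define lin where "lin n = (- r * d1 n + r / 2 * d2 n) / (r - 1)" for n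
  have r1: "0 < r - 1" using r by simp
  have h2: "2 powr (1 / \<rho> - 1) = r / 2" by (simp add: powr_diff)
  have "(\<lambda>n. (r * (e 1 n (d1 n) - (- (1 powr (1 / \<rho> - 1) * d1 n))) - (e 2 n (d2 n) - (- (2 powr (1 / \<rho> - 1) * d2 n)))) / (r - 1)) \<longlonglongrightarrow> (r * 0 - 0) / (r - 1)"
    using r1 by (intro tendsto_intros e_lim[where K = K] d1 d2) auto
  moreover have "(r * (e 1 n (d1 n) - (- (1 powr (1 / \<rho> - 1) * d1 n))) - (e 2 n (d2 n) - (- (2 powr (1 / \<rho> - 1) * d2 n)))) / (r - 1) = N n - lin n" for n
    unfolding h2 N_def lin_def diff_divide_distrib[symmetric] by (simp add: algebra_simps)
  ultimately have N: "(\<lambda>n. N n - lin n) \<longlonglongrightarrow> 0" by simp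
  have lin: "\<bar>lin n\<bar> \<le> (r * K + r / 2 * K) / (r - 1)" for n
  proof -
    have "\<bar>- r * d1 n + r / 2 * d2 n\<bar> \<le> \<bar>- r * d1 n\<bar> + \<bar>r / 2 * d2 n\<bar>" by (rule abs_triangle_ineq)
    also have "\<dots> \<le> r * K + r / 2 * K"
      using d1[of n] d2[of n] unfolding abs_mult by (intro add_mono mult_mono) (use K in auto)
    finally have "\<bar>- r * d1 n + r / 2 * d2 n\<bar> / (r - 1) \<le> (r * K + r / 2 * K) / (r - 1)"
      using r1 by (intro divide_right_mono) auto
    moreover have "\<bar>lin n\<bar> = \<bar>- r * d1 n + r / 2 * d2 n\<bar> / (r - 1)"
      using r1 unfolding lin_def abs_divide by simp
    ultimately show ?thesis by linarith
  qed
  have "(\<lambda>n. sqrt 2 / ((Q 1 n (d1 n) - Q 2 n (d2 n)) / A n)) \<longlonglongrightarrow> sqrt 2 / (\<rho> * (r - 1))"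
    using \<rho> r by (intro tendsto_intros spacing[OF d1 d2]) auto
  from mult_perturb[OF N this lin]
  have lim: "(\<lambda>n. N n * (sqrt 2 / ((Q 1 n (d1 n) - Q 2 n (d2 n)) / A n)) - sqrt 2 / (\<rho> * (r - 1)) * lin n) \<longlonglongrightarrow> 0" .
  have sp: "\<forall>\<^sub>F n in sequentially. 0 < (Q 1 n (d1 n) - Q 2 n (d2 n)) / A n"
    using \<rho> r1 by (intro order_tendstoD(1)[OF spacing[OF d1 d2]]) auto
  show ?thesis
  proof (rule Lim_transform_eventually[OF lim], use A_pos s_pos Q_e[of 1] Q_e[of 2] sp in eventually_elim)
    case (elim n)
    define x1 where "x1 = (Q 1 n (d1 n) - \<phi>) / A n"
    define x2 where "x2 = (Q 2 n (d2 n) - \<phi>) / A n"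
    have x: "x1 = - \<rho> + e 1 n (d1 n) / s n" "x2 = - (\<rho> * r) + e 2 n (d2 n) / s n"
      using elim by (auto simp: x1_def x2_def)
    have Q: "Q 1 n (d1 n) = \<phi> + A n * x1" "Q 2 n (d2 n) = \<phi> + A n * x2"
      using elim(1) unfolding x1_def x2_def by simp_all
    have df: "Q 1 n (d1 n) - Q 2 n (d2 n) = A n * (x1 - x2)" unfolding Q by (simp add: algebra_simps)
    have dpos: "0 < x1 - x2" using elim(5) elim(1) unfolding df by simp
    have gen: "inverse (R - 1) * (a * (y1 - y2)) + (\<phi> + a * y1) - \<phi> = a * ((R * y1 - y2) / (R - 1))"
      "0 < \<sigma> \<Longrightarrow> \<sigma> * ((R * (- \<rho> + f1 / \<sigma>) - (- (\<rho> * R) + f2 / \<sigma>)) / (R - 1)) = (R * f1 - f2) / (R - 1)"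
      if "1 < R" for R a y1 y2 \<sigma> f1 f2
      using that by (simp_all add: field_simps)
    have sq: "sqrt (2 * real (k n)) = sqrt 2 * s n" by (simp add: real_sqrt_mult s_def)
    have num: "inverse (r - 1) * (Q 1 n (d1 n) - Q 2 n (d2 n)) + Q 1 n (d1 n) - \<phi> = A n * ((r * x1 - x2) / (r - 1))"
      unfolding df unfolding Q(1) by (rule gen(1)[OF r])
    have sN: "s n * ((r * x1 - x2) / (r - 1)) = N n"
      unfolding N_def x by (rule gen(2)[OF r elim(2)])
    have "sqrt (2 * real (k n)) * ((inverse (r - 1) * (Q 1 n (d1 n) - Q 2 n (d2 n)) + Q 1 n (d1 n) - \<phi>) / (Q 1 n (d1 n) - Q 2 n (d2 n))) =
        sqrt 2 * s n * (A n * ((r * x1 - x2) / (r - 1)) / (A n * (x1 - x2)))"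
      unfolding num sq by (simp only: df)
    also have "\<dots> = N n * (sqrt 2 / (x1 - x2))" unfolding sN[symmetric] using elim(1) by simp
    finally have "sqrt (2 * real (k n)) * ((inverse (r - 1) * (Q 1 n (d1 n) - Q 2 n (d2 n)) + Q 1 n (d1 n) - \<phi>) / (Q 1 n (d1 n) - Q 2 n (d2 n))) =
        N n * (sqrt 2 / (x1 - x2))" .
    moreover have "(Q 1 n (d1 n) - Q 2 n (d2 n)) / A n = x1 - x2" unfolding df using elim by simp
    moreover have "sqrt 2 / (\<rho> * (r - 1)) * lin n = - (sqrt 2 * r / (\<rho> * (r - 1)\<^sup>2)) * d1 n + sqrt 2 * r / (2 * \<rho> * (r - 1)\<^sup>2) * d2 n"
    proof -
      have "c / (\<rho> * D) * ((- R * y1 + R / 2 * y2) / D) = - (c * R / (\<rho> * D\<^sup>2)) * y1 + c * R / (2 * \<rho> * D\<^sup>2) * y2"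
        if "0 < D" for c D R y1 y2 using that \<rho> by (simp add: field_simps power2_eq_square)
      then show ?thesis unfolding lin_def using r1 by blast
    qed
    ultimately show ?case by simp
  qed
qed

text \<open>Since \<open>2 powr (1 / \<rho>h)\<close> is exactly the ratio of the two spacings, the
  estimator is Aitken extrapolation of \<open>q\<^sub>4, q\<^sub>2, q\<^sub>1\<close>, with error
  \<open>A (x\<^sub>2^2 - x\<^sub>1 x\<^sub>4) / (\<Delta>2 - \<Delta>1)\<close>. The limits
  \<open>- \<rho>\<close>, \<open>- \<rho> r\<close>, \<open>- \<rho> r^2\<close> are geometric, so
  the leading term cancels. Hence estimating the index costs no rate.\<close>

lemma estimated_index_limit:
  assumes d1: "\<And>n. \<bar>d1 n\<bar> \<le> K" and d2: "\<And>n. \<bar>d2 n\<bar> \<le> K" and d4: "\<And>n. \<bar>d4 n\<bar> \<le> K"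
  defines "\<rho>h \<equiv> \<lambda>n. ln 2 * inverse (ln ((Q 2 n (d2 n) - Q 4 n (d4 n)) / (Q 1 n (d1 n) - Q 2 n (d2 n))))"
    and "b \<equiv> sqrt 2 * r\<^sup>2 / (\<rho> * (r - 1) ^ 3)"
  shows "(\<lambda>n. sqrt (2 * real (k n)) * ((inverse (2 powr (1 / \<rho>h n) - 1) * (Q 1 n (d1 n) - Q 2 n (d2 n)) + Q 1 n (d1 n) - \<phi>) / (Q 1 n (d1 n) - Q 2 n (d2 n)))
    - (- b * d1 n + b * d2 n + (- b / 4) * d4 n)) \<longlonglongrightarrow> 0"
proof -
  have K: "0 \<le> K" using d1[of 0] by linarith
  have r1: "0 < r - 1" using r by simp
  define e1 where "e1 n = e 1 n (d1 n)" for n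
  define e2 where "e2 n = e 2 n (d2 n)" for n
  define e4 where "e4 n = e 4 n (d4 n)" for n
  have h2: "2 powr (1 / \<rho> - 1) = r / 2" by (simp add: powr_diff)
  have h4: "4 powr (1 / \<rho> - 1) = r\<^sup>2 / 4" "4 powr (1 / \<rho>) = r\<^sup>2" by (simp_all add: powr_diff powr4)
  have e: "(\<lambda>n. e1 n - (- d1 n)) \<longlonglongrightarrow> 0" "(\<lambda>n. e2 n - (- (r / 2 * d2 n))) \<longlonglongrightarrow> 0" "(\<lambda>n. e4 n - (- (r\<^sup>2 / 4 * d4 n))) \<longlonglongrightarrow> 0"
    using e_lim[of 1 d1 K] e_lim[of 2 d2 K] e_lim[of 4 d4 K] d1 d2 d4 by (auto simp: e1_def e2_def e4_def h2 h4)
  have es: "(\<lambda>n. f n / s n) \<longlonglongrightarrow> 0" "(\<lambda>n. f n * g n / s n) \<longlonglongrightarrow> 0"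
    if f: "(\<lambda>n. f n - c * d n) \<longlonglongrightarrow> 0" "\<And>n. \<bar>d n\<bar> \<le> K" and g: "(\<lambda>n. g n - c' * d' n) \<longlonglongrightarrow> 0" "\<And>n. \<bar>d' n\<bar> \<le> K" for f g d d' c c'
  proof -
    have 1: "(\<lambda>n. f n / s n) \<longlonglongrightarrow> 0" if "(\<lambda>n. f n - c * d n) \<longlonglongrightarrow> 0" "\<And>n. \<bar>d n\<bar> \<le> K" for f c d
    proof -
      have "(\<lambda>n. (f n - c * d n) * (1 / s n) + c * (d n / s n)) \<longlonglongrightarrow> 0 * 0 + c * 0"
        by (intro tendsto_intros that(1) inv_s bounded_div_s[where K = K] that(2))
      then show ?thesis by (simp add: diff_divide_distrib left_diff_distrib)
    qed
    show "(\<lambda>n. f n / s n) \<longlonglongrightarrow> 0" by (rule 1[OF f])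
    have "(\<lambda>n. (g n - c' * d' n) * (f n / s n) + c' * ((f n / s n) * d' n)) \<longlonglongrightarrow> 0 * 0 + c' * 0"
      by (intro tendsto_intros g(1) 1[OF f] null_mult_bounded[OF 1[OF f], where K = K] always_eventually allI g(2))
    then show "(\<lambda>n. f n * g n / s n) \<longlonglongrightarrow> 0" by (simp add: algebra_simps diff_divide_distrib)
  qed
  have e': "(\<lambda>n. e1 n - (- 1) * d1 n) \<longlonglongrightarrow> 0" "(\<lambda>n. e2 n - (- (r / 2)) * d2 n) \<longlonglongrightarrow> 0" "(\<lambda>n. e4 n - (- (r\<^sup>2 / 4)) * d4 n) \<longlonglongrightarrow> 0"
    using e by simp_all
  \<comment> \<open>The expansion of \<open>sqrt k (x\<^sub>2^2 - x\<^sub>1 x\<^sub>4)\<close>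
    around the geometric limits. The bracket holds the second-order terms, which keep a factor
    \<open>1 / s\<close>.\<close>
  define N where "N n = \<rho> * r\<^sup>2 * e1 n - 2 * \<rho> * r * e2 n + \<rho> * e4 n + (e2 n * e2 n / s n - e1 n * e4 n / s n)" for n
  define lin where "lin n = \<rho> * r\<^sup>2 * (- d1 n + d2 n - d4 n / 4)" for n
  have "(\<lambda>n. \<rho> * r\<^sup>2 * (e1 n - (- d1 n)) - 2 * \<rho> * r * (e2 n - (- (r / 2 * d2 n))) + \<rho> * (e4 n - (- (r\<^sup>2 / 4 * d4 n)))
      + (e2 n * e2 n / s n - e1 n * e4 n / s n)) \<longlonglongrightarrow> \<rho> * r\<^sup>2 * 0 - 2 * \<rho> * r * 0 + \<rho> * 0 + (0 - 0)"
    by (intro tendsto_intros e es(2)[OF e'(2) d2 e'(2) d2] es(2)[OF e'(1) d1 e'(3) d4])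
  moreover have "\<rho> * r\<^sup>2 * (e1 n - (- d1 n)) - 2 * \<rho> * r * (e2 n - (- (r / 2 * d2 n))) + \<rho> * (e4 n - (- (r\<^sup>2 / 4 * d4 n)))
      + (e2 n * e2 n / s n - e1 n * e4 n / s n) = N n - lin n" for n
    by (simp add: N_def lin_def algebra_simps power2_eq_square)
  ultimately have N: "(\<lambda>n. N n - lin n) \<longlonglongrightarrow> 0" by simp
  have lin: "\<bar>lin n\<bar> \<le> \<rho> * r\<^sup>2 * (3 * K)" for n
  proof -
    have "\<bar>- d1 n + d2 n - d4 n / 4\<bar> \<le> 3 * K" using d1[of n] d2[of n] d4[of n] K unfolding abs_le_iff by linarith
    then show ?thesis using \<rho> unfolding lin_def abs_mult by (intro mult_mono) auto
  qed
  define x1 where "x1 n = (Q 1 n (d1 n) - \<phi>) / A n" for n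
  define x2 where "x2 n = (Q 2 n (d2 n) - \<phi>) / A n" for n
  define x4 where "x4 n = (Q 4 n (d4 n) - \<phi>) / A n" for n
  have xl: "x1 \<longlonglongrightarrow> - \<rho>" "x2 \<longlonglongrightarrow> - (\<rho> * r)" "x4 \<longlonglongrightarrow> - (\<rho> * r\<^sup>2)"
    using Q_ratio[of 1 d1 K] Q_ratio[of 2 d2 K] Q_ratio[of 4 d4 K] d1 d2 d4 h4 by (auto simp: x1_def[abs_def] x2_def[abs_def] x4_def[abs_def])
  have "(\<lambda>n. x1 n - x2 n) \<longlonglongrightarrow> - \<rho> - (- (\<rho> * r))" by (intro tendsto_intros xl)
  then have l12: "(\<lambda>n. x1 n - x2 n) \<longlonglongrightarrow> \<rho> * (r - 1)" by (simp add: algebra_simps)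
  have "(\<lambda>n. x2 n - x4 n) \<longlonglongrightarrow> - (\<rho> * r) - (- (\<rho> * r\<^sup>2))" by (intro tendsto_intros xl)
  then have l24: "(\<lambda>n. x2 n - x4 n) \<longlonglongrightarrow> \<rho> * r * (r - 1)" by (simp add: algebra_simps power2_eq_square)
  from tendsto_diff[OF l24 l12] have l: "(\<lambda>n. (x2 n - x4 n) - (x1 n - x2 n)) \<longlonglongrightarrow> \<rho> * (r - 1)\<^sup>2"
    by (simp add: algebra_simps power2_eq_square)
  have "(\<lambda>n. sqrt 2 / (((x2 n - x4 n) - (x1 n - x2 n)) * (x1 n - x2 n))) \<longlonglongrightarrow> sqrt 2 / (\<rho> * (r - 1)\<^sup>2 * (\<rho> * (r - 1)))"
    using \<rho> r1 by (intro tendsto_intros l l12) auto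
  from mult_perturb[OF N this lin]
  have lim: "(\<lambda>n. N n * (sqrt 2 / (((x2 n - x4 n) - (x1 n - x2 n)) * (x1 n - x2 n))) - sqrt 2 / (\<rho> * (r - 1)\<^sup>2 * (\<rho> * (r - 1))) * lin n) \<longlonglongrightarrow> 0" .
  have pos: "\<forall>\<^sub>F n in sequentially. 0 < x1 n - x2 n" "\<forall>\<^sub>F n in sequentially. 0 < x2 n - x4 n" "\<forall>\<^sub>F n in sequentially. 0 < (x2 n - x4 n) - (x1 n - x2 n)"
    by (rule order_tendstoD(1)[OF l12] order_tendstoD(1)[OF l24] order_tendstoD(1)[OF l];
        intro mult_pos_pos zero_less_power \<rho> r1; simp)+
  show ?thesis
  proof (rule Lim_transform_eventually[OF lim], use A_pos s_pos Q_e[of 1] Q_e[of 2] Q_e[of 4] pos in eventually_elim)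
    case (elim n)
    have x: "x1 n = - \<rho> + e1 n / s n" "x2 n = - (\<rho> * r) + e2 n / s n" "x4 n = - (\<rho> * r\<^sup>2) + e4 n / s n"
      using elim h4 by (auto simp: x1_def x2_def x4_def e1_def e2_def e4_def)
    have Q: "Q 1 n (d1 n) = \<phi> + A n * x1 n" "Q 2 n (d2 n) = \<phi> + A n * x2 n" "Q 4 n (d4 n) = \<phi> + A n * x4 n"
      using elim(1) unfolding x1_def x2_def x4_def by simp_all
    have df: "Q 1 n (d1 n) - Q 2 n (d2 n) = A n * (x1 n - x2 n)" "Q 2 n (d2 n) - Q 4 n (d4 n) = A n * (x2 n - x4 n)"
      unfolding Q by (simp_all add: algebra_simps)
    define \<Delta>1 where "\<Delta>1 = x1 n - x2 n"
    define \<Delta>2 where "\<Delta>2 = x2 n - x4 n"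
    have \<Delta>: "0 < \<Delta>1" "0 < \<Delta>2" "0 < \<Delta>2 - \<Delta>1" using elim by (auto simp: \<Delta>1_def \<Delta>2_def)
    \<comment> \<open>Positive spacings are what makes logarithm and power cancel here.\<close>
    have P: "2 powr (1 / \<rho>h n) = \<Delta>2 / \<Delta>1"
      unfolding \<rho>h_def df \<Delta>1_def[symmetric] \<Delta>2_def[symmetric] using elim \<Delta> by (simp add: powr_def field_simps)
    have "\<Delta>2 / \<Delta>1 - 1 = (\<Delta>2 - \<Delta>1) / \<Delta>1" using \<Delta> by (simp add: diff_divide_distrib)
    then have inv: "inverse (2 powr (1 / \<rho>h n) - 1) = \<Delta>1 / (\<Delta>2 - \<Delta>1)" by (simp only: P inverse_divide)
    have "inverse (2 powr (1 / \<rho>h n) - 1) * (Q 1 n (d1 n) - Q 2 n (d2 n)) + Q 1 n (d1 n) - \<phi> =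
        A n * (\<Delta>1 * \<Delta>1 / (\<Delta>2 - \<Delta>1) + x1 n)"
      unfolding inv df(1) \<Delta>1_def[symmetric] unfolding Q(1) by (simp add: distrib_left mult_ac)
    also have "\<Delta>1 * \<Delta>1 / (\<Delta>2 - \<Delta>1) + x1 n = (x2 n * x2 n - x1 n * x4 n) / (\<Delta>2 - \<Delta>1)"
    proof -
      have "\<Delta>1 * \<Delta>1 + x1 n * (\<Delta>2 - \<Delta>1) = x2 n * x2 n - x1 n * x4 n"
        by (simp add: \<Delta>1_def \<Delta>2_def algebra_simps)
      moreover have "\<Delta>1 * \<Delta>1 / (\<Delta>2 - \<Delta>1) + x1 n = (\<Delta>1 * \<Delta>1 + x1 n * (\<Delta>2 - \<Delta>1)) / (\<Delta>2 - \<Delta>1)"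
        using \<Delta> by (simp add: add_divide_distrib)
      ultimately show ?thesis by simp
    qed
    finally have num: "inverse (2 powr (1 / \<rho>h n) - 1) * (Q 1 n (d1 n) - Q 2 n (d2 n)) + Q 1 n (d1 n) - \<phi> =
        A n * ((x2 n * x2 n - x1 n * x4 n) / (\<Delta>2 - \<Delta>1))" .
    have "\<sigma> * ((- (\<rho> * R) + f2 / \<sigma>) * (- (\<rho> * R) + f2 / \<sigma>) - (- \<rho> + f1 / \<sigma>) * (- (\<rho> * R\<^sup>2) + f4 / \<sigma>)) =
        \<rho> * R\<^sup>2 * f1 - 2 * \<rho> * R * f2 + \<rho> * f4 + (f2 * f2 / \<sigma> - f1 * f4 / \<sigma>)" if "0 < \<sigma>" for \<sigma> R f1 f2 f4
      using that by (simp add: field_simps power2_eq_square)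
    then have sN: "s n * (x2 n * x2 n - x1 n * x4 n) = N n"
      unfolding N_def x using elim(2) by blast
    have sq: "sqrt (2 * real (k n)) = sqrt 2 * s n" by (simp add: real_sqrt_mult s_def)
    have "sqrt (2 * real (k n)) * ((inverse (2 powr (1 / \<rho>h n) - 1) * (Q 1 n (d1 n) - Q 2 n (d2 n)) + Q 1 n (d1 n) - \<phi>) / (Q 1 n (d1 n) - Q 2 n (d2 n))) =
        sqrt 2 * s n * (A n * ((x2 n * x2 n - x1 n * x4 n) / (\<Delta>2 - \<Delta>1)) / (A n * \<Delta>1))"
      unfolding num sq by (simp only: df(1) \<Delta>1_def)
    also have "\<dots> = N n * (sqrt 2 / ((\<Delta>2 - \<Delta>1) * \<Delta>1))"
      unfolding sN[symmetric] using elim(1) by simp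
    finally have "sqrt (2 * real (k n)) * ((inverse (2 powr (1 / \<rho>h n) - 1) * (Q 1 n (d1 n) - Q 2 n (d2 n)) + Q 1 n (d1 n) - \<phi>) / (Q 1 n (d1 n) - Q 2 n (d2 n))) =
        N n * (sqrt 2 / ((\<Delta>2 - \<Delta>1) * \<Delta>1))" .
    moreover have "sqrt 2 / (\<rho> * (r - 1)\<^sup>2 * (\<rho> * (r - 1))) * lin n = - b * d1 n + b * d2 n + (- b / 4) * d4 n"
    proof -
      have "sqrt 2 / (\<rho> * (r - 1)\<^sup>2 * (\<rho> * (r - 1))) * (\<rho> * r\<^sup>2) = b"
        using \<rho> by (simp add: b_def power2_eq_square power3_eq_cube)
      then have "sqrt 2 / (\<rho> * (r - 1)\<^sup>2 * (\<rho> * (r - 1))) * lin n = b * (- d1 n + d2 n - d4 n / 4)"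
        unfolding lin_def by (metis mult.assoc)
      then show ?thesis by (simp add: algebra_simps)
    qed
    ultimately show ?case by (simp add: \<Delta>1_def \<Delta>2_def)
  qed
qed

end

text \<open>The variances in the shape produced by the linear coefficients, using
  \<open>2^(-1/\<rho>) = 1 / r\<close>. For the second, coefficients \<open>- b, b, - b / 4\<close>
  give \<open>(1 + 9 + 2) / 16 = 3 / 4\<close> times \<open>b^2\<close>; for the third,
  \<open>- b', b' / 2, 0\<close> give \<open>1 / 2\<close> times \<open>b'^2\<close>.\<close>

lemma V1_eq:
  assumes "0 < \<rho>"
  defines "r \<equiv> 2 powr (1 / \<rho>)"
  shows "V1 \<rho> = (sqrt 2 / (\<rho> * (r - 1)))\<^sup>2"
    and "V2 \<rho> = 3 / 4 * (sqrt 2 * r\<^sup>2 / (\<rho> * (r - 1) ^ 3))\<^sup>2"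
    and "V3 \<rho> = 1 / 2 * (sqrt 2 * r / (\<rho> * (r - 1)\<^sup>2))\<^sup>2"
proof -
  have r: "1 < r" using assms by simp
  have inv: "2 powr (- 1 / \<rho>) = 1 / r" by (simp add: r_def powr_minus_divide)
  have inv2: "2 powr (- 2 / \<rho>) = 1 / r\<^sup>2"
  proof -
    have "2 powr (- 2 / \<rho>) = 2 powr (- 1 / \<rho> + - 1 / \<rho>)" by simp
    then show ?thesis unfolding powr_add inv by (simp add: power2_eq_square)
  qed
  have pr: "\<rho> powr (- 2) = 1 / \<rho>\<^sup>2" using assms by (simp add: powr_minus_divide)
  have d: "1 / r - 1 = - ((r - 1) / r)" using r by (simp add: field_simps)
  have a1: "2 powr (1 - 2 / \<rho>) = 2 / r\<^sup>2" using inv2 by (simp add: powr_diff powr_minus_divide)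
  have a2: "2 powr (- 1 - 2 / \<rho>) = 1 / (2 * r\<^sup>2)" using inv2 by (simp add: powr_diff powr_minus_divide)
  have pw: "(- x) ^ 2 = x ^ 2" "(- x) ^ 4 = x ^ 4" "(- x) ^ 6 = x ^ 6" for x :: real by simp_all
  have r0: "r - 1 \<noteq> 0" "r \<noteq> 0" "\<rho> \<noteq> 0" using r assms by auto
  show "V1 \<rho> = (sqrt 2 / (\<rho> * (r - 1)))\<^sup>2"
    unfolding V1_def inv pr a1 d pw using r0 by (simp add: power_divide power_mult_distrib)
  show "V2 \<rho> = 3 / 4 * (sqrt 2 * r\<^sup>2 / (\<rho> * (r - 1) ^ 3))\<^sup>2"
    unfolding V2_def inv pr a2 d pw using r0
    by (simp add: power_divide power_mult_distrib flip: power_mult) (simp add: divide_simps eval_nat_numeral)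
  show "V3 \<rho> = 1 / 2 * (sqrt 2 * r / (\<rho> * (r - 1)\<^sup>2))\<^sup>2"
    unfolding V3_def inv pr inv2 d pw using r0
    by (simp add: power_divide power_mult_distrib flip: power_mult) (simp add: divide_simps eval_nat_numeral)
qed

section \<open>The conditional tail under the three sets of hypotheses\<close>

text \<open>Here \<open>e\<close> bounds the relative oscillation of \<open>V\<close>. The tail
  expansion with \<open>E = C \<bar>e t\<bar> V t\<close>, evaluated at \<open>t / j\<close> and
  divided by \<open>t U'(t) = t^(-1/\<rho>) V t\<close>, bounds the bias by a multiple of
  \<open>\<bar>e t\<bar>\<close>.\<close>

lemma increment_bound_bias:
  fixes U V e :: "real \<Rightarrow> real"
  assumes "0 < \<rho>" "0 \<le> C" "\<eta> < 1 / \<rho>"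
    and diff: "\<And>t. t1 < t \<Longrightarrow> U differentiable (at t)" and pos: "\<And>t. t1 < t \<Longrightarrow> 0 < deriv U t"
    and lim: "(U \<longlongrightarrow> \<phi>) at_top"
    and V: "\<And>t. V t = t powr (1 + 1 / \<rho>) * deriv U t"
    and bound: "\<forall>\<^sub>F t in at_top. \<forall>z\<ge>1/8. \<bar>V (t * z) - V t\<bar> \<le> C * z powr \<eta> * (\<bar>e t\<bar> * V t)"
    and t: "filterlim t at_top sequentially" and e: "(\<lambda>n. s n * e (t n)) \<longlonglongrightarrow> 0" and j: "j \<in> {1, 2, 4}"
  shows "(\<lambda>n. s n * ((\<phi> - U (t n / j)) / (t n * deriv U (t n)) - \<rho> * j powr (1 / \<rho>))) \<longlonglongrightarrow> 0"
proof -
  define B where "B = C / (1 / \<rho> - \<eta>) * (1 / j) powr (\<eta> - 1 / \<rho>)"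
  have j': "0 < j" "1 / 8 \<le> 1 / j" using j by auto
  have "\<forall>\<^sub>F t in at_top. \<bar>(\<phi> - U (t / j)) / (t * deriv U t) - \<rho> * j powr (1 / \<rho>)\<bar> \<le> B * \<bar>e t\<bar>"
    using bound eventually_gt_at_top[of "8 * t1"] eventually_gt_at_top[of t1] eventually_gt_at_top[of 0]
  proof eventually_elim
    case (elim t)
    have t1': "t1 < s" if "t / 8 \<le> s" for s using that elim by linarith
    have Vpos: "0 < V t" using pos[of t] elim by (simp add: V)
    define E where "E = C * (\<bar>e t\<bar> * V t)"
    have E: "0 \<le> E" using \<open>0 \<le> C\<close> Vpos by (simp add: E_def)
    have tj: "t / 8 \<le> t / j" using j elim by auto
    have "\<bar>\<phi> - U (t / j) - \<rho> * (t / j) powr (- 1 / \<rho>) * V t\<bar> \<le> E / (1 / \<rho> - \<eta>) * (t / j) powr (\<eta> - 1 / \<rho>) * t powr (- \<eta>)"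
    proof (rule tail_expansion[OF elim(4) \<open>0 < \<rho>\<close> E \<open>\<eta> < 1 / \<rho>\<close> diff lim V _ tj])
      fix s assume s: "t / 8 \<le> s"
      then have "1 / 8 \<le> s / t" using elim by (simp add: field_simps)
      from elim(1)[rule_format, OF this] show "\<bar>V s - V t\<bar> \<le> E * (s / t) powr \<eta>"
        using elim by (simp add: E_def mult_ac)
    qed (rule t1')
    also have "(t / j) powr (\<eta> - 1 / \<rho>) = t powr \<eta> * t powr (- 1 / \<rho>) * (1 / j) powr (\<eta> - 1 / \<rho>)"
    proof -
      have "(t / j) powr (\<eta> - 1 / \<rho>) = (t * (1 / j)) powr (\<eta> - 1 / \<rho>)" by simp
      also have "\<dots> = t powr (\<eta> + - 1 / \<rho>) * (1 / j) powr (\<eta> - 1 / \<rho>)" using elim j' by (subst powr_mult) auto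
      finally show ?thesis by (simp only: powr_add)
    qed
    also have "E / (1 / \<rho> - \<eta>) * (t powr \<eta> * t powr (- 1 / \<rho>) * (1 / j) powr (\<eta> - 1 / \<rho>)) * t powr (- \<eta>) =
        B * \<bar>e t\<bar> * (t powr (- 1 / \<rho>) * V t)"
    proof -
      have "t powr \<eta> * t powr (- \<eta>) = 1" using elim by (simp flip: powr_add)
      then show ?thesis by (simp add: E_def B_def mult_ac)
    qed
    finally have main: "\<bar>\<phi> - U (t / j) - \<rho> * (t / j) powr (- 1 / \<rho>) * V t\<bar> \<le> B * \<bar>e t\<bar> * (t powr (- 1 / \<rho>) * V t)" .
    have A: "t * deriv U t = t powr (- 1 / \<rho>) * V t"
    proof -
      have "t powr (- 1 / \<rho>) * t powr (1 + 1 / \<rho>) = t" using elim by (simp flip: powr_add)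
      then show ?thesis by (simp add: V flip: mult.assoc)
    qed
    have tjp: "(t / j) powr (- 1 / \<rho>) = t powr (- 1 / \<rho>) * j powr (1 / \<rho>)"
      using elim j' by (simp add: powr_divide powr_minus_divide)
    define a where "a = t powr (- 1 / \<rho>) * V t"
    have a: "0 < a" using elim Vpos by (simp add: a_def)
    have "(\<phi> - U (t / j)) / a - \<rho> * j powr (1 / \<rho>) = (\<phi> - U (t / j) - \<rho> * (t / j) powr (- 1 / \<rho>) * V t) / a"
    proof -
      have eq: "\<rho> * (t / j) powr (- 1 / \<rho>) * V t = \<rho> * j powr (1 / \<rho>) * a"
        unfolding tjp a_def by (simp only: mult_ac)
      have "b / a - d = (b - d * a) / a" for b d using a by (simp add: diff_divide_distrib)
      then show ?thesis unfolding eq .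
    qed
    then have "\<bar>(\<phi> - U (t / j)) / a - \<rho> * j powr (1 / \<rho>)\<bar> = \<bar>\<phi> - U (t / j) - \<rho> * (t / j) powr (- 1 / \<rho>) * V t\<bar> / a"
      using a by (simp add: abs_divide)
    also have "\<dots> \<le> B * \<bar>e t\<bar>" using main[folded a_def] a by (subst pos_divide_le_eq) auto
    finally show ?case unfolding A a_def .
  qed
  then have ev: "\<forall>\<^sub>F n in sequentially. \<bar>(\<phi> - U (t n / j)) / (t n * deriv U (t n)) - \<rho> * j powr (1 / \<rho>)\<bar> \<le> B * \<bar>e (t n)\<bar>"
    by (rule eventually_compose_filterlim[OF _ t])
  have "(\<lambda>n. B * \<bar>s n * e (t n)\<bar>) \<longlonglongrightarrow> B * \<bar>0\<bar>" by (intro tendsto_intros e)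
  then have "(\<lambda>n. B * \<bar>s n * e (t n)\<bar>) \<longlonglongrightarrow> 0" by simp
  then show ?thesis
  proof (rule Lim_null_comparison[rotated], use ev in eventually_elim)
    case (elim n)
    have "\<bar>s n\<bar> * \<bar>(\<phi> - U (t n / j)) / (t n * deriv U (t n)) - \<rho> * j powr (1 / \<rho>)\<bar> \<le> \<bar>s n\<bar> * (B * \<bar>e (t n)\<bar>)"
      by (rule mult_left_mono[OF elim]) simp
    then show ?case by (simp add: abs_mult mult_ac)
  qed
qed

section \<open>The conditional distribution function and its quantile function\<close>

locale frontier_sample = prob_space M for M :: "'w measure" +
  fixes X :: "'w \<Rightarrow> real^'p" and Y :: "'w \<Rightarrow> real"
    and Xs :: "nat \<Rightarrow> 'w \<Rightarrow> real^'p" and Ys :: "nat \<Rightarrow> 'w \<Rightarrow> real"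
    and x :: "real^'p" and \<rho> :: real and k :: "nat \<Rightarrow> nat"
  assumes X [measurable]: "X \<in> borel_measurable M" and Y [measurable]: "Y \<in> borel_measurable M"
    and nonneg: "AE \<omega> in M. 0 \<le> X \<omega> \<and> 0 \<le> Y \<omega>"
    and sample_indep: "indep_vars (\<lambda>_. borel) (\<lambda>i \<omega>. (Xs i \<omega>, Ys i \<omega>)) {1..}"
    and sample_identical: "\<forall>i\<ge>1. distr M borel (\<lambda>\<omega>. (Xs i \<omega>, Ys i \<omega>)) = distr M borel (\<lambda>\<omega>. (X \<omega>, Y \<omega>))"
    and FX_pos: "0 < marg_cdf M X x"
    and bdd: "bdd_above {y. 0 \<le> y \<and> cond_cdf M X Y x y < 1}"
    and \<rho>: "0 < \<rho>" and k_pos: "\<forall>n\<ge>1. 0 < k n"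
begin

abbreviation "FX \<equiv> marg_cdf M X x"
abbreviation "G \<equiv> cond_cdf M X Y x"
abbreviation "\<phi> \<equiv> frontier_of_cdf G"
abbreviation "U \<equiv> tail_quantile M X Y x"

definition E :: "real \<Rightarrow> ((real^'p) \<times> real) set" where "E y = {..x} \<times> {y<..}"

lemma E_borel: "E y \<in> sets borel"
  unfolding E_def by (intro borel_Times borel_closed borel_open closed_eucl_atMost) auto

definition S :: "real \<Rightarrow> real" where "S y = FX * (1 - G y)"

lemma X_le_sets [measurable]: "{\<omega> \<in> space M. X \<omega> \<le> x} \<in> sets M"
proof -
  have "{..x} \<in> sets borel" by (intro borel_closed closed_eucl_atMost)
  from measurable_sets[OF X this] show ?thesis by (simp add: vimage_def Int_def conj_commute)
qed

text \<open>The law of \<open>Y\<close> restricted to the event \<open>X <= x\<close>, of total mass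
  \<open>FX\<close>. Its distribution function is \<open>FX * G\<close>, so \<open>G\<close>
  inherits monotonicity, right continuity and the limit at infinity from the theory of finite
  measures.\<close>

definition \<mu> :: "real measure" where
  "\<mu> = distr (density M (indicator {\<omega> \<in> space M. X \<omega> \<le> x})) borel Y"

lemma emeasure_\<mu>:
  assumes "B \<in> sets borel"
  shows "emeasure \<mu> B = emeasure M {\<omega> \<in> space M. X \<omega> \<le> x \<and> Y \<omega> \<in> B}"
proof -
  have "emeasure \<mu> B = emeasure (density M (indicator {\<omega> \<in> space M. X \<omega> \<le> x})) (Y -` B \<inter> space M)"
    unfolding \<mu>_def using assms by (subst emeasure_distr) auto
  also have "\<dots> = (\<integral>\<^sup>+ \<omega>. indicator {\<omega> \<in> space M. X \<omega> \<le> x} \<omega> * indicator (Y -` B \<inter> space M) \<omega> \<partial>M)"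
    using assms by (subst emeasure_density) auto
  also have "\<dots> = (\<integral>\<^sup>+ \<omega>. indicator ({\<omega> \<in> space M. X \<omega> \<le> x} \<inter> (Y -` B \<inter> space M)) \<omega> \<partial>M)"
    by (intro nn_integral_cong) (auto simp: indicator_def)
  also have "\<dots> = emeasure M ({\<omega> \<in> space M. X \<omega> \<le> x} \<inter> (Y -` B \<inter> space M))"
    using assms by (intro nn_integral_indicator sets.Int X_le_sets measurable_sets[OF Y]) auto
  also have "{\<omega> \<in> space M. X \<omega> \<le> x} \<inter> (Y -` B \<inter> space M) = {\<omega> \<in> space M. X \<omega> \<le> x \<and> Y \<omega> \<in> B}" by auto
  finally show ?thesis .
qed

sublocale \<mu>: finite_borel_measure \<mu>
proof (intro finite_borel_measure.intro finite_borel_measure_axioms.intro finite_measureI)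
  show "sets \<mu> = sets borel" by (simp add: \<mu>_def)
  show "emeasure \<mu> (space \<mu>) \<noteq> \<infinity>" using emeasure_\<mu>[of UNIV] by (simp add: \<mu>_def)
qed

lemma cdf_\<mu>: "cdf \<mu> y = FX * G y"
proof -
  have "cdf \<mu> y = joint_cdf M X Y x y"
    unfolding cdf_def joint_cdf_def measure_def using emeasure_\<mu>[of "{..y}"] by simp
  then show ?thesis using FX_pos by (simp add: cond_cdf_def)
qed

lemma G_eq: "G y = cdf \<mu> y / FX" using FX_pos by (simp add: cdf_\<mu>)

lemma G_mono: "y \<le> z \<Longrightarrow> G y \<le> G z"
  unfolding G_eq using FX_pos by (intro divide_right_mono \<mu>.cdf_nondecreasing) auto

lemma G_right_cont: "(G \<longlongrightarrow> G y) (at_right y)"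
proof -
  have "(cdf \<mu> \<longlongrightarrow> cdf \<mu> y) (at_right y)"
    using \<mu>.cdf_is_right_cont[of y] by (simp add: continuous_within)
  then have "((\<lambda>z. cdf \<mu> z / FX) \<longlongrightarrow> cdf \<mu> y / FX) (at_right y)"
    by (rule tendsto_divide) (use FX_pos in auto)
  then show ?thesis by (simp add: G_eq[abs_def])
qed

lemma G_lim: "(G \<longlongrightarrow> 1) at_top"
proof -
  have "measure \<mu> (space \<mu>) = FX"
    unfolding measure_def marg_cdf_def using emeasure_\<mu>[of UNIV] by (simp add: \<mu>_def)
  then have "(cdf \<mu> \<longlongrightarrow> FX) at_top" using \<mu>.cdf_lim_at_top by simp
  then have "((\<lambda>z. cdf \<mu> z / FX) \<longlongrightarrow> FX / FX) at_top"
    by (rule tendsto_divide) (use FX_pos in auto)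
  then show ?thesis using FX_pos by (simp add: G_eq[abs_def])
qed

lemma G_le_1: "G y \<le> 1"
  by (rule tendsto_lowerbound[OF G_lim]) (use eventually_ge_at_top[of y] in \<open>eventually_elim, simp add: G_mono\<close>, simp)

lemma G_neg:
  assumes "y < 0"
  shows "G y = 0"
proof -
  have "measure M {\<omega> \<in> space M. X \<omega> \<le> x \<and> Y \<omega> \<le> y} = measure M {}"
    by (rule measure_eq_AE) (use nonneg assms in \<open>auto elim: eventually_mono\<close>)
  then show ?thesis by (simp add: cond_cdf_def joint_cdf_def)
qed

lemma S_prob: "S y = prob {\<omega> \<in> space M. (X \<omega>, Y \<omega>) \<in> E y}"
proof -
  have "{\<omega> \<in> space M. X \<omega> \<le> x} = {\<omega> \<in> space M. X \<omega> \<le> x \<and> Y \<omega> \<le> y} \<union> {\<omega> \<in> space M. (X \<omega>, Y \<omega>) \<in> E y}"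
    by (auto simp: E_def)
  moreover have m: "{\<omega> \<in> space M. X \<omega> \<le> x \<and> Y \<omega> \<le> y} \<in> sets M" "{\<omega> \<in> space M. (X \<omega>, Y \<omega>) \<in> E y} \<in> sets M"
  proof -
    have "{\<omega> \<in> space M. X \<omega> \<le> x \<and> Y \<omega> \<le> y} = {\<omega> \<in> space M. X \<omega> \<le> x} \<inter> {\<omega> \<in> space M. Y \<omega> \<le> y}" by auto
    then show "{\<omega> \<in> space M. X \<omega> \<le> x \<and> Y \<omega> \<le> y} \<in> sets M" using X_le_sets by simp
    have "{\<omega> \<in> space M. (X \<omega>, Y \<omega>) \<in> E y} = {\<omega> \<in> space M. X \<omega> \<le> x} \<inter> {\<omega> \<in> space M. y < Y \<omega>}" by (auto simp: E_def)
    then show "{\<omega> \<in> space M. (X \<omega>, Y \<omega>) \<in> E y} \<in> sets M" using X_le_sets by simp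
  qed
  ultimately have "FX = joint_cdf M X Y x y + prob {\<omega> \<in> space M. (X \<omega>, Y \<omega>) \<in> E y}"
    unfolding marg_cdf_def joint_cdf_def by (simp add: E_def finite_measure_Union[symmetric] disjoint_iff)
  then show ?thesis using FX_pos by (simp add: S_def cond_cdf_def right_diff_distrib)
qed

lemma S_antimono: "y \<le> z \<Longrightarrow> S z \<le> S y"
  unfolding S_def using FX_pos G_mono by (intro mult_left_mono) auto

lemma U_eq: "U t = Inf {y. 0 \<le> y \<and> 1 - 1 / (t * FX) \<le> G y}"
  by (simp add: tail_quantile_def quantile_of_cdf_def)

lemma U_set_nonempty:
  assumes "0 < t"
  shows "{y. 0 \<le> y \<and> 1 - 1 / (t * FX) \<le> G y} \<noteq> {}"
proof -
  have "1 - 1 / (t * FX) < 1" using assms FX_pos by simp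
  from order_tendstoD(1)[OF G_lim this] eventually_ge_at_top[of 0]
  have "\<forall>\<^sub>F y in at_top. 0 \<le> y \<and> 1 - 1 / (t * FX) \<le> G y" by eventually_elim simp
  then show ?thesis by (auto dest: eventually_happens)
qed

lemma U_nonneg: "0 < t \<Longrightarrow> 0 \<le> U t"
  unfolding U_eq by (rule cInf_greatest[OF U_set_nonempty]) auto

lemma U_le: "0 \<le> y \<Longrightarrow> 1 - 1 / (t * FX) \<le> G y \<Longrightarrow> U t \<le> y"
  unfolding U_eq by (rule cInf_lower) (auto intro: bdd_belowI[of _ 0])

lemma less_U:
  assumes "0 < t" "0 \<le> y" "G y < 1 - 1 / (t * FX)"
  shows "y \<le> U t"
  unfolding U_eq
proof (rule cInf_greatest[OF U_set_nonempty[OF assms(1)]])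
  fix z assume z: "z \<in> {y. 0 \<le> y \<and> 1 - 1 / (t * FX) \<le> G y}"
  show "y \<le> z"
  proof (rule ccontr)
    assume "\<not> y \<le> z"
    then have "G z \<le> G y" by (intro G_mono) simp
    then show False using z assms by simp
  qed
qed

lemma U_mono:
  assumes "0 < s" "s \<le> t"
  shows "U s \<le> U t"
  unfolding U_eq[of t]
proof (rule cInf_greatest[OF U_set_nonempty])
  show "0 < t" using assms by simp
  fix z assume z: "z \<in> {y. 0 \<le> y \<and> 1 - 1 / (t * FX) \<le> G y}"
  have "1 / (t * FX) \<le> 1 / (s * FX)" using assms FX_pos by (intro divide_left_mono mult_right_mono mult_pos_pos) auto
  then show "U s \<le> z" using z by (intro U_le) auto
qed

text \<open>Right continuity of \<open>G\<close> makes the infimum defining the quantile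
  attained.\<close>

lemma G_U:
  assumes "0 < t"
  shows "1 - 1 / (t * FX) \<le> G (U t)"
proof (rule tendsto_lowerbound[OF G_right_cont])
  show "\<forall>\<^sub>F y in at_right (U t). 1 - 1 / (t * FX) \<le> G y"
    unfolding eventually_at_right_field
  proof (intro exI[of _ "U t + 1"] conjI allI impI)
    fix y assume "U t < y"
    then obtain z where "z \<in> {y. 0 \<le> y \<and> 1 - 1 / (t * FX) \<le> G y}" "z < y"
      using cInf_lessD[OF U_set_nonempty[OF assms], of y] unfolding U_eq by blast
    then show "1 - 1 / (t * FX) \<le> G y" using G_mono[of z y] by auto
  qed simp
qed simp

lemma G_lt_1:
  assumes "{y. 0 \<le> y \<and> G y < 1} \<noteq> {}" "y < \<phi>"
  shows "G y < 1"
proof -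
  obtain z where "z \<in> {y. 0 \<le> y \<and> G y < 1}" "y < z"
    using assms less_cSup_iff[OF assms(1) bdd] by (auto simp: frontier_of_cdf_def)
  then show ?thesis using G_mono[of y z] by auto
qed

text \<open>Even if 0 is the given point of the set, right continuity extends \<open>G < 1\<close>
  beyond it.\<close>

lemma \<phi>_pos:
  assumes ne: "{y. 0 \<le> y \<and> G y < 1} \<noteq> {}"
  shows "0 < \<phi>"
proof -
  obtain y where y: "0 \<le> y" "G y < 1" using ne by auto
  have "\<forall>\<^sub>F z in at_right y. G z < 1" by (rule order_tendstoD(2)[OF G_right_cont y(2)])
  moreover have "\<forall>\<^sub>F z in at_right y. y < z" by (simp add: eventually_at_filter)
  ultimately have "\<forall>\<^sub>F z in at_right y. y < z \<and> G z < 1" by eventually_elim simp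
  then obtain z where z: "y < z" "G z < 1" by (auto dest: eventually_happens)
  then have "z \<le> \<phi>" unfolding frontier_of_cdf_def using y by (intro cSup_upper bdd) auto
  then show ?thesis using y z by linarith
qed

lemma G_\<phi>:
  assumes ne: "{y. 0 \<le> y \<and> G y < 1} \<noteq> {}" and "\<phi> \<le> y"
  shows "G y = 1"
proof -
  have "1 \<le> G \<phi>"
  proof (rule tendsto_lowerbound[OF G_right_cont])
    show "\<forall>\<^sub>F z in at_right \<phi>. 1 \<le> G z"
      unfolding eventually_at_right_field
    proof (intro exI[of _ "\<phi> + 1"] conjI allI impI)
      fix z assume z: "\<phi> < z"
      show "1 \<le> G z"
      proof (rule ccontr)
        assume "\<not> 1 \<le> G z"
        then have "z \<in> {y. 0 \<le> y \<and> G y < 1}" using z \<phi>_pos[OF ne] by auto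
        then have "z \<le> \<phi>" unfolding frontier_of_cdf_def by (intro cSup_upper bdd)
        then show False using z by simp
      qed
    qed simp
  qed simp
  then show ?thesis using G_mono[OF assms(2)] G_le_1[of y] by simp
qed

lemma U_lim:
  assumes ne: "{y. 0 \<le> y \<and> G y < 1} \<noteq> {}"
  shows "(U \<longlongrightarrow> \<phi>) at_top"
proof (rule tendstoI)
  fix \<epsilon> :: real assume \<epsilon>: "0 < \<epsilon>"
  define y where "y = max 0 (\<phi> - \<epsilon> / 2)"
  have y: "0 \<le> y" "y < \<phi>" "\<phi> - \<epsilon> < y" using \<epsilon> \<phi>_pos[OF ne] by (auto simp: y_def)
  have "G y < 1" by (rule G_lt_1[OF ne y(2)])
  then have Gy: "0 < FX * (1 - G y)" using FX_pos by simp
  show "\<forall>\<^sub>F t in at_top. dist (U t) \<phi> < \<epsilon>"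
    using eventually_gt_at_top[of "1 / (FX * (1 - G y))"] eventually_gt_at_top[of 0]
  proof eventually_elim
    case (elim t)
    have "1 < t * (FX * (1 - G y))" using elim(1) by (simp only: pos_divide_less_eq[OF Gy])
    then have "1 < (1 - G y) * (t * FX)" by (simp add: mult_ac)
    then have "1 / (t * FX) < 1 - G y" using elim FX_pos by (subst pos_divide_less_eq) auto
    then have "y \<le> U t" using elim y by (intro less_U) auto
    moreover have "U t \<le> \<phi>" using \<phi>_pos[OF ne] G_\<phi>[OF ne order_refl] elim FX_pos by (intro U_le) auto
    ultimately show ?case using y by (simp add: dist_real_def)
  qed
qed

text \<open>Excludes the degenerate case \<open>Y = 0\<close> on \<open>X \<le> x\<close>, where the frontier is the supremum of
  the empty set.\<close>

lemma nonempty_of_deriv: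
  assumes "\<exists>\<^sub>F t in at_top. deriv G (\<phi> - 1 / t) \<noteq> 0"
  shows "{y. 0 \<le> y \<and> G y < 1} \<noteq> {}"
proof
  assume empty: "{y. 0 \<le> y \<and> G y < 1} = {}"
  then have G1: "G y = 1" if "0 \<le> y" for y using that G_le_1[of y] by (auto simp: not_less intro: antisym)
  have "\<forall>\<^sub>F t in at_top. deriv G (\<phi> - 1 / t) = 0"
  proof (cases "\<phi> \<le> 0")
    case True
    show ?thesis using eventually_gt_at_top[of 0]
    proof eventually_elim
      case (elim t)
      then have "0 < 1 / t" by simp
      then have "\<phi> - 1 / t < 0" using True by linarith
      then have "\<forall>\<^sub>F y in nhds (\<phi> - 1 / t). y \<in> {..<0}" by (intro eventually_nhds_in_open) auto
      then have "\<forall>\<^sub>F y in nhds (\<phi> - 1 / t). G y = (\<lambda>_. 0) y" by eventually_elim (simp add: G_neg)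
      then have "deriv G (\<phi> - 1 / t) = deriv (\<lambda>_. 0) (\<phi> - 1 / t)" by (intro deriv_cong_ev) auto
      then show ?case by simp
    qed
  next
    case False
    then have "0 < \<phi>" by simp
    show ?thesis using eventually_gt_at_top[of "1 / \<phi>"] eventually_gt_at_top[of 0]
    proof eventually_elim
      case (elim t)
      then have "0 < \<phi> - 1 / t" using \<open>0 < \<phi>\<close> by (simp add: field_simps)
      then have "\<forall>\<^sub>F y in nhds (\<phi> - 1 / t). y \<in> {0<..}" by (intro eventually_nhds_in_open) auto
      then have "\<forall>\<^sub>F y in nhds (\<phi> - 1 / t). G y = (\<lambda>_. 1) y" by eventually_elim (simp add: G1)
      then have "deriv G (\<phi> - 1 / t) = deriv (\<lambda>_. 1) (\<phi> - 1 / t)" by (intro deriv_cong_ev) auto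
      then show ?case by simp
    qed
  qed
  then show False using assms by (simp add: frequently_def)
qed

text \<open>Strict increase just to the left of \<open>\<phi> - v\<close> rules out a flat piece
  ending there, on which the infimum would lie further left.\<close>

lemma U_inverse:
  assumes v: "0 < v" "v < v0" "v0 \<le> \<phi>"
    and strict: "\<And>y. \<phi> - v0 < y \<Longrightarrow> y < \<phi> - v \<Longrightarrow> G y < G (\<phi> - v)"
    and lt: "G (\<phi> - v) < 1"
  shows "U (1 / (FX * (1 - G (\<phi> - v)))) = \<phi> - v"
proof -
  define t where "t = 1 / (FX * (1 - G (\<phi> - v)))"
  have t: "0 < t" using FX_pos lt by (simp add: t_def)
  have \<alpha>: "1 - 1 / (t * FX) = G (\<phi> - v)" using FX_pos lt by (simp add: t_def)
  have "U t \<le> \<phi> - v" using v by (intro U_le) (auto simp: \<alpha>)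
  moreover have "\<phi> - v \<le> U t"
  proof (rule ccontr)
    assume "\<not> ?thesis"
    then have less: "U t < \<phi> - v" by simp
    \<comment> \<open>\<open>U t\<close> may lie below \<open>\<phi> - v0\<close>, where strictness
      is not given; the maximum with a midpoint moves it into the known region.\<close>
    define y where "y = max (U t) (\<phi> - (v + v0) / 2)"
    have y: "\<phi> - v0 < y" "y < \<phi> - v" "U t \<le> y"
    proof -
      have "\<phi> - v0 < \<phi> - (v + v0) / 2" "\<phi> - (v + v0) / 2 < \<phi> - v" using v by (simp_all add: field_simps)
      then show "\<phi> - v0 < y" "y < \<phi> - v" "U t \<le> y" unfolding y_def using less by (auto simp: less_max_iff_disj)
    qed
    have "G (U t) \<le> G y" by (rule G_mono[OF y(3)])
    also have "\<dots> < G (\<phi> - v)" by (rule strict[OF y(1,2)])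
    finally show False using G_U[OF t] by (simp add: \<alpha>)
  qed
  ultimately show ?thesis unfolding t_def[symmetric] by simp
qed

text \<open>If \<open>g\<close> were eventually nonpositive, then \<open>g\<inverse>(n)\<close>
  would be infinite and the admissible rate 0, contradicting \<open>k n >= 1\<close>. Used to
  exclude a jump of \<open>G\<close> at the endpoint.\<close>

lemma small_o_rate_nontrivial:
  assumes "small_o_rate k g"
  shows "\<exists>\<^sub>F t in at_top. 0 < g t"
proof (rule ccontr)
  assume "\<not> ?thesis"
  then have "\<forall>\<^sub>F t in at_top. \<not> 0 < g t" by (simp add: frequently_def)
  then obtain t1 where t1: "\<And>t. t \<ge> t1 \<Longrightarrow> \<not> 0 < g t" unfolding eventually_at_top_linorder by blast
  obtain t2 where t2: "\<And>t. t \<ge> t2 \<Longrightarrow> (\<lambda>n. real (k n)) \<in> o(\<lambda>n. real_of_ereal (ereal (real n) / gen_inverse_from t g (real n)))"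
    using assms unfolding small_o_rate_def eventually_at_top_linorder by blast
  define t0 where "t0 = max t1 t2"
  have inf: "gen_inverse_from t0 g (real n) = \<infinity>" if "1 \<le> n" for n
  proof -
    have e: "{t. t0 \<le> t \<and> real n \<le> g t} = {}"
    proof (intro equals0I)
      fix t assume "t \<in> {t. t0 \<le> t \<and> real n \<le> g t}"
      then have "t1 \<le> t" "real n \<le> g t" by (auto simp: t0_def)
      moreover have "1 \<le> real n" using that by simp
      ultimately show False using t1[of t] by linarith
    qed
    show ?thesis unfolding gen_inverse_from_def e by (simp add: top_ereal_def)
  qed
  have "\<forall>\<^sub>F n in sequentially. norm (real (k n)) \<le> 1 * norm (real_of_ereal (ereal (real n) / gen_inverse_from t0 g (real n)))"
    by (rule landau_o.smallD[OF t2]) (auto simp: t0_def)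
  with eventually_ge_at_top[of 1] have "\<forall>\<^sub>F n in sequentially. False"
    by eventually_elim (use k_pos in \<open>auto simp: inf\<close>)
  then show False by simp
qed

text \<open>The hypotheses under which all limit laws except the endpoint ones hold; \<open>t\<^sub>1\<close> bounds
  the region where \<open>U\<close> is the inverse of \<open>1 / S\<close>.\<close>

definition good_tail :: "real \<Rightarrow> bool" where
  "good_tail t1 \<longleftrightarrow> 0 < t1 \<and> (\<forall>t>t1. U differentiable (at t) \<and> 0 < deriv U t \<and> S (U t) = 1 / t) \<and> deriv_varies \<rho> U"

definition unbiased :: bool where
  "unbiased \<longleftrightarrow> filterlim (\<lambda>n. real n / real (k n)) at_top sequentially \<and>
    (\<forall>j\<in>{1, 2, 4}. (\<lambda>n. sqrt (real (k n)) * ((\<phi> - U (real n / real (k n) / j)) /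
        (real n / real (k n) * deriv U (real n / real (k n))) - \<rho> * j powr (1 / \<rho>))) \<longlonglongrightarrow> 0)"

text \<open>Karamata's theorem for the tail \<open>p\<close> turns regular variation of the density
  into the von Mises condition for \<open>U\<close>, from which both the variation of
  \<open>U'\<close> and the ratios of tail differences follow.\<close>

lemma positive_density_case:
  assumes dens: "has_positive_density_upto G \<phi>"
    and rv: "regularly_varying (1 - \<rho>) (\<lambda>t. deriv G (\<phi> - 1 / t))"
  shows "\<exists>t1. good_tail t1"
    and "filterlim t at_top sequentially \<Longrightarrow> 0 < j \<Longrightarrow>
      (\<lambda>n::nat. (\<phi> - U (t n / j)) / (t n * deriv U (t n))) \<longlonglongrightarrow> \<rho> * j powr (1 / \<rho>)"
proof -
  have ne: "{y. 0 \<le> y \<and> G y < 1} \<noteq> {}"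
    by (rule nonempty_of_deriv, rule eventually_frequently[OF _ regularly_varying_nonzero[OF rv]]) simp
  note \<phi>0 = \<phi>_pos[OF ne]
  define p where "p v = 1 - G (\<phi> - v)" for v
  have dG: "(G has_real_derivative deriv G y) (at y)" "0 < deriv G y" if "0 < y" "y < \<phi>" for y
    using dens that unfolding has_positive_density_upto_def by (auto simp: DERIV_deriv_iff_real_differentiable)
  have dp: "(p has_real_derivative deriv G (\<phi> - v)) (at v)" if "0 < v" "v < \<phi>" for v
  proof -
    have "((\<lambda>v. G (\<phi> - v)) has_real_derivative deriv G (\<phi> - v) * (- 1)) (at v)"
      using that by (intro DERIV_chain2[OF dG(1)]) (auto intro!: derivative_eq_intros)
    from DERIV_diff[OF DERIV_const[of 1] this] show ?thesis unfolding p_def by simp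
  qed
  have dp': "deriv p v = deriv G (\<phi> - v)" if "0 < v" "v < \<phi>" for v by (rule DERIV_imp_deriv[OF dp[OF that]])
  have strict: "G y < G z" if "0 < y" "y < z" "z < \<phi>" for y z
  proof (rule DERIV_pos_imp_increasing[OF that(2)])
    fix u assume "y \<le> u" "u \<le> z"
    then have "0 < u" "u < \<phi>" using that by auto
    then show "\<exists>d. (G has_real_derivative d) (at u) \<and> 0 < d" using dG by blast
  qed
  \<comment> \<open>The integral identity up to the endpoint makes \<open>G\<close> left continuous
    at \<phi>, so the tail vanishes there and no atom remains.\<close>
  have p_lim: "(p \<longlongrightarrow> 0) (at_right 0)"
  proof -
    have hi: "(deriv G has_integral (G y - G 0)) {0..y}" if "y \<in> {0..\<phi>}" for y
      using dens that unfolding has_positive_density_upto_def by blast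
    have "continuous_on {0..\<phi>} (\<lambda>y. integral {0..y} (deriv G))"
      using hi[of \<phi>] \<phi>0 by (intro indefinite_integral_continuous_1) auto
    then have "continuous_on {0..\<phi>} (\<lambda>y. G y - G 0)"
      by (rule continuous_on_eq) (use hi in \<open>auto intro!: integral_unique\<close>)
    from continuous_on_add[OF this continuous_on_const[of _ "G 0"]]
    have "continuous_on {0..\<phi>} (\<lambda>y. (G y - G 0) + G 0)" .
    then have "continuous (at \<phi> within {0..\<phi>}) G" using \<phi>0 by (simp add: continuous_on_eq_continuous_within)
    moreover have "at \<phi> within {0..\<phi>} = at_left \<phi>" by (rule at_within_Icc_at_left[OF \<phi>0])
    ultimately have "(G \<longlongrightarrow> G \<phi>) (at_left \<phi>)" by (simp add: continuous_within)
    then have "(G \<longlongrightarrow> 1) (at_left \<phi>)" by (simp add: G_\<phi>[OF ne])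
    moreover have "filterlim (\<lambda>v. \<phi> - v) (at_left \<phi>) (at_right 0)"
      by (auto simp: filterlim_at eventually_at_filter intro!: tendsto_eq_intros)
    ultimately have "((\<lambda>v. G (\<phi> - v)) \<longlongrightarrow> 1) (at_right 0)" by (rule filterlim_compose)
    from tendsto_diff[OF tendsto_const[of 1] this] show ?thesis by (simp add: p_def[abs_def])
  qed
  have p_diff: "p differentiable (at v)" if "0 < v" "v < \<phi>" for v
    using dp[OF that] by (auto simp: real_differentiable_def)
  have p_pos: "0 < deriv p v" if "0 < v" "v < \<phi>" for v using dG(2)[of "\<phi> - v"] that by (simp add: dp')
  have inv: "U (1 / (FX * p v)) = \<phi> - v" if "0 < v" "v < \<phi>" for v
    unfolding p_def using that G_lt_1[OF ne] by (intro U_inverse[of v \<phi>] strict) auto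
  obtain t1 where t1: "0 < t1" "\<And>t. t1 < t \<Longrightarrow> 0 < \<phi> - U t \<and> \<phi> - U t < \<phi> \<and> FX * p (\<phi> - U t) = 1 / t \<and>
      (U has_real_derivative 1 / (t\<^sup>2 * FX * deriv p (\<phi> - U t))) (at t)"
    using tail_inverse(1)[OF p_diff p_pos \<phi>0 FX_pos p_lim inv] by blast
  have Ulim: "(U \<longlongrightarrow> \<phi>) at_top" by (rule U_lim[OF ne])
  have dU: "deriv U t = 1 / (t\<^sup>2 * FX * deriv p (\<phi> - U t))" if "t1 < t" for t
    using t1(2)[OF that] by (intro DERIV_imp_deriv) auto
  have "regularly_varying (1 - \<rho>) (\<lambda>t. deriv p (1 / t))"
  proof (rule regularly_varying_cong[OF _ rv])
    show "\<forall>\<^sub>F t in at_top. deriv G (\<phi> - 1 / t) = deriv p (1 / t)"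
      using eventually_gt_at_top[of "1 / \<phi>"] eventually_gt_at_top[of 0]
      by eventually_elim (use \<phi>0 in \<open>simp add: dp' field_simps\<close>)
  qed
  from karamata_at_right_0[OF p_diff \<phi>0 \<rho> p_lim this]
  have kar: "((\<lambda>v. p v / (v * deriv p v)) \<longlongrightarrow> 1 / \<rho>) (at_right 0)" .
  have ev: "\<forall>\<^sub>F t in at_top. U differentiable (at t)" "\<forall>\<^sub>F t in at_top. U t < \<phi>"
    using eventually_gt_at_top[of t1] by (eventually_elim, use t1(2) in \<open>force simp: real_differentiable_def\<close>)+
  have v_at: "filterlim (\<lambda>t. \<phi> - U t) (at_right 0) at_top"
    unfolding filterlim_at using tendsto_diff[OF tendsto_const[of \<phi>] Ulim] ev(2) by (auto elim: eventually_mono)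
  have vm: "((\<lambda>t. t * deriv U t / (\<phi> - U t)) \<longlongrightarrow> 1 / \<rho>) at_top"
  proof (rule Lim_transform_eventually[OF filterlim_compose[OF kar v_at]])
    show "\<forall>\<^sub>F t in at_top. p (\<phi> - U t) / ((\<phi> - U t) * deriv p (\<phi> - U t)) = t * deriv U t / (\<phi> - U t)"
      using eventually_gt_at_top[of t1]
    proof eventually_elim
      case (elim t)
      have "0 < t" using elim t1(1) by linarith
      have "FX * p (\<phi> - U t) = 1 / t" using t1(2)[OF elim] by blast
      moreover have "p (\<phi> - U t) = FX * p (\<phi> - U t) / FX" using FX_pos by simp
      ultimately have "p (\<phi> - U t) = 1 / t / FX" by simp
      then show ?case unfolding dU[OF elim] using \<open>0 < t\<close> by (simp add: power2_eq_square mult_ac)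
    qed
  qed
  have dv: "deriv_varies \<rho> U" by (rule von_mises_deriv_varies[OF ev vm \<rho>])
  have "good_tail t1"
    unfolding good_tail_def
  proof (intro conjI allI impI dv t1(1))
    fix t assume t: "t1 < t"
    show "U differentiable (at t)" using t1(2)[OF t] by (auto simp: real_differentiable_def)
    have "0 < t" using t t1(1) by linarith
    then show "0 < deriv U t" unfolding dU[OF t] using t1(2)[OF t] p_pos[of "\<phi> - U t"] FX_pos by simp
    show "S (U t) = 1 / t" using t1(2)[OF t] by (simp add: S_def p_def)
  qed
  then show "\<exists>t1. good_tail t1" by blast
  show "(\<lambda>n::nat. (\<phi> - U (t n / j)) / (t n * deriv U (t n))) \<longlonglongrightarrow> \<rho> * j powr (1 / \<rho>)"
    if t: "filterlim t at_top sequentially" and j: "0 < j" for t j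
  proof -
    have "(\<lambda>n. (\<phi> - U (t n * (1 / j))) / (\<phi> - U (t n)) / (t n * deriv U (t n) / (\<phi> - U (t n)))) \<longlonglongrightarrow> (1 / j) powr (- 1 / \<rho>) / (1 / \<rho>)"
      using j \<rho> by (intro tendsto_divide von_mises_ratio[OF ev vm t tendsto_const] filterlim_compose[OF vm t]) auto
    moreover have eq: "(1 / j) powr (- 1 / \<rho>) / (1 / \<rho>) = \<rho> * j powr (1 / \<rho>)"
      using j by (simp add: powr_divide powr_minus_divide)
    ultimately have lim: "(\<lambda>n. (\<phi> - U (t n * (1 / j))) / (\<phi> - U (t n)) / (t n * deriv U (t n) / (\<phi> - U (t n)))) \<longlonglongrightarrow> \<rho> * j powr (1 / \<rho>)"
      unfolding eq by blast
    show ?thesis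
      by (rule Lim_transform_eventually[OF lim], use eventually_compose_filterlim[OF ev(2) t] in eventually_elim) simp
  qed
qed

text \<open>The condition places \<open>V\<close> in a de Haan class, so \<open>V\<close> varies
  slowly and \<open>U'\<close> regularly. The bias is governed by \<open>e = A / V\<close>, and the
  rate function is exactly \<open>t / e(t)^2\<close>.\<close>

lemma condition_a_case:
  assumes cond: "condition_a \<rho> FX U k"
  shows "\<exists>t1. good_tail t1" and "unbiased"
proof -
  define V where "V t = t powr (1 + 1 / \<rho>) * deriv U t" for t
  obtain A s where diff: "\<And>t. 1 / FX < t \<Longrightarrow> U differentiable (at t)" and pos: "\<And>t. 1 / FX < t \<Longrightarrow> 0 < deriv U t"
    and A: "\<And>t. 1 / FX < t \<Longrightarrow> 0 < A t" and s: "s \<in> {1, - 1}"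
    and conv: "\<And>z. 0 < z \<Longrightarrow> ((\<lambda>t. (V (t * z) - V t) / A t) \<longlongrightarrow> s * ln z) at_top"
    and rate: "small_o_rate k (\<lambda>t. t powr (3 + 2 / \<rho>) * (deriv U t / A t)\<^sup>2)"
    using cond unfolding condition_a_def V_def by blast
  have t1: "0 < 1 / FX" using FX_pos by simp
  have der: "(U has_real_derivative deriv U t) (at t)" if "1 / FX < t" for t
    using diff[OF that] by (simp add: DERIV_deriv_iff_real_differentiable)
  have strict: "U a < U b" if "1 / FX < a" "a < b" for a b
  proof (rule DERIV_pos_imp_increasing[OF that(2)])
    fix u assume "a \<le> u" "u \<le> b"
    then have "1 / FX < u" using that by linarith
    then show "\<exists>d. (U has_real_derivative d) (at u) \<and> 0 < d" using der pos by blast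
  qed
  \<comment> \<open>If \<open>G\<close> overshot the order at \<open>U t\<close>, then slightly
    larger orders would have the same quantile, contradicting the strict increase of
    \<open>U\<close>.\<close>
  have GU: "G (U t) = 1 - 1 / (t * FX)" if t: "1 / FX < t" for t
  proof (rule antisym)
    have tp: "0 < t" using t t1 by linarith
    show "1 - 1 / (t * FX) \<le> G (U t)" by (rule G_U[OF tp])
    show "G (U t) \<le> 1 - 1 / (t * FX)"
    proof (rule ccontr)
      assume "\<not> ?thesis"
      then have *: "1 - G (U t) < 1 / (t * FX)" by simp
      have "((\<lambda>h. 1 / (h * FX)) \<longlongrightarrow> 1 / (t * FX)) (at_right t)"
        using tp FX_pos by (intro tendsto_intros) auto
      from order_tendstoD(1)[OF this *]
      have "\<forall>\<^sub>F h in at_right t. 1 - G (U t) < 1 / (h * FX)" .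
      moreover have "\<forall>\<^sub>F h in at_right t. t < h" by (simp add: eventually_at_filter)
      ultimately have "\<forall>\<^sub>F h in at_right t. t < h \<and> 1 - G (U t) < 1 / (h * FX)" by eventually_elim simp
      then obtain h where h: "t < h" "1 - G (U t) < 1 / (h * FX)" by (auto dest: eventually_happens)
      have "U h \<le> U t" using U_nonneg[OF tp] h by (intro U_le) auto
      then show False using strict[OF t h(1)] by simp
    qed
  qed
  have ne: "{y. 0 \<le> y \<and> G y < 1} \<noteq> {}"
  proof -
    have "G (U (2 / FX)) = 1 - 1 / (2 / FX * FX)" using FX_pos by (intro GU) (simp add: divide_strict_right_mono)
    then have "G (U (2 / FX)) < 1" using FX_pos by simp
    moreover have "0 \<le> U (2 / FX)" using FX_pos by (intro U_nonneg) simp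
    ultimately show ?thesis by blast
  qed
  \<comment> \<open>Below \<open>1 / FX\<close> nothing is known of \<open>U\<close>; the cut-off
    makes the function measurable.\<close>
  define V' where "V' t = (if 1 / FX < t then V t else 0)" for t
  have V'm: "V' \<in> borel_measurable borel"
  proof -
    have "V' = (\<lambda>t. t powr (1 + 1 / \<rho>) * (if 1 / FX < t then deriv U t else 0))" by (auto simp: V'_def V_def)
    moreover have "(\<lambda>t. if 1 / FX < t then deriv U t else 0) \<in> borel_measurable borel"
      by (rule borel_measurable_deriv_tail[OF diff])
    ultimately show ?thesis by simp
  qed
  have V'V: "\<forall>\<^sub>F t in at_top. V' t = V t"
    using eventually_gt_at_top[of "1 / FX"] by eventually_elim (simp add: V'_def)
  have Vpos: "0 < V t" if "1 / FX < t" for t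
  proof -
    have "0 < t" using that t1 by linarith
    then show ?thesis using pos[OF that] by (simp add: V_def)
  qed
  interpret dh: de_haan_class V' A s
  proof
    show "V' \<in> borel_measurable borel" by (rule V'm)
    show "s \<in> {1, - 1}" by (rule s)
    show "\<forall>\<^sub>F t in at_top. 0 < A t" using eventually_gt_at_top[of "1 / FX"] by eventually_elim (rule A)
    show "\<forall>\<^sub>F t in at_top. 0 < V' t"
      using V'V eventually_gt_at_top[of "1 / FX"] by eventually_elim (simp add: Vpos)
    fix z :: real assume z: "0 < z"
    show "((\<lambda>t. (V' (t * z) - V' t) / A t) \<longlongrightarrow> s * ln z) at_top"
      by (rule Lim_transform_eventually[OF conv[OF z]],
        use V'V eventually_compose_filterlim[OF V'V filterlim_at_top_mult_const[OF z]] in eventually_elim) simp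
  qed
  have dv: "deriv_varies \<rho> U"
    unfolding deriv_varies_def
  proof (intro allI impI)
    fix t z :: "nat \<Rightarrow> real" and z0 :: real
    assume t: "filterlim t at_top sequentially" and z: "z \<longlonglongrightarrow> z0" "0 < z0"
    note tz = filterlim_mult_tendsto_pos_at_top[OF t z]
    have "(\<lambda>n. z n powr (- 1 / \<rho> - 1) * (V' (t n * z n) / V' (t n))) \<longlonglongrightarrow> z0 powr (- 1 / \<rho> - 1) * 1"
      using z by (intro tendsto_intros dh.slowly_varying[OF t z]) auto
    then have lim: "(\<lambda>n. z n powr (- 1 / \<rho> - 1) * (V' (t n * z n) / V' (t n))) \<longlonglongrightarrow> z0 powr (- 1 / \<rho> - 1)" by simp
    show "(\<lambda>n. deriv U (t n * z n) / deriv U (t n)) \<longlonglongrightarrow> z0 powr (- 1 / \<rho> - 1)"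
    proof (rule Lim_transform_eventually[OF lim], use eventually_compose_filterlim[OF V'V t] eventually_compose_filterlim[OF V'V tz]
        eventually_compose_filterlim[OF eventually_gt_at_top[of 0] t] order_tendstoD(1)[OF z] in eventually_elim)
      case (elim n)
      have "z n powr (- 1 / \<rho> - 1) * z n powr (1 + 1 / \<rho>) = 1" using elim by (simp flip: powr_add)
      then have "z n powr (- 1 / \<rho> - 1) * V (t n * z n) = t n powr (1 + 1 / \<rho>) * deriv U (t n * z n)"
        using elim by (simp add: V_def powr_mult)
      then have "z n powr (- 1 / \<rho> - 1) * (V (t n * z n) / V (t n)) = t n powr (1 + 1 / \<rho>) * deriv U (t n * z n) / V (t n)" by simp
      then show ?case using elim by (simp add: V_def)
    qed
  qed
  show "\<exists>t1. good_tail t1"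
  proof (intro exI[of _ "1 / FX"], unfold good_tail_def, intro conjI allI impI t1 dv)
    fix t assume t: "1 / FX < t"
    show "U differentiable (at t)" "0 < deriv U t" using diff pos t by auto
    show "S (U t) = 1 / t" using FX_pos by (simp add: S_def GU[OF t])
  qed
  define e where "e t = A t / V' t" for t
  obtain C where C: "0 < C" "\<forall>\<^sub>F t in at_top. \<forall>z\<ge>1. A (t * z) / V' (t * z) \<le> C * z powr (1 / 4) * (A t / V' t)"
    using dh.ratio_upper_bound[of "1 / 4"] by auto
  have epos: "0 \<le> e t" if "1 / FX < t" for t using A[OF that] Vpos[OF that] that by (simp add: e_def V'_def)
  have potter: "\<forall>\<^sub>F t in at_top. \<forall>z\<ge>1. \<bar>e (t * z)\<bar> \<le> C * z powr (1 / 4) * \<bar>e t\<bar>"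
    using C(2) eventually_gt_at_top[of "1 / FX"]
  proof eventually_elim
    case (elim t)
    have tp: "0 < t" using elim(2) t1 by linarith
    have gt: "1 / FX < t * z" if "1 \<le> z" for z
    proof -
      have "t * 1 \<le> t * z" using that tp by (intro mult_left_mono) auto
      then show ?thesis using elim by linarith
    qed
    show ?case
    proof (intro allI impI)
      fix z :: real assume z: "1 \<le> z"
      show "\<bar>e (t * z)\<bar> \<le> C * z powr (1 / 4) * \<bar>e t\<bar>"
        unfolding abs_of_nonneg[OF epos[OF gt[OF z]]] abs_of_nonneg[OF epos[OF elim(2)]]
        unfolding e_def using elim(1) z by blast
    qed
  qed
  have grate: "\<forall>\<^sub>F t in at_top. \<forall>r>0. r \<le> t powr (3 + 2 / \<rho>) * (deriv U t / A t)\<^sup>2 \<longrightarrow> r * (e t)\<^sup>2 \<le> t"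
    using eventually_gt_at_top[of "1 / FX"]
  proof eventually_elim
    case (elim t)
    have tp: "0 < t" using elim t1 by linarith
    have "(t powr (1 + 1 / \<rho>))\<^sup>2 * t = t powr (3 + 2 / \<rho>)"
    proof -
      have "(t powr (1 + 1 / \<rho>))\<^sup>2 * t = t powr (1 + 1 / \<rho>) * t powr (1 + 1 / \<rho>) * t powr 1"
        using tp by (simp add: power2_eq_square)
      also have "\<dots> = t powr (1 + 1 / \<rho> + (1 + 1 / \<rho>) + 1)" by (simp only: powr_add)
      finally show ?thesis by (simp add: algebra_simps)
    qed
    note P = this[symmetric]
    have gen: "(P\<^sup>2 * t) * (D / a)\<^sup>2 * (a / (P * D))\<^sup>2 = t" if "0 < P" "0 < D" "0 < a" for P D a
      using that by (simp add: power_divide power_mult_distrib)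
    have eV: "e t = A t / (t powr (1 + 1 / \<rho>) * deriv U t)" using elim by (simp add: e_def V'_def V_def)
    have "t powr (3 + 2 / \<rho>) * (deriv U t / A t)\<^sup>2 * (e t)\<^sup>2 = t"
      unfolding P eV by (rule gen) (use A[OF elim] pos[OF elim] tp in auto)
    moreover have "r * (e t)\<^sup>2 \<le> t powr (3 + 2 / \<rho>) * (deriv U t / A t)\<^sup>2 * (e t)\<^sup>2"
      if "r \<le> t powr (3 + 2 / \<rho>) * (deriv U t / A t)\<^sup>2" for r using that by (intro mult_right_mono) auto
    ultimately show ?case by auto
  qed
  have kp: "0 < k n" if "1 \<le> n" for n using k_pos that by blast
  note bias = small_o_rate_bias[OF rate kp grate C(1) potter]
  \<comment> \<open>The exponent has to be positive for the increment bound and below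
    \<open>1 / \<rho>\<close> for the tail expansion.\<close>
  define \<eta> where "\<eta> = 1 / (2 * \<rho>)"
  have \<eta>: "0 < \<eta>" "\<eta> < 1 / \<rho>" using \<rho> by (auto simp: \<eta>_def field_simps)
  obtain C' where C': "0 < C'" "\<forall>\<^sub>F t in at_top. \<forall>z\<ge>1/8. \<bar>V' (t * z) - V' t\<bar> \<le> C' * z powr \<eta> * A t"
    using dh.increment_bound[OF \<eta>(1)] by blast
  have inc: "\<forall>\<^sub>F t in at_top. \<forall>z\<ge>1/8. \<bar>V (t * z) - V t\<bar> \<le> C' * z powr \<eta> * (\<bar>e t\<bar> * V t)"
    using C'(2) eventually_gt_at_top[of "8 * (1 / FX)"]
  proof eventually_elim
    case (elim t)
    have t: "1 / FX < t" using elim t1 by linarith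
    then have tp: "0 < t" using t1 by linarith
    have "1 / FX < t * z" if "1 / 8 \<le> z" for z
    proof -
      have "t * (1 / 8) \<le> t * z" using that tp by (intro mult_left_mono) auto
      then show ?thesis using elim by linarith
    qed
    moreover have "\<bar>e t\<bar> * V t = A t"
      unfolding abs_of_nonneg[OF epos[OF t]] using t Vpos[OF t] by (simp add: e_def V'_def)
    ultimately show ?case using elim t by (auto simp: V'_def)
  qed
  have "(\<lambda>n. sqrt (real (k n)) * ((\<phi> - U (real n / real (k n) / j)) /
        (real n / real (k n) * deriv U (real n / real (k n))) - \<rho> * j powr (1 / \<rho>))) \<longlonglongrightarrow> 0"
    if "j \<in> {1, 2, 4}" for j
    by (rule increment_bound_bias[OF \<rho> less_imp_le[OF C'(1)] \<eta>(2) diff pos U_lim[OF ne] V_def inc bias that])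
  then show unbiased unfolding unbiased_def using bias(1) by blast
qed

text \<open>The condition speaks only of the derivative of \<open>G\<close> near the endpoint.
  Positivity of that derivative and the absence of a jump at \<phi> have to be derived before
  \<open>U\<close> can be inverted; afterwards \<open>V - c\<close> plays the role of
  \<open>A\<close>.\<close>

lemma condition_b_case:
  assumes cond: "condition_b \<rho> FX G \<phi> U k"
  shows "\<exists>t1. good_tail t1" and "unbiased"
proof -
  define V where "V t = t powr (1 + 1 / \<rho>) * deriv U t" for t
  obtain \<kappa> \<delta> where diff_ev: "\<forall>\<^sub>F t in at_top. G differentiable (at (\<phi> - 1 / t))"
    and \<kappa>: "0 < \<kappa>" and \<delta>: "0 < \<delta>"
    and rv: "regularly_varying (- \<kappa>) (\<lambda>t. t powr (\<rho> - 1) * deriv G (\<phi> - 1 / t) - \<delta>)"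
    and rate: "small_o_rate k (\<lambda>t. t powr (3 + 2 / \<rho>) *
          (deriv U t / (V t - (\<delta> * FX) powr (- 1 / \<rho>) * \<rho> powr (1 / \<rho> - 1)))\<^sup>2)"
    using cond unfolding condition_b_def V_def by blast
  define c where "c = (\<delta> * FX) powr (- 1 / \<rho>) * \<rho> powr (1 / \<rho> - 1)"
  \<comment> \<open>In the degenerate case the derivative vanishes and the regularly varying
    function is eventually the constant \<open>- \<delta>\<close>, of index 0 instead of
    \<open>- \<kappa>\<close>.\<close>
  have ne: "{y. 0 \<le> y \<and> G y < 1} \<noteq> {}"
  proof (rule nonempty_of_deriv, rule ccontr)
    assume "\<not> (\<exists>\<^sub>F t in at_top. deriv G (\<phi> - 1 / t) \<noteq> 0)"
    then have "\<forall>\<^sub>F t in at_top. t powr (\<rho> - 1) * deriv G (\<phi> - 1 / t) - \<delta> = - \<delta>"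
      by (auto simp: frequently_def elim: eventually_mono)
    from regularly_varying_cong[OF this rv]
    have "((\<lambda>t::real. - \<delta> / - \<delta>) \<longlongrightarrow> 2 powr (- \<kappa>)) at_top" unfolding regularly_varying_def by simp
    then have "((\<lambda>t::real. 1) \<longlongrightarrow> 2 powr (- \<kappa>)) at_top" using \<delta> by simp
    then have "1 = 2 powr (- \<kappa>)" by (simp add: tendsto_const_iff)
    then show False using \<kappa> by (simp add: powr_minus_divide)
  qed
  note \<phi>0 = \<phi>_pos[OF ne]
  define p where "p v = 1 - G (\<phi> - v)" for v
  obtain T where T: "\<And>t. T \<le> t \<Longrightarrow> G differentiable (at (\<phi> - 1 / t))"
    using diff_ev unfolding eventually_at_top_linorder by blast
  define m where "m = max 1 T"
  have m: "0 < m" "T \<le> m" by (auto simp: m_def)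
  \<comment> \<open>The bound \<phi> keeps \<open>\<phi> - v\<close> positive, as quantiles are
    infima over nonnegative points.\<close>
  define v1 where "v1 = min \<phi> (1 / m)"
  have v1: "0 < v1" "v1 \<le> \<phi>" using \<phi>0 m by (auto simp: v1_def)
  have dG: "G differentiable (at (\<phi> - v))" if "0 < v" "v < v1" for v
  proof -
    have "v < 1 / m" using that by (simp add: v1_def)
    then have "v * m < 1" using m(1) by (simp add: pos_less_divide_eq)
    then have "m < 1 / v" using that by (simp add: pos_less_divide_eq mult.commute)
    then have "G differentiable (at (\<phi> - 1 / (1 / v)))" using m by (intro T) auto
    then show ?thesis by simp
  qed
  have dp: "(p has_real_derivative deriv G (\<phi> - v)) (at v)" if "0 < v" "v < v1" for v
  proof -
    have "(G has_real_derivative deriv G (\<phi> - v)) (at (\<phi> - v))"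
      using dG[OF that] by (simp add: DERIV_deriv_iff_real_differentiable)
    then have "((\<lambda>v. G (\<phi> - v)) has_real_derivative deriv G (\<phi> - v) * (- 1)) (at v)"
      by (rule DERIV_chain2) (auto intro!: derivative_eq_intros)
    from DERIV_diff[OF DERIV_const[of 1] this] show ?thesis unfolding p_def by simp
  qed
  have dp': "deriv p v = deriv G (\<phi> - v)" if "0 < v" "v < v1" for v by (rule DERIV_imp_deriv[OF dp[OF that]])
  have p_diff: "p differentiable (at v)" if "0 < v" "v < v1" for v
    using dp[OF that] by (auto simp: real_differentiable_def)
  have small_t: "0 < 1 / t" "1 / t < v1" if "1 / v1 < t" for t
  proof -
    have "0 < t" using that v1 by (meson less_trans zero_less_divide_1_iff)
    then show "0 < 1 / t" "1 / t < v1" using that v1 by (auto simp: field_simps)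
  qed
  have rvp: "regularly_varying (- \<kappa>) (\<lambda>t. t powr (\<rho> - 1) * deriv p (1 / t) - \<delta>)"
  proof (rule regularly_varying_cong[OF _ rv])
    show "\<forall>\<^sub>F t in at_top. t powr (\<rho> - 1) * deriv G (\<phi> - 1 / t) - \<delta> = t powr (\<rho> - 1) * deriv p (1 / t) - \<delta>"
      using eventually_gt_at_top[of "1 / v1"] by eventually_elim (simp only: dp'[OF small_t])
  qed
  have "\<forall>\<^sub>F t in at_top. 0 < deriv p (1 / t)"
  proof -
    \<comment> \<open>A function of negative index tends to 0, so the scaled derivative tends to the
      positive \<delta>.\<close>
    define h where "h t = t powr (\<rho> - 1) * (if 1 / v1 < t then deriv p (1 / t) else 0) - \<delta>" for t
    have "(\<lambda>t. if 1 / v1 < t then deriv p (1 / t) else 0) \<in> borel_measurable borel"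
      by (rule borel_measurable_deriv_at_right[OF p_diff v1(1)])
    then have "h \<in> borel_measurable borel" unfolding h_def by measurable
    moreover have "regularly_varying (- \<kappa>) h"
      by (rule regularly_varying_cong[OF _ rvp])
        (use eventually_gt_at_top[of "1 / v1"] in \<open>eventually_elim, simp add: h_def\<close>)
    ultimately have "(h \<longlongrightarrow> 0) at_top" using \<kappa> by (rule regularly_varying_neg_tendsto_0)
    then have "\<forall>\<^sub>F t in at_top. - \<delta> < h t" using \<delta> by (intro order_tendstoD) auto
    then show ?thesis using eventually_gt_at_top[of "1 / v1"] eventually_gt_at_top[of 0]
      by eventually_elim (simp add: h_def zero_less_mult_iff)
  qed
  then obtain T' where T': "\<And>t. T' \<le> t \<Longrightarrow> 0 < deriv p (1 / t)" unfolding eventually_at_top_linorder by blast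
  define m' where "m' = max 1 T'"
  have m': "0 < m'" "T' \<le> m'" by (auto simp: m'_def)
  define v0 where "v0 = min v1 (1 / m')"
  have v0: "0 < v0" "v0 \<le> v1" using v1 m' by (auto simp: v0_def)
  have p_pos: "0 < deriv p v" if "0 < v" "v < v0" for v
  proof -
    have "v < 1 / m'" using that by (simp add: v0_def)
    then have "v * m' < 1" using m'(1) by (simp add: pos_less_divide_eq)
    then have "m' < 1 / v" using that by (simp add: pos_less_divide_eq mult.commute)
    then have "0 < deriv p (1 / (1 / v))" using m' by (intro T') auto
    then show ?thesis by simp
  qed
  have p_diff0: "p differentiable (at v)" if "0 < v" "v < v0" for v using p_diff that v0 by auto
  \<comment> \<open>With an atom at \<phi> the quantile would eventually be constantly \<phi>, hence
    \<open>U'\<close> and the rate function eventually 0, which the growth condition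
    excludes.\<close>
  have p_lim: "(p \<longlongrightarrow> 0) (at_right 0)"
  proof (rule ccontr)
    assume nl: "\<not> (p \<longlongrightarrow> 0) (at_right 0)"
    have p_mono: "p v \<le> p w" if "v \<le> w" for v w using G_mono[of "\<phi> - w" "\<phi> - v"] that by (simp add: p_def)
    have p_nonneg: "0 \<le> p v" for v using G_le_1 by (simp add: p_def)
    have "\<exists>\<epsilon>>0. \<forall>v>0. \<epsilon> \<le> p v"
    proof (rule ccontr)
      assume "\<not> ?thesis"
      then have small: "\<exists>v>0. p v < \<epsilon>" if "0 < \<epsilon>" for \<epsilon> using that by (meson not_le)
      have "(p \<longlongrightarrow> 0) (at_right 0)"
      proof (rule tendstoI)
        fix \<epsilon> :: real assume "0 < \<epsilon>"
        then obtain v where v: "0 < v" "p v < \<epsilon>" using small by blast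
        show "\<forall>\<^sub>F u in at_right 0. dist (p u) 0 < \<epsilon>"
          using eventually_at_right_real[OF v(1)]
        proof eventually_elim
          case (elim u)
          then have "p u \<le> p v" by (intro p_mono) auto
          then show ?case using v p_nonneg[of u] by simp
        qed
      qed
      then show False using nl by simp
    qed
    then obtain \<epsilon> where \<epsilon>: "0 < \<epsilon>" "\<And>v. 0 < v \<Longrightarrow> \<epsilon> \<le> p v" by blast
    define t0 where "t0 = 1 / (FX * \<epsilon>)"
    have t0: "0 < t0" using FX_pos \<epsilon> by (simp add: t0_def)
    have U_const: "U t = \<phi>" if t: "t0 < t" for t
    proof (rule antisym)
      have tp: "0 < t" using t t0 by linarith
      show "U t \<le> \<phi>" using \<phi>0 G_\<phi>[OF ne order_refl] tp FX_pos by (intro U_le) auto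
      have lt: "1 / (t * FX) < \<epsilon>"
      proof -
        have "1 < t * (FX * \<epsilon>)" using t FX_pos \<epsilon> unfolding t0_def by (subst (asm) pos_divide_less_eq) auto
        then show ?thesis using tp FX_pos by (subst pos_divide_less_eq) (auto simp: mult_ac)
      qed
      show "\<phi> \<le> U t"
      proof (rule dense_le_bounded[OF \<phi>0])
        fix y assume "0 < y" "y < \<phi>"
        then show "y \<le> U t" using lt \<epsilon>(2)[of "\<phi> - y"] tp by (intro less_U) (auto simp: p_def)
      qed
    qed
    have dz: "deriv U t = 0" if "t0 < t" for t
    proof -
      have "\<forall>\<^sub>F s in nhds t. s \<in> {t0<..}" using that by (intro eventually_nhds_in_open) auto
      then have "\<forall>\<^sub>F s in nhds t. U s = (\<lambda>_. \<phi>) s" by eventually_elim (simp add: U_const)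
      then have "deriv U t = deriv (\<lambda>_. \<phi>) t" by (intro deriv_cong_ev) auto
      then show ?thesis by simp
    qed
    have "\<forall>\<^sub>F t in at_top. \<not> 0 < t powr (3 + 2 / \<rho>) * (deriv U t / (V t - (\<delta> * FX) powr (- 1 / \<rho>) * \<rho> powr (1 / \<rho> - 1)))\<^sup>2"
      using eventually_gt_at_top[of t0] by eventually_elim (simp add: dz)
    then show False using small_o_rate_nontrivial[OF rate] by (simp add: frequently_def)
  qed
  have strict: "G y < G (\<phi> - v)" if v: "0 < v" "v < v0" and y: "\<phi> - v0 < y" "y < \<phi> - v" for v y
  proof -
    have "p v < p (\<phi> - y)"
    proof (rule DERIV_pos_imp_increasing[of v "\<phi> - y" p])
      show "v < \<phi> - y" using y by simp
      fix u assume "v \<le> u" "u \<le> \<phi> - y"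
      then have "0 < u" "u < v0" using v y by auto
      then show "\<exists>d. (p has_real_derivative d) (at u) \<and> 0 < d"
        using p_diff0[of u] p_pos[of u]
        by (intro exI[of _ "deriv p u"]) (simp add: DERIV_deriv_iff_real_differentiable)
    qed
    then show ?thesis by (simp add: p_def)
  qed
  have inv: "U (1 / (FX * p v)) = \<phi> - v" if "0 < v" "v < v0" for v
    unfolding p_def using that v0 v1 G_lt_1[OF ne] by (intro U_inverse[of v v0] strict) auto
  obtain t1 where t1: "0 < t1" "\<And>t. t1 < t \<Longrightarrow> 0 < \<phi> - U t \<and> \<phi> - U t < v0 \<and> FX * p (\<phi> - U t) = 1 / t \<and>
      (U has_real_derivative 1 / (t\<^sup>2 * FX * deriv p (\<phi> - U t))) (at t)"
    using tail_inverse(1)[OF p_diff0 p_pos v0(1) FX_pos p_lim inv] by blast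
  have Ulim: "(U \<longlongrightarrow> \<phi>) at_top" by (rule U_lim[OF ne])
  have dU: "deriv U t = 1 / (t\<^sup>2 * FX * deriv p (\<phi> - U t))" if "t1 < t" for t
    using t1(2)[OF that] by (intro DERIV_imp_deriv) auto
  have diffU: "U differentiable (at t)" if "t1 < t" for t using t1(2)[OF that] by (auto simp: real_differentiable_def)
  have posU: "0 < deriv U t" if "t1 < t" for t
  proof -
    have "0 < t" using that t1(1) by linarith
    then show ?thesis unfolding dU[OF that] using t1(2)[OF that] p_pos[of "\<phi> - U t"] FX_pos by simp
  qed
  have evU: "\<forall>\<^sub>F t in at_top. U t < \<phi> \<and> FX * p (\<phi> - U t) = 1 / t \<and> deriv U t = 1 / (t\<^sup>2 * FX * deriv p (\<phi> - U t))"
    using eventually_gt_at_top[of t1]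
  proof eventually_elim
    case (elim t)
    then show ?case using t1(2)[OF elim] dU[OF elim] by simp
  qed
  have evmono: "\<forall>\<^sub>F t in at_top. \<forall>s\<ge>t. U t \<le> U s"
    using eventually_gt_at_top[of 0] by eventually_elim (auto intro: U_mono)
  note so = second_order_endpoint[OF p_diff0 v0(1) FX_pos \<rho> \<delta> \<kappa> p_lim rvp evU Ulim evmono, folded c_def V_def]
  have ev: "\<forall>\<^sub>F t in at_top. U differentiable (at t)" "\<forall>\<^sub>F t in at_top. U t < \<phi>"
    using eventually_gt_at_top[of t1] evU by (eventually_elim, simp add: diffU)+
  have dv: "deriv_varies \<rho> U" by (rule von_mises_deriv_varies[OF ev so(1) \<rho>])
  have "good_tail t1"
    unfolding good_tail_def
  proof (intro conjI allI impI dv t1(1) diffU posU)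
    fix t assume "t1 < t"
    then show "S (U t) = 1 / t" using t1(2)[of t] by (simp add: S_def p_def)
  qed
  then show "\<exists>t1. good_tail t1" by blast
  define e where "e t = V t - c" for t
  have Vlim: "(V \<longlongrightarrow> c) at_top" using so(2) by (simp add: V_def[abs_def])
  obtain C where C: "0 < C" "\<forall>\<^sub>F t in at_top. \<forall>z\<ge>1/8. \<bar>V (t * z) - c\<bar> \<le> C * \<bar>V t - c\<bar>"
    using so(3) by (auto simp: V_def)
  have cpos: "0 < c" using \<delta> FX_pos \<rho> by (simp add: c_def)
  have V_upper: "\<forall>\<^sub>F t in at_top. V t < 2 * c" and V_lower: "\<forall>\<^sub>F t in at_top. c / 2 < V t"
    using order_tendstoD(2)[OF Vlim, of "2 * c"] order_tendstoD(1)[OF Vlim, of "c / 2"] cpos by simp_all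
  have potter: "\<forall>\<^sub>F t in at_top. \<forall>z\<ge>1. \<bar>e (t * z)\<bar> \<le> C * z powr (1 / 4) * \<bar>e t\<bar>"
    using C(2)
  proof eventually_elim
    case (elim t)
    show ?case
    proof (intro allI impI)
      fix z :: real assume z: "1 \<le> z"
      have "\<bar>e (t * z)\<bar> \<le> C * 1 * \<bar>e t\<bar>" using elim z by (simp add: e_def)
      also have "\<dots> \<le> C * z powr (1 / 4) * \<bar>e t\<bar>"
        using C(1) z by (intro mult_right_mono mult_left_mono ge_one_powr_ge_zero) auto
      finally show "\<bar>e (t * z)\<bar> \<le> C * z powr (1 / 4) * \<bar>e t\<bar>" .
    qed
  qed
  \<comment> \<open>The rate function is \<open>t (V / e)^2\<close>. Replacing \<open>V\<close> by
    its eventual bound \<open>2 c\<close> leads to \<open>t / e'^2\<close> with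
    \<open>e' = e / (2 c)\<close>.\<close>
  define e' where "e' t = e t / c * (1 / 2)" for t
  have e'e: "\<bar>e' t\<bar> = \<bar>e t\<bar> / (2 * c)" for t using cpos by (simp add: e'_def abs_mult abs_divide)
  have potter': "\<forall>\<^sub>F t in at_top. \<forall>z\<ge>1. \<bar>e' (t * z)\<bar> \<le> C * z powr (1 / 4) * \<bar>e' t\<bar>"
    using potter by eventually_elim (use cpos in \<open>auto simp: e'e intro!: divide_right_mono\<close>)
  have grate: "\<forall>\<^sub>F t in at_top. \<forall>r>0. r \<le> t powr (3 + 2 / \<rho>) * (deriv U t / (V t - (\<delta> * FX) powr (- 1 / \<rho>) * \<rho> powr (1 / \<rho> - 1)))\<^sup>2
      \<longrightarrow> r * (e' t)\<^sup>2 \<le> t"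
    using eventually_gt_at_top[of 0] V_upper order_tendstoD(1)[OF Vlim cpos]
  proof eventually_elim
    case (elim t)
    show ?case unfolding c_def[symmetric] e_def[symmetric]
    proof (intro allI impI)
      fix r :: real assume r: "0 < r" "r \<le> t powr (3 + 2 / \<rho>) * (deriv U t / e t)\<^sup>2"
      have e0: "e t \<noteq> 0" using r by (auto simp: not_le)
      have "(t powr (1 + 1 / \<rho>))\<^sup>2 * t = t powr (3 + 2 / \<rho>)"
      proof -
        have "(t powr (1 + 1 / \<rho>))\<^sup>2 * t = t powr (1 + 1 / \<rho>) * t powr (1 + 1 / \<rho>) * t powr 1"
          using elim by (simp add: power2_eq_square)
        also have "\<dots> = t powr (1 + 1 / \<rho> + (1 + 1 / \<rho>) + 1)" by (simp only: powr_add)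
        finally show ?thesis by (simp add: algebra_simps)
      qed
      then have "t powr (3 + 2 / \<rho>) * (deriv U t / e t)\<^sup>2 * (e t)\<^sup>2 = (V t)\<^sup>2 * t"
        using e0 by (simp add: V_def power_divide power_mult_distrib mult_ac)
      moreover have "r * (e t)\<^sup>2 \<le> t powr (3 + 2 / \<rho>) * (deriv U t / e t)\<^sup>2 * (e t)\<^sup>2"
        using r by (intro mult_right_mono) auto
      ultimately have "r * (e t)\<^sup>2 \<le> (V t)\<^sup>2 * t" by simp
      also have "\<dots> \<le> (2 * c)\<^sup>2 * t" using elim by (intro mult_right_mono power_mono) auto
      finally have "r * (e t)\<^sup>2 / (2 * c)\<^sup>2 \<le> t" using cpos by (simp add: divide_le_eq mult.commute)
      moreover have "(e' t)\<^sup>2 = (e t)\<^sup>2 / (2 * c)\<^sup>2" by (simp add: e'_def power_mult_distrib power_divide)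
      ultimately show "r * (e' t)\<^sup>2 \<le> t" by simp
    qed
  qed
  have kp: "0 < k n" if "1 \<le> n" for n using k_pos that by blast
  note bias = small_o_rate_bias[OF rate kp grate C(1) potter']
  \<comment> \<open>Since \<open>V > c / 2\<close> eventually,
    \<open>\<bar>e\<bar> = 2 c \<bar>e'\<bar>\<close> is at most \<open>4 \<bar>e'\<bar> V\<close>.
    The exponent 0 suffices because the bound on \<open>V - c\<close> is uniform in
    \<open>z\<close>.\<close>
  have inc: "\<forall>\<^sub>F t in at_top. \<forall>z\<ge>1/8. \<bar>V (t * z) - V t\<bar> \<le> 4 * (C + 1) * z powr 0 * (\<bar>e' t\<bar> * V t)"
    using C(2) V_lower
  proof eventually_elim
    case (elim t)
    show ?case
    proof (intro allI impI)
      fix z :: real assume z: "1 / 8 \<le> z"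
      have "\<bar>V (t * z) - V t\<bar> \<le> \<bar>V (t * z) - c\<bar> + \<bar>V t - c\<bar>" by linarith
      also have "\<dots> \<le> (C + 1) * \<bar>e t\<bar>" using elim z by (simp add: e_def distrib_right)
      also have "\<bar>e t\<bar> = 4 * (\<bar>e' t\<bar> * (c / 2))" using cpos by (simp add: e'e)
      also have "(C + 1) * (4 * (\<bar>e' t\<bar> * (c / 2))) \<le> (C + 1) * (4 * (\<bar>e' t\<bar> * V t))"
        using elim C(1) by (intro mult_left_mono) auto
      finally show "\<bar>V (t * z) - V t\<bar> \<le> 4 * (C + 1) * z powr 0 * (\<bar>e' t\<bar> * V t)"
        using z by (simp add: mult_ac)
    qed
  qed
  have "(\<lambda>n. sqrt (real (k n)) * ((\<phi> - U (real n / real (k n) / j)) /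
        (real n / real (k n) * deriv U (real n / real (k n))) - \<rho> * j powr (1 / \<rho>))) \<longlonglongrightarrow> 0"
    if "j \<in> {1, 2, 4}" for j
    by (rule increment_bound_bias[OF \<rho> _ _ diffU posU Ulim V_def inc bias that]) (use C(1) \<rho> in auto)
  then show unbiased unfolding unbiased_def using bias(1) by blast
qed

end

section \<open>Empirical conditional quantiles\<close>

context frontier_sample
begin

text \<open>From \<open>S (U t) = 1 / t\<close> alone \<open>y\<close> could differ from
  \<open>U (1 / S y)\<close> on a flat piece of \<open>S\<close>. Continuity of \<open>U\<close>
  shows that every such \<open>y\<close> is a value \<open>U t\<close>, and then
  \<open>t = 1 / S y\<close>.\<close>

lemma good_tail_inverse:
  assumes gt: "good_tail t1" and y: "0 < S y" "S y < 1 / t1"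
  shows "y = U (1 / S y)"
proof -
  have t1: "0 < t1" and SU: "\<And>t. t1 < t \<Longrightarrow> S (U t) = 1 / t" and diff: "\<And>t. t1 < t \<Longrightarrow> U differentiable (at t)"
    using gt by (auto simp: good_tail_def)
  define t0 where "t0 = 1 / S y"
  have t0: "t1 < t0" using y t1 by (simp add: t0_def field_simps)
  \<comment> \<open>Times on either side of \<open>t0\<close> give strict inequalities for
    \<open>S\<close>, which is what an only weakly decreasing \<open>S\<close> needs to enclose
    \<open>y\<close> between values of \<open>U\<close>.\<close>
  define ta where "ta = (t1 + t0) / 2"
  have ta: "t1 < ta" "ta < t0" using t0 by (auto simp: ta_def)
  have S0: "S y = 1 / t0" by (simp add: t0_def)
  have "S y < S (U ta)" unfolding SU[OF ta(1)] S0 using ta t1 by (intro divide_strict_left_mono mult_pos_pos) auto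
  then have lo: "U ta < y" using S_antimono[of y "U ta"] by linarith
  have "S (U (t0 + 1)) < S y"
    unfolding S0 using SU[of "t0 + 1"] t0 t1 by (simp add: divide_strict_left_mono)
  then have hi: "y < U (t0 + 1)" using S_antimono[of "U (t0 + 1)" y] by linarith
  have "\<exists>t\<ge>ta. t \<le> t0 + 1 \<and> U t = y"
  proof (rule IVT)
    show "U ta \<le> y" "y \<le> U (t0 + 1)" "ta \<le> t0 + 1" using lo hi ta by auto
    show "\<forall>t. ta \<le> t \<and> t \<le> t0 + 1 \<longrightarrow> isCont U t"
    proof (intro allI impI)
      fix t assume "ta \<le> t \<and> t \<le> t0 + 1"
      then have "t1 < t" using ta by linarith
      from diff[OF this] show "isCont U t" by (rule differentiable_imp_continuous_within)
    qed
  qed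
  then obtain t where t: "ta \<le> t" "U t = y" by blast
  then have "S y = 1 / t" using SU[of t] ta by auto
  then show ?thesis using t by simp
qed

section \<open>Empirical quantiles as order statistics\<close>

definition num_below :: "nat \<Rightarrow> 'w \<Rightarrow> nat" where
  "num_below n \<omega> = card {i\<in>{1..n}. Xs i \<omega> \<le> x}"

definition exceed :: "real \<Rightarrow> nat \<Rightarrow> 'w \<Rightarrow> nat" where
  "exceed y n \<omega> = card {i\<in>{1..n}. Xs i \<omega> \<le> x \<and> y < Ys i \<omega>}"

lemma exceed_sum: "real (exceed y n \<omega>) = (\<Sum>i=1..n. indicator (E y) (Xs i \<omega>, Ys i \<omega>))"
proof -
  have "(\<Sum>i=1..n. indicator (E y) (Xs i \<omega>, Ys i \<omega>) :: real) = (\<Sum>i=1..n. of_bool (Xs i \<omega> \<le> x \<and> y < Ys i \<omega>))"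
    by (intro sum.cong) (auto simp: E_def indicator_def)
  also have "\<dots> = real (card ({1..n} \<inter> {i. Xs i \<omega> \<le> x \<and> y < Ys i \<omega>}))"
    by (subst sum_of_bool_eq) auto
  also have "{1..n} \<inter> {i. Xs i \<omega> \<le> x \<and> y < Ys i \<omega>} = {i\<in>{1..n}. Xs i \<omega> \<le> x \<and> y < Ys i \<omega>}" by auto
  finally show ?thesis by (simp add: exceed_def)
qed

lemma emp_marg: "emp_marg_cdf Xs n \<omega> x = 1 / real n * real (num_below n \<omega>)"
proof -
  have "{1..n} \<inter> {i. Xs i \<omega> \<le> x} = {i\<in>{1..n}. Xs i \<omega> \<le> x}" by auto
  then show ?thesis unfolding emp_marg_cdf_def num_below_def by (subst sum_of_bool_eq) auto
qed

lemma emp_joint: "emp_joint_cdf Xs Ys n \<omega> x y = 1 / real n * (real (num_below n \<omega>) - real (exceed y n \<omega>))"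
proof -
  have "{1..n} \<inter> {i. Xs i \<omega> \<le> x \<and> Ys i \<omega> \<le> y} = {i\<in>{1..n}. Xs i \<omega> \<le> x} - {i\<in>{1..n}. Xs i \<omega> \<le> x \<and> y < Ys i \<omega>}"
    by auto
  moreover have "card ({i\<in>{1..n}. Xs i \<omega> \<le> x} - {i\<in>{1..n}. Xs i \<omega> \<le> x \<and> y < Ys i \<omega>}) = num_below n \<omega> - exceed y n \<omega>"
    unfolding num_below_def exceed_def by (rule card_Diff_subset) auto
  moreover have "exceed y n \<omega> \<le> num_below n \<omega>"
    unfolding num_below_def exceed_def by (rule card_mono) auto
  ultimately show ?thesis unfolding emp_joint_cdf_def by (subst sum_of_bool_eq) (auto simp: of_nat_diff)
qed

text \<open>With \<open>N\<close> observations in \<open>X <= x\<close>, the condition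
  \<open>1 - (j k - 1) / N <= (N - exceed) / N\<close> reads \<open>exceed + 1 <= j k\<close>. The
  random \<open>N\<close> cancels, and the \<open>- 1\<close> in the order is what makes the
  inequality on counts strict.\<close>

lemma qhat_eq:
  assumes "1 \<le> n" "0 < num_below n \<omega>"
  shows "qhat Xs Ys x k j n \<omega> = Inf {y. 0 \<le> y \<and> exceed y n \<omega> < j * k n}"
proof -
  have n: "0 < real n" and c: "0 < real (num_below n \<omega>)" using assms by auto
  have "1 - (real j * real (k n) - 1) / (real n * emp_marg_cdf Xs n \<omega> x) \<le> emp_cond_cdf Xs Ys n \<omega> x y \<longleftrightarrow>
      exceed y n \<omega> < j * k n" for y
  proof -
    have "emp_cond_cdf Xs Ys n \<omega> x y = (real (num_below n \<omega>) - real (exceed y n \<omega>)) / real (num_below n \<omega>)"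
      using n by (simp add: emp_cond_cdf_def emp_marg emp_joint)
    moreover have "real n * emp_marg_cdf Xs n \<omega> x = real (num_below n \<omega>)" using n by (simp add: emp_marg)
    moreover have "1 - (a - 1) / b \<le> (b - e) / b \<longleftrightarrow> e + 1 \<le> a" if "0 < b" for a b e :: real
    proof -
      have "1 - (a - 1) / b = (b - (a - 1)) / b" using that by (simp add: diff_divide_distrib)
      then show ?thesis using that by (auto simp: divide_le_cancel)
    qed
    ultimately have "1 - (real j * real (k n) - 1) / (real n * emp_marg_cdf Xs n \<omega> x) \<le> emp_cond_cdf Xs Ys n \<omega> x y \<longleftrightarrow>
        real (exceed y n \<omega>) + 1 \<le> real j * real (k n)" using c by (simp only:)
    also have "\<dots> \<longleftrightarrow> real (exceed y n \<omega> + 1) \<le> real (j * k n)" by (simp only: of_nat_mult of_nat_add of_nat_1)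
    also have "\<dots> \<longleftrightarrow> exceed y n \<omega> < j * k n" by (simp only: of_nat_le_iff) auto
    finally show ?thesis .
  qed
  then show ?thesis by (simp add: qhat_def quantile_of_cdf_def)
qed

text \<open>By \<open>x / 0 = 0\<close> the empirical function is 0 and the order is 1, whatever
  \<open>j\<close>; the value is a constant, which is all that measurability requires.\<close>

lemma qhat_degenerate:
  assumes "n = 0 \<or> num_below n \<omega> = 0"
  shows "qhat Xs Ys x k j n \<omega> = quantile_of_cdf (\<lambda>_. 0) 1"
proof -
  have e: "emp_cond_cdf Xs Ys n \<omega> x = (\<lambda>_. 0)" "real n * emp_marg_cdf Xs n \<omega> x = 0"
    using assms by (auto simp: emp_cond_cdf_def emp_marg fun_eq_iff)
  show ?thesis unfolding qhat_def e by simp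
qed

lemma order_stat_set_nonempty:
  assumes "0 < m"
  shows "{y. 0 \<le> y \<and> exceed y n \<omega> < m} \<noteq> {}"
proof -
  define y where "y = (\<Sum>i=1..n. \<bar>Ys i \<omega>\<bar>)"
  have "Ys i \<omega> \<le> y" if "i \<in> {1..n}" for i
    using member_le_sum[OF that, of "\<lambda>i. \<bar>Ys i \<omega>\<bar>"] by (simp add: y_def)
  then have "{i\<in>{1..n}. Xs i \<omega> \<le> x \<and> y < Ys i \<omega>} = {}" by (auto simp: not_less)
  then have "exceed y n \<omega> = 0" by (simp add: exceed_def)
  moreover have "0 \<le> y" by (simp add: y_def sum_nonneg)
  ultimately show ?thesis using assms by auto
qed

lemma qhat_nonneg:
  assumes "1 \<le> n" "0 < num_below n \<omega>" "0 < j"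
  shows "0 \<le> qhat Xs Ys x k j n \<omega>"
  unfolding qhat_eq[OF assms(1,2)] using assms k_pos
  by (intro cInf_greatest order_stat_set_nonempty) auto

text \<open>The infimum is attained: if at least \<open>j k\<close> observations exceed
  \<open>y\<close>, then their minimum \<open>m\<close> exceeds \<open>y\<close>, and every point
  below \<open>m\<close> is exceeded by all of them, so the quantile is at least
  \<open>m\<close>.\<close>

lemma qhat_le:
  assumes n: "1 \<le> n" "0 < num_below n \<omega>" and j: "0 < j" and y: "0 \<le> y"
  shows "qhat Xs Ys x k j n \<omega> \<le> y \<longleftrightarrow> exceed y n \<omega> < j * k n"
proof
  assume "exceed y n \<omega> < j * k n"
  then show "qhat Xs Ys x k j n \<omega> \<le> y"
    unfolding qhat_eq[OF n] using y by (intro cInf_lower) (auto intro: bdd_belowI[of _ 0])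
next
  assume le: "qhat Xs Ys x k j n \<omega> \<le> y"
  have jk: "0 < j * k n" using j n k_pos by simp
  show "exceed y n \<omega> < j * k n"
  proof (rule ccontr)
    assume "\<not> ?thesis"
    then have ex: "j * k n \<le> exceed y n \<omega>" by simp
    define F where "F = {i\<in>{1..n}. Xs i \<omega> \<le> x \<and> y < Ys i \<omega>}"
    have "card F = exceed y n \<omega>" by (simp add: F_def exceed_def)
    then have "0 < card F" using ex jk by linarith
    then have F: "finite F" "F \<noteq> {}" by (auto simp: card_gt_0_iff)
    define m where "m = Min ((\<lambda>i. Ys i \<omega>) ` F)"
    have m: "y < m" unfolding m_def using F by (subst Min_gr_iff) (auto simp: F_def)
    have "m \<le> Inf {y. 0 \<le> y \<and> exceed y n \<omega> < j * k n}"
    proof (rule cInf_greatest[OF order_stat_set_nonempty[OF jk]])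
      fix z assume z: "z \<in> {y. 0 \<le> y \<and> exceed y n \<omega> < j * k n}"
      show "m \<le> z"
      proof (rule ccontr)
        assume "\<not> m \<le> z"
        have "z < Ys i \<omega>" if "i \<in> F" for i
        proof -
          have "m \<le> Ys i \<omega>" unfolding m_def using F that by (intro Min_le) auto
          then show ?thesis using \<open>\<not> m \<le> z\<close> by linarith
        qed
        then have "F \<subseteq> {i\<in>{1..n}. Xs i \<omega> \<le> x \<and> z < Ys i \<omega>}" by (auto simp: F_def)
        then have "card F \<le> exceed z n \<omega>" unfolding exceed_def by (rule card_mono[rotated]) simp
        then show False using z ex by (simp add: F_def exceed_def)
      qed
    qed
    then show False using le m unfolding qhat_eq[OF n] by linarith
  qed
qed

lemma sample_measurable:
  assumes "1 \<le> i"
  shows "Xs i \<in> borel_measurable M" "Ys i \<in> borel_measurable M"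
proof -
  have p: "(\<lambda>\<omega>. (Xs i \<omega>, Ys i \<omega>)) \<in> borel_measurable M" using sample_indep assms by (auto simp: indep_vars_def)
  have "(\<lambda>\<omega>. fst (Xs i \<omega>, Ys i \<omega>)) \<in> borel_measurable M" "(\<lambda>\<omega>. snd (Xs i \<omega>, Ys i \<omega>)) \<in> borel_measurable M"
    by (rule measurable_compose[OF p borel_measurable_continuous_onI], intro continuous_intros)+
  then show "Xs i \<in> borel_measurable M" "Ys i \<in> borel_measurable M" by simp_all
qed

lemma num_below_measurable: "(\<lambda>\<omega>. real (num_below n \<omega>)) \<in> borel_measurable M"
proof -
  have "real (num_below n \<omega>) = (\<Sum>i=1..n. indicator {..x} (Xs i \<omega>))" for \<omega>
  proof -
    have "{1..n} \<inter> {i. Xs i \<omega> \<le> x} = {i\<in>{1..n}. Xs i \<omega> \<le> x}" by auto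
    then have "real (num_below n \<omega>) = (\<Sum>i=1..n. of_bool (Xs i \<omega> \<le> x))" unfolding num_below_def by (subst sum_of_bool_eq) auto
    also have "\<dots> = (\<Sum>i=1..n. indicator {..x} (Xs i \<omega>))" by (intro sum.cong) (auto simp: indicator_def)
    finally show ?thesis .
  qed
  moreover have "(indicator {..x} :: _ \<Rightarrow> real) \<in> borel_measurable borel"
    by (intro borel_measurable_indicator borel_closed closed_eucl_atMost)
  ultimately show ?thesis
    by (simp only:) (intro borel_measurable_sum measurable_compose[OF sample_measurable(1)], auto)
qed

lemma exceed_measurable: "(\<lambda>\<omega>. real (exceed y n \<omega>)) \<in> borel_measurable M"
proof -
  have "(\<lambda>\<omega>. (Xs i \<omega>, Ys i \<omega>)) \<in> borel_measurable M" if "1 \<le> i" for i using sample_indep that by (auto simp: indep_vars_def)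
  then show ?thesis unfolding exceed_sum
    by (intro borel_measurable_sum measurable_compose[OF _ borel_measurable_indicator[OF E_borel]]) auto
qed

lemma qhat_measurable:
  assumes j: "0 < j"
  shows "qhat Xs Ys x k j n \<in> borel_measurable M"
proof (cases "n = 0")
  case True
  then have "qhat Xs Ys x k j n = (\<lambda>_. quantile_of_cdf (\<lambda>_. 0) 1)" by (auto simp: qhat_degenerate)
  then show ?thesis by simp
next
  case False
  then have n: "1 \<le> n" by simp
  note [measurable] = num_below_measurable exceed_measurable
  show ?thesis
    unfolding borel_measurable_iff_le
  proof
    fix a :: real
    let ?c = "quantile_of_cdf (\<lambda>_. 0) 1"
    have "{\<omega> \<in> space M. qhat Xs Ys x k j n \<omega> \<le> a} =
      {\<omega> \<in> space M. real (num_below n \<omega>) = 0 \<and> ?c \<le> a} \<union>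
      {\<omega> \<in> space M. 0 < real (num_below n \<omega>) \<and> 0 \<le> a \<and> real (exceed a n \<omega>) < real (j * k n)}"
    proof (rule set_eqI)
      fix \<omega>
      show "\<omega> \<in> {\<omega> \<in> space M. qhat Xs Ys x k j n \<omega> \<le> a} \<longleftrightarrow> \<omega> \<in> {\<omega> \<in> space M. real (num_below n \<omega>) = 0 \<and> ?c \<le> a} \<union>
        {\<omega> \<in> space M. 0 < real (num_below n \<omega>) \<and> 0 \<le> a \<and> real (exceed a n \<omega>) < real (j * k n)}"
      proof (cases "num_below n \<omega> = 0")
        case True
        then show ?thesis using qhat_degenerate[of n \<omega> j] by simp
      next
        case False
        then have c: "0 < num_below n \<omega>" by simp
        show ?thesis
        proof (cases "0 \<le> a")
          case True
          then show ?thesis using qhat_le[OF n c j True] c by (simp del: of_nat_mult)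
        next
          case False
          then show ?thesis using qhat_nonneg[OF n c j] c by auto
        qed
      qed
    qed
    also have "\<dots> \<in> sets M" by measurable
    finally show "{\<omega> \<in> space M. qhat Xs Ys x k j n \<omega> \<le> a} \<in> sets M" .
  qed
qed

lemma tail_sample:
  assumes gt: "good_tail t1" and k: "filterlim (\<lambda>n. real (k n)) at_top sequentially"
    and nk: "filterlim (\<lambda>n. real n / real (k n)) at_top sequentially"
  shows "tail_sample M borel (\<lambda>\<omega>. (X \<omega>, Y \<omega>)) (\<lambda>i \<omega>. (Xs i \<omega>, Ys i \<omega>)) E U t1 k S"
proof
  show "(\<lambda>\<omega>. (X \<omega>, Y \<omega>)) \<in> borel_measurable M" by (intro borel_measurable_Pair X Y)
  show "indep_vars (\<lambda>_. borel) (\<lambda>i \<omega>. (Xs i \<omega>, Ys i \<omega>)) {1..}" by (rule sample_indep)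
  show "distr M borel (\<lambda>\<omega>. (Xs i \<omega>, Ys i \<omega>)) = distr M borel (\<lambda>\<omega>. (X \<omega>, Y \<omega>))" if "1 \<le> i" for i
    using sample_identical that by blast
  show "E y \<in> sets borel" for y by (rule E_borel)
  show "E z \<subseteq> E y" if "y \<le> z" for y z using that by (auto simp: E_def)
  show "S y = prob {\<omega> \<in> space M. (X \<omega>, Y \<omega>) \<in> E y}" for y by (rule S_prob)
  show "0 < t1" using gt by (simp add: good_tail_def)
  show "S (U t) = 1 / t" if "t1 < t" for t using gt that by (simp add: good_tail_def)
  show "0 \<le> U t" if "t1 < t" for t using gt that by (intro U_nonneg) (auto simp: good_tail_def)
  show "filterlim (\<lambda>n. real (k n)) at_top sequentially" "filterlim (\<lambda>n. real n / real (k n)) at_top sequentially"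
    by fact+
qed

lemma qhat_order_stat:
  assumes ts: "tail_sample M borel (\<lambda>\<omega>. (X \<omega>, Y \<omega>)) (\<lambda>i \<omega>. (Xs i \<omega>, Ys i \<omega>)) E U t1 k S" and j: "0 < j"
  shows "tail_sample.is_upper_order_stat M (\<lambda>i \<omega>. (Xs i \<omega>, Ys i \<omega>)) E k (real j) (qhat Xs Ys x k j)"
proof -
  interpret ts: tail_sample M borel "\<lambda>\<omega>. (X \<omega>, Y \<omega>)" "\<lambda>i \<omega>. (Xs i \<omega>, Ys i \<omega>)" E U t1 k S by (rule ts)
  have cnt: "ts.cnt y n \<omega> = real (exceed y n \<omega>)" for y n \<omega> by (simp add: ts.cnt_def exceed_sum)
  show ?thesis
    unfolding ts.is_upper_order_stat_def
  proof (intro conjI allI impI ballI qhat_measurable j)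
    fix n \<omega> and y :: real
    assume n: "1 \<le> n" and y: "0 \<le> y" and "\<exists>y'. 0 < ts.cnt y' n \<omega>"
    then obtain y' where "0 < exceed y' n \<omega>" by (auto simp: cnt)
    also have "exceed y' n \<omega> \<le> num_below n \<omega>" unfolding exceed_def num_below_def by (rule card_mono) auto
    finally have c: "0 < num_below n \<omega>" .
    from qhat_le[OF n c j y] show "qhat Xs Ys x k j n \<omega> \<le> y \<longleftrightarrow> ts.cnt y n \<omega> < real j * real (k n)"
      by (simp add: cnt flip: of_nat_mult)
  qed
qed

section \<open>The limit laws\<close>

lemma quantile_limit_law:
  assumes dens: "has_positive_density_upto G \<phi>"
    and rv: "regularly_varying (1 - \<rho>) (\<lambda>t. deriv G (\<phi> - 1 / t))"
    and p: "p \<longlonglongrightarrow> 0" and np: "filterlim (\<lambda>n. real n * p n) at_top sequentially"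
    and kp: "\<forall>n\<ge>1. int (k n) = \<lfloor>real n * p n\<rfloor>"
  shows "conv_distr_normal M (\<lambda>n \<omega>. sqrt (2 * real (k n)) *
             ((qhat Xs Ys x k 1 n \<omega> - quantile_of_cdf G (1 - p n / FX)) / (qhat Xs Ys x k 1 n \<omega> - qhat Xs Ys x k 2 n \<omega>))) (V1 \<rho>)"
proof -
  have kr: "real (k n) = real_of_int \<lfloor>real n * p n\<rfloor>" if "1 \<le> n" for n
    using kp that by (metis of_int_of_nat_eq)
  have k: "filterlim (\<lambda>n. real (k n)) at_top sequentially"
  proof (rule filterlim_at_top_mono)
    show "filterlim (\<lambda>n. - 1 + real n * p n) at_top sequentially"
      by (rule filterlim_tendsto_add_at_top[OF tendsto_const np])
    show "\<forall>\<^sub>F n in sequentially. - 1 + real n * p n \<le> real (k n)"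
      using eventually_ge_at_top[of 1]
    proof eventually_elim
      case (elim n)
      show ?case unfolding kr[OF elim] by linarith
    qed
  qed
  have np_pos: "\<forall>\<^sub>F n in sequentially. 0 < real n * p n" by (rule eventually_compose_filterlim[OF eventually_gt_at_top np])
  then have p_pos: "\<forall>\<^sub>F n in sequentially. 0 < p n" by eventually_elim (simp add: zero_less_mult_iff)
  have nk: "filterlim (\<lambda>n. real n / real (k n)) at_top sequentially"
  proof (rule filterlim_at_top_mono)
    show "filterlim (\<lambda>n. inverse (p n)) at_top sequentially" by (rule filterlim_inverse_at_top[OF p p_pos])
    show "\<forall>\<^sub>F n in sequentially. inverse (p n) \<le> real n / real (k n)"
      using p_pos eventually_ge_at_top[of 1]
    proof eventually_elim
      case (elim n)
      have "real (k n) \<le> real n * p n" unfolding kr[OF elim(2)] by linarith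
      moreover have "0 < real (k n)" using k_pos elim(2) by simp
      ultimately show ?case using elim by (simp add: field_simps)
    qed
  qed
  obtain t1 where gt: "good_tail t1" using positive_density_case(1)[OF dens rv] by blast
  interpret ts: tail_sample M borel "\<lambda>\<omega>. (X \<omega>, Y \<omega>)" "\<lambda>i \<omega>. (Xs i \<omega>, Ys i \<omega>)" E U t1 k S
    by (rule tail_sample[OF gt k nk])
  interpret iq: intermediate_quantiles U \<rho> t1 \<phi> k
  proof
    show "(\<lambda>n. (\<phi> - U (real n / real (k n) / j)) / (real n / real (k n) * deriv U (real n / real (k n)))) \<longlonglongrightarrow> \<rho> * j powr (1 / \<rho>)"
      if "j \<in> {1, 2, 4}" for j
      using positive_density_case(2)[OF dens rv nk, of j] that by auto
  qed (use gt k nk \<rho> in \<open>auto simp: good_tail_def\<close>)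
  have q: "ts.is_upper_order_stat 1 (qhat Xs Ys x k 1)" "ts.is_upper_order_stat 2 (qhat Xs Ys x k 2)" "ts.is_upper_order_stat 4 (qhat Xs Ys x k 4)"
    using qhat_order_stat[OF ts.tail_sample_axioms, of 1] qhat_order_stat[OF ts.tail_sample_axioms, of 2]
      qhat_order_stat[OF ts.tail_sample_axioms, of 4] by simp_all
  note [measurable] = qhat_measurable[of 1] qhat_measurable[of 2] qhat_measurable[of 4]
  have pU: "quantile_of_cdf G (1 - p n / FX) = U (1 / p n)" for n by (simp add: tail_quantile_def)
  have qU: "\<forall>\<^sub>F n in sequentially. \<forall>\<omega>\<in>space M. \<bar>ts.D j q n \<omega>\<bar> \<le> K \<longrightarrow> q n \<omega> = iq.Q j n (ts.D j q n \<omega>)"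
    if "0 < j" "0 < K" for j q K
    using ts.q_eq_U[OF that(1) good_tail_inverse[OF gt] that(2)] by (simp add: iq.Q_def iq.t_def iq.s_def)
  show ?thesis
    unfolding pU
  proof (rule ts.asymptotic_normality[OF _ q, where
      \<Phi> = "\<lambda>n d1 d2 d4. sqrt (2 * real (k n)) * ((iq.Q 1 n d1 - U (1 / p n)) / (iq.Q 1 n d1 - iq.Q 2 n d2))" and
      ?c1.0 = "- (sqrt 2 / (\<rho> * (2 powr (1 / \<rho>) - 1)))" and ?c2.0 = 0 and ?c4.0 = 0])
    show "(\<lambda>\<omega>. sqrt (2 * real (k n)) * ((qhat Xs Ys x k 1 n \<omega> - U (1 / p n)) / (qhat Xs Ys x k 1 n \<omega> - qhat Xs Ys x k 2 n \<omega>))) \<in> borel_measurable M" for n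
      by measurable
    show "\<forall>\<^sub>F n in sequentially. \<forall>\<omega>\<in>space M. \<bar>ts.D 1 (qhat Xs Ys x k 1) n \<omega>\<bar> \<le> K \<longrightarrow> \<bar>ts.D 2 (qhat Xs Ys x k 2) n \<omega>\<bar> \<le> K \<longrightarrow> \<bar>ts.D 4 (qhat Xs Ys x k 4) n \<omega>\<bar> \<le> K \<longrightarrow>
        sqrt (2 * real (k n)) * ((qhat Xs Ys x k 1 n \<omega> - U (1 / p n)) / (qhat Xs Ys x k 1 n \<omega> - qhat Xs Ys x k 2 n \<omega>)) =
        sqrt (2 * real (k n)) * ((iq.Q 1 n (ts.D 1 (qhat Xs Ys x k 1) n \<omega>) - U (1 / p n)) /
          (iq.Q 1 n (ts.D 1 (qhat Xs Ys x k 1) n \<omega>) - iq.Q 2 n (ts.D 2 (qhat Xs Ys x k 2) n \<omega>)))" if "0 < K" for K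
      using qU[of 1 K "qhat Xs Ys x k 1", OF zero_less_one that] qU[of 2 K "qhat Xs Ys x k 2", OF zero_less_numeral that]
    proof eventually_elim
      case (elim n)
      show ?case
      proof (intro ballI impI)
        fix \<omega> assume w: "\<omega> \<in> space M" "\<bar>ts.D 1 (qhat Xs Ys x k 1) n \<omega>\<bar> \<le> K" "\<bar>ts.D 2 (qhat Xs Ys x k 2) n \<omega>\<bar> \<le> K"
        have "qhat Xs Ys x k 1 n \<omega> = iq.Q 1 n (ts.D 1 (qhat Xs Ys x k 1) n \<omega>)" using elim(1) w by blast
        moreover have "qhat Xs Ys x k 2 n \<omega> = iq.Q 2 n (ts.D 2 (qhat Xs Ys x k 2) n \<omega>)" using elim(2) w by blast
        ultimately show "sqrt (2 * real (k n)) * ((qhat Xs Ys x k 1 n \<omega> - U (1 / p n)) / (qhat Xs Ys x k 1 n \<omega> - qhat Xs Ys x k 2 n \<omega>)) =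
          sqrt (2 * real (k n)) * ((iq.Q 1 n (ts.D 1 (qhat Xs Ys x k 1) n \<omega>) - U (1 / p n)) /
          (iq.Q 1 n (ts.D 1 (qhat Xs Ys x k 1) n \<omega>) - iq.Q 2 n (ts.D 2 (qhat Xs Ys x k 2) n \<omega>)))"
          by (simp only:)
      qed
    qed
    show "(\<lambda>n. sqrt (2 * real (k n)) * ((iq.Q 1 n (d1 n) - U (1 / p n)) / (iq.Q 1 n (d1 n) - iq.Q 2 n (d2 n))) -
        (- (sqrt 2 / (\<rho> * (2 powr (1 / \<rho>) - 1))) * d1 n + 0 * d2 n + 0 * d4 n)) \<longlonglongrightarrow> 0"
      if "\<And>n. \<bar>d1 n\<bar> \<le> K" "\<And>n. \<bar>d2 n\<bar> \<le> K" "\<And>n. \<bar>d4 n\<bar> \<le> K" for K d1 d2 d4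
      using iq.quantile_limit[OF that(1,2) np] kp by simp
    show "V1 \<rho> = (- (sqrt 2 / (\<rho> * (2 powr (1 / \<rho>) - 1))) + 0 + 0)\<^sup>2 + (0 + 0)\<^sup>2 + 2 * 0\<^sup>2"
      using V1_eq(1)[OF \<rho>] by simp
    have "1 < 2 powr (1 / \<rho>)" using \<rho> by simp
    then show "0 < V1 \<rho>" unfolding V1_eq(1)[OF \<rho>] using \<rho> by (intro zero_less_power divide_pos_pos mult_pos_pos) auto
  qed
qed

lemma endpoint_limit_laws:
  assumes cond: "condition_a \<rho> FX U k \<or> condition_b \<rho> FX G \<phi> U k"
  shows "conv_distr_normal M (\<lambda>n \<omega>. sqrt (2 * real (k n)) *
           ((phi_hat_star Xs Ys x k n \<omega> - \<phi>) / (qhat Xs Ys x k 1 n \<omega> - qhat Xs Ys x k 2 n \<omega>))) (V2 \<rho>)"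
    and "conv_distr_normal M (\<lambda>n \<omega>. sqrt (2 * real (k n)) *
           ((phi_tilde_star Xs Ys x k \<rho> n \<omega> - \<phi>) / (qhat Xs Ys x k 1 n \<omega> - qhat Xs Ys x k 2 n \<omega>))) (V3 \<rho>)"
    and "conv_in_prob M (\<lambda>n \<omega>. (qhat Xs Ys x k 1 n \<omega> - qhat Xs Ys x k 2 n \<omega>)
           / (real n / (2 * real (k n)) * deriv U (real n / (2 * real (k n))))) (\<rho> * (1 - 2 powr (- 1 / \<rho>)))"
proof -
  obtain t1 where gt: "good_tail t1" using cond condition_a_case(1) condition_b_case(1) by blast
  have unb: unbiased using cond condition_a_case(2) condition_b_case(2) by blast
  have "filterlim k at_top sequentially" using cond unfolding condition_a_def condition_b_def by blast
  then have k: "filterlim (\<lambda>n. real (k n)) at_top sequentially"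
    by (rule filterlim_compose[OF filterlim_real_sequentially])
  have nk: "filterlim (\<lambda>n. real n / real (k n)) at_top sequentially" using unb by (simp add: unbiased_def)
  have bias: "(\<lambda>n. sqrt (real (k n)) * ((\<phi> - U (real n / real (k n) / j)) /
        (real n / real (k n) * deriv U (real n / real (k n))) - \<rho> * j powr (1 / \<rho>))) \<longlonglongrightarrow> 0" if "j \<in> {1, 2, 4}" for j
    using unb that unfolding unbiased_def by blast
  interpret ts: tail_sample M borel "\<lambda>\<omega>. (X \<omega>, Y \<omega>)" "\<lambda>i \<omega>. (Xs i \<omega>, Ys i \<omega>)" E U t1 k S
    by (rule tail_sample[OF gt k nk])
  have inv_s: "(\<lambda>n. 1 / sqrt (real (k n))) \<longlonglongrightarrow> 0"
    using tendsto_inverse_0_at_top[OF filterlim_compose[OF sqrt_at_top k]] by (simp add: inverse_eq_divide)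
  interpret iq: unbiased_quantiles U \<rho> t1 \<phi> k
  proof
    fix j :: real assume j: "j \<in> {1, 2, 4}"
    let ?d = "\<lambda>n. (\<phi> - U (real n / real (k n) / j)) / (real n / real (k n) * deriv U (real n / real (k n)))"
    show "(\<lambda>n. sqrt (real (k n)) * (?d n - \<rho> * j powr (1 / \<rho>))) \<longlonglongrightarrow> 0" by (rule bias[OF j])
    from tendsto_add[OF tendsto_mult[OF this inv_s] tendsto_const[of "\<rho> * j powr (1 / \<rho>)"]]
    have lim: "(\<lambda>n. sqrt (real (k n)) * (?d n - \<rho> * j powr (1 / \<rho>)) * (1 / sqrt (real (k n))) + \<rho> * j powr (1 / \<rho>)) \<longlonglongrightarrow> \<rho> * j powr (1 / \<rho>)"
      by simp
    show "?d \<longlonglongrightarrow> \<rho> * j powr (1 / \<rho>)"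
      by (rule Lim_transform_eventually[OF lim], use ts.k_pos in eventually_elim) simp
  qed (use gt k nk \<rho> in \<open>auto simp: good_tail_def\<close>)
  have q: "ts.is_upper_order_stat 1 (qhat Xs Ys x k 1)" "ts.is_upper_order_stat 2 (qhat Xs Ys x k 2)" "ts.is_upper_order_stat 4 (qhat Xs Ys x k 4)"
    using qhat_order_stat[OF ts.tail_sample_axioms, of 1] qhat_order_stat[OF ts.tail_sample_axioms, of 2]
      qhat_order_stat[OF ts.tail_sample_axioms, of 4] by simp_all
  have qm [measurable]: "qhat Xs Ys x k 1 n \<in> borel_measurable M" "qhat Xs Ys x k 2 n \<in> borel_measurable M" "qhat Xs Ys x k 4 n \<in> borel_measurable M" for n
    by (simp_all add: qhat_measurable)
  have qU: "\<forall>\<^sub>F n in sequentially. \<forall>\<omega>\<in>space M. \<bar>ts.D j q n \<omega>\<bar> \<le> K \<longrightarrow> q n \<omega> = iq.Q j n (ts.D j q n \<omega>)"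
    if "0 < j" "0 < K" for j q K
    using ts.q_eq_U[OF that(1) good_tail_inverse[OF gt] that(2)] by (simp add: iq.Q_def iq.t_def iq.s_def)
  \<comment> \<open>Stated for an arbitrary function \<Psi> of the three order statistics, so that
    it serves both estimators and the spacing.\<close>
  have T_eq: "\<forall>\<^sub>F n in sequentially. \<forall>\<omega>\<in>space M. \<bar>ts.D 1 (qhat Xs Ys x k 1) n \<omega>\<bar> \<le> K \<longrightarrow> \<bar>ts.D 2 (qhat Xs Ys x k 2) n \<omega>\<bar> \<le> K \<longrightarrow> \<bar>ts.D 4 (qhat Xs Ys x k 4) n \<omega>\<bar> \<le> K \<longrightarrow>
        \<Psi> n (qhat Xs Ys x k 1 n \<omega>) (qhat Xs Ys x k 2 n \<omega>) (qhat Xs Ys x k 4 n \<omega>) =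
        \<Psi> n (iq.Q 1 n (ts.D 1 (qhat Xs Ys x k 1) n \<omega>)) (iq.Q 2 n (ts.D 2 (qhat Xs Ys x k 2) n \<omega>)) (iq.Q 4 n (ts.D 4 (qhat Xs Ys x k 4) n \<omega>))"
    if K: "0 < K" for \<Psi> :: "nat \<Rightarrow> real \<Rightarrow> real \<Rightarrow> real \<Rightarrow> real" and K :: real
    using qU[of 1 K "qhat Xs Ys x k 1", OF zero_less_one K]
      qU[of 2 K "qhat Xs Ys x k 2", OF zero_less_numeral K] qU[of 4 K "qhat Xs Ys x k 4", OF zero_less_numeral K]
  proof eventually_elim
    case (elim n)
    show ?case
    proof (intro ballI impI)
      fix \<omega> assume w: "\<omega> \<in> space M" "\<bar>ts.D 1 (qhat Xs Ys x k 1) n \<omega>\<bar> \<le> K" "\<bar>ts.D 2 (qhat Xs Ys x k 2) n \<omega>\<bar> \<le> K" "\<bar>ts.D 4 (qhat Xs Ys x k 4) n \<omega>\<bar> \<le> K"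
      have "qhat Xs Ys x k 1 n \<omega> = iq.Q 1 n (ts.D 1 (qhat Xs Ys x k 1) n \<omega>)" using elim(1) w by blast
      moreover have "qhat Xs Ys x k 2 n \<omega> = iq.Q 2 n (ts.D 2 (qhat Xs Ys x k 2) n \<omega>)" using elim(2) w by blast
      moreover have "qhat Xs Ys x k 4 n \<omega> = iq.Q 4 n (ts.D 4 (qhat Xs Ys x k 4) n \<omega>)" using elim(3) w by blast
      ultimately show "\<Psi> n (qhat Xs Ys x k 1 n \<omega>) (qhat Xs Ys x k 2 n \<omega>) (qhat Xs Ys x k 4 n \<omega>) =
        \<Psi> n (iq.Q 1 n (ts.D 1 (qhat Xs Ys x k 1) n \<omega>)) (iq.Q 2 n (ts.D 2 (qhat Xs Ys x k 2) n \<omega>)) (iq.Q 4 n (ts.D 4 (qhat Xs Ys x k 4) n \<omega>))"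
        by (simp only:)
    qed
  qed
  have r: "1 < 2 powr (1 / \<rho>)" using \<rho> by simp
  define \<Psi>2 where "\<Psi>2 n a1 a2 a4 = sqrt (2 * real (k n)) *
      ((inverse (2 powr (1 / (ln 2 * inverse (ln ((a2 - a4) / (a1 - a2))))) - 1) * (a1 - a2) + a1 - \<phi>) / (a1 - a2))" for n and a1 a2 a4 :: real
  define b where "b = sqrt 2 * (2 powr (1 / \<rho>))\<^sup>2 / (\<rho> * (2 powr (1 / \<rho>) - 1) ^ 3)"
  have b: "0 < b" using r \<rho> unfolding b_def by (intro divide_pos_pos mult_pos_pos zero_less_power) auto
  have T2: "sqrt (2 * real (k n)) * ((phi_hat_star Xs Ys x k n \<omega> - \<phi>) / (qhat Xs Ys x k 1 n \<omega> - qhat Xs Ys x k 2 n \<omega>)) =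
      \<Psi>2 n (qhat Xs Ys x k 1 n \<omega>) (qhat Xs Ys x k 2 n \<omega>) (qhat Xs Ys x k 4 n \<omega>)" for n \<omega>
    by (simp add: \<Psi>2_def phi_hat_star_def phi_star_def rho_hat_def)
  show "conv_distr_normal M (\<lambda>n \<omega>. sqrt (2 * real (k n)) *
           ((phi_hat_star Xs Ys x k n \<omega> - \<phi>) / (qhat Xs Ys x k 1 n \<omega> - qhat Xs Ys x k 2 n \<omega>))) (V2 \<rho>)"
    unfolding T2
  \<comment> \<open>The coefficients come from the linear part
    \<open>\<rho> r^2 (- d1 + d2 - d4 / 4)\<close> of the Aitken numerator.\<close>
  proof (rule ts.asymptotic_normality[OF _ q T_eq, where ?c1.0 = "- b" and ?c2.0 = b and ?c4.0 = "- b / 4"])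
    show "(\<lambda>\<omega>. \<Psi>2 n (qhat Xs Ys x k 1 n \<omega>) (qhat Xs Ys x k 2 n \<omega>) (qhat Xs Ys x k 4 n \<omega>)) \<in> borel_measurable M" for n
      unfolding \<Psi>2_def by measurable
    show "(\<lambda>n. \<Psi>2 n (iq.Q 1 n (d1 n)) (iq.Q 2 n (d2 n)) (iq.Q 4 n (d4 n)) - (- b * d1 n + b * d2 n + (- b / 4) * d4 n)) \<longlonglongrightarrow> 0"
      if "\<And>n. \<bar>d1 n\<bar> \<le> K" "\<And>n. \<bar>d2 n\<bar> \<le> K" "\<And>n. \<bar>d4 n\<bar> \<le> K" for K d1 d2 d4
      using iq.estimated_index_limit[OF that] unfolding \<Psi>2_def b_def .
    show "V2 \<rho> = (- b + b + - b / 4)\<^sup>2 + (b + - b / 4)\<^sup>2 + 2 * (- b / 4)\<^sup>2"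
      unfolding V1_eq(2)[OF \<rho>] b_def[symmetric] by (simp add: power2_eq_square)
    show "0 < V2 \<rho>" unfolding V1_eq(2)[OF \<rho>] b_def[symmetric] using b by simp
  qed
  define \<Psi>3 where "\<Psi>3 n a1 a2 a4 = sqrt (2 * real (k n)) *
      ((inverse (2 powr (1 / \<rho>) - 1) * (a1 - a2) + a1 - \<phi>) / (a1 - a2))" for n and a1 a2 a4 :: real
  define b' where "b' = sqrt 2 * 2 powr (1 / \<rho>) / (\<rho> * (2 powr (1 / \<rho>) - 1)\<^sup>2)"
  have b': "0 < b'" using r \<rho> unfolding b'_def by (intro divide_pos_pos mult_pos_pos zero_less_power) auto
  have T3: "sqrt (2 * real (k n)) * ((phi_tilde_star Xs Ys x k \<rho> n \<omega> - \<phi>) / (qhat Xs Ys x k 1 n \<omega> - qhat Xs Ys x k 2 n \<omega>)) =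
      \<Psi>3 n (qhat Xs Ys x k 1 n \<omega>) (qhat Xs Ys x k 2 n \<omega>) (qhat Xs Ys x k 4 n \<omega>)" for n \<omega>
    by (simp add: \<Psi>3_def phi_tilde_star_def phi_star_def)
  show "conv_distr_normal M (\<lambda>n \<omega>. sqrt (2 * real (k n)) *
           ((phi_tilde_star Xs Ys x k \<rho> n \<omega> - \<phi>) / (qhat Xs Ys x k 1 n \<omega> - qhat Xs Ys x k 2 n \<omega>))) (V3 \<rho>)"
    unfolding T3
  proof (rule ts.asymptotic_normality[OF _ q T_eq, where ?c1.0 = "- b'" and ?c2.0 = "b' / 2" and ?c4.0 = 0])
    show "(\<lambda>\<omega>. \<Psi>3 n (qhat Xs Ys x k 1 n \<omega>) (qhat Xs Ys x k 2 n \<omega>) (qhat Xs Ys x k 4 n \<omega>)) \<in> borel_measurable M" for n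
      unfolding \<Psi>3_def by measurable
    show "(\<lambda>n. \<Psi>3 n (iq.Q 1 n (d1 n)) (iq.Q 2 n (d2 n)) (iq.Q 4 n (d4 n)) - (- b' * d1 n + b' / 2 * d2 n + 0 * d4 n)) \<longlonglongrightarrow> 0"
      if "\<And>n. \<bar>d1 n\<bar> \<le> K" "\<And>n. \<bar>d2 n\<bar> \<le> K" "\<And>n. \<bar>d4 n\<bar> \<le> K" for K d1 d2 d4
    proof -
      have "b' / 2 = sqrt 2 * 2 powr (1 / \<rho>) / (2 * \<rho> * (2 powr (1 / \<rho>) - 1)\<^sup>2)" by (simp add: b'_def)
      then show ?thesis using iq.known_index_limit[OF that(1,2)] unfolding \<Psi>3_def b'_def by (simp only: mult_zero_left add_0_right)
    qed
    show "V3 \<rho> = (- b' + b' / 2 + 0)\<^sup>2 + (b' / 2 + 0)\<^sup>2 + 2 * 0\<^sup>2"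
      unfolding V1_eq(3)[OF \<rho>] b'_def[symmetric] by (simp add: power2_eq_square)
    show "0 < V3 \<rho>" unfolding V1_eq(3)[OF \<rho>] b'_def[symmetric] using b' by simp
  qed
  show "conv_in_prob M (\<lambda>n \<omega>. (qhat Xs Ys x k 1 n \<omega> - qhat Xs Ys x k 2 n \<omega>)
           / (real n / (2 * real (k n)) * deriv U (real n / (2 * real (k n))))) (\<rho> * (1 - 2 powr (- 1 / \<rho>)))"
  proof (rule conv_in_prob_of_bounded_sequences[where ?D1.0 = "ts.D 1 (qhat Xs Ys x k 1)" and ?D2.0 = "ts.D 2 (qhat Xs Ys x k 2)" and
      ?D4.0 = "ts.D 4 (qhat Xs Ys x k 4)" and
      \<Phi> = "\<lambda>n d1 d2 d4. (iq.Q 1 n d1 - iq.Q 2 n d2) / (real n / (2 * real (k n)) * deriv U (real n / (2 * real (k n))))"])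
    show "tight_seq (ts.D 1 (qhat Xs Ys x k 1))" by (rule ts.D_tight[OF zero_less_one q(1)])
    show "tight_seq (ts.D 2 (qhat Xs Ys x k 2))" by (rule ts.D_tight[OF zero_less_numeral q(2)])
    show "tight_seq (ts.D 4 (qhat Xs Ys x k 4))" by (rule ts.D_tight[OF zero_less_numeral q(3)])
    show "\<forall>\<^sub>F n in sequentially. \<forall>\<omega>\<in>space M. \<bar>ts.D 1 (qhat Xs Ys x k 1) n \<omega>\<bar> \<le> K \<longrightarrow> \<bar>ts.D 2 (qhat Xs Ys x k 2) n \<omega>\<bar> \<le> K \<longrightarrow> \<bar>ts.D 4 (qhat Xs Ys x k 4) n \<omega>\<bar> \<le> K \<longrightarrow>
        (qhat Xs Ys x k 1 n \<omega> - qhat Xs Ys x k 2 n \<omega>) / (real n / (2 * real (k n)) * deriv U (real n / (2 * real (k n)))) =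
        (iq.Q 1 n (ts.D 1 (qhat Xs Ys x k 1) n \<omega>) - iq.Q 2 n (ts.D 2 (qhat Xs Ys x k 2) n \<omega>)) / (real n / (2 * real (k n)) * deriv U (real n / (2 * real (k n))))"
      if "0 < K" for K
      by (rule T_eq[OF that, of "\<lambda>n a1 a2 a4. (a1 - a2) / (real n / (2 * real (k n)) * deriv U (real n / (2 * real (k n))))"])
    show "(\<lambda>\<omega>. (qhat Xs Ys x k 1 n \<omega> - qhat Xs Ys x k 2 n \<omega>) / (real n / (2 * real (k n)) * deriv U (real n / (2 * real (k n))))) \<in> borel_measurable M" for n
      by measurable
    show "(\<lambda>n. (iq.Q 1 n (d1 n) - iq.Q 2 n (d2 n)) / (real n / (2 * real (k n)) * deriv U (real n / (2 * real (k n))))) \<longlonglongrightarrow> \<rho> * (1 - 2 powr (- 1 / \<rho>))"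
      if "\<And>n. \<bar>d1 n\<bar> \<le> K" "\<And>n. \<bar>d2 n\<bar> \<le> K" "\<And>n. \<bar>d4 n\<bar> \<le> K" for K d1 d2 d4
      by (rule iq.spacing_limit[OF that(1,2)])
  qed
qed

end

theorem theorem2p5:
  fixes M :: "'w measure"
    and X :: "'w \<Rightarrow> real^'p" and Y :: "'w \<Rightarrow> real"
    and Xs :: "nat \<Rightarrow> 'w \<Rightarrow> real^'p" and Ys :: "nat \<Rightarrow> 'w \<Rightarrow> real"
    and x :: "real^'p" and \<rho> :: real and k :: "nat \<Rightarrow> nat"
  assumes "prob_space M"
    and "X \<in> borel_measurable M" and "Y \<in> borel_measurable M"
    and "AE \<omega> in M. 0 \<le> X \<omega> \<and> 0 \<le> Y \<omega>"
    and "prob_space.indep_vars M (\<lambda>_. borel) (\<lambda>i \<omega>. (Xs i \<omega>, Ys i \<omega>)) {1..}"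
    and "\<forall>i\<ge>1. distr M borel (\<lambda>\<omega>. (Xs i \<omega>, Ys i \<omega>)) = distr M borel (\<lambda>\<omega>. (X \<omega>, Y \<omega>))"
    and "0 \<le> x" and "0 < marg_cdf M X x"
    and "bdd_above {y. 0 \<le> y \<and> cond_cdf M X Y x y < 1}"
    and "0 < \<rho>" and "\<forall>n\<ge>1. 0 < k n"
  shows
    "(has_positive_density_upto (cond_cdf M X Y x) (frontier_of_cdf (cond_cdf M X Y x)) \<and>
      regularly_varying (1 - \<rho>)
        (\<lambda>t. deriv (cond_cdf M X Y x) (frontier_of_cdf (cond_cdf M X Y x) - 1 / t)) \<longrightarrow>
      (\<forall>p::nat \<Rightarrow> real.
        p \<longlonglongrightarrow> 0 \<and> filterlim (\<lambda>n. real n * p n) at_top sequentially \<and>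
        (\<forall>n\<ge>1. int (k n) = \<lfloor>real n * p n\<rfloor>) \<longrightarrow>
        conv_distr_normal M
          (\<lambda>n \<omega>. sqrt (2 * real (k n)) *
             ((qhat Xs Ys x k 1 n \<omega> - quantile_of_cdf (cond_cdf M X Y x) (1 - p n / marg_cdf M X x))
              / (qhat Xs Ys x k 1 n \<omega> - qhat Xs Ys x k 2 n \<omega>)))
          (V1 \<rho>)))
    \<and>
     (condition_a \<rho> (marg_cdf M X x) (tail_quantile M X Y x) k \<or>
      condition_b \<rho> (marg_cdf M X x) (cond_cdf M X Y x) (frontier_of_cdf (cond_cdf M X Y x))
        (tail_quantile M X Y x) k \<longrightarrow>
      conv_distr_normal M
        (\<lambda>n \<omega>. sqrt (2 * real (k n)) *
           ((phi_hat_star Xs Ys x k n \<omega> - frontier_of_cdf (cond_cdf M X Y x))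
            / (qhat Xs Ys x k 1 n \<omega> - qhat Xs Ys x k 2 n \<omega>)))
        (V2 \<rho>)
      \<and>
      conv_distr_normal M
        (\<lambda>n \<omega>. sqrt (2 * real (k n)) *
           ((phi_tilde_star Xs Ys x k \<rho> n \<omega> - frontier_of_cdf (cond_cdf M X Y x))
            / (qhat Xs Ys x k 1 n \<omega> - qhat Xs Ys x k 2 n \<omega>)))
        (V3 \<rho>)
      \<and>
      conv_in_prob M
        (\<lambda>n \<omega>. (qhat Xs Ys x k 1 n \<omega> - qhat Xs Ys x k 2 n \<omega>)
           / (real n / (2 * real (k n)) * deriv (tail_quantile M X Y x) (real n / (2 * real (k n)))))
        (\<rho> * (1 - 2 powr (- 1 / \<rho>))))"

proof -
  interpret prob_space M by fact
  interpret frontier_sample M X Y Xs Ys x \<rho> k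
    by unfold_locales (use assms in auto)
  show ?thesis using quantile_limit_law endpoint_limit_laws by blast
qed

end
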